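(* Let $T\in(0,+\infty)$, $\alpha\in(\frac12,1]$, $q\in\mathcal{P}^{\log}(\mathbb{R}^3)$ with $\frac{3}{2\alpha-1}<q^-\le q^+=q_\infty<+\infty$, and $p\in\mathcal{P}^{\log}((0,+\infty))$ with $\frac{2\alpha}{2\alpha-1}<p^-\le p^+<+\infty$. Suppose that $$\frac{\alpha}{p^-}+\frac{3\vartheta_1}{2}\le\alpha-\frac12,\qquad\text{where}\quad \vartheta_1:=\left(\frac2{q^-}-\frac1{q_\infty}\right)\left(\frac{2+q_\infty(1-\frac2{q^-})}{1+q_\infty(1-\frac2{q^-})}-\frac1{q_\infty-1}\right).$$ Then there is $\varepsilon>0$ such that the following holds: if the data $u_0,f$ are such that $$e_0(t,x):=g_{\alpha,t}*u_0(x)+\int_0^tg_{\alpha,t-s}*f(s,x)\,ds$$ belongs to $L^{p(\cdot)}\big(0,T;L^{q(\cdot)}(\mathbb{R}^3)\big)$ with norm at most $\varepsilon$ (i.e. $e_0$ is small enough in norm), then there is a unique mild solution of the fractional Navier–Stokes equations with data $u_0,f$ in the space $L^{p(\cdot)}\big(0,T;L^{q(\cdot)}(\mathbb{R}^3)\big)$.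
   Context: Variable Lebesgue spaces. For $\Omega=\mathbb{R}^3$ or an interval, $\mathcal{P}(\Omega)$ is the set of measurable $p:\Omega\to[1,\infty]$; $p^-,p^+$ are the essential infimum and supremum; $\frac1\infty:=0$. With $\omega_p(s)=s^p$ for $p<\infty$, $\omega_\infty(s)=0$ for $s\le1$ and $\omega_\infty(s)=\infty$ for $s>1$, put $\varrho_{p(\cdot)}(f)=\int_\Omega\omega_{p(x)}(|f(x)|)dx$; $L^{p(\cdot)}(\Omega)$ is the space of measurable $f$ with $\varrho_{p(\cdot)}(\lambda f)<\infty$ for some $\lambda>0$, with norm $\inf\{\lambda>0:\varrho_{p(\cdot)}(f/\lambda)\le1\}$ (similarly for vector fields). $L^{p(\cdot)}(0,T;X)$ has norm $\big\|\,\|u(t,\cdot)\|_X\big\|_{L^{p(\cdot)}((0,T))}$. $\mathcal{P}^{\log}(\Omega)$ (for $\Omega=\mathbb{R}^3$ or a half-line) is the set of $p\in\mathcal{P}(\Omega)$ such that $g=1/p$ satisfies, for some $c>0$, $g_\infty\in\mathbb{R}$ and all $x,y\in\Omega$, $|g(x)-g(y)|\le\frac{c}{\log(e+1/|x-y|)}$ and $|g(x)-g_\infty|\le\frac{c}{\log(e+|x|)}$; $p_\infty$ is defined by $\frac1{p_\infty}=\lim_{|x|\to\infty}\frac1{p(x)}$ (similarly $q_\infty$). Fractional Navier–Stokes equations on $\mathbb{R}^3$: $\partial_tu=-(-\Delta)^\alpha u-(u\cdot\nabla)u+\nabla P+f$, $\operatorname{div}u=0$, $u(0,\cdot)=u_0$,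 $\operatorname{div}u_0=0$, with unknown velocity $u$ and pressure $P$, given initial datum $u_0$ and (divergence-free) force $f$; $(-\Delta)^\alpha$ has symbol $|\xi|^{2\alpha}$. A mild solution on $(0,T)$ is a solution $u$ of $$u(t,x)=e_0(t,x)-\int_0^tK_{\alpha,t-s}*(u\otimes u)(s,x)\,ds,$$ where $g_{\alpha,t}$ (in $e_0$) is the convolution kernel of $e^{-t(-\Delta)^\alpha}$ (symbol $e^{-t|\xi|^{2\alpha}}$) and $K_{\alpha,t}$ is the kernel of $e^{-t(-\Delta)^\alpha}\mathbb{P}\operatorname{div}$, $\mathbb{P}$ the Leray projector; i.e. the $j$-th component of $K_{\alpha,t}*(u\otimes u)$ is $\sum_{h,k=1}^3K^{j;h,k}_{\alpha,t}*(u_hu_k)$, where $K^{j;h,k}_{\alpha,t}$ has symbol $i\xi_k\big(\delta_{jh}-\frac{\xi_j\xi_h}{|\xi|^2}\big)e^{-t|\xi|^{2\alpha}}$. *)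

theory Defs
  imports "HOL-Analysis.Analysis" "HOL-Probability.Essential_Supremum"
begin

section \<open>Variable exponents\<close>

text \<open>
  An exponent on \<open>\<Omega>\<close> is a function into \<^typ>\<open>ennreal\<close>; only its values on \<open>\<Omega>\<close> matter.
  On \<^typ>\<open>ennreal\<close> one has \<open>inverse \<infinity> = 0\<close>, which is the convention \<open>1/\<infinity> = 0\<close>.
\<close>

definition var_exponents :: "'a::euclidean_space set \<Rightarrow> ('a \<Rightarrow> ennreal) set" where
  "var_exponents \<Omega> = {p \<in> borel_measurable (lebesgue_on \<Omega>). \<forall>x\<in>\<Omega>. 1 \<le> p x}"

definition exponent_sup :: "'a::euclidean_space set \<Rightarrow> ('a \<Rightarrow> ennreal) \<Rightarrow> ennreal" where
  "exponent_sup \<Omega> p = esssup (lebesgue_on \<Omega>) p"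

definition exponent_inf :: "'a::euclidean_space set \<Rightarrow> ('a \<Rightarrow> ennreal) \<Rightarrow> ennreal" where
  "exponent_inf \<Omega> p = Sup {m. AE x in lebesgue_on \<Omega>. m \<le> p x}"

text \<open>
  For \<open>x = y\<close> the right-hand side of the local condition is \<open>c\<close> (as \<open>1 / 0 = 0\<close>), and the
  left-hand side is \<open>0\<close>, so the condition is void on the diagonal, as it should be.
\<close>

definition log_holder_exponents :: "'a::euclidean_space set \<Rightarrow> ('a \<Rightarrow> ennreal) set" where
  "log_holder_exponents \<Omega> =
     {p \<in> var_exponents \<Omega>.
        let g = (\<lambda>x. enn2real (inverse (p x)))
        in \<exists>c>0. \<exists>g_inf::real.
             (\<forall>x\<in>\<Omega>. \<forall>y\<in>\<Omega>. \<bar>g x - g y\<bar> \<le> c / ln (exp 1 + 1 / norm (x - y))) \<and>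
             (\<forall>x\<in>\<Omega>. \<bar>g x - g_inf\<bar> \<le> c / ln (exp 1 + norm x))}"

definition exponent_at_infinity :: "('a::euclidean_space \<Rightarrow> ennreal) \<Rightarrow> ennreal" where
  "exponent_at_infinity p = inverse (Lim at_infinity (\<lambda>x. inverse (p x)))"


section \<open>Variable Lebesgue spaces\<close>

definition omega :: "ennreal \<Rightarrow> real \<Rightarrow> ennreal" where
  "omega p s = (if p = \<infinity> then (if s \<le> 1 then 0 else \<infinity>) else ennreal (s powr enn2real p))"

definition modular ::
  "'a::euclidean_space set \<Rightarrow> ('a \<Rightarrow> ennreal) \<Rightarrow> ('a \<Rightarrow> 'b::real_normed_vector) \<Rightarrow> ennreal" where
  "modular \<Omega> p f = (\<integral>\<^sup>+ x. omega (p x) (norm (f x)) \<partial>lebesgue_on \<Omega>)"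

definition var_Lebesgue ::
  "'a::euclidean_space set \<Rightarrow> ('a \<Rightarrow> ennreal) \<Rightarrow> ('a \<Rightarrow> 'b::real_normed_vector) set" where
  "var_Lebesgue \<Omega> p =
     {f \<in> borel_measurable (lebesgue_on \<Omega>). \<exists>c>0. modular \<Omega> p (\<lambda>x. c *\<^sub>R f x) < \<infinity>}"

definition var_norm ::
  "'a::euclidean_space set \<Rightarrow> ('a \<Rightarrow> ennreal) \<Rightarrow> ('a \<Rightarrow> 'b::real_normed_vector) \<Rightarrow> real" where
  "var_norm \<Omega> p f = Inf {c. 0 < c \<and> modular \<Omega> p (\<lambda>x. f x /\<^sub>R c) \<le> 1}"


section \<open>The mixed space \<open>L\<^sup>p\<close> in time on \<open>(0,T)\<close> with values in \<open>L\<^sup>q\<close> of \<open>R\<^sup>3\<close>\<close>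

abbreviation slab :: "real \<Rightarrow> (real \<times> (real^3)) measure" where
  "slab T \<equiv> lebesgue_on ({0<..<T} \<times> UNIV)"

text \<open>
  Elements are functions of \<open>(t,x)\<close>, measurable on the slab, to be identified when they agree
  almost everywhere there. The norm of a time slice has no meaning at the (negligible) times
  where the slice is not in \<open>L\<^sup>q\<close>.
\<close>

definition mixed_Lebesgue ::
  "real \<Rightarrow> (real \<Rightarrow> ennreal) \<Rightarrow> (real^3 \<Rightarrow> ennreal) \<Rightarrow> (real \<Rightarrow> real^3 \<Rightarrow> real^3) set" where
  "mixed_Lebesgue T p q =
     {u. (\<lambda>(t, x). u t x) \<in> borel_measurable (slab T) \<and>
         (AE t in lebesgue_on {0<..<T}. u t \<in> var_Lebesgue UNIV q) \<and>
         (\<lambda>t. var_norm UNIV q (u t)) \<in> var_Lebesgue {0<..<T} p}"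

definition mixed_norm ::
  "real \<Rightarrow> (real \<Rightarrow> ennreal) \<Rightarrow> (real^3 \<Rightarrow> ennreal) \<Rightarrow> (real \<Rightarrow> real^3 \<Rightarrow> real^3) \<Rightarrow> real" where
  "mixed_norm T p q u = var_norm {0<..<T} p (\<lambda>t. var_norm UNIV q (u t))"


section \<open>Divergence-free fields\<close>

definition partial_deriv :: "3 \<Rightarrow> (real^3 \<Rightarrow> real) \<Rightarrow> real^3 \<Rightarrow> real" where
  "partial_deriv i \<phi> x = frechet_derivative \<phi> (at x) (axis i 1)"

definition test_functions :: "(real^3 \<Rightarrow> real) set" where
  "test_functions =
     {\<phi>. (\<forall>js. fold partial_deriv js \<phi> differentiable_on UNIV) \<and>
          compact (closure {x. \<phi> x \<noteq> 0})}"

text \<open>\<open>div v = 0\<close> in the sense of distributions.\<close>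

definition div_free :: "(real^3 \<Rightarrow> real^3) \<Rightarrow> bool" where
  "div_free v \<longleftrightarrow>
     (\<forall>C. compact C \<longrightarrow> set_integrable lebesgue C v) \<and>
     (\<forall>\<phi>\<in>test_functions. (LINT x|lebesgue. (\<Sum>i\<in>UNIV. v x $ i * partial_deriv i \<phi> x)) = 0)"


section \<open>Kernels\<close>

text \<open>
  Kernels are recovered from their symbols with the convention under which the partial derivative
  of index \<open>k\<close> has symbol \<open>i\<xi>\<^sub>k\<close>. For \<open>t > 0\<close> the symbols below are integrable and satisfy
  \<open>m (-\<xi>) = cnj (m \<xi>)\<close>, so that the inverse transforms are real-valued; taking \<^const>\<open>Re\<close> only
  changes the type.
\<close>

definition inv_fourier :: "(real^3 \<Rightarrow> complex) \<Rightarrow> real^3 \<Rightarrow> complex" where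
  "inv_fourier m x = (LINT \<xi>|lebesgue. cis (x \<bullet> \<xi>) * m \<xi>) / complex_of_real ((2 * pi) ^ 3)"

definition frac_heat_symbol :: "real \<Rightarrow> real \<Rightarrow> real^3 \<Rightarrow> real" where
  "frac_heat_symbol \<alpha> t \<xi> = exp (- t * norm \<xi> powr (2 * \<alpha>))"

definition heat_kernel :: "real \<Rightarrow> real \<Rightarrow> real^3 \<Rightarrow> real" where
  "heat_kernel \<alpha> t x = Re (inv_fourier (\<lambda>\<xi>. complex_of_real (frac_heat_symbol \<alpha> t \<xi>)) x)"

definition leray_symbol :: "3 \<Rightarrow> 3 \<Rightarrow> real^3 \<Rightarrow> real" where
  "leray_symbol j h \<xi> = (if j = h then 1 else 0) - \<xi> $ j * \<xi> $ h / (norm \<xi>)\<^sup>2"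

definition oseen_kernel :: "real \<Rightarrow> real \<Rightarrow> 3 \<Rightarrow> 3 \<Rightarrow> 3 \<Rightarrow> real^3 \<Rightarrow> real" where
  "oseen_kernel \<alpha> t j h k x =
     Re (inv_fourier (\<lambda>\<xi>. \<i> * complex_of_real
           (\<xi> $ k * leray_symbol j h \<xi> * frac_heat_symbol \<alpha> t \<xi>)) x)"


section \<open>Convolutions and mild solutions\<close>

definition conv_exists ::
  "(real^3 \<Rightarrow> real) \<Rightarrow> (real^3 \<Rightarrow> 'b::{banach, second_countable_topology}) \<Rightarrow> real^3 \<Rightarrow> bool" where
  "conv_exists K v x \<longleftrightarrow> integrable lebesgue (\<lambda>y. K (x - y) *\<^sub>R v y)"

definition conv ::
  "(real^3 \<Rightarrow> real) \<Rightarrow> (real^3 \<Rightarrow> 'b::{banach, second_countable_topology}) \<Rightarrow> real^3 \<Rightarrow> 'b" where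
  "conv K v x = (LINT y|lebesgue. K (x - y) *\<^sub>R v y)"

definition e0 ::
  "real \<Rightarrow> (real^3 \<Rightarrow> real^3) \<Rightarrow> (real \<Rightarrow> real^3 \<Rightarrow> real^3) \<Rightarrow> real \<Rightarrow> real^3 \<Rightarrow> real^3" where
  "e0 \<alpha> u0 f t x =
     conv (heat_kernel \<alpha> t) u0 x +
     (LINT s|lebesgue_on {0<..<t}. conv (heat_kernel \<alpha> (t - s)) (f s) x)"

text \<open>
  The data are measurable divergence-free fields for which the integrals in \<^const>\<open>e0\<close> converge
  at almost every point of the slab. Convergence has to be demanded explicitly since the Bochner
  integral of a non-integrable function is \<open>0\<close>.
\<close>

definition admissible_data ::
  "real \<Rightarrow> real \<Rightarrow> (real^3 \<Rightarrow> real^3) \<Rightarrow> (real \<Rightarrow> real^3 \<Rightarrow> real^3) \<Rightarrow> bool" where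
  "admissible_data T \<alpha> u0 f \<longleftrightarrow>
     u0 \<in> borel_measurable lebesgue \<and> div_free u0 \<and>
     (\<lambda>(t, x). f t x) \<in> borel_measurable (slab T) \<and>
     (AE t in lebesgue_on {0<..<T}. div_free (f t)) \<and>
     (AE (t, x) in slab T.
        conv_exists (heat_kernel \<alpha> t) u0 x \<and>
        (AE s in lebesgue_on {0<..<t}. conv_exists (heat_kernel \<alpha> (t - s)) (f s) x) \<and>
        integrable (lebesgue_on {0<..<t}) (\<lambda>s. conv (heat_kernel \<alpha> (t - s)) (f s) x))"

text \<open>The convolution of the kernel of order \<open>(\<alpha>,t)\<close> with the tensor product of \<open>v\<close> with itself.\<close>

definition oseen_conv :: "real \<Rightarrow> real \<Rightarrow> (real^3 \<Rightarrow> real^3) \<Rightarrow> real^3 \<Rightarrow> real^3" where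
  "oseen_conv \<alpha> t v x =
     (\<chi> j. \<Sum>h\<in>UNIV. \<Sum>k\<in>UNIV. conv (oseen_kernel \<alpha> t j h k) (\<lambda>y. v y $ h * v y $ k) x)"

text \<open>
  The integral equation is understood almost everywhere on the slab, and includes the convergence
  of the integrals occurring in its bilinear term.
\<close>

definition mild_solution ::
  "real \<Rightarrow> real \<Rightarrow> (real^3 \<Rightarrow> real^3) \<Rightarrow> (real \<Rightarrow> real^3 \<Rightarrow> real^3) \<Rightarrow> (real \<Rightarrow> real^3 \<Rightarrow> real^3) \<Rightarrow> bool"
where
  "mild_solution T \<alpha> u0 f u \<longleftrightarrow>
     (AE (t, x) in slab T.
        (AE s in lebesgue_on {0<..<t}. \<forall>j h k.
           conv_exists (oseen_kernel \<alpha> (t - s) j h k) (\<lambda>y. u s y $ h * u s y $ k) x) \<and>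
        integrable (lebesgue_on {0<..<t}) (\<lambda>s. oseen_conv \<alpha> (t - s) (u s) x) \<and>
        u t x = e0 \<alpha> u0 f t x - (LINT s|lebesgue_on {0<..<t}. oseen_conv \<alpha> (t - s) (u s) x))"

definition theta1 :: "real \<Rightarrow> real \<Rightarrow> real" where
  "theta1 q_minus q_inf =
     (2 / q_minus - 1 / q_inf) *
     ((2 + q_inf * (1 - 2 / q_minus)) / (1 + q_inf * (1 - 2 / q_minus)) - 1 / (q_inf - 1))"

end

theory Submission
  imports Defs
begin

text \<open>
  Since \<open>q \<le> q\<^sub>\<infinity>\<close> with logarithmic decay of \<open>1/q - 1/q\<^sub>\<infinity>\<close>, the space \<open>L\<^sup>q\<close> lies between \<open>L\<^sup>M\<close>
  and \<open>L\<^sup>m + L\<^sup>M\<close>, where \<open>m = q\<^sup>-\<close> and \<open>M = q\<^sub>\<infinity>\<close>. Hence only Young's inequality with constant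
  exponents is needed in space. The Oseen kernel at time \<open>t\<close> is bounded by
  \<open>C \<sigma>^(-4) \<Prod>\<^sub>i (1 + \<bar>x\<^sub>i\<bar>/\<sigma>)^(-1)\<close> with \<open>\<sigma> = t^(1/(2\<alpha>))\<close>, so that the bilinear term carries a
  singularity \<open>(t - s)^(-a)\<close> in time with \<open>a = (1 + 3(2/m - 1/M))/(2\<alpha>)\<close>. Because
  \<open>2/m - 1/M \<le> \<theta>\<^sub>1\<close>, the hypothesis on \<open>\<theta>\<^sub>1\<close> gives \<open>a \<le> 1 - 1/p\<^sup>-\<close>, which is exactly what is needed
  for the fractional integral of order \<open>1 - a\<close> to map the time space of exponent \<open>p/2\<close> into that of exponent
  \<open>p\<close>; this mapping property follows from Hedberg's pointwise estimate, the maximal theorem and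
  the log-Hoelder continuity of \<open>1/p\<close>. A solution is then the limit of Picard iterates dominated by a scalar
  monotone iteration with positive kernels. If two solutions
  agree up to a time \<open>b < T\<close>, then on a short interval beyond \<open>b\<close> their difference is at most half of
  itself in norm, hence they agree past \<open>b\<close>, and a supremum argument reaches \<open>T\<close>.
\<close>

text \<open>All sizes are measured in \<open>ennreal\<close>, by modulars of quotients being at most
  1 or 2 rather than by norms. Estimates then make sense for slices of zero or infinite size, and in
  space the triangle inequality is replaced by the fact that a quotient of sums is at most the
  larger of the two quotients. The exponent \<open>a\<close> comes from Young's inequality: the
  square of an L^m function lies in L^(m/2), and to reach L^M the kernel must be in L^r with 1/r = 1
  - (2/m - 1/M); scaling of the kernel does the rest. The product majorant is in L^r for every r >
  1, the range that occurs, and reduces integrals over R^3 to integrals over the line. The solution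
  is not sought as a fixed point in the mixed space, whose completeness would have to be shown
  first. The positive iteration always has a limit, possibly infinite; where this limit is finite,
  the increments of the Picard iterates are summable. Uniqueness concerns solutions of any size, so
  no contraction with a small norm is at hand: smallness is taken from the length of the time
  interval, through absolute continuity of the modular.\<close>

section \<open>Powers of extended reals and integral inequalities\<close>

text \<open>The value at \<open>\<infinity>\<close> is \<open>\<infinity>\<close> for every exponent, and the value at \<open>0\<close> is \<open>0\<close>, also for
  exponents \<open>\<le> 0\<close>. With these conventions powers are multiplicative without side conditions.\<close>

definition epow :: "ennreal \<Rightarrow> real \<Rightarrow> ennreal" where
  "epow x a = (if x = \<infinity> then \<infinity> else ennreal (enn2real x powr a))"

lemma epow_ennreal: "0 \<le> r \<Longrightarrow> epow (ennreal r) a = ennreal (r powr a)"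
  by (simp add: epow_def)

lemma epow_0 [simp]: "epow 0 a = 0"
  by (simp add: epow_def)

lemma epow_top [simp]: "epow \<infinity> a = \<infinity>" "epow top a = top"
  by (simp_all add: epow_def)

lemma epow_1 [simp]: "epow x 1 = x"
  by (cases x) (auto simp: epow_ennreal)

lemma epow_one [simp]: "epow 1 a = 1"
  using epow_ennreal[of 1 a] by simp

lemma epow_eq_0_iff [simp]: "epow x a = 0 \<longleftrightarrow> x = 0"
  by (cases x) (auto simp: epow_ennreal)

lemma epow_eq_top_iff [simp]: "epow x a = \<infinity> \<longleftrightarrow> x = \<infinity>" "epow x a = top \<longleftrightarrow> x = top"
  by (cases x; auto simp: epow_ennreal)+

lemma epow_mono: "0 \<le> a \<Longrightarrow> x \<le> y \<Longrightarrow> epow x a \<le> epow y a"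
  by (cases x; cases y) (auto simp: epow_ennreal powr_mono2 ennreal_leI top_unique)

lemma epow_mult: "epow (x * y) a = epow x a * epow y a"
proof (cases x)
  case (real r)
  show ?thesis
  proof (cases y)
    case (real s)
    then show ?thesis using \<open>x = _\<close> \<open>0 \<le> r\<close>
      by (simp add: epow_ennreal ennreal_mult[symmetric] powr_mult)
  next
    case top
    then show ?thesis using \<open>x = _\<close> \<open>0 \<le> r\<close>
      by (cases "r = 0") (auto simp: epow_ennreal ennreal_mult_top)
  qed
next
  case top
  then show ?thesis
    by (cases "y = 0") (auto simp: ennreal_top_mult)
qed

lemma epow_epow: "epow (epow x a) b = epow x (a * b)"
  by (cases x) (auto simp: epow_ennreal powr_powr)

lemma epow_add: "epow x (a + b) = epow x a * epow x b"
  by (cases x) (auto simp: epow_ennreal ennreal_mult[symmetric] powr_add)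

lemma epow_inverse: "epow (inverse x) a = inverse (epow x a)"
proof (cases x)
  case (real r)
  then show ?thesis
    by (cases "r = 0") (auto simp: epow_ennreal inverse_ennreal inverse_powr less_le)
qed auto

lemma epow_divide: "epow (x / y) a = epow x a / epow y a"
  by (simp add: divide_ennreal_def epow_mult epow_inverse)

lemma epow_plus_le:
  assumes "0 \<le> a"
  shows "epow (x + y) a \<le> ennreal (2 powr a) * (epow x a + epow y a)"
proof -
  have *: "epow (x + y) a \<le> ennreal (2 powr a) * (epow x a + epow y a)" if "x \<le> y" for x y
  proof -
    have "x + y \<le> ennreal 2 * y"
      using add_mono[OF that order_refl, of y] by (simp add: mult_2)
    from epow_mono[OF assms this]
    have "epow (x + y) a \<le> ennreal (2 powr a) * epow y a"
      by (simp add: epow_mult epow_ennreal flip: ennreal_numeral)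
    also have "\<dots> \<le> ennreal (2 powr a) * (epow x a + epow y a)"
      by (intro mult_left_mono) auto
    finally show ?thesis .
  qed
  show ?thesis
    using *[of x y] *[of y x] by (cases "x \<le> y") (auto simp: add.commute)
qed

lemma epow_measurable [measurable]:
  assumes [measurable]: "f \<in> borel_measurable M" "g \<in> borel_measurable M"
  shows "(\<lambda>x. epow (f x) (g x)) \<in> borel_measurable M"
  unfolding epow_def by measurable

text \<open>For \<open>a > 0\<close> the map has the increasing inverse
  \<open>epow _ (1 / a)\<close>, and order isomorphisms preserve suprema. An empty \<open>A\<close>
  is covered because \<open>epow 0 a = 0\<close>.\<close>

lemma epow_SUP:
  assumes "0 < a"
  shows "epow (SUP n\<in>A. f n) a = (SUP n\<in>A. epow (f n) a)"
proof (rule antisym)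
  let ?S = "SUP n\<in>A. epow (f n) a"
  have "f n \<le> epow ?S (1 / a)" if "n \<in> A" for n
  proof -
    have "f n = epow (epow (f n) a) (1 / a)" using assms by (simp add: epow_epow)
    also have "\<dots> \<le> epow ?S (1 / a)" using assms that by (intro epow_mono SUP_upper) auto
    finally show ?thesis .
  qed
  then have "(SUP n\<in>A. f n) \<le> epow ?S (1 / a)" by (rule SUP_least)
  from epow_mono[OF _ this, of a] show "epow (SUP n\<in>A. f n) a \<le> ?S"
    using assms by (simp add: epow_epow)
next
  show "(SUP n\<in>A. epow (f n) a) \<le> epow (SUP n\<in>A. f n) a"
    using assms by (intro SUP_least epow_mono SUP_upper) auto
qed

lemma epow_le_iff: "0 < a \<Longrightarrow> epow x a \<le> epow y a \<longleftrightarrow> x \<le> y"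
  using epow_mono[of a x y] epow_mono[of "1/a" "epow x a" "epow y a"] by (auto simp: epow_epow)

lemma young_ennreal:
  assumes "0 < \<theta>" "\<theta> < 1"
  shows "epow x \<theta> * epow y (1 - \<theta>) \<le> ennreal \<theta> * x + ennreal (1 - \<theta>) * y"
proof (cases x)
  case (real r)
  show ?thesis
  proof (cases y)
    case (real s)
    have "r powr \<theta> * s powr (1 - \<theta>) \<le> \<theta> * r + (1 - \<theta>) * s"
      using Youngs_inequality_0[of \<theta> "1 - \<theta>" r s] assms \<open>0 \<le> r\<close> \<open>0 \<le> s\<close>
      by (cases "r = 0 \<or> s = 0") auto
    then show ?thesis using \<open>x = _\<close> \<open>y = _\<close> \<open>0 \<le> r\<close> \<open>0 \<le> s\<close> assms
      by (simp add: epow_ennreal ennreal_mult[symmetric] ennreal_plus[symmetric] ennreal_leI del: ennreal_plus)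
  next
    case top
    then show ?thesis using assms by (simp add: ennreal_mult_top)
  qed
next
  case top
  then show ?thesis using assms by (simp add: ennreal_mult_top)
qed

text \<open>The weights \<open>\<theta>\<close> and \<open>1 - \<theta>\<close> stand for the
  reciprocals of conjugate exponents. After division by the two integrals, Young's inequality is
  applied pointwise. The division is legitimate only for integrals in (0, \<infinity>): a zero
  integral makes the integrand vanish almost everywhere, and otherwise an infinite one makes the
  right-hand side infinite.\<close>

lemma nn_integral_holder:
  assumes [measurable]: "f \<in> borel_measurable M" "g \<in> borel_measurable M"
    and \<theta>: "0 < \<theta>" "\<theta> < 1"
  shows "(\<integral>\<^sup>+x. epow (f x) \<theta> * epow (g x) (1 - \<theta>) \<partial>M) \<le>
         epow (\<integral>\<^sup>+x. f x \<partial>M) \<theta> * epow (\<integral>\<^sup>+x. g x \<partial>M) (1 - \<theta>)"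
proof -
  let ?A = "\<integral>\<^sup>+x. f x \<partial>M" and ?B = "\<integral>\<^sup>+x. g x \<partial>M"
  consider "?A = 0" | "?B = 0" | "?A \<noteq> 0" "?B \<noteq> 0" "?A = \<infinity> \<or> ?B = \<infinity>"
    | "?A \<noteq> 0" "?B \<noteq> 0" "?A \<noteq> \<infinity>" "?B \<noteq> \<infinity>" by blast
  then show ?thesis
  proof cases
    case 1
    then have "AE x in M. f x = 0" by (simp add: nn_integral_0_iff_AE)
    then have "(\<integral>\<^sup>+x. epow (f x) \<theta> * epow (g x) (1 - \<theta>) \<partial>M) = 0"
      by (subst nn_integral_0_iff_AE) auto
    then show ?thesis by simp
  next
    case 2
    then have "AE x in M. g x = 0" by (simp add: nn_integral_0_iff_AE)
    then have "(\<integral>\<^sup>+x. epow (f x) \<theta> * epow (g x) (1 - \<theta>) \<partial>M) = 0"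
      by (subst nn_integral_0_iff_AE) auto
    then show ?thesis by simp
  next
    case 3
    then have "epow ?A \<theta> * epow ?B (1 - \<theta>) = \<infinity>"
      by (auto simp: ennreal_mult_eq_top_iff)
    then show ?thesis by simp
  next
    case 4
    let ?C = "epow ?A \<theta> * epow ?B (1 - \<theta>)"
    have "epow (f x) \<theta> * epow (g x) (1 - \<theta>) \<le>
        ?C * (ennreal \<theta> * (f x / ?A) + ennreal (1 - \<theta>) * (g x / ?B))" for x
    proof -
      have *: "f x = ?A * (f x / ?A)" "g x = ?B * (g x / ?B)"
        using 4 by (simp_all add: ennreal_times_divide ennreal_mult_divide_eq mult.commute)
      have "epow (f x) \<theta> * epow (g x) (1 - \<theta>) =
          ?C * (epow (f x / ?A) \<theta> * epow (g x / ?B) (1 - \<theta>))"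
        by (subst *(1), subst *(2)) (simp only: epow_mult mult_ac)
      also have "\<dots> \<le> ?C * (ennreal \<theta> * (f x / ?A) + ennreal (1 - \<theta>) * (g x / ?B))"
        by (intro mult_left_mono young_ennreal \<theta>) simp
      finally show ?thesis .
    qed
    then have "(\<integral>\<^sup>+x. epow (f x) \<theta> * epow (g x) (1 - \<theta>) \<partial>M) \<le>
       (\<integral>\<^sup>+x. ?C * (ennreal \<theta> * (f x / ?A) + ennreal (1 - \<theta>) * (g x / ?B)) \<partial>M)"
      by (intro nn_integral_mono) auto
    also have "\<dots> = ?C * (ennreal \<theta> * (?A / ?A) + ennreal (1 - \<theta>) * (?B / ?B))"
      by (simp add: nn_integral_cmult nn_integral_add nn_integral_divide)
    also have "\<dots> = ?C"
      using 4 \<theta> by (simp add: ennreal_divide_self ennreal_plus[symmetric] top.not_eq_extremum del: ennreal_plus)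
    finally show ?thesis .
  qed
qed

lemma nn_integral_holder3:
  assumes [measurable]: "f \<in> borel_measurable M" "g \<in> borel_measurable M" "h \<in> borel_measurable M"
    and \<theta>: "0 < a" "0 < b" "0 < c" "a + b + c = 1"
  shows "(\<integral>\<^sup>+x. epow (f x) a * epow (g x) b * epow (h x) c \<partial>M) \<le>
         epow (\<integral>\<^sup>+x. f x \<partial>M) a * epow (\<integral>\<^sup>+x. g x \<partial>M) b * epow (\<integral>\<^sup>+x. h x \<partial>M) c"
proof -
  have "1 - a \<noteq> 0" "c = 1 - a - b" using \<theta> by auto
  then have d: "c = (1 - b / (1 - a)) * (1 - a)" by (simp add: left_diff_distrib)
  \<comment> \<open>The last two factors are merged so that the two-factor inequality can be applied
    twice; \<open>b / (1 - a)\<close> is the share of \<open>g\<close> in the remaining weight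
    \<open>1 - a\<close>.\<close>
  let ?G = "\<lambda>x. epow (g x) (b / (1 - a)) * epow (h x) (1 - b / (1 - a))"
  have "(\<integral>\<^sup>+x. epow (f x) a * epow (g x) b * epow (h x) c \<partial>M) =
        (\<integral>\<^sup>+x. epow (f x) a * epow (?G x) (1 - a) \<partial>M)"
    using \<theta> by (intro nn_integral_cong) (simp add: epow_mult epow_epow mult.assoc d[symmetric])
  also have "\<dots> \<le> epow (\<integral>\<^sup>+x. f x \<partial>M) a * epow (\<integral>\<^sup>+x. ?G x \<partial>M) (1 - a)"
    using \<theta> by (intro nn_integral_holder) auto
  also have "\<dots> \<le> epow (\<integral>\<^sup>+x. f x \<partial>M) a *
      epow (epow (\<integral>\<^sup>+x. g x \<partial>M) (b / (1 - a)) * epow (\<integral>\<^sup>+x. h x \<partial>M) (1 - b / (1 - a))) (1 - a)"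
    using \<theta> by (intro mult_left_mono epow_mono nn_integral_holder) (auto simp: field_simps)
  also have "\<dots> = epow (\<integral>\<^sup>+x. f x \<partial>M) a * epow (\<integral>\<^sup>+x. g x \<partial>M) b * epow (\<integral>\<^sup>+x. h x \<partial>M) c"
    using \<theta> by (simp add: epow_mult epow_epow mult.assoc d[symmetric])
  finally show ?thesis .
qed

text \<open>Any measurable majorant \<open>w\<close> of the norms of the slices may be used. No
  duality is involved: Hoelder's inequality against the weight \<open>w\<close> bounds the p-th
  power of the integral over s by the integral of G^p w^(1-p) times the (p-1)-th power of
  \<open>?W\<close>, and after Tonelli the bound on the slices turns the first factor into
  \<open>?W\<close>.\<close>

lemma nn_integral_minkowski:
  fixes G :: "'a \<times> 'b \<Rightarrow> ennreal" and w :: "'a \<Rightarrow> ennreal" and p :: real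
  assumes "sigma_finite_measure N" "sigma_finite_measure M"
    and [measurable]: "G \<in> borel_measurable (N \<Otimes>\<^sub>M M)" "w \<in> borel_measurable N"
    and p: "1 < p"
    and bd: "AE s in N. (\<integral>\<^sup>+x. epow (G (s, x)) p \<partial>M) \<le> epow (w s) p"
  shows "(\<integral>\<^sup>+x. epow (\<integral>\<^sup>+s. G (s, x) \<partial>N) p \<partial>M) \<le> epow (\<integral>\<^sup>+s. w s \<partial>N) p"
proof -
  interpret N: sigma_finite_measure N by fact
  interpret M: sigma_finite_measure M by fact
  interpret NM: pair_sigma_finite N M ..
  let ?W = "\<integral>\<^sup>+s. w s \<partial>N"
  show ?thesis
  proof (cases "?W = \<infinity>")
    case False
    have fin: "AE s in N. w s \<noteq> \<infinity>"
      by (rule nn_integral_noteq_infinite) (use False in auto)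
    \<comment> \<open>Where \<open>w\<close> vanishes the weight below degenerates, so
      \<open>G\<close> has to vanish there as well. This is known for almost every \<open>x\<close>
      at fixed \<open>s\<close> and is used for almost every \<open>s\<close> at fixed
      \<open>x\<close>, hence the exchange of quantifiers.\<close>
    have "AE s in N. AE x in M. w s = 0 \<longrightarrow> G (s, x) = 0"
      using bd AE_space
    proof eventually_elim
      case (elim s)
      have [measurable]: "(\<lambda>x. G (s, x)) \<in> borel_measurable M" using elim(2) by simp
      show ?case
      proof (cases "w s = 0")
        case True
        then have "(\<integral>\<^sup>+x. epow (G (s, x)) p \<partial>M) = 0" using elim by simp
        then show ?thesis by (subst (asm) nn_integral_0_iff_AE) auto
      qed simp
    qed
    then have "AE x in M. AE s in N. w s = 0 \<longrightarrow> G (s, x) = 0"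
      by (subst (asm) NM.AE_commute) auto
    then have "AE x in M. epow (\<integral>\<^sup>+s. G (s, x) \<partial>N) p \<le>
        (\<integral>\<^sup>+s. epow (G (s, x)) p * inverse (epow (w s) (p - 1)) \<partial>N) * epow ?W (p - 1)"
      using AE_space
    proof eventually_elim
      case (elim x)
      have [measurable]: "(\<lambda>s. G (s, x)) \<in> borel_measurable N" using elim(2) by simp
      have e: "(p - 1) * (1 / p) = 1 - 1 / p" "(1 - 1 / p) * p = p - 1"
        using p by (auto simp: field_simps)
      have "(\<integral>\<^sup>+s. G (s, x) \<partial>N) =
          (\<integral>\<^sup>+s. epow (epow (G (s, x)) p * inverse (epow (w s) (p - 1))) (1 / p) * epow (w s) (1 - 1 / p) \<partial>N)"
      proof (rule nn_integral_cong_AE)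
        show "AE s in N. G (s, x) = epow (epow (G (s, x)) p * inverse (epow (w s) (p - 1))) (1 / p) *
                  epow (w s) (1 - 1 / p)"
          using elim(1) fin
        proof eventually_elim
          case (elim s)
          show ?case
          proof (cases "w s = 0")
            case False
            have "inverse (epow (w s) (1 - 1 / p)) * epow (w s) (1 - 1 / p) = 1"
              using False elim by (cases "w s") (auto simp: epow_ennreal inverse_ennreal
                 ennreal_mult[symmetric] less_le)
            then show ?thesis
              using p e by (simp add: epow_mult epow_epow epow_inverse mult.assoc)
          qed (use elim in simp)
        qed
      qed
      also have "\<dots> \<le> epow (\<integral>\<^sup>+s. epow (G (s, x)) p * inverse (epow (w s) (p - 1)) \<partial>N) (1 / p) *
           epow ?W (1 - 1 / p)"
        using p by (intro nn_integral_holder) auto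
      finally have "epow (\<integral>\<^sup>+s. G (s, x) \<partial>N) p \<le> epow (epow (\<integral>\<^sup>+s. epow (G (s, x)) p *
           inverse (epow (w s) (p - 1)) \<partial>N) (1 / p) * epow ?W (1 - 1 / p)) p"
        using p by (intro epow_mono) auto
      then show ?case using p e by (simp add: epow_mult epow_epow)
    qed
    then have "(\<integral>\<^sup>+x. epow (\<integral>\<^sup>+s. G (s, x) \<partial>N) p \<partial>M) \<le>
       (\<integral>\<^sup>+x. (\<integral>\<^sup>+s. epow (G (s, x)) p * inverse (epow (w s) (p - 1)) \<partial>N) * epow ?W (p - 1) \<partial>M)"
      by (rule nn_integral_mono_AE)
    also have "\<dots> = (\<integral>\<^sup>+x. (\<integral>\<^sup>+s. epow (G (s, x)) p * inverse (epow (w s) (p - 1)) \<partial>N) \<partial>M) * epow ?W (p - 1)"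
      by (rule nn_integral_multc) measurable
    also have "(\<integral>\<^sup>+x. (\<integral>\<^sup>+s. epow (G (s, x)) p * inverse (epow (w s) (p - 1)) \<partial>N) \<partial>M) =
       (\<integral>\<^sup>+s. (\<integral>\<^sup>+x. epow (G (s, x)) p * inverse (epow (w s) (p - 1)) \<partial>M) \<partial>N)"
      by (rule NM.Fubini') measurable
    also have "\<dots> = (\<integral>\<^sup>+s. (\<integral>\<^sup>+x. epow (G (s, x)) p \<partial>M) * inverse (epow (w s) (p - 1)) \<partial>N)"
      by (intro nn_integral_cong nn_integral_multc) measurable
    also have "\<dots> \<le> ?W"
    proof (rule nn_integral_mono_AE)
      show "AE s in N. (\<integral>\<^sup>+x. epow (G (s, x)) p \<partial>M) * inverse (epow (w s) (p - 1)) \<le> w s"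
        using bd fin
      proof eventually_elim
        case (elim s)
        have "(\<integral>\<^sup>+x. epow (G (s, x)) p \<partial>M) * inverse (epow (w s) (p - 1)) \<le>
           epow (w s) (1 + (p - 1)) * inverse (epow (w s) (p - 1))"
          using elim by (intro mult_right_mono) auto
        also have "\<dots> = w s"
          using elim unfolding epow_add
          by (cases "w s"; cases "w s = 0") (auto simp: epow_ennreal inverse_ennreal
                 ennreal_mult[symmetric] less_le)
        finally show ?case .
      qed
    qed
    finally have "(\<integral>\<^sup>+x. epow (\<integral>\<^sup>+s. G (s, x) \<partial>N) p \<partial>M) \<le> ?W * epow ?W (p - 1)"
      by (simp add: mult_right_mono)
    also have "\<dots> = epow ?W p" using epow_add[of ?W 1 "p - 1"] by simp
    finally show ?thesis .
  qed (simp add: top_unique)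
qed

section \<open>Young's inequality for convolutions\<close>

lemma nn_integral_lborel_reflect:
  fixes f :: "'a::euclidean_space \<Rightarrow> ennreal"
  assumes [measurable]: "f \<in> borel_measurable borel"
  shows "(\<integral>\<^sup>+y. f (x - y) \<partial>lborel) = (\<integral>\<^sup>+y. f y \<partial>lborel)"
proof -
  have "(\<integral>\<^sup>+y. f y \<partial>lborel) =
      (\<integral>\<^sup>+y. f y \<partial>density (distr lborel borel (\<lambda>y. x + (-1) *\<^sub>R y)) (\<lambda>_. ennreal (\<bar>-1::real\<bar> ^ DIM('a))))"
    by (subst lborel_affine[of "-1" x, symmetric]) auto
  also have "\<dots> = (\<integral>\<^sup>+y. f (x - y) \<partial>lborel)"
    by (subst nn_integral_density) (auto simp: nn_integral_distr)
  finally show ?thesis ..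
qed

lemma nn_integral_lborel_shift:
  fixes f :: "'a::euclidean_space \<Rightarrow> ennreal"
  assumes [measurable]: "f \<in> borel_measurable borel"
  shows "(\<integral>\<^sup>+y. f (y - x) \<partial>lborel) = (\<integral>\<^sup>+y. f y \<partial>lborel)"
proof -
  have "(\<integral>\<^sup>+y. f y \<partial>lborel) = (\<integral>\<^sup>+y. f y \<partial>distr lborel borel ((+) (-x)))"
    by (simp add: lborel_distr_plus)
  also have "\<dots> = (\<integral>\<^sup>+y. f (y - x) \<partial>lborel)"
    by (subst nn_integral_distr) (auto simp: algebra_simps)
  finally show ?thesis ..
qed

text \<open>The integrand is split into three factors with the weights 1/p, 1/r - 1/p and 1/s - 1/p,
  whose sum is 1. The strict inequalities make all three weights positive, as the three-factor
  Hoelder inequality requires.\<close>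

lemma young_convolution:
  fixes k F :: "'a::euclidean_space \<Rightarrow> ennreal" and p r s :: real
  assumes [measurable]: "k \<in> borel_measurable borel" "F \<in> borel_measurable borel"
    and e: "0 < r" "0 < s" "1 < p" "1 / p < 1 / r" "1 / p < 1 / s" "1 / r + 1 / s = 1 + 1 / p"
  shows "(\<integral>\<^sup>+x. epow (\<integral>\<^sup>+y. k (x - y) * F y \<partial>lborel) p \<partial>lborel) \<le>
     epow (epow (\<integral>\<^sup>+x. epow (k x) r \<partial>lborel) (1 / r) * epow (\<integral>\<^sup>+x. epow (F x) s \<partial>lborel) (1 / s)) p"
proof -
  let ?K = "\<integral>\<^sup>+x. epow (k x) r \<partial>lborel" and ?F = "\<integral>\<^sup>+x. epow (F x) s \<partial>lborel"
  let ?J = "\<lambda>x. \<integral>\<^sup>+y. epow (k (x - y)) r * epow (F y) s \<partial>lborel"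
  have split: "epow u r = epow u r" "r * (1 / p) + r * (1 / r - 1 / p) = 1"
     "s * (1 / p) + s * (1 / s - 1 / p) = 1" for u
    using e by (auto simp: field_simps)
  have "epow (\<integral>\<^sup>+y. k (x - y) * F y \<partial>lborel) p \<le> ?J x * (epow ?K (p / r - 1) * epow ?F (p / s - 1))" for x
  proof -
    have "k (x - y) * F y = epow (epow (k (x - y)) r * epow (F y) s) (1 / p) *
        epow (epow (k (x - y)) r) (1 / r - 1 / p) * epow (epow (F y) s) (1 / s - 1 / p)" for y
    proof -
      have "k (x - y) * F y = epow (k (x - y)) (r * (1 / p) + r * (1 / r - 1 / p)) *
          epow (F y) (s * (1 / p) + s * (1 / s - 1 / p))"
        unfolding split by simp
      then show ?thesis unfolding epow_add by (simp only: epow_mult epow_epow mult_ac)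
    qed
    then have "(\<integral>\<^sup>+y. k (x - y) * F y \<partial>lborel) \<le> epow (?J x) (1 / p) *
       epow (\<integral>\<^sup>+y. epow (k (x - y)) r \<partial>lborel) (1 / r - 1 / p) * epow ?F (1 / s - 1 / p)"
      using e by (simp only:) (intro nn_integral_holder3, auto)
    also have "(\<integral>\<^sup>+y. epow (k (x - y)) r \<partial>lborel) = ?K"
      by (rule nn_integral_lborel_reflect) measurable
    finally have "epow (\<integral>\<^sup>+y. k (x - y) * F y \<partial>lborel) p \<le>
       epow (epow (?J x) (1 / p) * epow ?K (1 / r - 1 / p) * epow ?F (1 / s - 1 / p)) p"
      using e by (intro epow_mono) auto
    also have "\<dots> = ?J x * (epow ?K (p / r - 1) * epow ?F (p / s - 1))"
      using e by (simp add: epow_mult epow_epow algebra_simps)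
    finally show ?thesis .
  qed
  then have "(\<integral>\<^sup>+x. epow (\<integral>\<^sup>+y. k (x - y) * F y \<partial>lborel) p \<partial>lborel) \<le>
     (\<integral>\<^sup>+x. ?J x * (epow ?K (p / r - 1) * epow ?F (p / s - 1)) \<partial>lborel)"
    by (intro nn_integral_mono) auto
  also have "\<dots> = (\<integral>\<^sup>+x. ?J x \<partial>lborel) * (epow ?K (p / r - 1) * epow ?F (p / s - 1))"
    by (rule nn_integral_multc) measurable
  also have "(\<integral>\<^sup>+x. ?J x \<partial>lborel) = (\<integral>\<^sup>+y. \<integral>\<^sup>+x. epow (k (x - y)) r * epow (F y) s \<partial>lborel \<partial>lborel)"
    by (rule lborel_pair.Fubini') measurable
  also have "\<dots> = (\<integral>\<^sup>+y. ?K * epow (F y) s \<partial>lborel)"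
    by (subst nn_integral_multc) (auto simp: nn_integral_lborel_shift[of "\<lambda>x. epow (k x) r"])
  also have "\<dots> = ?K * ?F" by (rule nn_integral_cmult) measurable
  also have "?K * ?F * (epow ?K (p / r - 1) * epow ?F (p / s - 1)) =
     (epow ?K 1 * epow ?K (p / r - 1)) * (epow ?F 1 * epow ?F (p / s - 1))"
    by (simp add: mult_ac)
  also have "\<dots> = epow (epow ?K (1 / r) * epow ?F (1 / s)) p"
    unfolding epow_add[symmetric] by (simp add: epow_mult epow_epow)
  finally show ?thesis .
qed

section \<open>The dyadic maximal operator\<close>

definition avg :: "real \<Rightarrow> (real \<Rightarrow> ennreal) \<Rightarrow> real \<Rightarrow> ennreal" where
  "avg r F t = (\<integral>\<^sup>+s. (if \<bar>t - s\<bar> \<le> r then F s else 0) \<partial>lborel) / ennreal (2 * r)"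

text \<open>Only the radii T/2^n occur. The supremum is then countable, hence measurable, and these
  are the scales into which the singular kernel in time is decomposed.\<close>

definition maximal :: "real \<Rightarrow> (real \<Rightarrow> ennreal) \<Rightarrow> real \<Rightarrow> ennreal" where
  "maximal T F t = (SUP n. avg (T / 2 ^ n) F t)"

lemma avg_measurable [measurable]:
  assumes [measurable]: "F \<in> borel_measurable borel"
  shows "avg r F \<in> borel_measurable borel"
proof -
  have [measurable]: "(\<lambda>t. \<integral>\<^sup>+s. (if \<bar>t - s\<bar> \<le> r then F s else 0) \<partial>lborel) \<in> borel_measurable borel"
    by measurable
  show ?thesis unfolding avg_def[abs_def] by measurable
qed

lemma maximal_measurable [measurable]:
  assumes [measurable]: "F \<in> borel_measurable borel"
  shows "maximal T F \<in> borel_measurable borel"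
  unfolding maximal_def[abs_def] by measurable

lemma avg_add:
  assumes [measurable]: "F \<in> borel_measurable borel" "G \<in> borel_measurable borel"
  shows "avg r (\<lambda>s. F s + G s) t = avg r F t + avg r G t"
proof -
  have "(\<integral>\<^sup>+s. (if \<bar>t - s\<bar> \<le> r then F s + G s else 0) \<partial>lborel) =
    (\<integral>\<^sup>+s. (if \<bar>t - s\<bar> \<le> r then F s else 0) + (if \<bar>t - s\<bar> \<le> r then G s else 0) \<partial>lborel)"
    by (intro nn_integral_cong) auto
  then show ?thesis
    unfolding avg_def by (simp add: nn_integral_add add_divide_distrib_ennreal)
qed

lemma avg_cmult:
  assumes [measurable]: "F \<in> borel_measurable borel"
  shows "avg r (\<lambda>s. c * F s) t = c * avg r F t"
proof -
  have "(\<integral>\<^sup>+s. (if \<bar>t - s\<bar> \<le> r then c * F s else 0) \<partial>lborel) =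
    (\<integral>\<^sup>+s. c * (if \<bar>t - s\<bar> \<le> r then F s else 0) \<partial>lborel)"
    by (intro nn_integral_cong) auto
  then show ?thesis
    unfolding avg_def by (simp add: nn_integral_cmult ennreal_times_divide)
qed

lemma avg_mono:
  "(\<And>s. \<bar>t - s\<bar> \<le> r \<Longrightarrow> F s \<le> G s) \<Longrightarrow> avg r F t \<le> avg r G t"
  unfolding avg_def by (intro divide_right_mono_ennreal nn_integral_mono) auto

lemma avg_const: "0 < r \<Longrightarrow> avg r (\<lambda>_. c) t = c"
proof -
  assume r: "0 < r"
  have "(\<integral>\<^sup>+s. (if \<bar>t - s\<bar> \<le> r then c else 0) \<partial>lborel) = (\<integral>\<^sup>+s. c * indicator {t-r..t+r} s \<partial>lborel)"
    by (intro nn_integral_cong) (auto simp: indicator_def)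
  also have "\<dots> = c * ennreal (2 * r)" using r by (simp add: nn_integral_cmult_indicator)
  finally show ?thesis unfolding avg_def
    using r by (simp add: ennreal_mult_divide_eq)
qed

text \<open>Vitali's covering lemma, applicable because the radii are bounded by \<open>T\<close>,
  selects disjoint intervals whose fivefold enlargements cover the level set. On each selected
  interval the integral of \<open>F\<close> is at least \<open>l\<close> times the length, and the
  enlargement gives the constant 5/l.\<close>

lemma maximal_weak_type:
  assumes [measurable]: "F \<in> borel_measurable borel" and T: "0 < T" and l: "0 < l"
  shows "emeasure lborel {t. ennreal l < maximal T F t} \<le> ennreal (5 / l) * (\<integral>\<^sup>+s. F s \<partial>lborel)"
proof -
  let ?E = "{t. ennreal l < maximal T F t}"
  have "\<exists>n. ennreal l < avg (T / 2 ^ n) F t" if "t \<in> ?E" for t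
    using that unfolding maximal_def by (auto simp: less_SUP_iff)
  then obtain n where n: "\<And>t. t \<in> ?E \<Longrightarrow> ennreal l < avg (T / 2 ^ n t) F t" by metis
  define r where "r t = T / 2 ^ n t" for t
  have r: "0 < r t" "r t \<le> T" for t
    using T by (auto simp: r_def field_simps)
  have big: "ennreal (10 * r t) \<le> ennreal (5 / l) * (\<integral>\<^sup>+s. F s * indicator (cball t (r t)) s \<partial>lborel)"
    if "t \<in> ?E" for t
  proof -
    have "(\<integral>\<^sup>+s. (if \<bar>t - s\<bar> \<le> r t then F s else 0) \<partial>lborel) = (\<integral>\<^sup>+s. F s * indicator (cball t (r t)) s \<partial>lborel)"
      by (intro nn_integral_cong) (auto simp: dist_real_def)
    then have "ennreal l \<le> (\<integral>\<^sup>+s. F s * indicator (cball t (r t)) s \<partial>lborel) / ennreal (2 * r t)"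
      using n[OF that] unfolding avg_def r_def by simp
    from mult_right_mono[OF this, of "ennreal (2 * r t)"]
    have "ennreal l * ennreal (2 * r t) \<le> (\<integral>\<^sup>+s. F s * indicator (cball t (r t)) s \<partial>lborel)"
      using r[of t] by (simp add: ennreal_divide_times)
    then have "ennreal (5 / l) * (ennreal l * ennreal (2 * r t)) \<le>
       ennreal (5 / l) * (\<integral>\<^sup>+s. F s * indicator (cball t (r t)) s \<partial>lborel)"
      by (rule mult_left_mono) simp
    also have "ennreal (5 / l) * (ennreal l * ennreal (2 * r t)) = ennreal (10 * r t)"
      using r[of t] l by (simp add: ennreal_mult[symmetric])
    finally show ?thesis .
  qed
  obtain C where C: "countable C" "C \<subseteq> ?E"
     "pairwise (\<lambda>i j. disjnt (cball i (r i)) (cball j (r j))) C"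
     "?E \<subseteq> (\<Union>i\<in>C. cball i (5 * r i))"
    by (rule Vitali_covering_lemma_cballs[where S = ?E and K = ?E and a = "\<lambda>t. t" and r = r and B = T]) (use r in \<open>auto simp: less_imp_le\<close>)
  have "emeasure lborel ?E = (\<integral>\<^sup>+x. indicator ?E x \<partial>lborel)" by simp
  \<comment> \<open>The sum over the countable selection is written as an integral for the counting
    measure, so that it can be exchanged with the Lebesgue integral.\<close>
  also have "\<dots> \<le> (\<integral>\<^sup>+x. \<integral>\<^sup>+i. indicator (cball i (5 * r i)) x \<partial>count_space C \<partial>lborel)"
  proof (rule nn_integral_mono)
    fix x
    show "indicator ?E x \<le> (\<integral>\<^sup>+i. indicator (cball i (5 * r i)) x \<partial>count_space C)"
    proof (cases "x \<in> ?E")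
      case True
      then obtain i where i: "i \<in> C" "x \<in> cball i (5 * r i)" using C by blast
      have "1 = (\<integral>\<^sup>+j. indicator {i} j \<partial>count_space C)"
        using i by (simp add: emeasure_count_space_finite)
      also have "\<dots> \<le> (\<integral>\<^sup>+i. indicator (cball i (5 * r i)) x \<partial>count_space C)"
        using i by (intro nn_integral_mono) (auto split: split_indicator)
      finally show ?thesis using True by simp
    qed simp
  qed
  also have "\<dots> = (\<integral>\<^sup>+i. \<integral>\<^sup>+x. indicator (cball i (5 * r i)) x \<partial>lborel \<partial>count_space C)"
    by (rule nn_integral_count_space_nn_integral) (use C in \<open>auto intro!: borel_measurable_indicator\<close>)
  also have "\<dots> = (\<integral>\<^sup>+i. ennreal (10 * r i) \<partial>count_space C)"
    using r by (intro nn_integral_cong) (simp add: cball_eq_atLeastAtMost less_imp_le)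
  also have "\<dots> \<le> (\<integral>\<^sup>+i. ennreal (5 / l) * (\<integral>\<^sup>+s. F s * indicator (cball i (r i)) s \<partial>lborel) \<partial>count_space C)"
    using C big by (intro nn_integral_mono) auto
  also have "\<dots> = ennreal (5 / l) * (\<integral>\<^sup>+i. \<integral>\<^sup>+s. F s * indicator (cball i (r i)) s \<partial>lborel \<partial>count_space C)"
    by (rule nn_integral_cmult) simp
  also have "(\<integral>\<^sup>+i. \<integral>\<^sup>+s. F s * indicator (cball i (r i)) s \<partial>lborel \<partial>count_space C) =
      (\<integral>\<^sup>+s. \<integral>\<^sup>+i. F s * indicator (cball i (r i)) s \<partial>count_space C \<partial>lborel)"
    by (rule nn_integral_count_space_nn_integral[symmetric]) (use C assms(1) in \<open>auto intro!: borel_measurable_times_ennreal borel_measurable_indicator\<close>)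
  also have "\<dots> \<le> (\<integral>\<^sup>+s. F s \<partial>lborel)"
  proof (rule nn_integral_mono)
    fix s
    \<comment> \<open>By disjointness at most one of the unenlarged intervals contains
      \<open>s\<close>.\<close>
    have "(\<integral>\<^sup>+i. indicator (cball i (r i)) s \<partial>count_space C) \<le> (1::ennreal)"
    proof (cases "\<exists>i\<in>C. s \<in> cball i (r i)")
      case True
      then obtain i where i: "i \<in> C" "s \<in> cball i (r i)" by blast
      have "indicator (cball j (r j)) s \<le> (indicator {i} j :: ennreal)" if "j \<in> C" for j
        using pairwiseD[OF C(3) that i(1)] i unfolding disjnt_iff by (auto split: split_indicator simp del: mem_cball)
      then have "(\<integral>\<^sup>+i. indicator (cball i (r i)) s \<partial>count_space C) \<le> (\<integral>\<^sup>+j. indicator {i} j \<partial>count_space C)"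
        by (intro nn_integral_mono) auto
      then show ?thesis using i by (simp add: emeasure_count_space_finite)
    next
      case False
      then have "(\<integral>\<^sup>+i. indicator (cball i (r i)) s \<partial>count_space C) = (\<integral>\<^sup>+i. (0::ennreal) \<partial>count_space C)"
        by (intro nn_integral_cong) auto
      then show ?thesis by simp
    qed
    then have "F s * (\<integral>\<^sup>+i. indicator (cball i (r i)) s \<partial>count_space C) \<le> F s * 1"
      by (intro mult_left_mono) auto
    then show "(\<integral>\<^sup>+i. F s * indicator (cball i (r i)) s \<partial>count_space C) \<le> F s"
      by (simp add: nn_integral_cmult)
  qed
  finally show ?thesis by (simp add: mult_left_mono)
qed

lemma epow_layer_cake:
  assumes c: "0 < c"
  shows "epow y c = (\<integral>\<^sup>+l. ennreal (c * l powr (c - 1)) * (if 0 < l \<and> ennreal l < y then 1 else 0) \<partial>lborel)"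
    (is "_ = ?I y")
proof -
  have fin: "?I (ennreal Y) = ennreal (Y powr c)" if Y: "0 \<le> Y" for Y
  proof -
    have "((\<lambda>l. c * l powr (c - 1)) has_integral (c * (Y powr (c - 1 + 1) / (c - 1 + 1)))) {0..Y}"
      by (intro has_integral_mult_right has_integral_powr_from_0) (use c Y in auto)
    then have "((\<lambda>l. if l \<in> {0..Y} then c * l powr (c - 1) else 0) has_integral (Y powr c)) UNIV"
      using c by (subst has_integral_restrict_UNIV) simp
    then have "(\<integral>\<^sup>+l. ennreal (if l \<in> {0..Y} then c * l powr (c - 1) else 0) \<partial>lborel) = ennreal (Y powr c)"
      using c by (intro nn_integral_has_integral_lborel) auto
    moreover have "(\<integral>\<^sup>+l. ennreal (if l \<in> {0..Y} then c * l powr (c - 1) else 0) \<partial>lborel) = ?I (ennreal Y)"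
    proof (rule nn_integral_cong_AE)
      show "AE l in lborel. ennreal (if l \<in> {0..Y} then c * l powr (c - 1) else 0) =
          ennreal (c * l powr (c - 1)) * (if 0 < l \<and> ennreal l < ennreal Y then 1 else 0)"
        using AE_lborel_singleton[of Y] AE_lborel_singleton[of 0]
        by eventually_elim (auto simp: ennreal_less_iff)
    qed
    ultimately show ?thesis by simp
  qed
  show ?thesis
  proof (cases y)
    case (real Y)
    then show ?thesis using fin by (simp add: epow_ennreal)
  next
    case top
    \<comment> \<open>For an infinite \<open>y\<close> the integral dominates its value at every
      finite level, so it exceeds every real number.\<close>
    have "ennreal Z \<le> ?I y" if "0 \<le> Z" for Z
    proof -
      have "ennreal Z = ?I (ennreal (Z powr (1 / c)))"
        using fin[of "Z powr (1/c)"] c that by (simp add: powr_powr)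
      also have "\<dots> \<le> ?I y" using top by (intro nn_integral_mono mult_left_mono) auto
      finally show ?thesis .
    qed
    from this[of "enn2real (?I y) + 1"] have "?I y = top"
      by (cases "?I y") (auto simp: ennreal_le_iff)
    then show ?thesis using top by simp
  qed
qed

text \<open>Marcinkiewicz interpolation between the weak bound and the trivial bound for bounded
  functions. At height \<open>l\<close> the part of \<open>F\<close> below \<open>l / 2\<close>
  contributes at most \<open>l / 2\<close> to any average, so only the part above
  \<open>l / 2\<close> enters the weak bound; integrating over \<open>l\<close> leaves a layer-cake
  formula with exponent \<open>b - 1\<close>.\<close>

lemma maximal_strong_type:
  fixes b :: real
  assumes [measurable]: "F \<in> borel_measurable borel" and T: "0 < T" and b: "1 < b"
  shows "(\<integral>\<^sup>+t. epow (maximal T F t) b \<partial>lborel) \<le>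
     ennreal (10 * b / (b - 1) * 2 powr (b - 1)) * (\<integral>\<^sup>+t. epow (F t) b \<partial>lborel)"
proof -
  let ?P = "\<lambda>b l (y::ennreal). ennreal (b * l powr (b - 1)) * (if 0 < l \<and> ennreal l < y then 1 else 0)"
  define K where "K = 10 * b / (b - 1)"
  have K0: "0 \<le> K" "0 \<le> (b - 1) * l powr (b - 1 - 1)" for l using b by (auto simp: K_def)
  have weak: "emeasure lborel {t. ennreal l < maximal T F t} \<le>
     ennreal (10 / l) * (\<integral>\<^sup>+s. (if ennreal l < 2 * F s then F s else 0) \<partial>lborel)" if l: "0 < l" for l
  proof -
    let ?G = "\<lambda>s. if ennreal l < 2 * F s then F s else 0"
    have "ennreal (l/2) < maximal T ?G t" if lt: "ennreal l < maximal T F t" for t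
    proof -
      obtain n where n: "ennreal l < avg (T / 2 ^ n) F t"
        using lt unfolding maximal_def less_SUP_iff by blast
      have le: "F s \<le> ennreal (l/2) + ?G s" for s
      proof (cases "ennreal l < 2 * F s")
        case False
        then have "2 * F s \<le> ennreal l" by simp
        then show ?thesis using l
          by (cases "F s") (auto simp: ennreal_mult_top ennreal_mult[symmetric] ennreal_numeral[symmetric]
              ennreal_le_iff top_unique simp del: ennreal_numeral)
      qed auto
      have "avg (T / 2 ^ n) F t \<le> avg (T / 2 ^ n) (\<lambda>s. ennreal (l/2) + ?G s) t"
        by (rule avg_mono) (rule le)
      also have "\<dots> = ennreal (l/2) + avg (T / 2 ^ n) ?G t"
        using T by (subst avg_add) (auto simp: avg_const)
      finally have "ennreal (l / 2) + ennreal (l/2) < ennreal (l/2) + avg (T / 2 ^ n) ?G t"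
        using n l by (simp add: ennreal_plus[symmetric] del: ennreal_plus)
      then have "ennreal (l/2) < avg (T / 2 ^ n) ?G t" by (simp add: ennreal_add_left_cancel_less)
      then show ?thesis unfolding maximal_def by (auto simp: less_SUP_iff)
    qed
    then have "emeasure lborel {t. ennreal l < maximal T F t} \<le> emeasure lborel {t. ennreal (l/2) < maximal T ?G t}"
      by (intro emeasure_mono) auto
    also have "\<dots> \<le> ennreal (5 / (l/2)) * (\<integral>\<^sup>+s. ?G s \<partial>lborel)"
      using l T by (intro maximal_weak_type) auto
    finally show ?thesis by simp
  qed
  have "(\<integral>\<^sup>+t. epow (maximal T F t) b \<partial>lborel) = (\<integral>\<^sup>+t. \<integral>\<^sup>+l. ?P b l (maximal T F t) \<partial>lborel \<partial>lborel)"
    using b by (subst epow_layer_cake) auto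
  also have "\<dots> = (\<integral>\<^sup>+l. \<integral>\<^sup>+t. ?P b l (maximal T F t) \<partial>lborel \<partial>lborel)"
    by (rule lborel_pair.Fubini') measurable
  also have "\<dots> \<le> (\<integral>\<^sup>+l. \<integral>\<^sup>+s. ennreal K * (F s * ?P (b - 1) l (2 * F s)) \<partial>lborel \<partial>lborel)"
  proof (rule nn_integral_mono)
    fix l :: real
    show "(\<integral>\<^sup>+t. ?P b l (maximal T F t) \<partial>lborel) \<le>
       (\<integral>\<^sup>+s. ennreal K * (F s * ?P (b - 1) l (2 * F s)) \<partial>lborel)"
    proof (cases "0 < l")
      case True
      have "(\<integral>\<^sup>+t. ?P b l (maximal T F t) \<partial>lborel) =
          ennreal (b * l powr (b - 1)) * emeasure lborel {t. ennreal l < maximal T F t}"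
        using True by (subst nn_integral_cmult_indicator[symmetric]) (auto intro!: nn_integral_cong simp: indicator_def)
      also have "\<dots> \<le> ennreal (b * l powr (b - 1)) * (ennreal (10 / l) * (\<integral>\<^sup>+s. (if ennreal l < 2 * F s then F s else 0) \<partial>lborel))"
        by (intro mult_left_mono weak True) simp
      also have "\<dots> = ennreal (b * l powr (b - 1) * (10 / l)) * (\<integral>\<^sup>+s. (if ennreal l < 2 * F s then F s else 0) \<partial>lborel)"
        using True b by (subst mult.assoc[symmetric], subst ennreal_mult[symmetric]) auto
      \<comment> \<open>The constant \<open>K\<close> is chosen so that the factor left over is the
        density of the layer-cake formula for the exponent \<open>b - 1\<close>.\<close>
      also have "b * l powr (b - 1) * (10 / l) = K * ((b - 1) * l powr (b - 1 - 1))"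
        using True b by (simp add: K_def powr_diff power2_eq_square)
      also have "ennreal \<dots> * (\<integral>\<^sup>+s. (if ennreal l < 2 * F s then F s else 0) \<partial>lborel) =
          (\<integral>\<^sup>+s. ennreal K * (F s * ?P (b - 1) l (2 * F s)) \<partial>lborel)"
        using True by (subst ennreal_mult[OF K0], subst nn_integral_cmult[symmetric])
         (auto intro!: nn_integral_cong simp: mult_ac)
      finally show ?thesis .
    qed simp
  qed
  also have "\<dots> = (\<integral>\<^sup>+s. \<integral>\<^sup>+l. ennreal K * (F s * ?P (b - 1) l (2 * F s)) \<partial>lborel \<partial>lborel)"
    by (rule lborel_pair.Fubini') measurable
  also have "\<dots> = (\<integral>\<^sup>+s. ennreal K * (F s * epow (2 * F s) (b - 1)) \<partial>lborel)"
    using b by (subst epow_layer_cake) (simp_all add: nn_integral_cmult)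
  also have "\<dots> = (\<integral>\<^sup>+s. ennreal (K * 2 powr (b - 1)) * epow (F s) (1 + (b - 1)) \<partial>lborel)"
  proof (rule nn_integral_cong)
    fix s
    have "epow 2 (b - 1) = ennreal (2 powr (b - 1))" using epow_ennreal[of 2] by simp
    then show "ennreal K * (F s * epow (2 * F s) (b - 1)) =
       ennreal (K * 2 powr (b - 1)) * epow (F s) (1 + (b - 1))"
      unfolding epow_add epow_mult using K0 by (simp add: ennreal_mult[of K "2 powr (b - 1)"] mult_ac)
  qed
  also have "\<dots> = ennreal (K * 2 powr (b - 1)) * (\<integral>\<^sup>+s. epow (F s) b \<partial>lborel)"
    by (simp add: nn_integral_cmult)
  finally show ?thesis unfolding K_def .
qed

text \<open>Diening's variable-exponent substitute for Jensen's inequality: as \<open>A \<le> D / r\<close>, the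
  log-Hoelder condition keeps \<open>A powr (h s - h t)\<close> bounded for \<open>\<bar>s - t\<bar> \<le> r\<close>, where
  \<open>A = 1 + avg r (\<lambda>s. epow (F s) (1 / h s)) t\<close>.\<close>

lemma avg_log_holder:
  fixes h :: "real \<Rightarrow> real"
  assumes [measurable]: "F \<in> borel_measurable borel" "h \<in> borel_measurable borel"
    and r: "0 < r" and D: "1 \<le> D" and c: "0 < c"
    and h: "\<And>s. s \<in> S \<Longrightarrow> 0 < h s \<and> h s \<le> 1"
    and hol: "\<And>s. s \<in> S \<Longrightarrow> \<bar>h s - h t\<bar> \<le> c / ln (exp 1 + 1 / \<bar>s - t\<bar>)"
    and t: "t \<in> S" and F0: "\<And>s. s \<notin> S \<Longrightarrow> F s = 0"
    and A: "1 + avg r (\<lambda>s. epow (F s) (1 / h s)) t \<le> ennreal (D / r)"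
  shows "avg r F t \<le> ennreal (2 * (D powr c * exp c)) *
     epow (1 + avg r (\<lambda>s. epow (F s) (1 / h s)) t) (h t)"
proof -
  define A where "A = 1 + avg r (\<lambda>s. epow (F s) (1 / h s)) t"
  have "A < top" using A unfolding A_def by (metis ennreal_less_top le_less_trans)
  then obtain a where a: "A = ennreal a" "0 \<le> a" by (cases A) auto
  have "1 \<le> A" unfolding A_def by simp
  then have a1: "1 \<le> a" using a by simp
  have aD: "a \<le> D / r" using A a r D unfolding A_def[symmetric] by (simp add: ennreal_le_iff)
  define L where "L = ln (exp 1 + 1 / r)"
  have "ln (exp 1) \<le> L" unfolding L_def using r by (subst ln_le_cancel_iff) (auto intro: add_pos_pos)
  then have L: "1 \<le> L" by simp
  have hr: "h s - h t \<le> c / L" if s: "s \<in> S" "\<bar>t - s\<bar> \<le> r" for s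
  proof (cases "s = t")
    case False
    then have "1 / r \<le> 1 / \<bar>s - t\<bar>" using s by (intro divide_left_mono) (auto simp: abs_minus_commute r)
    then have "L \<le> ln (exp 1 + 1 / \<bar>s - t\<bar>)"
      unfolding L_def using r False by (subst ln_le_cancel_iff) (auto intro: add_pos_pos)
    then have "c / ln (exp 1 + 1 / \<bar>s - t\<bar>) \<le> c / L"
      using c L by (intro divide_left_mono) auto
    then show ?thesis using hol[OF s(1)] by linarith
  qed (use c L in simp)
  \<comment> \<open>Here the logarithm is matched: \<open>a \<le> D / r\<close>, and
    \<open>ln (1 / r) \<le> L\<close> gives \<open>(1 / r) powr (c / L) \<le> exp c\<close>, a bound
    free of \<open>r\<close>.\<close>
  have "a powr (c / L) \<le> D powr c * exp c"
  proof -
    have "a powr (c / L) \<le> (D / r) powr (c / L)"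
      using a aD c L by (intro powr_mono2) auto
    also have "\<dots> = D powr (c / L) * (1 / r) powr (c / L)"
      using D r by (subst powr_mult[symmetric]) auto
    also have "\<dots> \<le> D powr c * exp c"
    proof (intro mult_mono)
      have "c / L \<le> c / 1" using c L by (intro divide_left_mono) auto
      then show "D powr (c / L) \<le> D powr c" using D by (intro powr_mono) auto
      have "ln (1 / r) \<le> L" unfolding L_def using r by (subst ln_le_cancel_iff) (auto intro: add_pos_pos)
      then have "c / L * ln (1 / r) \<le> c / L * L" using c L by (intro mult_left_mono) auto
      also have "\<dots> = c" using L by simp
      finally show "(1 / r) powr (c / L) \<le> exp c" using r by (simp add: powr_def)
    qed auto
    finally show ?thesis .
  qed
  then have pw: "a powr (h s) \<le> (D powr c * exp c) * a powr (h t)" if "s \<in> S" "\<bar>t - s\<bar> \<le> r" for s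
  proof -
    have "a powr (h s) = a powr (h s - h t) * a powr (h t)" by (simp add: powr_add[symmetric])
    also have "\<dots> \<le> a powr (c / L) * a powr (h t)"
      using hr[OF that] a1 by (intro mult_right_mono powr_mono) auto
    also have "\<dots> \<le> (D powr c * exp c) * a powr (h t)"
      using \<open>a powr (c / L) \<le> D powr c * exp c\<close> by (intro mult_right_mono) auto
    finally show ?thesis .
  qed
  let ?C = "ennreal (D powr c * exp c)"
  have "F s \<le> ?C * epow A (h t) * (1 + epow (F s) (1 / h s) / A)" if "\<bar>t - s\<bar> \<le> r" for s
  proof (cases "s \<in> S")
    case True
    \<comment> \<open>Where \<open>F s\<close> exceeds \<open>epow A (h s)\<close>, the quotient of
      the two is at least 1 and grows under the exponent \<open>1 / h s \<ge> 1\<close>; its power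
      is \<open>epow (F s) (1 / h s) / A\<close>, whose average is at most 1 by the definition of
      \<open>A\<close>.\<close>
    have "F s \<le> epow A (h s) * (1 + epow (F s) (1 / h s) / A)"
    proof (cases "F s \<le> epow A (h s)")
      case True
      then have "F s \<le> epow A (h s) * 1" by simp
      also have "\<dots> \<le> epow A (h s) * (1 + epow (F s) (1 / h s) / A)" by (intro mult_left_mono) auto
      finally show ?thesis .
    next
      case False
      show ?thesis
      proof (cases "F s")
        case (real f)
        have f: "a powr (h s) < f" using False a real by (simp add: epow_ennreal)
        have f0: "0 < f" using f by (meson le_less_trans powr_ge_zero)
        have h': "1 \<le> 1 / h s" using h[OF \<open>s \<in> S\<close>] by simp
        have "(f / a powr h s) powr 1 \<le> (f / a powr h s) powr (1 / h s)"
          using f a1 h' by (intro powr_mono) auto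
        also have "\<dots> = f powr (1 / h s) / a"
          using h[OF \<open>s \<in> S\<close>] a1 f0 by (simp add: powr_divide powr_powr)
        finally have "f \<le> a powr h s * (f powr (1 / h s) / a)"
          using f0 a1 by (simp add: field_simps)
        also have "\<dots> \<le> a powr h s * (1 + f powr (1 / h s) / a)"
          by (intro mult_left_mono) auto
        finally show ?thesis
          using real a a1 by (simp add: epow_ennreal divide_ennreal ennreal_mult[symmetric]
              ennreal_plus[symmetric] ennreal_leI ennreal_1[symmetric] del: ennreal_plus ennreal_1)
      next
        case top
        then show ?thesis using a a1 by (simp add: epow_ennreal ennreal_top_divide ennreal_mult_top)
      qed
    qed
    also have "\<dots> \<le> (?C * epow A (h t)) * (1 + epow (F s) (1 / h s) / A)"
      using pw[OF True that] a by (intro mult_right_mono) (auto simp: epow_ennreal ennreal_mult[symmetric] ennreal_leI)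
    finally show ?thesis .
  qed (simp add: F0)
  then have "avg r F t \<le> avg r (\<lambda>s. ?C * epow A (h t) * (1 + epow (F s) (1 / h s) / A)) t"
    by (rule avg_mono)
  also have "\<dots> = ?C * epow A (h t) * (1 + avg r (\<lambda>s. inverse A * epow (F s) (1 / h s)) t)"
    using r by (subst avg_cmult) (auto simp: avg_add avg_const divide_ennreal_def mult.commute[of _ "inverse A"])
  also have "avg r (\<lambda>s. inverse A * epow (F s) (1 / h s)) t = avg r (\<lambda>s. epow (F s) (1 / h s)) t / A"
    by (simp add: avg_cmult divide_ennreal_def mult.commute)
  also have "\<dots> \<le> A / A" unfolding A_def by (intro divide_right_mono_ennreal) simp
  also have "A / A = 1" using a a1 by (simp add: divide_ennreal)
  finally have "avg r F t \<le> ?C * epow A (h t) * (1 + 1)"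
    by (simp add: mult_left_mono)
  also have "\<dots> = ennreal (2 * (D powr c * exp c)) * epow A (h t)"
    by (simp add: ennreal_mult mult_ac)
  finally show ?thesis unfolding A_def .
qed

section \<open>Fractional integrals with variable exponent\<close>

text \<open>This is the optimisation over scales in Hedberg's argument. After rescaling by
  \<open>sqrt x\<close>, a geometric sequence \<open>z n\<close> crosses the level 1 once, and
  \<open>min (z n) (1 / z n)\<close> decays geometrically on both sides of the crossing. Each side
  sums to at most \<open>1 / (1 - \<theta>)\<close>.\<close>

lemma suminf_min_geometric:
  fixes \<theta> x y :: real
  assumes \<theta>: "0 < \<theta>" "\<theta> < 1" and x: "0 \<le> x" and y: "0 < y"
  shows "(\<Sum>n. ennreal (min (x * (y * \<theta> ^ n)) (1 / (y * \<theta> ^ n)))) \<le> ennreal (2 / (1 - \<theta>) * sqrt x)"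
proof (cases "x = 0")
  case True
  then show ?thesis using y \<theta> by simp
next
  case False
  then have x: "0 < x" using x by simp
  define z where "z n = sqrt x * (y * \<theta> ^ n)" for n
  have z: "0 < z n" for n using x y \<theta> by (simp add: z_def)
  have m: "min (x * (y * \<theta> ^ n)) (1 / (y * \<theta> ^ n)) = sqrt x * min (z n) (1 / z n)" for n
  proof -
    have "x = sqrt x * sqrt x" using x by simp
    then have "x * (y * \<theta> ^ n) = sqrt x * z n" unfolding z_def by (simp add: mult.assoc[symmetric])
    moreover have "1 / (y * \<theta> ^ n) = sqrt x * (1 / z n)" using x by (simp add: z_def)
    ultimately show ?thesis using x by (simp add: min_mult_distrib_left)
  qed
  have "\<exists>n. z n \<le> 1"
  proof -
    have "(\<lambda>n. sqrt x * (y * \<theta> ^ n)) \<longlonglongrightarrow> sqrt x * (y * 0)"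
      using \<theta> by (intro tendsto_intros) auto
    then have "eventually (\<lambda>n. z n < 1) sequentially"
      unfolding z_def by (rule order_tendstoD) simp
    then show ?thesis unfolding eventually_sequentially by (meson order_refl less_imp_le)
  qed
  define N where "N = (LEAST n. z n \<le> 1)"
  have N: "z N \<le> 1" unfolding N_def using \<open>\<exists>n. z n \<le> 1\<close> by (rule LeastI_ex)
  have zadd: "z (i + n) = z n * \<theta> ^ i" for i n by (simp add: z_def power_add mult_ac)
  have hi: "min (z (i + N)) (1 / z (i + N)) \<le> \<theta> ^ i" for i
    using N mult_right_mono[OF N, of "\<theta> ^ i"] \<theta> by (auto simp: zadd intro: min.coboundedI1)
  have lo: "min (z n) (1 / z n) \<le> \<theta> ^ (N - 1 - n)" if n: "n < N" for n
  proof -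
    have "\<not> z (N - 1) \<le> 1" using n not_less_Least[of "N - 1" "\<lambda>n. z n \<le> 1"] unfolding N_def[symmetric] by auto
    moreover have "z (N - 1) = z n * \<theta> ^ (N - 1 - n)" using zadd[of "N - 1 - n" n] n by simp
    ultimately have "1 \<le> z n * \<theta> ^ (N - 1 - n)" by simp
    then have "1 / z n \<le> \<theta> ^ (N - 1 - n)" using z[of n] by (simp add: field_simps)
    then show ?thesis by simp
  qed
  have geo: "(\<Sum>i. \<theta> ^ i) = 1 / (1 - \<theta>)" "summable (\<lambda>i. \<theta> ^ i)"
    using \<theta> by (auto intro: suminf_geometric summable_geometric)
  have s: "summable (\<lambda>i. min (z (i + N)) (1 / z (i + N)))"
    by (rule summable_comparison_test'[OF geo(2), of 0]) (use hi z in \<open>auto simp: less_imp_le\<close>)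
  then have s': "summable (\<lambda>i. min (z i) (1 / z i))" by (subst (asm) summable_iff_shift)
  have "(\<Sum>i. min (z i) (1 / z i)) = (\<Sum>i. min (z (i + N)) (1 / z (i + N))) + (\<Sum>i<N. min (z i) (1 / z i))"
    by (rule suminf_split_initial_segment[OF s'])
  also have "\<dots> \<le> 1 / (1 - \<theta>) + 1 / (1 - \<theta>)"
  proof (rule add_mono)
    show "(\<Sum>i. min (z (i + N)) (1 / z (i + N))) \<le> 1 / (1 - \<theta>)"
      unfolding geo(1)[symmetric] by (intro suminf_le hi s geo)
    have "(\<Sum>i<N. min (z i) (1 / z i)) \<le> (\<Sum>i<N. \<theta> ^ (N - 1 - i))"
      by (intro sum_mono lo) auto
    also have "\<dots> = (\<Sum>i<N. \<theta> ^ i)" by (subst sum.nat_diff_reindex[symmetric]) simp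
    also have "\<dots> \<le> (\<Sum>i. \<theta> ^ i)" using \<theta> by (intro sum_le_suminf geo) auto
    finally show "(\<Sum>i<N. min (z i) (1 / z i)) \<le> 1 / (1 - \<theta>)" by (simp add: geo)
  qed
  finally have *: "(\<Sum>i. min (z i) (1 / z i)) \<le> 2 / (1 - \<theta>)" by simp
  have "(\<Sum>n. ennreal (min (x * (y * \<theta> ^ n)) (1 / (y * \<theta> ^ n)))) = ennreal (\<Sum>n. sqrt x * min (z n) (1 / z n))"
    unfolding m using x z s' by (intro suminf_ennreal2 summable_mult) (auto simp: less_imp_le)
  also have "(\<Sum>n. sqrt x * min (z n) (1 / z n)) = sqrt x * (\<Sum>n. min (z n) (1 / z n))"
    by (rule suminf_mult[OF s'])
  also have "\<dots> \<le> sqrt x * (2 / (1 - \<theta>))" using * x by (intro mult_left_mono) auto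
  finally show ?thesis by (simp add: ennreal_leI mult.commute)
qed

lemma epow_le_one_plus:
  assumes "0 < u" "u \<le> v"
  shows "epow x u \<le> 1 + epow x v"
proof (cases x)
  case (real r)
  have "r powr u \<le> 1 + r powr v"
  proof (cases "r \<le> 1")
    case True
    then have "r powr u \<le> 1" using assms real powr_mono2[of u r 1] by simp
    then show ?thesis using powr_ge_zero[of r v] by linarith
  next
    case False
    then have "r powr u \<le> r powr v" using assms by (intro powr_mono) auto
    then show ?thesis by simp
  qed
  then have "ennreal (r powr u) \<le> ennreal (1 + r powr v)" by (rule ennreal_leI)
  then show ?thesis using real by (simp add: epow_ennreal)
qed simp

text \<open>One term of the series is enough, that of the scale r = T/2^n with r/2 < d \<le> r. The
  condition \<open>a \<le> 1 - g\<close> allows replacing the power \<open>- a\<close> by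
  \<open>g - 1\<close> at the price of \<open>max 1 T\<close>. Of the constant 4, one factor 2 pays
  for d > r/2 and the other for the normalisation by 2r of an average.\<close>

lemma powr_near_singularity_le_suminf:
  fixes a g T :: real
  assumes T: "0 < T" and g: "0 < g" "g < 1" and a: "0 \<le> a" "a \<le> 1 - g" and d: "0 < d" "d \<le> T"
  shows "ennreal (d powr - a) \<le>
    (\<Sum>n. ennreal (4 * max 1 T * (T / 2 ^ n) powr g) * (if d \<le> T / 2 ^ n then inverse (ennreal (2 * (T / 2 ^ n))) else 0))"
    (is "_ \<le> (\<Sum>n. ?f n)")
proof -
  have "(\<lambda>n. T * (1/2) ^ n) \<longlonglongrightarrow> T * 0"
    by (intro tendsto_intros) auto
  then have "eventually (\<lambda>n. T * (1/2) ^ n < d) sequentially"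
    by (rule order_tendstoD) (use d in simp)
  then obtain m where "T / 2 ^ m < d"
    unfolding eventually_sequentially by (auto simp: power_divide)
  moreover have "T / 2 ^ Suc m \<le> T / 2 ^ m" using T by (simp add: field_simps)
  ultimately have ex: "\<exists>n. T / 2 ^ Suc n < d" by (meson le_less_trans)
  define n where "n = (LEAST n. T / 2 ^ Suc n < d)"
  have n1: "T / 2 ^ Suc n < d" unfolding n_def by (rule LeastI_ex[OF ex])
  have n2: "d \<le> T / 2 ^ n"
  proof (cases n)
    case (Suc k)
    then have "\<not> T / 2 ^ Suc k < d" using not_less_Least[of k] unfolding n_def[symmetric] by (metis lessI n_def)
    then show ?thesis using Suc by simp
  qed (use d in simp)
  define r where "r = T / 2 ^ n"
  have r: "0 < r" "r / 2 < d" "d \<le> r" using T n1 n2 by (auto simp: r_def)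
  have "d powr - a = d powr (1 - g - a) * d powr (g - 1)" by (simp add: powr_add[symmetric])
  also have "\<dots> \<le> max 1 T * (2 * r powr (g - 1))"
  proof (rule mult_mono)
    have "d powr (1 - g - a) \<le> max 1 T powr (1 - g - a)" using d a by (intro powr_mono2) auto
    also have "\<dots> \<le> max 1 T powr 1" using g a by (intro powr_mono) auto
    finally show "d powr (1 - g - a) \<le> max 1 T" by simp
    have "d powr (g - 1) \<le> (r / 2) powr (g - 1)" using r g by (intro powr_mono2') auto
    also have "\<dots> = 2 powr (1 - g) * r powr (g - 1)"
      using r by (simp add: powr_divide powr_minus_divide powr_diff)
    also have "\<dots> \<le> 2 powr 1 * r powr (g - 1)" using g by (intro mult_right_mono powr_mono) auto
    finally show "d powr (g - 1) \<le> 2 * r powr (g - 1)" by simp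
  qed auto
  also have "\<dots> = 4 * max 1 T * r powr g * inverse (2 * r)"
    using r by (simp add: powr_diff field_simps)
  finally have "ennreal (d powr - a) \<le> ennreal (4 * max 1 T * r powr g * inverse (2 * r))" by (rule ennreal_leI)
  also have "\<dots> = ?f n"
    using n2 r unfolding r_def[symmetric] by (simp add: inverse_ennreal ennreal_mult[symmetric])
  also have "\<dots> \<le> (\<Sum>n. ?f n)"
    using sum_le_suminf[of ?f "{n}"] by simp
  finally show ?thesis .
qed

text \<open>At scale r the kernel contributes r^(g t) times an average of \<open>F\<close>. That
  average is bounded by the maximal function and also by a multiple of r^(-2 g t); summing the
  better of the two bounds over the scales gives the square root of the maximal function. The latter
  is controlled by the maximal function of F^(1/(P g)), whose power P/2 > 1 is integrable, so that
  the maximal theorem for a constant exponent applies.\<close>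

lemma fractional_integral_bound:
  fixes g :: "real \<Rightarrow> real" and T \<gamma> P c a :: real
  assumes T: "0 < T" and [measurable]: "g \<in> borel_measurable borel"
    and P: "2 < P" and \<gamma>: "0 < \<gamma>" and c: "0 < c"
    and g: "\<And>s. 0 < s \<Longrightarrow> s < T \<Longrightarrow> \<gamma> \<le> g s \<and> g s \<le> 1 / P"
    and hol: "\<And>s t. 0 < s \<Longrightarrow> s < T \<Longrightarrow> 0 < t \<Longrightarrow> t < T \<Longrightarrow>
        \<bar>g s - g t\<bar> \<le> c / ln (exp 1 + 1 / \<bar>s - t\<bar>)"
    and a: "0 \<le> a" "a \<le> 1 - 1 / P"
  obtains K where "1 \<le> K"
    "\<And>F. F \<in> borel_measurable borel \<Longrightarrow>
        (\<integral>\<^sup>+s. indicator {0<..<T} s * epow (F s) (1 / (2 * g s)) \<partial>lborel) \<le> 1 \<Longrightarrow>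
        (\<integral>\<^sup>+t. indicator {0<..<T} t * epow (\<integral>\<^sup>+s. indicator {0<..<T} s *
            (ennreal (\<bar>t - s\<bar> powr - a) * F s) \<partial>lborel) (1 / g t) \<partial>lborel) \<le> ennreal K"
proof -
  \<comment> \<open>\<open>D\<close> makes the last hypothesis of \<open>avg_log_holder\<close> true
    for all radii up to \<open>T\<close>. \<open>C1\<close> and \<open>C2\<close> are the constants
    of that lemma for the functions \<open>P * g\<close> and \<open>2 * g\<close>, \<open>Ka\<close>
    is the constant of the dyadic decomposition, and \<open>Cm\<close> that of the maximal theorem
    for the exponent \<open>P / 2\<close>.\<close>
  define D where "D = 2 * T + 2"
  define C1 where "C1 = 2 * (D powr (P * c) * exp (P * c))"
  define C2 where "C2 = 2 * (D powr (2 * c) * exp (2 * c))"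
  define Ka where "Ka = 4 * max 1 T"
  define Kb where "Kb = Ka * (C2 * D * (2 / (1 - 2 powr - \<gamma>)))"
  define Kc where "Kc = max 1 (Kb * C1 powr (1/2))"
  define Cm where "Cm = 10 * (P / 2) / (P / 2 - 1) * 2 powr (P / 2 - 1)"
  define K where "K = max 1 (Kc powr (1 / \<gamma>) * 2 powr (P / 2) * (T + Cm))"
  have D: "1 \<le> D" using T by (simp add: D_def)
  have "1 * 1 \<le> D powr (P * c) * exp (P * c)" "1 * 1 \<le> D powr (2 * c) * exp (2 * c)"
    using D P c by (intro mult_mono ge_one_powr_ge_zero; simp)+
  then have C: "1 \<le> C1" "1 \<le> C2" by (auto simp: C1_def C2_def)
  have "1 / P < 1 / 2" using P by simp
  have \<gamma>2: "2 powr - \<gamma> < 1" using \<gamma> powr_less_mono[of "-\<gamma>" 0 2] by simp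
  have pos: "0 < Ka" "0 < Kb" "1 \<le> Kc" "0 \<le> Cm"
    using T C D \<gamma>2 P by (auto simp: Ka_def Kb_def Kc_def Cm_def intro!: mult_pos_pos)
  have main: "(\<integral>\<^sup>+t. indicator {0<..<T} t * epow (\<integral>\<^sup>+s. indicator {0<..<T} s *
            (ennreal (\<bar>t - s\<bar> powr - a) * F s) \<partial>lborel) (1 / g t) \<partial>lborel) \<le> ennreal K"
    if [measurable]: "F \<in> borel_measurable borel"
      and F: "(\<integral>\<^sup>+s. indicator {0<..<T} s * epow (F s) (1 / (2 * g s)) \<partial>lborel) \<le> 1" for F
  proof -
    define F0 where "F0 s = indicator {0<..<T} s * F s" for s
    define H where "H s = epow (F0 s) (1 / (P * g s))" for s
    have [measurable]: "F0 \<in> borel_measurable borel" unfolding F0_def[abs_def] by measurable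
    have [measurable]: "H \<in> borel_measurable borel" unfolding H_def[abs_def] by measurable
    have gpos: "0 < g s" "g s \<le> 1 / P" "g s < 1" "g s \<le> 1/2" "0 < 1 / g s" "1 \<le> 1 / g s"
      if "s \<in> {0<..<T}" for s
    proof -
      show "0 < g s" "g s \<le> 1 / P" using g[of s] \<gamma> that by auto
      then show "g s < 1" "g s \<le> 1/2" "0 < 1 / g s" "1 \<le> 1 / g s" using \<open>1 / P < 1/2\<close> by auto
    qed
    have F0int: "(\<integral>\<^sup>+s. epow (F0 s) (1 / (2 * g s)) \<partial>lborel) \<le> 1"
      by (rule order_trans[OF eq_refl F], intro nn_integral_cong) (auto simp: F0_def indicator_def)
    have intle: "(\<integral>\<^sup>+s. epow (F0 s) (1 / (k * g s)) \<partial>lborel) \<le> ennreal (T + 1)" if k: "2 \<le> k" for k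
    proof -
      have "(\<integral>\<^sup>+s. epow (F0 s) (1 / (k * g s)) \<partial>lborel) \<le>
         (\<integral>\<^sup>+s. indicator {0<..<T} s + epow (F0 s) (1 / (2 * g s)) \<partial>lborel)"
      proof (rule nn_integral_mono)
        fix s
        show "epow (F0 s) (1 / (k * g s)) \<le> indicator {0<..<T} s + epow (F0 s) (1 / (2 * g s))"
        proof (cases "s \<in> {0<..<T}")
          case True
          have "1 / (k * g s) \<le> 1 / (2 * g s)"
            using gpos[OF True] k by (intro divide_left_mono mult_right_mono mult_pos_pos) auto
          then show ?thesis using True epow_le_one_plus[of "1 / (k * g s)" "1 / (2 * g s)" "F0 s"] gpos[OF True] k
            by simp
        qed (simp add: F0_def)
      qed
      also have "\<dots> = ennreal T + (\<integral>\<^sup>+s. epow (F0 s) (1 / (2 * g s)) \<partial>lborel)"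
        using T by (subst nn_integral_add) auto
      also have "\<dots> \<le> ennreal T + 1" by (intro add_left_mono F0int)
      finally show ?thesis using T by simp
    qed
    have avgle: "1 + avg r (\<lambda>s. epow (F0 s) (1 / (k * g s))) t \<le> ennreal (D / r)"
      if "2 \<le> k" "0 < r" "r \<le> T" for k r t
    proof -
      have "avg r (\<lambda>s. epow (F0 s) (1 / (k * g s))) t \<le> ennreal (T + 1) / ennreal (2 * r)"
        unfolding avg_def by (intro divide_right_mono_ennreal order_trans[OF nn_integral_mono intle[OF that(1)]]) auto
      also have "\<dots> = ennreal ((T + 1) / (2 * r))" using that T by (subst divide_ennreal) auto
      finally have "1 + avg r (\<lambda>s. epow (F0 s) (1 / (k * g s))) t \<le> ennreal (1 + (T + 1) / (2 * r))"
        using that T by (simp add: add_left_mono)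
      also have "\<dots> \<le> ennreal (D / r)"
      proof (rule ennreal_leI)
        have "1 + (T + 1) / (2 * r) = (2 * r + (T + 1)) / (2 * r)" using that by (simp add: field_simps)
        also have "\<dots> \<le> (2 * D) / (2 * r)" using that T by (intro divide_right_mono) (auto simp: D_def)
        finally show "1 + (T + 1) / (2 * r) \<le> D / r" by simp
      qed
      finally show ?thesis .
    qed
    \<comment> \<open>Two values of \<open>k\<close> matter. With \<open>k = P\<close>, the largest
      factor for which \<open>k * g \<le> 1\<close> is known, the maximal function is reduced to a
      constant exponent; with \<open>k = 2\<close> the modular of \<open>F\<close> itself
      appears.\<close>
    have avgF: "avg r F0 t \<le> ennreal (2 * (D powr (k * c) * exp (k * c))) *
        epow (1 + avg r (\<lambda>s. epow (F0 s) (1 / (k * g s))) t) (k * g t)"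
      if k: "2 \<le> k" "k \<le> P" and r: "0 < r" "r \<le> T" and t: "t \<in> {0<..<T}" for k r t
    proof (rule avg_log_holder[where S = "{0<..<T}" and h = "\<lambda>s. k * g s"])
      show "\<And>s. s \<in> {0<..<T} \<Longrightarrow> 0 < k * g s \<and> k * g s \<le> 1"
      proof -
        fix s assume s: "s \<in> {0<..<T}"
        have "k * g s \<le> P * (1 / P)" using gpos[OF s] k by (intro mult_mono) auto
        then show "0 < k * g s \<and> k * g s \<le> 1" using gpos[OF s] k P by auto
      qed
      show "\<bar>k * g s - k * g t\<bar> \<le> k * c / ln (exp 1 + 1 / \<bar>s - t\<bar>)" if "s \<in> {0<..<T}" for s
      proof -
        have "k * \<bar>g s - g t\<bar> \<le> k * (c / ln (exp 1 + 1 / \<bar>s - t\<bar>))"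
          using hol[of s t] that t k by (intro mult_left_mono) auto
        then show ?thesis using k by (simp add: right_diff_distrib[symmetric] abs_mult)
      qed
    qed (use k r c t D avgle in \<open>auto simp: F0_def\<close>)
    have rn: "0 < T / 2 ^ n" "T / 2 ^ n \<le> T" for n using T by (auto simp: field_simps)
    have mF: "maximal T F0 t \<le> ennreal C1 * epow (1 + maximal T H t) (P * g t)" if t: "t \<in> {0<..<T}" for t
      unfolding maximal_def[of T F0]
    proof (rule SUP_least)
      fix n
      have "avg (T / 2 ^ n) F0 t \<le> ennreal C1 * epow (1 + avg (T / 2 ^ n) H t) (P * g t)"
        using avgF[of P "T / 2 ^ n" t] P rn t unfolding C1_def H_def[abs_def] by simp
      also have "\<dots> \<le> ennreal C1 * epow (1 + maximal T H t) (P * g t)"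
        using gpos[OF t] P unfolding maximal_def
        by (intro mult_left_mono epow_mono add_left_mono SUP_upper) auto
      finally show "avg (T / 2 ^ n) F0 t \<le> ennreal C1 * epow (1 + maximal T H t) (P * g t)" .
    qed
    \<comment> \<open>For \<open>k = 2\<close> the average on the right is at most of order 1/r
      because its integral is bounded. This is the bound that wins at large scales.\<close>
    have avg2: "avg (T / 2 ^ n) F0 t \<le> ennreal (C2 * D * (T / 2 ^ n) powr (- (2 * g t)))" if t: "t \<in> {0<..<T}" for n t
    proof -
      have "avg (T / 2 ^ n) F0 t \<le> ennreal C2 * epow (ennreal (D / (T / 2 ^ n))) (2 * g t)"
        using gpos[OF t] P rn t unfolding C2_def
        by (intro order_trans[OF avgF[of 2 "T / 2 ^ n" t]] mult_left_mono epow_mono avgle) auto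
      also have "\<dots> = ennreal (C2 * (D powr (2 * g t) * (T / 2 ^ n) powr (- (2 * g t))))"
      proof -
        have "(D / r) powr e = D powr e * r powr (- e)" if "0 < r" for r e
          using D that by (simp add: powr_divide powr_minus_divide)
        note pd = this[OF rn(1)[of n]]
        have nn: "0 \<le> D / (T / 2 ^ n)" using D T by simp
        show ?thesis
          unfolding epow_ennreal[OF nn] pd using C by (intro ennreal_mult[symmetric]) auto
      qed
      also have "\<dots> \<le> ennreal (C2 * (D powr 1 * (T / 2 ^ n) powr (- (2 * g t))))"
        using D gpos[OF t] C by (intro ennreal_leI mult_left_mono mult_right_mono powr_mono) auto
      finally show ?thesis using D by (simp add: mult.assoc)
    qed
    define I where "I t = (\<integral>\<^sup>+s. indicator {0<..<T} s * (ennreal (\<bar>t - s\<bar> powr - a) * F s) \<partial>lborel)" for t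
    have I1: "I t \<le> (\<Sum>n. ennreal (Ka * (T / 2 ^ n) powr g t) * avg (T / 2 ^ n) F0 t)" if t: "t \<in> {0<..<T}" for t
    proof -
      have "I t \<le> (\<integral>\<^sup>+s. (\<Sum>n. ennreal (Ka * (T / 2 ^ n) powr g t) * inverse (ennreal (2 * (T / 2 ^ n))) *
            (if \<bar>t - s\<bar> \<le> T / 2 ^ n then F0 s else 0)) \<partial>lborel)"
        unfolding I_def
      proof (rule nn_integral_mono_AE)
        show "AE s in lborel. indicator {0<..<T} s * (ennreal (\<bar>t - s\<bar> powr - a) * F s) \<le>
          (\<Sum>n. ennreal (Ka * (T / 2 ^ n) powr g t) * inverse (ennreal (2 * (T / 2 ^ n))) *
            (if \<bar>t - s\<bar> \<le> T / 2 ^ n then F0 s else 0))"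
          using AE_lborel_singleton[of t]
        proof eventually_elim
          case (elim s)
          show ?case
          proof (cases "s \<in> {0<..<T}")
            case True
            have "ennreal (\<bar>t - s\<bar> powr - a) \<le>
               (\<Sum>n. ennreal (4 * max 1 T * (T / 2 ^ n) powr g t) *
                  (if \<bar>t - s\<bar> \<le> T / 2 ^ n then inverse (ennreal (2 * (T / 2 ^ n))) else 0))"
              using elim True t a gpos[OF t] T by (intro powr_near_singularity_le_suminf) auto
            then have "F0 s * ennreal (\<bar>t - s\<bar> powr - a) \<le> F0 s *
               (\<Sum>n. ennreal (4 * max 1 T * (T / 2 ^ n) powr g t) *
                  (if \<bar>t - s\<bar> \<le> T / 2 ^ n then inverse (ennreal (2 * (T / 2 ^ n))) else 0))"
              by (rule mult_left_mono) simp
            also have "\<dots> = (\<Sum>n. ennreal (Ka * (T / 2 ^ n) powr g t) * inverse (ennreal (2 * (T / 2 ^ n))) *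
              (if \<bar>t - s\<bar> \<le> T / 2 ^ n then F0 s else 0))"
              unfolding Ka_def by (subst ennreal_suminf_cmult[symmetric]) (auto intro!: suminf_cong simp: mult_ac simp del: ennreal_suminf_cmult)
            finally show ?thesis using True by (simp add: F0_def mult_ac)
          qed simp
        qed
      qed
      also have "\<dots> = (\<Sum>n. \<integral>\<^sup>+s. ennreal (Ka * (T / 2 ^ n) powr g t) * inverse (ennreal (2 * (T / 2 ^ n))) *
            (if \<bar>t - s\<bar> \<le> T / 2 ^ n then F0 s else 0) \<partial>lborel)"
        by (rule nn_integral_suminf) measurable
      also have "\<dots> = (\<Sum>n. ennreal (Ka * (T / 2 ^ n) powr g t) * avg (T / 2 ^ n) F0 t)"
        by (intro suminf_cong) (simp add: nn_integral_cmult avg_def divide_ennreal_def mult_ac)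
      finally show ?thesis .
    qed
    have I2: "I t \<le> ennreal Kb * epow (maximal T F0 t) (1/2)" if t: "t \<in> {0<..<T}" for t
    proof (cases "maximal T F0 t")
      case (real x)
      define y where "y = T powr g t"
      define \<theta> where "\<theta> = 2 powr - g t"
      have \<theta>: "0 < \<theta>" "\<theta> < 1" using gpos[OF t] powr_less_mono[of "- g t" 0 2] by (auto simp: \<theta>_def)
      have y: "0 < y" using T by (simp add: y_def)
      have yn: "(T / 2 ^ n) powr g t = y * \<theta> ^ n" for n
        using T by (simp add: y_def \<theta>_def powr_divide powr_minus_divide powr_realpow[symmetric] powr_powr
            power_divide mult.commute)
      have "ennreal (Ka * (T / 2 ^ n) powr g t) * avg (T / 2 ^ n) F0 t \<le>
         ennreal (Ka * (C2 * D)) * ennreal (min (x * (y * \<theta> ^ n)) (1 / (y * \<theta> ^ n)))" for n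
      proof -
        have *: "avg (T / 2 ^ n) F0 t \<le> ennreal (min x (C2 * D * (T / 2 ^ n) powr (- (2 * g t))))"
        proof -
          have "avg (T / 2 ^ n) F0 t \<le> ennreal x" unfolding real(2)[symmetric] maximal_def by (rule SUP_upper) simp
          with avg2[OF t, of n] show ?thesis by (auto simp: min_def)
        qed
        have "(y * \<theta> ^ n) * min x (C2 * D * (T / 2 ^ n) powr (- (2 * g t))) \<le>
            C2 * D * min (x * (y * \<theta> ^ n)) (1 / (y * \<theta> ^ n))"
        proof -
          have z: "0 < y * \<theta> ^ n" using y \<theta> by simp
          have e: "(T / 2 ^ n) powr (- (2 * g t)) = 1 / (y * \<theta> ^ n) * (1 / (y * \<theta> ^ n))"
            unfolding yn[symmetric] using powr_add[of "T / 2 ^ n" "- g t" "- g t"]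
            by (simp only: powr_minus_divide minus_add_distrib[symmetric] mult_2)
          have CD: "1 \<le> C2 * D" using C D mult_mono[of 1 C2 1 D] by simp
          have "(y * \<theta> ^ n) * min x (C2 * D * (1 / (y * \<theta> ^ n) * (1 / (y * \<theta> ^ n)))) =
              min (x * (y * \<theta> ^ n)) (C2 * D * (1 / (y * \<theta> ^ n)))"
          proof -
            have "w * min x (k * (1 / w * (1 / w))) = min (x * w) (k * (1 / w))" if "0 < w" for w k :: real
              using that by (simp add: min_mult_distrib_left mult.commute)
            then show ?thesis using z .
          qed
          also have "\<dots> \<le> min (C2 * D * (x * (y * \<theta> ^ n))) (C2 * D * (1 / (y * \<theta> ^ n)))"
            using mult_right_mono[OF CD, of "x * (y * \<theta> ^ n)"] real z by (intro min.mono) auto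
          also have "\<dots> = C2 * D * min (x * (y * \<theta> ^ n)) (1 / (y * \<theta> ^ n))"
            using CD by (simp only: min_mult_distrib_left) simp
          finally show ?thesis unfolding e .
        qed
        then have "Ka * ((y * \<theta> ^ n) * min x (C2 * D * (T / 2 ^ n) powr (- (2 * g t)))) \<le>
           Ka * (C2 * D * min (x * (y * \<theta> ^ n)) (1 / (y * \<theta> ^ n)))"
          using pos by (intro mult_left_mono) auto
        then have le: "ennreal (Ka * (y * \<theta> ^ n) * min x (C2 * D * (T / 2 ^ n) powr (- (2 * g t)))) \<le>
           ennreal (Ka * (C2 * D) * min (x * (y * \<theta> ^ n)) (1 / (y * \<theta> ^ n)))"
          by (intro ennreal_leI) (simp add: mult.assoc)
        have "ennreal (Ka * (T / 2 ^ n) powr g t) * avg (T / 2 ^ n) F0 t \<le>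
           ennreal (Ka * (T / 2 ^ n) powr g t) * ennreal (min x (C2 * D * (T / 2 ^ n) powr (- (2 * g t))))"
          by (intro mult_left_mono *) simp
        also have "\<dots> = ennreal (Ka * (y * \<theta> ^ n) * min x (C2 * D * (T / 2 ^ n) powr (- (2 * g t))))"
          unfolding yn using pos y \<theta> C D real by (subst ennreal_mult) auto
        also note le
        also have "ennreal (Ka * (C2 * D) * min (x * (y * \<theta> ^ n)) (1 / (y * \<theta> ^ n))) =
           ennreal (Ka * (C2 * D)) * ennreal (min (x * (y * \<theta> ^ n)) (1 / (y * \<theta> ^ n)))"
          using pos y \<theta> C D real by (subst ennreal_mult) auto
        finally show ?thesis .
      qed
      then have "(\<Sum>n. ennreal (Ka * (T / 2 ^ n) powr g t) * avg (T / 2 ^ n) F0 t) \<le>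
         (\<Sum>n. ennreal (Ka * (C2 * D)) * ennreal (min (x * (y * \<theta> ^ n)) (1 / (y * \<theta> ^ n))))"
        by (intro suminf_le) auto
      also have "\<dots> = ennreal (Ka * (C2 * D)) * (\<Sum>n. ennreal (min (x * (y * \<theta> ^ n)) (1 / (y * \<theta> ^ n))))"
        by (rule ennreal_suminf_cmult)
      also have "\<dots> \<le> ennreal (Ka * (C2 * D)) * ennreal (2 / (1 - \<theta>) * sqrt x)"
        using \<theta> y real by (intro mult_left_mono suminf_min_geometric) auto
      also have "\<dots> \<le> ennreal (Ka * (C2 * D)) * ennreal (2 / (1 - 2 powr - \<gamma>) * sqrt x)"
      proof -
        have "\<theta> \<le> 2 powr - \<gamma>" unfolding \<theta>_def using g[of t] t by (intro powr_mono) auto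
        then have "2 / (1 - \<theta>) \<le> 2 / (1 - 2 powr - \<gamma>)" using \<gamma>2 by (intro divide_left_mono) auto
        then show ?thesis using real by (intro mult_left_mono ennreal_leI mult_right_mono) auto
      qed
      also have "\<dots> = ennreal Kb * ennreal (sqrt x)"
        using pos C D \<gamma>2 real by (simp add: Kb_def ennreal_mult[symmetric] mult_ac)
      also have "ennreal (sqrt x) = epow (maximal T F0 t) (1/2)"
        using real by (simp add: epow_ennreal powr_half_sqrt)
      finally show ?thesis using I1[OF t] by (rule order_trans[rotated])
    qed (use pos in \<open>simp add: ennreal_mult_top\<close>)
    have I3: "epow (I t) (1 / g t) \<le> ennreal (Kc powr (1 / \<gamma>) * 2 powr (P / 2)) * (1 + epow (maximal T H t) (P / 2))"
      if t: "t \<in> {0<..<T}" for t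
    proof -
      have "I t \<le> ennreal Kb * epow (ennreal C1 * epow (1 + maximal T H t) (P * g t)) (1 / 2)"
        by (rule order_trans[OF I2[OF t]], intro mult_left_mono epow_mono mF t) auto
      also have "\<dots> = ennreal (Kb * C1 powr (1/2)) * epow (1 + maximal T H t) (P * g t / 2)"
        using C pos by (simp add: epow_mult epow_epow epow_ennreal ennreal_mult mult.assoc)
      also have "\<dots> \<le> ennreal Kc * epow (1 + maximal T H t) (P * g t / 2)"
        by (intro mult_right_mono ennreal_leI) (auto simp: Kc_def)
      finally have "epow (I t) (1 / g t) \<le> epow (ennreal Kc * epow (1 + maximal T H t) (P * g t / 2)) (1 / g t)"
        using gpos[OF t] by (intro epow_mono) auto
      \<comment> \<open>The variable exponents cancel: raising \<open>epow _ (P * g t / 2)\<close>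
        to \<open>1 / g t\<close> leaves the constant exponent \<open>P / 2\<close>.\<close>
      also have "\<dots> = ennreal (Kc powr (1 / g t)) * epow (1 + maximal T H t) (P / 2)"
        using gpos[OF t] pos by (simp add: epow_mult epow_epow epow_ennreal)
      also have "\<dots> \<le> ennreal (Kc powr (1 / \<gamma>)) * (ennreal (2 powr (P / 2)) * (epow 1 (P / 2) + epow (maximal T H t) (P / 2)))"
      proof (intro mult_mono epow_plus_le ennreal_leI powr_mono)
        show "1 / g t \<le> 1 / \<gamma>" using g[of t] t \<gamma> by (intro divide_left_mono) auto
      qed (use pos P in auto)
      also have "\<dots> = ennreal (Kc powr (1 / \<gamma>) * 2 powr (P / 2)) * (1 + epow (maximal T H t) (P / 2))"
        by (simp add: ennreal_mult mult.assoc)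
      finally show ?thesis .
    qed
    have HF: "(\<integral>\<^sup>+t. epow (H t) (P / 2) \<partial>lborel) \<le> 1"
      by (rule order_trans[OF eq_refl F0int], intro nn_integral_cong) (use P in \<open>simp add: H_def epow_epow mult.commute\<close>)
    have "(\<integral>\<^sup>+t. indicator {0<..<T} t * epow (I t) (1 / g t) \<partial>lborel) \<le>
       (\<integral>\<^sup>+t. ennreal (Kc powr (1 / \<gamma>) * 2 powr (P / 2)) * (indicator {0<..<T} t + epow (maximal T H t) (P / 2)) \<partial>lborel)"
      by (intro nn_integral_mono) (auto split: split_indicator intro: I3)
    also have "\<dots> = ennreal (Kc powr (1 / \<gamma>) * 2 powr (P / 2)) *
        (ennreal T + (\<integral>\<^sup>+t. epow (maximal T H t) (P / 2) \<partial>lborel))"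
      using T by (simp add: nn_integral_cmult nn_integral_add)
    also have "(\<integral>\<^sup>+t. epow (maximal T H t) (P / 2) \<partial>lborel) \<le> ennreal Cm * 1"
      unfolding Cm_def using T P by (intro order_trans[OF maximal_strong_type] mult_left_mono HF) auto
    finally have "(\<integral>\<^sup>+t. indicator {0<..<T} t * epow (I t) (1 / g t) \<partial>lborel) \<le>
        ennreal (Kc powr (1 / \<gamma>) * 2 powr (P / 2)) * (ennreal T + ennreal Cm)"
      by (simp add: mult_left_mono add_left_mono)
    also have "\<dots> = ennreal (Kc powr (1 / \<gamma>) * 2 powr (P / 2) * (T + Cm))"
      using T pos by (simp add: ennreal_mult)
    also have "\<dots> \<le> ennreal K" unfolding K_def by (intro ennreal_leI) simp
    finally show ?thesis unfolding I_def .
  qed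
  show ?thesis by (rule that[of K]) (use main in \<open>auto simp: K_def\<close>)
qed

section \<open>Decay of the Oseen kernel\<close>

text \<open>Symbols of order \<open>d\<close> at the origin with exponential decay at infinity; each derivative lowers
  the order by one.\<close>

inductive symbol_class :: "real \<Rightarrow> real \<Rightarrow> (real^3 \<Rightarrow> real) \<Rightarrow> bool" for \<alpha> where
  exp: "symbol_class \<alpha> 0 (\<lambda>\<xi>. exp (- (norm \<xi> powr (2 * \<alpha>))))"
| coord: "symbol_class \<alpha> d f \<Longrightarrow> symbol_class \<alpha> (d + 1) (\<lambda>\<xi>. \<xi> $ i * f \<xi>)"
| norm: "symbol_class \<alpha> d f \<Longrightarrow> symbol_class \<alpha> (d + s) (\<lambda>\<xi>. norm \<xi> powr s * f \<xi>)"
| cmult: "symbol_class \<alpha> d f \<Longrightarrow> symbol_class \<alpha> d (\<lambda>\<xi>. c * f \<xi>)"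
| add: "symbol_class \<alpha> d f \<Longrightarrow> symbol_class \<alpha> d g \<Longrightarrow> symbol_class \<alpha> d (\<lambda>\<xi>. f \<xi> + g \<xi>)"
| weaken: "symbol_class \<alpha> d f \<Longrightarrow> d' \<le> d \<Longrightarrow> symbol_class \<alpha> d' f"

lemma symbol_class_measurable [measurable_dest]:
  "symbol_class \<alpha> d f \<Longrightarrow> f \<in> borel_measurable borel"
  by (induction rule: symbol_class.induct) auto

text \<open>The factor \<open>(1 + norm \<xi>) powr N\<close> absorbs the surplus when the order is
  lowered from \<open>d\<close> to \<open>d'\<close>: near the origin the smaller order gives the
  larger power, and at infinity the difference is polynomial, hence harmless against the
  exponential.\<close>

lemma symbol_class_bound:
  assumes "symbol_class \<alpha> d f"
  shows "\<exists>C N. 0 \<le> C \<and> 0 \<le> N \<and>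
    (\<forall>\<xi>. \<xi> \<noteq> 0 \<longrightarrow> \<bar>f \<xi>\<bar> \<le> C * norm \<xi> powr d * (1 + norm \<xi>) powr N * exp (- (norm \<xi> powr (2 * \<alpha>))))"
  using assms
proof induction
  case exp
  show ?case by (intro exI[of _ 1] exI[of _ 0]) (auto simp: powr_zero_eq_one)
next
  case (coord d f i)
  then obtain C N where C: "0 \<le> C" "0 \<le> N"
    "\<And>\<xi>. \<xi> \<noteq> 0 \<Longrightarrow> \<bar>f \<xi>\<bar> \<le> C * norm \<xi> powr d * (1 + norm \<xi>) powr N * exp (- (norm \<xi> powr (2 * \<alpha>)))" by blast
  have "\<bar>\<xi> $ i * f \<xi>\<bar> \<le> C * norm \<xi> powr (d + 1) * (1 + norm \<xi>) powr N * exp (- (norm \<xi> powr (2 * \<alpha>)))"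
    if "\<xi> \<noteq> 0" for \<xi>
  proof -
    have "\<bar>\<xi> $ i\<bar> * \<bar>f \<xi>\<bar> \<le> norm \<xi> * (C * norm \<xi> powr d * (1 + norm \<xi>) powr N * exp (- (norm \<xi> powr (2 * \<alpha>))))"
      by (intro mult_mono C that component_le_norm_cart) auto
    then show ?thesis using that by (simp add: abs_mult powr_add mult_ac)
  qed
  then show ?case using C by blast
next
  case (norm d f s)
  then obtain C N where C: "0 \<le> C" "0 \<le> N"
    "\<And>\<xi>. \<xi> \<noteq> 0 \<Longrightarrow> \<bar>f \<xi>\<bar> \<le> C * norm \<xi> powr d * (1 + norm \<xi>) powr N * exp (- (norm \<xi> powr (2 * \<alpha>)))" by blast
  have "\<bar>norm \<xi> powr s * f \<xi>\<bar> \<le> C * norm \<xi> powr (d + s) * (1 + norm \<xi>) powr N * exp (- (norm \<xi> powr (2 * \<alpha>)))"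
    if "\<xi> \<noteq> 0" for \<xi>
    using mult_left_mono[OF C(3)[OF that], of "norm \<xi> powr s"] by (simp add: abs_mult powr_add mult_ac)
  then show ?case using C by blast
next
  case (cmult d f c)
  then obtain C N where C: "0 \<le> C" "0 \<le> N"
    "\<And>\<xi>. \<xi> \<noteq> 0 \<Longrightarrow> \<bar>f \<xi>\<bar> \<le> C * norm \<xi> powr d * (1 + norm \<xi>) powr N * exp (- (norm \<xi> powr (2 * \<alpha>)))" by blast
  have "\<bar>c * f \<xi>\<bar> \<le> (\<bar>c\<bar> * C) * norm \<xi> powr d * (1 + norm \<xi>) powr N * exp (- (norm \<xi> powr (2 * \<alpha>)))"
    if "\<xi> \<noteq> 0" for \<xi>
    using mult_left_mono[OF C(3)[OF that], of "\<bar>c\<bar>"] by (simp add: abs_mult mult_ac)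
  moreover have "0 \<le> \<bar>c\<bar> * C" using C by simp
  ultimately show ?case using C(2) by blast
next
  case (add d f g)
  then obtain C N where C: "0 \<le> C" "0 \<le> N"
    "\<And>\<xi>. \<xi> \<noteq> 0 \<Longrightarrow> \<bar>f \<xi>\<bar> \<le> C * norm \<xi> powr d * (1 + norm \<xi>) powr N * exp (- (norm \<xi> powr (2 * \<alpha>)))" by blast
  from add obtain C' N' where C': "0 \<le> C'" "0 \<le> N'"
    "\<And>\<xi>. \<xi> \<noteq> 0 \<Longrightarrow> \<bar>g \<xi>\<bar> \<le> C' * norm \<xi> powr d * (1 + norm \<xi>) powr N' * exp (- (norm \<xi> powr (2 * \<alpha>)))" by blast
  have "\<bar>f \<xi> + g \<xi>\<bar> \<le> (C + C') * norm \<xi> powr d * (1 + norm \<xi>) powr (max N N') * exp (- (norm \<xi> powr (2 * \<alpha>)))"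
    if "\<xi> \<noteq> 0" for \<xi>
  proof -
    have "\<bar>f \<xi>\<bar> \<le> C * norm \<xi> powr d * (1 + norm \<xi>) powr (max N N') * exp (- (norm \<xi> powr (2 * \<alpha>)))"
      using C by (intro order_trans[OF C(3)[OF that]] mult_right_mono mult_left_mono powr_mono) auto
    moreover have "\<bar>g \<xi>\<bar> \<le> C' * norm \<xi> powr d * (1 + norm \<xi>) powr (max N N') * exp (- (norm \<xi> powr (2 * \<alpha>)))"
      using C' by (intro order_trans[OF C'(3)[OF that]] mult_right_mono mult_left_mono powr_mono) auto
    ultimately show ?thesis by (simp add: distrib_right)
  qed
  moreover have "0 \<le> C + C'" "0 \<le> max N N'" using C C' by auto
  ultimately show ?case by blast
next
  case (weaken d f d')
  then obtain C N where C: "0 \<le> C" "0 \<le> N"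
    "\<And>\<xi>. \<xi> \<noteq> 0 \<Longrightarrow> \<bar>f \<xi>\<bar> \<le> C * norm \<xi> powr d * (1 + norm \<xi>) powr N * exp (- (norm \<xi> powr (2 * \<alpha>)))" by blast
  have "\<bar>f \<xi>\<bar> \<le> C * norm \<xi> powr d' * (1 + norm \<xi>) powr (N + (d - d')) * exp (- (norm \<xi> powr (2 * \<alpha>)))"
    if "\<xi> \<noteq> 0" for \<xi>
  proof -
    have "norm \<xi> powr d = norm \<xi> powr d' * norm \<xi> powr (d - d')" by (simp add: powr_add[symmetric])
    also have "\<dots> \<le> norm \<xi> powr d' * (1 + norm \<xi>) powr (d - d')"
      using weaken by (intro mult_left_mono powr_mono2) auto
    finally have "C * (norm \<xi> powr d * (1 + norm \<xi>) powr N * exp (- (norm \<xi> powr (2 * \<alpha>)))) \<le>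
      C * ((norm \<xi> powr d' * (1 + norm \<xi>) powr (d - d')) * (1 + norm \<xi>) powr N * exp (- (norm \<xi> powr (2 * \<alpha>))))"
      using C by (intro mult_left_mono mult_right_mono) auto
    then show ?thesis using C(3)[OF that] by (simp add: powr_add mult_ac)
  qed
  moreover have "0 \<le> N + (d - d')" using C weaken by auto
  ultimately show ?case using C(1) by blast
qed

lemma norm_powr_has_derivative_line:
  fixes \<xi> :: "real^3"
  assumes "\<xi> + s *\<^sub>R axis l 1 \<noteq> 0"
  shows "((\<lambda>s. norm (\<xi> + s *\<^sub>R axis l 1) powr b) has_real_derivative
     b * ((\<xi> + s *\<^sub>R axis l 1) $ l * norm (\<xi> + s *\<^sub>R axis l 1) powr (b - 2))) (at s)"
proof -
  let ?v = "\<xi> + s *\<^sub>R axis l (1::real)"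
  have "((\<lambda>s. norm (\<xi> + s *\<^sub>R axis l (1::real))) has_derivative (\<lambda>h. (h *\<^sub>R axis l 1) \<bullet> sgn ?v)) (at s)"
    using has_derivative_compose[OF has_derivative_add[OF has_derivative_const
        has_derivative_scaleR_left[OF has_derivative_ident]] has_derivative_norm[OF assms]]
    by simp
  then have "((\<lambda>s. norm (\<xi> + s *\<^sub>R axis l (1::real))) has_real_derivative (?v $ l / norm ?v)) (at s)"
    by (rule has_derivative_imp_has_field_derivative)
       (auto simp: inner_axis' sgn_div_norm divide_inverse inner_axis)
  from DERIV_chain2[OF has_real_derivative_powr[of "norm ?v" b] this] assms
  show ?thesis by (simp add: powr_diff power2_eq_square mult_ac)
qed

text \<open>Derivatives are taken along coordinate lines off the origin, the form in which they
  enter the integration by parts. Differentiating the exponential gives a symbol of order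
  \<open>2 * \<alpha> - 1\<close>, which is lowered to the required order -1.\<close>

lemma symbol_class_derivative:
  assumes "symbol_class \<alpha> d f" "1 / 2 < \<alpha>"
  shows "\<exists>f'. symbol_class \<alpha> (d - 1) f' \<and>
    (\<forall>\<xi> s. \<xi> + s *\<^sub>R axis l 1 \<noteq> 0 \<longrightarrow>
      ((\<lambda>s. f (\<xi> + s *\<^sub>R axis l 1)) has_real_derivative f' (\<xi> + s *\<^sub>R axis l 1)) (at s))"
  using assms
proof induction
  case exp
  let ?f' = "\<lambda>\<xi>. - (2 * \<alpha>) * (\<xi> $ l * (norm \<xi> powr (2 * \<alpha> - 2) * exp (- (norm \<xi> powr (2 * \<alpha>)))))"
  have "symbol_class \<alpha> (0 + (2 * \<alpha> - 2) + 1) ?f'"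
    by (intro symbol_class.exp symbol_class.coord symbol_class.norm symbol_class.cmult)
  then have "symbol_class \<alpha> (0 - 1) ?f'"
    by (rule symbol_class.weaken) (use exp in simp)
  moreover have "((\<lambda>s. exp (- (norm (\<xi> + s *\<^sub>R axis l 1) powr (2 * \<alpha>)))) has_real_derivative ?f' (\<xi> + s *\<^sub>R axis l 1)) (at s)"
    if "\<xi> + s *\<^sub>R axis l 1 \<noteq> 0" for \<xi> s
    using DERIV_fun_exp[OF DERIV_minus[OF norm_powr_has_derivative_line[OF that]], of "2 * \<alpha>"]
    by (simp add: mult_ac)
  ultimately show ?case by blast
next
  case (coord d f i)
  then obtain f' where f': "symbol_class \<alpha> (d - 1) f'"
    "\<And>\<xi> s. \<xi> + s *\<^sub>R axis l 1 \<noteq> 0 \<Longrightarrow>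
      ((\<lambda>s. f (\<xi> + s *\<^sub>R axis l 1)) has_real_derivative f' (\<xi> + s *\<^sub>R axis l 1)) (at s)" by blast
  let ?\<delta> = "if i = l then 1 else (0::real)"
  have "symbol_class \<alpha> ((d - 1) + 1) (\<lambda>\<xi>. \<xi> $ i * f' \<xi>)" by (intro symbol_class.coord symbol_class.norm f')
  then have "symbol_class \<alpha> d (\<lambda>\<xi>. ?\<delta> * f \<xi> + \<xi> $ i * f' \<xi>)"
    using coord by (intro symbol_class.add symbol_class.cmult) auto
  then have "symbol_class \<alpha> (d + 1 - 1) (\<lambda>\<xi>. ?\<delta> * f \<xi> + \<xi> $ i * f' \<xi>)" by simp
  moreover have "((\<lambda>s. (\<xi> + s *\<^sub>R axis l 1) $ i * f (\<xi> + s *\<^sub>R axis l 1)) has_real_derivative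
      (?\<delta> * f (\<xi> + s *\<^sub>R axis l 1) + (\<xi> + s *\<^sub>R axis l 1) $ i * f' (\<xi> + s *\<^sub>R axis l 1))) (at s)"
    if "\<xi> + s *\<^sub>R axis l 1 \<noteq> 0" for \<xi> s
  proof -
    have "((\<lambda>s. (\<xi> + s *\<^sub>R axis l 1) $ i) has_real_derivative ?\<delta>) (at s)"
      by (auto simp: axis_def intro!: derivative_eq_intros)
    from DERIV_mult[OF this f'(2)[OF that]] show ?thesis by (simp add: mult.commute)
  qed
  ultimately show ?case by blast
next
  case (norm d f r)
  then obtain f' where f': "symbol_class \<alpha> (d - 1) f'"
    "\<And>\<xi> s. \<xi> + s *\<^sub>R axis l 1 \<noteq> 0 \<Longrightarrow>
      ((\<lambda>s. f (\<xi> + s *\<^sub>R axis l 1)) has_real_derivative f' (\<xi> + s *\<^sub>R axis l 1)) (at s)" by blast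
  let ?f' = "\<lambda>\<xi>. r * (\<xi> $ l * (norm \<xi> powr (r - 2) * f \<xi>)) + norm \<xi> powr r * f' \<xi>"
  have A: "symbol_class \<alpha> (d + (r - 2) + 1) (\<lambda>\<xi>. r * (\<xi> $ l * (norm \<xi> powr (r - 2) * f \<xi>)))"
    by (intro symbol_class.coord symbol_class.norm symbol_class.cmult norm)
  have B: "symbol_class \<alpha> (d - 1 + r) (\<lambda>\<xi>. norm \<xi> powr r * f' \<xi>)"
    by (intro symbol_class.norm f')
  have "symbol_class \<alpha> (d + r - 1) ?f'"
    by (rule symbol_class.add[OF symbol_class.weaken[OF A] symbol_class.weaken[OF B]]) simp_all
  moreover have "((\<lambda>s. norm (\<xi> + s *\<^sub>R axis l 1) powr r * f (\<xi> + s *\<^sub>R axis l 1)) has_real_derivative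
      ?f' (\<xi> + s *\<^sub>R axis l 1)) (at s)"
    if "\<xi> + s *\<^sub>R axis l 1 \<noteq> 0" for \<xi> s
    using DERIV_mult[OF norm_powr_has_derivative_line[OF that] f'(2)[OF that], of r]
    by (simp only: mult_ac)
  ultimately show ?case by blast
next
  case (cmult d f c)
  then obtain f' where f': "symbol_class \<alpha> (d - 1) f'"
    "\<And>\<xi> s. \<xi> + s *\<^sub>R axis l 1 \<noteq> 0 \<Longrightarrow>
      ((\<lambda>s. f (\<xi> + s *\<^sub>R axis l 1)) has_real_derivative f' (\<xi> + s *\<^sub>R axis l 1)) (at s)" by blast
  then show ?case by (intro exI[of _ "\<lambda>\<xi>. c * f' \<xi>"]) (auto intro!: symbol_class.cmult DERIV_cmult)
next
  case (add d f g)
  then obtain f' g' where "symbol_class \<alpha> (d - 1) f'" "symbol_class \<alpha> (d - 1) g'"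
    "\<And>\<xi> s. \<xi> + s *\<^sub>R axis l 1 \<noteq> 0 \<Longrightarrow>
      ((\<lambda>s. f (\<xi> + s *\<^sub>R axis l 1)) has_real_derivative f' (\<xi> + s *\<^sub>R axis l 1)) (at s)"
    "\<And>\<xi> s. \<xi> + s *\<^sub>R axis l 1 \<noteq> 0 \<Longrightarrow>
      ((\<lambda>s. g (\<xi> + s *\<^sub>R axis l 1)) has_real_derivative g' (\<xi> + s *\<^sub>R axis l 1)) (at s)" by blast
  then show ?case by (intro exI[of _ "\<lambda>\<xi>. f' \<xi> + g' \<xi>"]) (auto intro!: symbol_class.add DERIV_add)
next
  case (weaken d f d')
  then show ?case by (meson diff_right_mono symbol_class.weaken)
qed

lemma powr_times_exp_bounded:
  assumes "1 \<le> 2 * \<alpha>"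
  shows "\<exists>C>0. \<forall>z\<ge>0. (1 + z) powr N * exp (- (z powr (2 * \<alpha>))) \<le> (C::real)"
proof -
  obtain n :: nat where n: "N \<le> real n" using real_arch_simple by blast
  have "(1 + z) powr N * exp (- (z powr (2 * \<alpha>))) \<le> fact n * exp 2" if z: "0 \<le> z" for z
  proof -
    \<comment> \<open>This reduces the exponential to \<open>exp (1 - z)\<close>, which is played
      off against \<open>(1 + z) ^ n \<le> fact n * exp (1 + z)\<close>, a single term of the
      exponential series.\<close>
    have "z - 1 \<le> z powr (2 * \<alpha>)"
    proof (cases "z \<le> 1")
      case False
      then have "z powr 1 \<le> z powr (2 * \<alpha>)" using assms by (intro powr_mono) auto
      then show ?thesis using False by simp
    qed (use powr_ge_zero[of z "2 * \<alpha>"] in linarith)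
    then have e: "exp (- (z powr (2 * \<alpha>))) \<le> exp (1 - z)" by simp
    have "(1 + z) powr N \<le> (1 + z) powr (real n)" using n z by (intro powr_mono) auto
    also have "\<dots> = (1 + z) ^ n" using z by (simp add: powr_realpow)
    also have "(1 + z) ^ n \<le> fact n * exp (1 + z)"
    proof -
      have "inverse (fact n) * (1 + z) ^ n \<le> exp (1 + z)"
        unfolding exp_def using z summable_exp_generic[of "1 + z"]
        by (intro order_trans[OF _ sum_le_suminf[of _ "{n}"]]) auto
      then show ?thesis by (simp add: field_simps)
    qed
    finally have "(1 + z) powr N * exp (- (z powr (2 * \<alpha>))) \<le> fact n * exp (1 + z) * exp (1 - z)"
      using e by (intro mult_mono) auto
    also have "\<dots> = fact n * exp 2" by (simp add: exp_add[symmetric] mult.assoc)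
    finally show ?thesis .
  qed
  then show ?thesis by (intro exI[of _ "fact n * exp 2"]) auto
qed

section \<open>Integrability of symbols\<close>

lemma nn_integral_even_le:
  assumes [measurable]: "f \<in> borel_measurable borel"
  shows "(\<integral>\<^sup>+x. f \<bar>x\<bar> \<partial>lborel) \<le> 2 * (\<integral>\<^sup>+x. f x * indicator {0..} (x::real) \<partial>lborel)"
proof -
  have "(\<integral>\<^sup>+x. f \<bar>x\<bar> \<partial>lborel) \<le>
      (\<integral>\<^sup>+x. f x * indicator {0..} x + f (0 - x) * indicator {0..} (0 - x) \<partial>lborel)"
    by (intro nn_integral_mono) (auto split: split_indicator)
  also have "\<dots> = (\<integral>\<^sup>+x. f x * indicator {0..} x \<partial>lborel) + (\<integral>\<^sup>+x. f (0 - x) * indicator {0..} (0 - x) \<partial>lborel)"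
    by (rule nn_integral_add) measurable
  also have "(\<integral>\<^sup>+x. f (0 - x) * indicator {0..} (0 - x) \<partial>lborel) = (\<integral>\<^sup>+x. f x * indicator {0..} x \<partial>lborel)"
    by (rule nn_integral_lborel_reflect) measurable
  finally show ?thesis by (simp add: mult_2)
qed

lemma nn_integral_one_plus_abs_powr_finite:
  assumes r: "1 < r"
  shows "(\<integral>\<^sup>+x. ennreal ((1 + \<bar>x\<bar>) powr - r) \<partial>lborel) < (\<infinity>::ennreal)"
proof -
  have "(\<integral>\<^sup>+x. ennreal ((1 + x) powr - r) * indicator {0..} x \<partial>lborel) =
      ennreal (0 - (- ((1 + 0) powr (1 - r) / (r - 1))))"
  proof (rule nn_integral_FTC_atLeast)
    show "DERIV (\<lambda>x. - ((1 + x) powr (1 - r) / (r - 1))) x :> (1 + x) powr - r" if "0 \<le> x" for x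
    proof -
      have "DERIV (\<lambda>x. (1 + x) powr (1 - r)) x :> (1 - r) * (1 + x) powr (1 - r - 1) * 1"
        using that by (intro DERIV_chain2[OF has_real_derivative_powr]) (auto intro!: derivative_eq_intros)
      note D = DERIV_minus[OF DERIV_cdivide[OF this, of "r - 1"]]
      have eq: "- ((1 - r) * z * 1 / (r - 1)) = z" for z using r by (simp add: field_simps)
      show ?thesis using D unfolding eq by simp
    qed
    have "((\<lambda>x. (1 + x) powr (1 - r)) \<longlongrightarrow> 0) at_top"
      using r by (intro tendsto_neg_powr filterlim_tendsto_add_at_top[OF tendsto_const filterlim_ident]) auto
    then have "((\<lambda>x. - ((1 + x) powr (1 - r) / (r - 1))) \<longlongrightarrow> - (0 / (r - 1))) at_top"
      using r by (intro tendsto_intros) auto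
    then show "((\<lambda>x. - ((1 + x) powr (1 - r) / (r - 1))) \<longlongrightarrow> 0) at_top" by simp
  qed auto
  then have "(\<integral>\<^sup>+x. ennreal ((1 + x) powr - r) * indicator {0..} x \<partial>lborel) < \<infinity>" by simp
  then have "2 * (\<integral>\<^sup>+x. ennreal ((1 + x) powr - r) * indicator {0..} x \<partial>lborel) < \<infinity>"
    by (simp add: ennreal_mult_less_top)
  then show ?thesis
    by (rule le_less_trans[rotated], intro nn_integral_even_le) measurable
qed

text \<open>Each coordinate receives a third of the singularity of
  \<open>norm \<xi> powr (-2)\<close>: the power -2/3 is integrable on the line, and the product of
  three weights dominates \<open>norm \<xi> powr (-2) * (1 + norm \<xi>) powr (-6)\<close>, since
  the norm dominates every coordinate. The value at 0 overrides the convention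
  \<open>0 powr (-2/3) = 0\<close>.\<close>

definition singular_weight :: "real \<Rightarrow> ennreal" where
  "singular_weight x = (if x = 0 then \<infinity> else ennreal (\<bar>x\<bar> powr (-2/3) * (1 + \<bar>x\<bar>) powr - 2))"

lemma singular_weight_measurable [measurable]: "singular_weight \<in> borel_measurable borel"
  unfolding singular_weight_def[abs_def] by measurable

lemma nn_integral_singular_weight: "(\<integral>\<^sup>+x. singular_weight x \<partial>lborel) < \<infinity>"
proof -
  let ?f = "\<lambda>x::real. ennreal (if x \<in> {0..1} then x powr (-2/3) else 0)"
  have "((\<lambda>x. x powr (-2/3)) has_integral (1 powr (-2/3 + 1) / (-2/3 + 1))) {0..1::real}"
    by (rule has_integral_powr_from_0) auto
  then have "((\<lambda>x::real. if x \<in> {0..1} then x powr (-2/3) else 0) has_integral 3) UNIV"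
    by (subst has_integral_restrict_UNIV) simp
  then have "(\<integral>\<^sup>+x. ?f x \<partial>lborel) = ennreal 3"
    by (intro nn_integral_has_integral_lborel) auto
  moreover have "(\<integral>\<^sup>+x. ?f x * indicator {0..} x \<partial>lborel) \<le> (\<integral>\<^sup>+x. ?f x \<partial>lborel)"
    by (intro nn_integral_mono) (auto split: split_indicator)
  ultimately have "(\<integral>\<^sup>+x. ?f x * indicator {0..} x \<partial>lborel) \<le> ennreal 3" by simp
  then have "2 * (\<integral>\<^sup>+x. ?f x * indicator {0..} x \<partial>lborel) < \<infinity>"
    by (simp add: ennreal_mult_less_top le_less_trans[OF _ ennreal_less_top[of 3]])
  then have A: "(\<integral>\<^sup>+x. ?f \<bar>x\<bar> \<partial>lborel) < \<infinity>"
    by (rule le_less_trans[rotated], intro nn_integral_even_le) measurable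
  have "(\<integral>\<^sup>+x. singular_weight x \<partial>lborel) \<le> (\<integral>\<^sup>+x. ?f \<bar>x\<bar> + ennreal ((1 + \<bar>x\<bar>) powr - 2) \<partial>lborel)"
  proof (rule nn_integral_mono_AE)
    show "AE x in lborel. singular_weight x \<le> ?f \<bar>x\<bar> + ennreal ((1 + \<bar>x\<bar>) powr - 2)"
      using AE_lborel_singleton[of 0]
    proof eventually_elim
      case (elim x)
      have p: "(1 + \<bar>x\<bar>) powr - 2 \<le> 1" using powr_mono[of "-2" 0 "1 + \<bar>x\<bar>"] elim by (auto split: if_splits)
      show ?case
      proof (cases "\<bar>x\<bar> \<le> 1")
        case True
        have "\<bar>x\<bar> powr (-2/3) * (1 + \<bar>x\<bar>) powr - 2 \<le> \<bar>x\<bar> powr (-2/3) * 1"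
          using p by (intro mult_left_mono) auto
        then have "singular_weight x \<le> ?f \<bar>x\<bar>" using elim True by (simp add: singular_weight_def ennreal_leI)
        then show ?thesis by (simp add: add_increasing2)
      next
        case False
        have "\<bar>x\<bar> powr (-2/3) * (1 + \<bar>x\<bar>) powr - 2 \<le> 1 * (1 + \<bar>x\<bar>) powr - 2"
        proof (intro mult_right_mono)
          have "\<bar>x\<bar> powr (-2/3) \<le> \<bar>x\<bar> powr 0" using False by (intro powr_mono) auto
          then show "\<bar>x\<bar> powr (-2/3) \<le> 1" using elim by simp
        qed auto
        then show ?thesis using elim False by (simp add: singular_weight_def ennreal_leI)
      qed
    qed
  qed
  also have "\<dots> = (\<integral>\<^sup>+x. ?f \<bar>x\<bar> \<partial>lborel) + (\<integral>\<^sup>+x. ennreal ((1 + \<bar>x\<bar>) powr - 2) \<partial>lborel)"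
    by (rule nn_integral_add) measurable
  also have "\<dots> < \<infinity>" using A nn_integral_one_plus_abs_powr_finite[of 2] by simp
  finally show ?thesis .
qed

text \<open>A bound by a product over the coordinates lets Tonelli's theorem play the role of polar
  coordinates. Order -2 is the lowest integer order integrable at the origin of R^3, and the one
  reached after three derivatives of a symbol of order 1.\<close>

lemma symbol_class_integrable:
  assumes f: "symbol_class \<alpha> d f" and d: "- 2 \<le> d" and \<alpha>: "1 / 2 < \<alpha>"
  shows "integrable lborel f"
proof (rule integrableI_bounded)
  show "f \<in> borel_measurable lborel" using f by measurable
  obtain C N where C: "0 \<le> C" "0 \<le> N"
    "\<And>\<xi>. \<xi> \<noteq> 0 \<Longrightarrow> \<bar>f \<xi>\<bar> \<le> C * norm \<xi> powr d * (1 + norm \<xi>) powr N * exp (- (norm \<xi> powr (2 * \<alpha>)))"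
    using symbol_class_bound[OF f] by blast
  \<comment> \<open>The exponent collects the polynomial factor of the symbol, the surplus
    \<open>d + 2\<close> of its order over -2, and 6 for the decay of three weights of power
    -2.\<close>
  obtain B where B: "0 < B" "\<And>z. 0 \<le> z \<Longrightarrow> (1 + z) powr (N + (d + 2) + 6) * exp (- (z powr (2 * \<alpha>))) \<le> B"
    using powr_times_exp_bounded[of \<alpha> "N + (d + 2) + 6"] \<alpha> by auto
  have bd: "ennreal (norm (f \<xi>)) \<le> ennreal (C * B) * (\<Prod>b\<in>Basis. singular_weight (\<xi> \<bullet> b))" if nz: "\<forall>b\<in>Basis. \<xi> \<bullet> b \<noteq> 0" for \<xi>
  proof -
    have "\<xi> \<noteq> 0" using nz nonempty_Basis by auto
    then have n: "0 < norm \<xi>" by simp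
    have "norm \<xi> powr d = norm \<xi> powr (-2) * norm \<xi> powr (d + 2)" by (simp add: powr_add[symmetric])
    also have "\<dots> \<le> norm \<xi> powr (-2) * (1 + norm \<xi>) powr (d + 2)"
      using d by (intro mult_left_mono powr_mono2) auto
    finally have "C * norm \<xi> powr d * (1 + norm \<xi>) powr N * exp (- (norm \<xi> powr (2 * \<alpha>))) \<le>
      C * (norm \<xi> powr (-2) * (1 + norm \<xi>) powr (d + 2)) * (1 + norm \<xi>) powr N * exp (- (norm \<xi> powr (2 * \<alpha>)))"
      using C by (intro mult_right_mono mult_left_mono) auto
    also have "\<dots> = C * norm \<xi> powr (-2) * (1 + norm \<xi>) powr (-6) *
        ((1 + norm \<xi>) powr (N + (d + 2) + 6) * exp (- (norm \<xi> powr (2 * \<alpha>))))"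
    proof -
      have "(1 + norm \<xi>) powr (d + 2) * (1 + norm \<xi>) powr N =
          (1 + norm \<xi>) powr (-6) * (1 + norm \<xi>) powr (N + (d + 2) + 6)"
        by (simp add: powr_add[symmetric] add_ac)
      then have "C * norm \<xi> powr (-2) * ((1 + norm \<xi>) powr (d + 2) * (1 + norm \<xi>) powr N) * E =
          C * norm \<xi> powr (-2) * ((1 + norm \<xi>) powr (-6) * (1 + norm \<xi>) powr (N + (d + 2) + 6)) * E" for E
        by simp
      from this[of "exp (- (norm \<xi> powr (2 * \<alpha>)))"] show ?thesis by (simp only: mult_ac)
    qed
    also have "\<dots> \<le> C * norm \<xi> powr (-2) * (1 + norm \<xi>) powr (-6) * B"
      using C B(2)[of "norm \<xi>"] by (intro mult_left_mono) auto
    finally have A: "\<bar>f \<xi>\<bar> \<le> C * B * (norm \<xi> powr (-2) * (1 + norm \<xi>) powr (-6))"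
      using C(3)[OF \<open>\<xi> \<noteq> 0\<close>] by (simp add: mult_ac)
    have "norm \<xi> powr (-2) * (1 + norm \<xi>) powr (-6) =
        (\<Prod>b\<in>(Basis::(real^3) set). norm \<xi> powr (-2/3) * (1 + norm \<xi>) powr - 2)"
    proof -
      have "1 + norm \<xi> \<noteq> 0" "norm \<xi> \<noteq> 0" using n by linarith+
      note powr_power[OF this(1), of "-2" 3] powr_power[OF this(2), of "-2/3" 3]
      then show ?thesis by (simp add: power_mult_distrib DIM_cart)
    qed
    also have "\<dots> \<le> (\<Prod>b\<in>Basis. \<bar>\<xi> \<bullet> b\<bar> powr (-2/3) * (1 + \<bar>\<xi> \<bullet> b\<bar>) powr - 2)"
      using nz by (intro prod_mono) (auto intro!: mult_mono powr_mono2' Basis_le_norm)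
    finally have le: "norm \<xi> powr (-2) * (1 + norm \<xi>) powr (-6) \<le>
        (\<Prod>b\<in>Basis. \<bar>\<xi> \<bullet> b\<bar> powr (-2/3) * (1 + \<bar>\<xi> \<bullet> b\<bar>) powr - 2)" .
    have "0 \<le> C * B" using C B by simp
    from order_trans[OF A mult_left_mono[OF le this]] have "ennreal (norm (f \<xi>)) \<le>
        ennreal (C * B * (\<Prod>b\<in>Basis. \<bar>\<xi> \<bullet> b\<bar> powr (-2/3) * (1 + \<bar>\<xi> \<bullet> b\<bar>) powr - 2))"
      by (simp add: ennreal_leI)
    also have "\<dots> = ennreal (C * B) * (\<Prod>b\<in>Basis. ennreal (\<bar>\<xi> \<bullet> b\<bar> powr (-2/3) * (1 + \<bar>\<xi> \<bullet> b\<bar>) powr - 2))"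
      using C B by (subst ennreal_mult) (auto simp: prod_ennreal intro!: prod_nonneg)
    also have "\<dots> = ennreal (C * B) * (\<Prod>b\<in>Basis. singular_weight (\<xi> \<bullet> b))"
      using nz by (simp add: singular_weight_def)
    finally show ?thesis .
  qed
  have "AE \<xi> in lborel. \<forall>b\<in>Basis. \<xi> \<bullet> b \<noteq> (0::real)"
    by (subst AE_ball_countable) (auto intro!: AE_lborel_inner_neq countable_finite)
  then have "AE \<xi> in lborel. ennreal (norm (f \<xi>)) \<le> ennreal (C * B) * (\<Prod>b\<in>Basis. singular_weight (\<xi> \<bullet> b))"
    by (rule eventually_mono) (rule bd)
  then have "(\<integral>\<^sup>+\<xi>. ennreal (norm (f \<xi>)) \<partial>lborel) \<le>
      (\<integral>\<^sup>+\<xi>. ennreal (C * B) * (\<Prod>b\<in>(Basis::(real^3) set). singular_weight (\<xi> \<bullet> b)) \<partial>lborel)"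
    by (rule nn_integral_mono_AE)
  also have "\<dots> = ennreal (C * B) * (\<integral>\<^sup>+\<xi>. (\<Prod>b\<in>(Basis::(real^3) set). singular_weight (\<xi> \<bullet> b)) \<partial>lborel)"
    by (rule nn_integral_cmult) measurable
  also have "(\<integral>\<^sup>+\<xi>. (\<Prod>b\<in>(Basis::(real^3) set). singular_weight (\<xi> \<bullet> b)) \<partial>lborel) =
     (\<Prod>b\<in>(Basis::(real^3) set). (\<integral>\<^sup>+x. singular_weight x \<partial>lborel))"
    by (rule nn_integral_lborel_prod) auto
  also have "ennreal (C * B) * \<dots> < \<infinity>"
    using nn_integral_singular_weight by (simp add: ennreal_mult_less_top power_less_top_ennreal)
  finally show "(\<integral>\<^sup>+\<xi>. ennreal (norm (f \<xi>)) \<partial>lborel) < \<infinity>" .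
qed

text \<open>The average of \<open>G\<close> over a unit step along \<open>e\<close> has the same
  integral as \<open>G\<close> and equals \<open>g (\<xi> + e) - g \<xi>\<close> by the fundamental
  theorem of calculus; by translation invariance this integrates to 0. In this way no boundary terms
  at infinity arise.\<close>

lemma integral_directional_derivative_zero:
  fixes g G :: "'a::euclidean_space \<Rightarrow> 'b::euclidean_space" and e :: 'a
  assumes g: "integrable lborel g" and G: "integrable lborel G"
    and der: "AE \<xi> in lborel. \<forall>s. ((\<lambda>s. g (\<xi> + s *\<^sub>R e)) has_vector_derivative G (\<xi> + s *\<^sub>R e)) (at s)"
    and cont: "AE \<xi> in lborel. continuous_on UNIV (\<lambda>s. G (\<xi> + s *\<^sub>R e))"
  shows "(LINT \<xi>|lborel. G \<xi>) = 0"
proof -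
  have shift: "integrable lborel (\<lambda>\<xi>. h (\<xi> + v))" "(LINT \<xi>|lborel. h (\<xi> + v)) = (LINT \<xi>|lborel. h \<xi>)"
    if h: "integrable lborel h" for h :: "'a \<Rightarrow> 'b" and v
  proof -
    have [measurable]: "h \<in> borel_measurable borel" using h by auto
    have "integrable (distr lborel borel ((+) v)) h" using h by (simp add: lborel_distr_plus)
    then show "integrable lborel (\<lambda>\<xi>. h (\<xi> + v))" by (subst (asm) integrable_distr_eq) (auto simp: add.commute)
    have "(LINT \<xi>|lborel. h \<xi>) = (LINT \<xi>|distr lborel borel ((+) v). h \<xi>)" by (simp add: lborel_distr_plus)
    then show "(LINT \<xi>|lborel. h (\<xi> + v)) = (LINT \<xi>|lborel. h \<xi>)"
      by (subst (asm) integral_distr) (auto simp: add.commute)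
  qed
  have [measurable]: "g \<in> borel_measurable borel" "G \<in> borel_measurable borel" using g G by auto
  let ?f = "\<lambda>(s::real) \<xi>. indicator {0..1} s *\<^sub>R G (\<xi> + s *\<^sub>R e)"
  have "(\<lambda>s. LINT \<xi>|lborel. norm (?f s \<xi>)) = (\<lambda>s. indicator {0..1} s * (LINT \<xi>|lborel. norm (G \<xi>)))"
  proof
    fix s
    have "(LINT \<xi>|lborel. norm (G (\<xi> + s *\<^sub>R e))) = (LINT \<xi>|lborel. norm (G \<xi>))"
      using integral_distr[of "(+) (s *\<^sub>R e)" lborel borel "\<lambda>\<xi>. norm (G \<xi>)"]
      by (simp add: lborel_distr_plus add.commute)
    then show "(LINT \<xi>|lborel. norm (?f s \<xi>)) = indicator {0..1} s * (LINT \<xi>|lborel. norm (G \<xi>))"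
      by simp
  qed
  then have int: "integrable (lborel \<Otimes>\<^sub>M lborel) (case_prod ?f)"
    using shift(1)[OF G] by (intro lborel_pair.Fubini_integrable) auto
  have "(LINT \<xi>|lborel. LINT s|lborel. ?f s \<xi>) = (LINT s|lborel. LINT \<xi>|lborel. ?f s \<xi>)"
    by (rule lborel_pair.Fubini_integral[OF int])
  also have "\<dots> = (LINT \<xi>|lborel. G \<xi>)"
    by (simp add: shift(2)[OF G])
  finally have "(LINT \<xi>|lborel. G \<xi>) = (LINT \<xi>|lborel. LINT s|lborel. ?f s \<xi>)" ..
  also have "\<dots> = (LINT \<xi>|lborel. g (\<xi> + e) - g \<xi>)"
  proof (rule integral_cong_AE)
    show "AE \<xi> in lborel. (LINT s|lborel. ?f s \<xi>) = g (\<xi> + e) - g \<xi>"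
      using der cont
    proof eventually_elim
      case (elim \<xi>)
      then show ?case
        by (subst integral_FTC_Icc[where F = "\<lambda>s. g (\<xi> + s *\<^sub>R e)"])
           (auto intro: has_vector_derivative_at_within continuous_on_subset)
    qed
  qed measurable
  also have "\<dots> = 0" using g shift[OF g] by simp
  finally show ?thesis .
qed

text \<open>Integration by parts against \<open>cis (x \<bullet> \<xi>)\<close>. The bound on
  \<open>d\<close> makes \<open>f\<close> and \<open>f'\<close> integrable. The singularity at the
  origin does no harm: a line in direction \<open>l\<close> misses the origin as soon as some other
  coordinate is nonzero, which is almost always the case.\<close>

lemma symbol_class_fourier_derivative:
  assumes f: "symbol_class \<alpha> d f" "- 1 \<le> d" and \<alpha>: "1 / 2 < \<alpha>"
    and f': "symbol_class \<alpha> (d - 1) f'"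
    and der: "\<And>\<xi> s. \<xi> + s *\<^sub>R axis l 1 \<noteq> 0 \<Longrightarrow>
      ((\<lambda>s. f (\<xi> + s *\<^sub>R axis l 1)) has_real_derivative f' (\<xi> + s *\<^sub>R axis l 1)) (at s)"
  shows "(LINT \<xi>|lborel. cis (x \<bullet> \<xi>) * complex_of_real (f' \<xi>)) =
     - (\<i> * complex_of_real (x $ l)) * (LINT \<xi>|lborel. cis (x \<bullet> \<xi>) * complex_of_real (f \<xi>))"
proof -
  have [measurable]: "f \<in> borel_measurable borel" "f' \<in> borel_measurable borel" using f f' by (auto dest: symbol_class_measurable)
  have if0: "integrable lborel f" by (rule symbol_class_integrable[OF f(1) _ \<alpha>]) (use f in simp)
  have if1: "integrable lborel f'" by (rule symbol_class_integrable[OF f' _ \<alpha>]) (use f in simp)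
  have [measurable]: "(\<lambda>\<xi>. cis (x \<bullet> \<xi>)) \<in> borel_measurable borel"
    by (intro borel_measurable_continuous_onI continuous_intros)
  have ci: "integrable lborel (\<lambda>\<xi>. cis (x \<bullet> \<xi>) * complex_of_real (h \<xi>))" if h: "integrable lborel h" for h
    by (rule Bochner_Integration.integrable_bound[OF h]) (use h in \<open>auto simp: norm_mult\<close>)
  let ?g = "\<lambda>\<xi>. cis (x \<bullet> \<xi>) * complex_of_real (f \<xi>)"
  let ?G = "\<lambda>\<xi>. (\<i> * complex_of_real (x $ l)) * (cis (x \<bullet> \<xi>) * complex_of_real (f \<xi>)) + cis (x \<bullet> \<xi>) * complex_of_real (f' \<xi>)"
  obtain i :: 3 where i: "i \<noteq> l" using exhaust_3 by (metis num1_eq1 zero_neq_one one_neq_zero)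
  have ib: "axis i (1::real) \<in> (Basis :: (real^3) set)" by (simp add: axis_in_Basis_iff)
  have nz: "AE \<xi> in lborel. \<forall>s. \<xi> + s *\<^sub>R axis l (1::real) \<noteq> (0::real^3)"
    using AE_lborel_inner_neq[OF ib, of 0]
  proof (eventually_elim, safe)
    fix \<xi> :: "real^3" and s assume "\<xi> \<bullet> axis i 1 \<noteq> 0" "\<xi> + s *\<^sub>R axis l 1 = 0"
    then have "\<xi> $ i \<noteq> 0" "(\<xi> + s *\<^sub>R axis l 1) $ i = 0" by (simp_all add: inner_axis)
    then show False using i by (simp add: axis_def)
  qed
  \<comment> \<open>One more derivative shows that \<open>f'\<close> is continuous along these
    lines, as the fundamental theorem requires.\<close>
  obtain f'' where f'': "\<And>\<xi> s. \<xi> + s *\<^sub>R axis l 1 \<noteq> 0 \<Longrightarrow>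
      ((\<lambda>s. f' (\<xi> + s *\<^sub>R axis l 1)) has_real_derivative f'' (\<xi> + s *\<^sub>R axis l 1)) (at s)"
    using symbol_class_derivative[OF f' \<alpha>, of l] by blast
  have cis_der: "((\<lambda>s. cis (x \<bullet> (\<xi> + s *\<^sub>R axis l 1))) has_vector_derivative
      \<i> * complex_of_real (x $ l) * cis (x \<bullet> (\<xi> + s *\<^sub>R axis l 1))) (at s)" for \<xi> s
  proof -
    have "((\<lambda>s. x \<bullet> (\<xi> + s *\<^sub>R axis l 1)) has_real_derivative x $ l) (at s)"
      by (auto simp: inner_add_right inner_axis intro!: derivative_eq_intros)
    then have "((\<lambda>s. \<i> * complex_of_real (x \<bullet> (\<xi> + s *\<^sub>R axis l 1))) has_vector_derivative
        \<i> * complex_of_real (x $ l)) (at s)"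
      by (intro has_vector_derivative_mult_right has_vector_derivative_of_real)
    from field_vector_diff_chain_at[OF this DERIV_exp] show ?thesis
      by (simp add: cis_conv_exp o_def)
  qed
  have "(LINT \<xi>|lborel. ?G \<xi>) = 0"
  proof (rule integral_directional_derivative_zero[of ?g ?G "axis l 1"])
    show "integrable lborel ?g" "integrable lborel ?G" using ci if0 if1 by auto
    show "AE \<xi> in lborel. \<forall>s. ((\<lambda>s. ?g (\<xi> + s *\<^sub>R axis l 1)) has_vector_derivative ?G (\<xi> + s *\<^sub>R axis l 1)) (at s)"
      using nz
    proof (eventually_elim, intro allI)
      fix \<xi> s assume "\<forall>s. \<xi> + s *\<^sub>R axis l (1::real) \<noteq> (0::real^3)"
      then have "((\<lambda>s. f (\<xi> + s *\<^sub>R axis l 1)) has_real_derivative f' (\<xi> + s *\<^sub>R axis l 1)) (at s)"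
        using der by simp
      from has_vector_derivative_mult[OF cis_der has_vector_derivative_of_real[OF this], of \<xi>]
      show "((\<lambda>s. ?g (\<xi> + s *\<^sub>R axis l 1)) has_vector_derivative ?G (\<xi> + s *\<^sub>R axis l 1)) (at s)"
        by (simp add: mult_ac add.commute)
    qed
    show "AE \<xi> in lborel. continuous_on UNIV (\<lambda>s. ?G (\<xi> + s *\<^sub>R axis l 1))"
      using nz
    proof eventually_elim
      case (elim \<xi>)
      have "continuous_on UNIV (\<lambda>s. f (\<xi> + s *\<^sub>R axis l 1))" "continuous_on UNIV (\<lambda>s. f' (\<xi> + s *\<^sub>R axis l 1))"
        using elim by (auto intro!: continuous_at_imp_continuous_on DERIV_isCont[OF der] DERIV_isCont[OF f''])
      then show ?case by (intro continuous_intros)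
    qed
  qed
  then show ?thesis
    using ci[OF if0] ci[OF if1] by (simp add: eq_neg_iff_add_eq_0 add.commute)
qed

lemma symbol_class_fourier_bounded:
  assumes f: "symbol_class \<alpha> d f" "- 2 \<le> d" and \<alpha>: "1 / 2 < \<alpha>"
  shows "\<exists>B\<ge>0. \<forall>x. norm (LINT \<xi>|lborel. cis (x \<bullet> \<xi>) * complex_of_real (f \<xi>)) \<le> B"
proof (intro exI conjI allI)
  fix x
  have "norm (LINT \<xi>|lborel. cis (x \<bullet> \<xi>) * complex_of_real (f \<xi>)) \<le>
     (LINT \<xi>|lborel. norm (cis (x \<bullet> \<xi>) * complex_of_real (f \<xi>)))"
    by (rule integral_norm_bound)
  then show "norm (LINT \<xi>|lborel. cis (x \<bullet> \<xi>) * complex_of_real (f \<xi>)) \<le> (LINT \<xi>|lborel. \<bar>f \<xi>\<bar>)"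
    by (simp add: norm_mult)
qed simp

text \<open>Order 1 allows three derivatives, ending at the integrable order -2; they give cubic
  decay in each single coordinate. The geometric mean of the three coordinate bounds is the product
  on the right.\<close>

lemma symbol_class_fourier_decay:
  assumes f: "symbol_class \<alpha> 1 f" and \<alpha>: "1 / 2 < \<alpha>"
  shows "\<exists>C\<ge>0. \<forall>x. norm (LINT \<xi>|lborel. cis (x \<bullet> \<xi>) * complex_of_real (f \<xi>)) \<le>
     C * (\<Prod>b\<in>Basis. inverse (1 + \<bar>x \<bullet> b\<bar>))"
proof -
  let ?K = "\<lambda>f x. LINT \<xi>|lborel. cis (x \<bullet> \<xi>) * complex_of_real (f \<xi>)"
  have "\<exists>B\<ge>0. \<forall>x. (1 + \<bar>x $ l\<bar>) ^ 3 * norm (?K f x) \<le> B" for l :: 3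
  proof -
    obtain f1 where f1: "symbol_class \<alpha> (1 - 1) f1" "\<And>\<xi> s. \<xi> + s *\<^sub>R axis l 1 \<noteq> 0 \<Longrightarrow>
      ((\<lambda>s. f (\<xi> + s *\<^sub>R axis l 1)) has_real_derivative f1 (\<xi> + s *\<^sub>R axis l 1)) (at s)"
      using symbol_class_derivative[OF f \<alpha>, of l] by blast
    obtain f2 where f2: "symbol_class \<alpha> (1 - 1 - 1) f2" "\<And>\<xi> s. \<xi> + s *\<^sub>R axis l 1 \<noteq> 0 \<Longrightarrow>
      ((\<lambda>s. f1 (\<xi> + s *\<^sub>R axis l 1)) has_real_derivative f2 (\<xi> + s *\<^sub>R axis l 1)) (at s)"
      using symbol_class_derivative[OF f1(1) \<alpha>, of l] by blast
    obtain f3 where f3: "symbol_class \<alpha> (1 - 1 - 1 - 1) f3" "\<And>\<xi> s. \<xi> + s *\<^sub>R axis l 1 \<noteq> 0 \<Longrightarrow>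
      ((\<lambda>s. f2 (\<xi> + s *\<^sub>R axis l 1)) has_real_derivative f3 (\<xi> + s *\<^sub>R axis l 1)) (at s)"
      using symbol_class_derivative[OF f2(1) \<alpha>, of l] by blast
    have "?K f3 x = - (\<i> * complex_of_real (x $ l)) * (- (\<i> * complex_of_real (x $ l)) * (- (\<i> * complex_of_real (x $ l)) * ?K f x))" for x
      using symbol_class_fourier_derivative[OF f _ \<alpha> f1, of x]
        symbol_class_fourier_derivative[OF f1(1) _ \<alpha> f2, of x]
        symbol_class_fourier_derivative[OF f2(1) _ \<alpha> f3, of x] by simp
    then have n3: "norm (?K f3 x) = \<bar>x $ l\<bar> ^ 3 * norm (?K f x)" for x
      by (simp add: norm_mult power3_eq_cube mult.assoc)
    obtain B0 where B0: "0 \<le> B0" "\<And>x. norm (?K f x) \<le> B0"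
      using symbol_class_fourier_bounded[OF f _ \<alpha>] by auto
    obtain B3 where B3: "0 \<le> B3" "\<And>x. norm (?K f3 x) \<le> B3"
      using symbol_class_fourier_bounded[OF f3(1) _ \<alpha>] by auto
    have "(1 + \<bar>x $ l\<bar>) ^ 3 * norm (?K f x) \<le> 8 * (B0 + B3)" for x
    proof (cases "\<bar>x $ l\<bar> \<le> 1")
      case True
      then have "(1 + \<bar>x $ l\<bar>) ^ 3 \<le> 2 ^ 3" by (intro power_mono) auto
      then have "(1 + \<bar>x $ l\<bar>) ^ 3 * norm (?K f x) \<le> 2 ^ 3 * B0" using B0 by (intro mult_mono) auto
      then show ?thesis using B3 by simp
    next
      case False
      then have "(1 + \<bar>x $ l\<bar>) ^ 3 \<le> (2 * \<bar>x $ l\<bar>) ^ 3" by (intro power_mono) auto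
      then have "(1 + \<bar>x $ l\<bar>) ^ 3 * norm (?K f x) \<le> (2 * \<bar>x $ l\<bar>) ^ 3 * norm (?K f x)"
        by (intro mult_right_mono) auto
      also have "\<dots> = 8 * norm (?K f3 x)" by (simp add: n3 power_mult_distrib)
      finally show ?thesis using B3(2)[of x] B0(1) by simp
    qed
    then show ?thesis using B0 B3 by (intro exI[of _ "8 * (B0 + B3)"]) auto
  qed
  then obtain B where B: "\<And>l. 0 \<le> B l" "\<And>l x. (1 + \<bar>x $ l\<bar>) ^ 3 * norm (?K f x) \<le> B l" by metis
  define C where "C = (\<Sum>l\<in>UNIV. B l)"
  have C: "0 \<le> C" unfolding C_def by (intro sum_nonneg B)
  have BC: "B l \<le> C" for l unfolding C_def by (rule member_le_sum) (auto intro: B)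
  have "norm (?K f x) \<le> C * (\<Prod>b\<in>Basis. inverse (1 + \<bar>x \<bullet> b\<bar>))" for x
  proof -
    have "(1 + \<bar>x \<bullet> b\<bar>) ^ 3 * norm (?K f x) \<le> C" if b: "b \<in> Basis" for b
    proof -
      obtain l where "b = axis l 1" using b by (auto simp: Basis_vec_def)
      then show ?thesis using B(2)[of x l] BC[of l] by (simp add: inner_axis)
    qed
    then have "(\<Prod>b\<in>(Basis::(real^3) set). (1 + \<bar>x \<bullet> b\<bar>) ^ 3 * norm (?K f x)) \<le> (\<Prod>b\<in>(Basis::(real^3) set). C)"
      by (intro prod_mono) auto
    then have "((\<Prod>b\<in>Basis. 1 + \<bar>x \<bullet> b\<bar>) * norm (?K f x)) ^ 3 \<le> C ^ 3"
      by (simp add: prod.distrib prod_power_distrib power_mult_distrib DIM_cart)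
    then have "(\<Prod>b\<in>Basis. 1 + \<bar>x \<bullet> b\<bar>) * norm (?K f x) \<le> C"
      using power_strict_mono[of C "(\<Prod>b\<in>Basis. 1 + \<bar>x \<bullet> b\<bar>) * norm (?K f x)" 3] C by fastforce
    moreover have "0 < (\<Prod>b\<in>Basis. 1 + \<bar>x \<bullet> b\<bar>)" by (intro prod_pos) (auto intro: add_pos_nonneg)
    ultimately show ?thesis unfolding prod_inversef[of "\<lambda>b. 1 + \<bar>x \<bullet> b\<bar>" Basis, unfolded o_def]
      by (simp add: divide_inverse[symmetric] pos_le_divide_eq mult.commute)
  qed
  then show ?thesis using C by blast
qed

section \<open>The Oseen kernel and its majorant\<close>

definition kernel_majorant :: "real \<Rightarrow> real \<Rightarrow> real^3 \<Rightarrow> real" where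
  "kernel_majorant \<alpha> t x =
     (let \<sigma> = t powr (1 / (2 * \<alpha>)) in \<sigma> powr - 4 * (\<Prod>b\<in>Basis. inverse (1 + \<bar>x \<bullet> b\<bar> / \<sigma>)))"

lemma kernel_majorant_nonneg: "0 \<le> kernel_majorant \<alpha> t x"
  unfolding kernel_majorant_def Let_def by (intro mult_nonneg_nonneg prod_nonneg) auto

lemma kernel_majorant_measurable [measurable]:
  assumes [measurable]: "f \<in> borel_measurable M" "g \<in> borel_measurable M"
  shows "(\<lambda>x. kernel_majorant \<alpha> (f x) (g x)) \<in> borel_measurable M"
  unfolding kernel_majorant_def Let_def by measurable

lemma borel_measurable_vec_nth' [measurable (raw)]:
  fixes f :: "'a \<Rightarrow> real^'n"
  assumes "f \<in> borel_measurable M"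
  shows "(\<lambda>x. f x $ k) \<in> borel_measurable M"
  by (rule measurable_compose[OF assms]) (intro borel_measurable_continuous_onI continuous_intros)

lemma leray_symbol_measurable [measurable]: "leray_symbol j h \<in> borel_measurable borel"
  unfolding leray_symbol_def[abs_def] by measurable

lemma oseen_kernel_lborel:
  "oseen_kernel \<alpha> t j h k x = Re ((LINT \<xi>|lborel. cis (x \<bullet> \<xi>) * (\<i> * complex_of_real
           (\<xi> $ k * leray_symbol j h \<xi> * frac_heat_symbol \<alpha> t \<xi>))) / complex_of_real ((2 * pi) ^ 3))"
proof -
  have [measurable]: "(\<lambda>\<xi>. cis (x \<bullet> \<xi>)) \<in> borel_measurable borel"
    by (intro borel_measurable_continuous_onI continuous_intros)
  show ?thesis
    unfolding oseen_kernel_def inv_fourier_def frac_heat_symbol_def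
    by (subst integral_completion) auto
qed

lemma oseen_kernel_measurable [measurable]:
  assumes [measurable]: "f \<in> borel_measurable M" "g \<in> borel_measurable M"
  shows "(\<lambda>x. oseen_kernel \<alpha> (f x) j h k (g x)) \<in> borel_measurable M"
proof -
  have [measurable]: "(\<lambda>y. cis (a y)) \<in> borel_measurable N" if "a \<in> borel_measurable N" for a :: "'z \<Rightarrow> real" and N
    by (rule measurable_compose[OF that]) (intro borel_measurable_continuous_onI continuous_intros)
  show ?thesis
    unfolding oseen_kernel_lborel frac_heat_symbol_def by measurable
qed

text \<open>The Leray symbol has order 0: its singular part consists of
  \<open>norm \<xi> powr - 2\<close> and two coordinates. The remaining factor
  \<open>\<xi> $ k\<close> raises the order to 1.\<close>

lemma oseen_symbol_class:
  "symbol_class \<alpha> 1 (\<lambda>\<xi>. \<xi> $ k * leray_symbol j h \<xi> * exp (- (norm \<xi> powr (2 * \<alpha>))))"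
proof -
  let ?E = "\<lambda>\<xi>::real^3. exp (- (norm \<xi> powr (2 * \<alpha>)))"
  have "symbol_class \<alpha> (0 + 1) (\<lambda>\<xi>. (if j = h then 1 else 0) * (\<xi> $ k * ?E \<xi>))"
    by (intro symbol_class.cmult symbol_class.coord symbol_class.exp)
  moreover have "symbol_class \<alpha> (0 + - 2 + 1 + 1 + 1) (\<lambda>\<xi>. - 1 * (\<xi> $ k * (\<xi> $ j * (\<xi> $ h * (norm \<xi> powr - 2 * ?E \<xi>)))))"
    by (intro symbol_class.cmult symbol_class.coord symbol_class.norm symbol_class.exp)
  ultimately have "symbol_class \<alpha> 1 (\<lambda>\<xi>. (if j = h then 1 else 0) * (\<xi> $ k * ?E \<xi>) +
     - 1 * (\<xi> $ k * (\<xi> $ j * (\<xi> $ h * (norm \<xi> powr - 2 * ?E \<xi>)))))"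
    by (intro symbol_class.add) auto
  moreover have "(\<lambda>\<xi>. (if j = h then 1 else 0) * (\<xi> $ k * ?E \<xi>) +
     - 1 * (\<xi> $ k * (\<xi> $ j * (\<xi> $ h * (norm \<xi> powr - 2 * ?E \<xi>))))) =
     (\<lambda>\<xi>. \<xi> $ k * leray_symbol j h \<xi> * ?E \<xi>)"
  proof
    fix \<xi> :: "real^3"
    show "(if j = h then 1 else 0) * (\<xi> $ k * ?E \<xi>) +
     - 1 * (\<xi> $ k * (\<xi> $ j * (\<xi> $ h * (norm \<xi> powr - 2 * ?E \<xi>)))) = \<xi> $ k * leray_symbol j h \<xi> * ?E \<xi>"
      by (cases "\<xi> = 0") (auto simp: leray_symbol_def powr_minus field_simps)
  qed
  ultimately show ?thesis by simp
qed

lemma integral_lborel_scale: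
  fixes f :: "'a::euclidean_space \<Rightarrow> 'b::{banach, second_countable_topology}"
  assumes [measurable]: "f \<in> borel_measurable borel" and c: "0 < c"
  shows "(LINT x|lborel. f x) = c ^ DIM('a) *\<^sub>R (LINT x|lborel. f (c *\<^sub>R x))"
proof -
  have "(LINT x|lborel. f x) =
      (LINT x|density (distr lborel borel (\<lambda>x. 0 + c *\<^sub>R x)) (\<lambda>_. ennreal (\<bar>c\<bar> ^ DIM('a))). f x)"
    using c by (subst lborel_affine[of c 0, symmetric]) auto
  also have "\<dots> = c ^ DIM('a) *\<^sub>R (LINT x|lborel. f (c *\<^sub>R x))"
    using c by (subst integral_density) (auto simp: integral_distr)
  finally show ?thesis .
qed

text \<open>The substitution of \<open>\<xi> / \<sigma>\<close> for \<open>\<xi>\<close>, with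
  \<open>\<sigma>\<close> the length scale belonging to the time \<open>t\<close>, reduces the
  kernel to time 1. Of the factor \<open>\<sigma> powr - 4\<close>, three powers are the Jacobian
  and one comes from \<open>\<xi> $ k\<close>; the Leray symbol is invariant under
  dilations.\<close>

lemma oseen_kernel_bound:
  assumes \<alpha>: "1 / 2 < \<alpha>"
  shows "\<exists>C>0. \<forall>t>0. \<forall>x j h k. \<bar>oseen_kernel \<alpha> t j h k x\<bar> \<le> C * kernel_majorant \<alpha> t x"
proof -
  let ?m = "\<lambda>j h k \<xi>. \<xi> $ k * leray_symbol j h \<xi> * exp (- (norm \<xi> powr (2 * \<alpha>)))"
  let ?I = "\<lambda>j h k x. LINT \<xi>|lborel. cis (x \<bullet> \<xi>) * complex_of_real (?m j h k \<xi>)"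
  have "\<exists>C\<ge>0. \<forall>x. norm (?I j h k x) \<le> C * (\<Prod>b\<in>Basis. inverse (1 + \<bar>x \<bullet> b\<bar>))" for j h k
    by (rule symbol_class_fourier_decay[OF oseen_symbol_class \<alpha>])
  note ex = this
  define C where "C j h k = (SOME C. 0 \<le> C \<and> (\<forall>x. norm (?I j h k x) \<le> C * (\<Prod>b\<in>Basis. inverse (1 + \<bar>x \<bullet> b\<bar>))))" for j h k
  have "0 \<le> C j h k \<and> (\<forall>x. norm (?I j h k x) \<le> C j h k * (\<Prod>b\<in>Basis. inverse (1 + \<bar>x \<bullet> b\<bar>)))" for j h k
    unfolding C_def by (rule someI_ex) (use ex in blast)
  then have C: "\<And>j h k. 0 \<le> C j h k"
    "\<And>j h k x. norm (?I j h k x) \<le> C j h k * (\<Prod>b\<in>Basis. inverse (1 + \<bar>x \<bullet> b\<bar>))" by blast+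
  define D where "D = 1 + (\<Sum>j\<in>UNIV. \<Sum>h\<in>UNIV. \<Sum>k\<in>UNIV. C j h k)"
  have D: "C j h k \<le> D" for j h k
  proof -
    have "C j h k \<le> (\<Sum>k\<in>UNIV. C j h k)" by (rule member_le_sum) (auto intro: C)
    also have "\<dots> \<le> (\<Sum>h\<in>UNIV. \<Sum>k\<in>UNIV. C j h k)"
      by (rule member_le_sum[of h UNIV "\<lambda>h. \<Sum>k\<in>UNIV. C j h k"]) (auto intro: C sum_nonneg)
    also have "\<dots> \<le> (\<Sum>j\<in>UNIV. \<Sum>h\<in>UNIV. \<Sum>k\<in>UNIV. C j h k)"
      by (rule member_le_sum[of j UNIV "\<lambda>j. \<Sum>h\<in>UNIV. \<Sum>k\<in>UNIV. C j h k"]) (auto intro: C sum_nonneg)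
    finally show ?thesis by (simp add: D_def)
  qed
  have "\<bar>oseen_kernel \<alpha> t j h k x\<bar> \<le> D * kernel_majorant \<alpha> t x" if t: "0 < t" for t j h k x
  proof -
    define \<sigma> where "\<sigma> = t powr (1 / (2 * \<alpha>))"
    have \<sigma>: "0 < \<sigma>" "\<sigma> powr (2 * \<alpha>) = t" using t \<alpha> by (auto simp: \<sigma>_def powr_powr)
    let ?H = "\<lambda>\<xi>. cis (x \<bullet> \<xi>) * (\<i> * complex_of_real (\<xi> $ k * leray_symbol j h \<xi> * frac_heat_symbol \<alpha> t \<xi>))"
    have [measurable]: "(\<lambda>\<xi>. cis (x \<bullet> \<xi>)) \<in> borel_measurable borel"
      by (intro borel_measurable_continuous_onI continuous_intros)
    have "(LINT \<xi>|lborel. ?H \<xi>) = (1 / \<sigma>) ^ 3 *\<^sub>R (LINT \<xi>|lborel. ?H ((1 / \<sigma>) *\<^sub>R \<xi>))"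
      using integral_lborel_scale[of ?H "1 / \<sigma>"] \<sigma> unfolding frac_heat_symbol_def by simp
    also have "(\<lambda>\<xi>. ?H ((1 / \<sigma>) *\<^sub>R \<xi>)) = (\<lambda>\<xi>. (\<i> * complex_of_real (1 / \<sigma>)) *
        (cis ((x /\<^sub>R \<sigma>) \<bullet> \<xi>) * complex_of_real (?m j h k \<xi>)))"
    proof
      fix \<xi> :: "real^3"
      have "leray_symbol j h ((1 / \<sigma>) *\<^sub>R \<xi>) = leray_symbol j h \<xi>"
        using \<sigma> by (simp add: leray_symbol_def power_mult_distrib power2_eq_square)
      moreover have "frac_heat_symbol \<alpha> t ((1 / \<sigma>) *\<^sub>R \<xi>) = exp (- (norm \<xi> powr (2 * \<alpha>)))"
        using \<sigma> t by (simp add: frac_heat_symbol_def powr_divide)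
      ultimately show "?H ((1 / \<sigma>) *\<^sub>R \<xi>) = (\<i> * complex_of_real (1 / \<sigma>)) *
        (cis ((x /\<^sub>R \<sigma>) \<bullet> \<xi>) * complex_of_real (?m j h k \<xi>))"
        by (simp add: divide_inverse mult_ac)
    qed
    finally have "(LINT \<xi>|lborel. ?H \<xi>) = (1 / \<sigma>) ^ 3 *\<^sub>R ((\<i> * complex_of_real (1 / \<sigma>)) * ?I j h k (x /\<^sub>R \<sigma>))"
      by simp
    then have "norm (LINT \<xi>|lborel. ?H \<xi>) = \<sigma> powr - 4 * norm (?I j h k (x /\<^sub>R \<sigma>))"
      using \<sigma> by (simp add: norm_mult norm_divide powr_minus power_divide field_simps power4_eq_xxxx power3_eq_cube)
    also have "\<dots> \<le> \<sigma> powr - 4 * (D * (\<Prod>b\<in>Basis. inverse (1 + \<bar>(x /\<^sub>R \<sigma>) \<bullet> b\<bar>)))"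
      using D by (intro mult_left_mono order_trans[OF C(2)] mult_right_mono prod_nonneg) auto
    also have "\<dots> = D * kernel_majorant \<alpha> t x"
      using \<sigma> unfolding kernel_majorant_def Let_def \<sigma>_def[symmetric]
      by (simp add: abs_mult divide_inverse mult_ac)
    finally have 1: "norm (LINT \<xi>|lborel. ?H \<xi>) \<le> D * kernel_majorant \<alpha> t x" .
    have "\<bar>oseen_kernel \<alpha> t j h k x\<bar> \<le> norm ((LINT \<xi>|lborel. ?H \<xi>) / complex_of_real ((2 * pi) ^ 3))"
      unfolding oseen_kernel_lborel by (rule abs_Re_le_cmod)
    also have "\<dots> = norm (LINT \<xi>|lborel. ?H \<xi>) / (2 * pi) ^ 3"
      by (simp only: norm_divide norm_of_real) simp
    also have "\<dots> \<le> norm (LINT \<xi>|lborel. ?H \<xi>) / 1"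
    proof (rule divide_left_mono)
      show "1 \<le> (2 * pi) ^ 3" using pi_gt3 by (intro one_le_power) simp
    qed auto
    finally show ?thesis using 1 by simp
  qed
  moreover have "0 < D" unfolding D_def by (intro add_pos_nonneg sum_nonneg C) simp
  ultimately show ?thesis by blast
qed

text \<open>The product form splits the integral into three integrals over the line, each finite
  since \<open>r > 1\<close> and each proportional to \<open>\<sigma>\<close>. Together with
  \<open>\<sigma> powr - 4\<close> this gives the norm as a multiple of
  \<open>\<sigma> powr (3 / r - 4)\<close>.\<close>

lemma kernel_majorant_norm:
  assumes r: "1 < r"
  shows "\<exists>c>0. \<forall>t>0. epow (\<integral>\<^sup>+x. epow (ennreal (kernel_majorant \<alpha> t x)) r \<partial>lborel) (1 / r) =
     ennreal (c * t powr ((3 / r - 4) / (2 * \<alpha>)))"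
proof -
  define c where "c = enn2real (\<integral>\<^sup>+x. ennreal ((1 + \<bar>x\<bar>) powr - r) \<partial>lborel)"
  have c: "(\<integral>\<^sup>+x. ennreal ((1 + \<bar>x\<bar>) powr - r) \<partial>lborel) = ennreal c"
    using nn_integral_one_plus_abs_powr_finite[OF r] by (simp add: c_def)
  have "c \<noteq> 0"
  proof
    assume "c = 0"
    with c have "AE x in lborel. ennreal ((1 + \<bar>x\<bar>) powr - r) = 0" by (simp add: nn_integral_0_iff_AE)
    then have "AE x in (lborel :: real measure). False" by (rule eventually_mono) (auto simp: ennreal_eq_0_iff)
    then show False by (simp add: AE_iff_measurable[OF _ refl] eventually_False trivial_limit_def[symmetric] ae_filter_eq_bot_iff)
  qed
  then have c0: "0 < c" using enn2real_nonneg unfolding c_def by (simp add: less_le)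
  have "epow (\<integral>\<^sup>+x. epow (ennreal (kernel_majorant \<alpha> t x)) r \<partial>lborel) (1 / r) =
     ennreal (c powr (3 / r) * t powr ((3 / r - 4) / (2 * \<alpha>)))" if t: "0 < t" for t
  proof -
    define \<sigma> where "\<sigma> = t powr (1 / (2 * \<alpha>))"
    have \<sigma>: "0 < \<sigma>" using t by (auto simp: \<sigma>_def)
    have e: "epow (ennreal (kernel_majorant \<alpha> t x)) r = ennreal (\<sigma> powr (- 4 * r)) *
        (\<Prod>b\<in>Basis. ennreal ((1 + \<bar>x \<bullet> b\<bar> / \<sigma>) powr - r))" for x
    proof -
      have "kernel_majorant \<alpha> t x powr r = (\<sigma> powr - 4) powr r * (\<Prod>b\<in>Basis. inverse (1 + \<bar>x \<bullet> b\<bar> / \<sigma>) powr r)"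
        unfolding kernel_majorant_def Let_def \<sigma>_def[symmetric]
        using \<sigma> by (subst powr_mult) (auto intro!: prod_nonneg simp: prod_powr_distrib)
      also have "\<dots> = \<sigma> powr (- 4 * r) * (\<Prod>b\<in>Basis. (1 + \<bar>x \<bullet> b\<bar> / \<sigma>) powr - r)"
      proof -
        have "inverse (1 + \<bar>x \<bullet> b\<bar> / \<sigma>) powr r = (1 + \<bar>x \<bullet> b\<bar> / \<sigma>) powr - r" for b
          using \<sigma> by (simp add: inverse_powr powr_minus)
        then show ?thesis by (simp only: powr_powr)
      qed
      finally show ?thesis
        by (simp add: epow_ennreal kernel_majorant_nonneg ennreal_mult prod_nonneg prod_ennreal)
    qed
    have "(\<integral>\<^sup>+y. ennreal ((1 + \<bar>y\<bar> / \<sigma>) powr - r) \<partial>lborel) =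
        ennreal \<sigma> * (\<integral>\<^sup>+y. ennreal ((1 + \<bar>0 + \<sigma> * y\<bar> / \<sigma>) powr - r) \<partial>lborel)"
      using \<sigma> by (subst nn_integral_real_affine[of _ \<sigma> 0]) auto
    also have "\<dots> = ennreal (\<sigma> * c)"
      using \<sigma> c c0 by (simp add: abs_mult ennreal_mult)
    finally have s: "(\<integral>\<^sup>+y. ennreal ((1 + \<bar>y\<bar> / \<sigma>) powr - r) \<partial>lborel) = ennreal (\<sigma> * c)" .
    have "(\<integral>\<^sup>+x. epow (ennreal (kernel_majorant \<alpha> t x)) r \<partial>lborel) =
       ennreal (\<sigma> powr (- 4 * r)) * (\<integral>\<^sup>+x. (\<Prod>b\<in>(Basis::(real^3) set). ennreal ((1 + \<bar>x \<bullet> b\<bar> / \<sigma>) powr - r)) \<partial>lborel)"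
      unfolding e by (rule nn_integral_cmult) measurable
    also have "(\<integral>\<^sup>+x. (\<Prod>b\<in>(Basis::(real^3) set). ennreal ((1 + \<bar>x \<bullet> b\<bar> / \<sigma>) powr - r)) \<partial>lborel) =
       (\<Prod>b\<in>(Basis::(real^3) set). \<integral>\<^sup>+y. ennreal ((1 + \<bar>y\<bar> / \<sigma>) powr - r) \<partial>lborel)"
      by (rule nn_integral_lborel_prod) auto
    also have "\<dots> = ennreal ((\<sigma> * c) ^ 3)"
      unfolding s using \<sigma> c0 by (simp add: ennreal_power DIM_cart)
    also have "ennreal (\<sigma> powr (- 4 * r)) * ennreal ((\<sigma> * c) ^ 3) = ennreal (\<sigma> powr (- 4 * r) * (\<sigma> powr 3 * c powr 3))"
      using \<sigma> c0 by (simp add: ennreal_mult[symmetric] power_mult_distrib)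
    also have "\<sigma> powr (- 4 * r) * (\<sigma> powr 3 * c powr 3) = \<sigma> powr (3 - 4 * r) * c powr 3"
      by (simp only: mult.assoc[symmetric] powr_add[symmetric]) simp
    finally have "epow (\<integral>\<^sup>+x. epow (ennreal (kernel_majorant \<alpha> t x)) r \<partial>lborel) (1 / r) =
        ennreal ((\<sigma> powr (3 - 4 * r) * c powr 3) powr (1 / r))"
      by (simp add: epow_ennreal)
    also have "(\<sigma> powr (3 - 4 * r) * c powr 3) powr (1 / r) = \<sigma> powr ((3 - 4 * r) * (1 / r)) * c powr (3 * (1 / r))"
      using \<sigma> c0 by (simp only: powr_mult powr_powr powr_ge_zero)
    also have "\<dots> = c powr (3 / r) * t powr ((3 / r - 4) / (2 * \<alpha>))"
      using r by (simp add: \<sigma>_def powr_powr diff_divide_distrib)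
    finally show ?thesis .
  qed
  then show ?thesis using c0 by (intro exI[of _ "c powr (3 / r)"]) auto
qed

section \<open>The bilinear estimate\<close>

text \<open>A modular for the sum \<open>L\<^sup>m + L\<^sup>M\<close> when \<open>m \<le> M\<close>.\<close>

definition sum_modular :: "real \<Rightarrow> real \<Rightarrow> (real^3 \<Rightarrow> ennreal) \<Rightarrow> ennreal" where
  "sum_modular m M U = (\<integral>\<^sup>+x. min (epow (U x) m) (epow (U x) M) \<partial>lborel)"

lemma ennreal_mult_le_squares: "(x::ennreal) * y \<le> epow x 2 + epow y 2"
proof -
  have "x * y \<le> max x y * max x y" by (intro mult_mono) auto
  also have "\<dots> = epow (max x y) (1 + 1)" unfolding epow_add by simp
  also have "\<dots> \<le> epow x 2 + epow y 2" by (auto simp: max_def)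
  finally show ?thesis .
qed

lemma epow_2: "epow 2 a = ennreal (2 powr a)"
  using epow_ennreal[of 2 a] by simp

lemma young_convolution_le:
  fixes k F :: "'a::euclidean_space \<Rightarrow> ennreal" and p r s :: real
  assumes [measurable]: "k \<in> borel_measurable borel" "F \<in> borel_measurable borel"
    and e: "0 < r" "1 \<le> s" "1 < p" "1 / p < 1 / r" "1 / p < 1 / s" "1 / r + 1 / s = 1 + 1 / p"
    and F: "(\<integral>\<^sup>+x. epow (F x) s \<partial>lborel) \<le> 2"
    and k: "epow (\<integral>\<^sup>+x. epow (k x) r \<partial>lborel) (1 / r) \<le> N"
  shows "(\<integral>\<^sup>+x. epow (\<integral>\<^sup>+y. k (x - y) * F y \<partial>lborel) p \<partial>lborel) \<le> epow (2 * N) p"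
proof -
  have "epow (\<integral>\<^sup>+x. epow (F x) s \<partial>lborel) (1 / s) \<le> epow (ennreal 2) (1 / s)"
    using F e by (intro epow_mono) auto
  also have "\<dots> \<le> ennreal 2"
  proof -
    have "2 powr (1 / s) \<le> 2 powr (1::real)" using e by (intro powr_mono) auto
    then have "ennreal (2 powr (1 / s)) \<le> ennreal 2" by (intro ennreal_leI) simp
    then show ?thesis by (subst epow_ennreal) auto
  qed
  finally have "epow (\<integral>\<^sup>+x. epow (F x) s \<partial>lborel) (1 / s) \<le> 2" by simp
  then have "epow (\<integral>\<^sup>+x. epow (k x) r \<partial>lborel) (1 / r) * epow (\<integral>\<^sup>+x. epow (F x) s \<partial>lborel) (1 / s) \<le> N * 2"
    by (intro mult_mono k) auto
  then show ?thesis
    using e by (intro order_trans[OF young_convolution[of k F r s p]] epow_mono) (auto simp: mult.commute)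
qed

text \<open>\<open>U\<close> is cut at height 1: the square of the large part lies in L^(m/2), that
  of the small part in L^(M/2). Young's inequality sends both into L^M with kernel exponents
  \<open>r1\<close> and \<open>r2\<close>, and the first of these determines the power
  \<open>a\<close> of time.\<close>

lemma kernel_convolution_bound:
  fixes \<alpha> m M T :: real
  assumes \<alpha>: "1 / 2 < \<alpha>" and m: "2 < m" "m \<le> M" and T: "0 < T"
  defines "a \<equiv> (1 + 3 * (2 / m - 1 / M)) / (2 * \<alpha>)"
  shows "\<exists>c>0. \<forall>t U. 0 < t \<longrightarrow> t < T \<longrightarrow> U \<in> borel_measurable borel \<longrightarrow> sum_modular m M U \<le> 2 \<longrightarrow>
     (\<integral>\<^sup>+x. epow (\<integral>\<^sup>+y. ennreal (kernel_majorant \<alpha> t (x - y)) * epow (U y) 2 \<partial>lborel) M \<partial>lborel)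
       \<le> epow (ennreal (c * t powr - a)) M"
proof -
  define r1 where "r1 = 1 / (1 - (2 / m - 1 / M))"
  define r2 where "r2 = 1 / (1 - 1 / M)"
  have M: "2 < M" using m by simp
  have i: "0 < 1 / M" "1 / M \<le> 1 / m" "1 / m < 1 / 2"
    using m by (auto intro!: divide_left_mono)
  have eq2: "2 * (1 / m) = 2 / m" by simp
  have A: "0 < 2 / m - 1 / M" "2 / m - 1 / M < 1" "1 / M \<le> 2 / m - 1 / M"
    using i eq2 by linarith+
  have A': "1 / M < 2 / m" "1 / M < 1 - (2 / m - 1 / M)" "1 / M < 1 - 1 / M"
    using i eq2 by linarith+
  have A'': "1 / M < 2 / M" using M by (intro divide_strict_right_mono) auto
  have r: "1 < r1" "1 < r2" "1 / r1 = 1 - (2 / m - 1 / M)" "1 / r2 = 1 - 1 / M"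
  proof -
    have *: "1 < 1 / (1 - z)" if "0 < z" "z < 1" for z :: real using that by simp
    show "1 < r1" unfolding r1_def by (rule *) (use A in auto)
    have "1 / M < 1" using i by linarith
    then show "1 < r2" unfolding r2_def by (intro * i)
  qed (simp_all add: r1_def r2_def)
  obtain c1 where c1: "0 < c1" "\<And>t. 0 < t \<Longrightarrow> epow (\<integral>\<^sup>+x. epow (ennreal (kernel_majorant \<alpha> t x)) r1 \<partial>lborel) (1 / r1) =
     ennreal (c1 * t powr ((3 / r1 - 4) / (2 * \<alpha>)))" using kernel_majorant_norm[OF r(1)] by blast
  obtain c2 where c2: "0 < c2" "\<And>t. 0 < t \<Longrightarrow> epow (\<integral>\<^sup>+x. epow (ennreal (kernel_majorant \<alpha> t x)) r2 \<partial>lborel) (1 / r2) =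
     ennreal (c2 * t powr ((3 / r2 - 4) / (2 * \<alpha>)))" using kernel_majorant_norm[OF r(2)] by blast
  define b where "b = (1 + 3 * (1 / M)) / (2 * \<alpha>)"
  have e1: "(3 / r1 - 4) / (2 * \<alpha>) = - a"
  proof -
    have "3 / r1 - 4 = - (1 + 3 * (2 / m - 1 / M))" using r(3) by (simp add: divide_inverse)
    then show ?thesis unfolding a_def by (simp only: minus_divide_left)
  qed
  have e2: "(3 / r2 - 4) / (2 * \<alpha>) = - b"
  proof -
    have "3 / r2 - 4 = - (1 + 3 * (1 / M))" using r(4) by (simp add: divide_inverse)
    then show ?thesis unfolding b_def by (simp only: minus_divide_left)
  qed
  \<comment> \<open>The small part is less singular in time; on the bounded time interval its power
    \<open>- b\<close> is replaced by \<open>- a\<close> at the cost of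
    \<open>T powr (a - b)\<close>.\<close>
  have ba: "b \<le> a" unfolding a_def b_def using A \<alpha> by (intro divide_right_mono) auto
  define c where "c = c1 + c2 * T powr (a - b)"
  have c0: "0 < c" using c1 c2 by (simp add: c_def add_pos_nonneg)
  define C where "C = 2 * (2 * c) * 2 powr (1 / M)"
  have C0: "0 < C" using c0 by (simp add: C_def)
  have "(\<integral>\<^sup>+x. epow (\<integral>\<^sup>+y. ennreal (kernel_majorant \<alpha> t (x - y)) * epow (U y) 2 \<partial>lborel) M \<partial>lborel)
       \<le> epow (ennreal (C * t powr - a)) M"
    if t: "0 < t" "t < T" and [measurable]: "U \<in> borel_measurable borel" and U: "sum_modular m M U \<le> 2" for t U
  proof -
    let ?k = "\<lambda>x. ennreal (kernel_majorant \<alpha> t x)"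
    define F1 where "F1 y = (if 1 < U y then epow (U y) 2 else 0)" for y
    define F2 where "F2 y = (if 1 < U y then 0 else epow (U y) 2)" for y
    have [measurable]: "F1 \<in> borel_measurable borel" "F2 \<in> borel_measurable borel"
      unfolding F1_def[abs_def] F2_def[abs_def] by measurable
    have split: "epow (U y) 2 = F1 y + F2 y" for y by (simp add: F1_def F2_def)
    have le1: "(epow u m \<le> epow u M)" if "1 \<le> u" for u
    proof (cases u)
      case (real x)
      then have "1 \<le> x" using that by simp
      then show ?thesis using real m by (auto simp: epow_ennreal intro!: ennreal_leI powr_mono)
    qed simp
    have le2: "(epow u M \<le> epow u m)" if "u \<le> 1" for u
    proof (cases u)
      case (real x)
      then have "x \<le> 1" using that by simp
      then show ?thesis using real m by (auto simp: epow_ennreal intro!: ennreal_leI powr_mono')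
    qed (use that in simp)
    have "(\<integral>\<^sup>+x. epow (F1 x) (m / 2) \<partial>lborel) \<le> sum_modular m M U"
      unfolding sum_modular_def
      by (intro nn_integral_mono) (auto simp: F1_def epow_epow intro: le1)
    then have I1: "(\<integral>\<^sup>+x. epow (F1 x) (m / 2) \<partial>lborel) \<le> 2" using U by simp
    have "(\<integral>\<^sup>+x. epow (F2 x) (M / 2) \<partial>lborel) \<le> sum_modular m M U"
      unfolding sum_modular_def
      by (intro nn_integral_mono) (auto simp: F2_def epow_epow intro: le2)
    then have I2: "(\<integral>\<^sup>+x. epow (F2 x) (M / 2) \<partial>lborel) \<le> 2" using U by simp
    have n1: "epow (\<integral>\<^sup>+x. epow (?k x) r1 \<partial>lborel) (1 / r1) \<le> ennreal (c * t powr - a)"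
      unfolding c1(2)[OF t(1)] e1 using c1 c2 by (intro ennreal_leI mult_right_mono) (auto simp: c_def)
    have n2: "epow (\<integral>\<^sup>+x. epow (?k x) r2 \<partial>lborel) (1 / r2) \<le> ennreal (c * t powr - a)"
      unfolding c2(2)[OF t(1)] e2
    proof (rule ennreal_leI)
      have "c2 * t powr - b = c2 * t powr (a - b) * t powr - a" by (simp add: powr_add[symmetric])
      also have "\<dots> \<le> c2 * T powr (a - b) * t powr - a"
        using t ba c2 by (intro mult_right_mono mult_left_mono powr_mono2) auto
      also have "\<dots> \<le> c * t powr - a" using c1 by (intro mult_right_mono) (auto simp: c_def)
      finally show "c2 * t powr - b \<le> c * t powr - a" .
    qed
    let ?c1 = "\<lambda>x. \<integral>\<^sup>+y. ?k (x - y) * F1 y \<partial>lborel" and ?c2 = "\<lambda>x. \<integral>\<^sup>+y. ?k (x - y) * F2 y \<partial>lborel"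
    have B1: "(\<integral>\<^sup>+x. epow (?c1 x) M \<partial>lborel) \<le> epow (2 * ennreal (c * t powr - a)) M"
      by (rule young_convolution_le[where r = r1 and s = "m / 2"]) (use r A A' m M I1 n1 in auto)
    have B2: "(\<integral>\<^sup>+x. epow (?c2 x) M \<partial>lborel) \<le> epow (2 * ennreal (c * t powr - a)) M"
      by (rule young_convolution_le[where r = r2 and s = "M / 2"]) (use r A A' A'' m M I2 n2 in auto)
    have "(\<integral>\<^sup>+x. epow (\<integral>\<^sup>+y. ?k (x - y) * epow (U y) 2 \<partial>lborel) M \<partial>lborel) =
        (\<integral>\<^sup>+x. epow (?c1 x + ?c2 x) M \<partial>lborel)"
      unfolding split by (simp add: distrib_left nn_integral_add)
    also have "\<dots> \<le> (\<integral>\<^sup>+x. ennreal (2 powr M) * (epow (?c1 x) M + epow (?c2 x) M) \<partial>lborel)"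
      using M by (intro nn_integral_mono epow_plus_le) auto
    also have "\<dots> = ennreal (2 powr M) * ((\<integral>\<^sup>+x. epow (?c1 x) M \<partial>lborel) + (\<integral>\<^sup>+x. epow (?c2 x) M \<partial>lborel))"
      by (simp add: nn_integral_cmult nn_integral_add)
    also have "\<dots> \<le> ennreal (2 powr M) * (epow (2 * ennreal (c * t powr - a)) M + epow (2 * ennreal (c * t powr - a)) M)"
      by (intro mult_left_mono add_mono B1 B2) auto
    also have "\<dots> = epow (ennreal (C * t powr - a)) M"
    proof -
      have "ennreal (C * t powr - a) = ennreal 2 * (2 * ennreal (c * t powr - a)) * ennreal (2 powr (1 / M))"
        using c0 by (simp add: C_def ennreal_mult[symmetric] ennreal_numeral[symmetric] mult_ac del: ennreal_numeral)
      then have "epow (ennreal (C * t powr - a)) M = ennreal (2 powr M) * epow (2 * ennreal (c * t powr - a)) M * 2"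
        using M by (simp only: epow_mult) (simp add: epow_ennreal powr_powr epow_2)
      then show ?thesis by (simp add: mult_2[symmetric] mult_ac)
    qed
    finally show ?thesis .
  qed
  then show ?thesis using C0 by (intro exI[of _ C]) auto
qed

text \<open>After both functions are normalised, their product is bounded by the sum of the squares.
  The sizes \<open>\<phi>\<close> and \<open>\<psi>\<close> are arbitrary in [0, \<infinity>]: a
  zero size forces its function to vanish almost everywhere, since a nonzero value divided by 0 is
  \<infinity>, and if neither is zero an infinite size makes the bound trivial.\<close>

lemma kernel_bilinear_bound:
  fixes \<alpha> m M T :: real
  assumes \<alpha>: "1 / 2 < \<alpha>" and m: "2 < m" "m \<le> M" and T: "0 < T"
  defines "a \<equiv> (1 + 3 * (2 / m - 1 / M)) / (2 * \<alpha>)"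
  shows "\<exists>c>0. \<forall>t U V \<phi> \<psi>. 0 < t \<longrightarrow> t < T \<longrightarrow> U \<in> borel_measurable borel \<longrightarrow> V \<in> borel_measurable borel \<longrightarrow>
     sum_modular m M (\<lambda>x. U x / \<phi>) \<le> 2 \<longrightarrow> sum_modular m M (\<lambda>x. V x / \<psi>) \<le> 2 \<longrightarrow>
     (\<integral>\<^sup>+x. epow (\<integral>\<^sup>+y. ennreal (kernel_majorant \<alpha> t (x - y)) * (U y * V y) \<partial>lborel) M \<partial>lborel)
       \<le> epow (ennreal (c * t powr - a) * (\<phi> * \<psi>)) M"
proof -
  obtain c where c: "0 < c" and conv: "\<And>t U. 0 < t \<Longrightarrow> t < T \<Longrightarrow> U \<in> borel_measurable borel \<Longrightarrow> sum_modular m M U \<le> 2 \<Longrightarrow>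
     (\<integral>\<^sup>+x. epow (\<integral>\<^sup>+y. ennreal (kernel_majorant \<alpha> t (x - y)) * epow (U y) 2 \<partial>lborel) M \<partial>lborel)
       \<le> epow (ennreal (c * t powr - a)) M"
    using kernel_convolution_bound[OF \<alpha> m T] unfolding a_def by blast
  define C where "C = 2 * c * 2 powr (1 / M)"
  have C0: "0 < C" using c by (simp add: C_def)
  have M: "0 < M" "0 < m" using m by auto
  have main: "(\<integral>\<^sup>+x. epow (\<integral>\<^sup>+y. ennreal (kernel_majorant \<alpha> t (x - y)) * (U y * V y) \<partial>lborel) M \<partial>lborel)
       \<le> epow (ennreal (C * t powr - a)) M"
    if t: "0 < t" "t < T" and [measurable]: "U \<in> borel_measurable borel" "V \<in> borel_measurable borel"
      and UV: "sum_modular m M U \<le> 2" "sum_modular m M V \<le> 2" for t U V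
  proof -
    let ?k = "\<lambda>x. ennreal (kernel_majorant \<alpha> t x)"
    let ?c = "\<lambda>U x. \<integral>\<^sup>+y. ?k (x - y) * epow (U y) 2 \<partial>lborel"
    have "(\<integral>\<^sup>+x. epow (\<integral>\<^sup>+y. ?k (x - y) * (U y * V y) \<partial>lborel) M \<partial>lborel) \<le>
        (\<integral>\<^sup>+x. epow (\<integral>\<^sup>+y. ?k (x - y) * (epow (U y) 2 + epow (V y) 2) \<partial>lborel) M \<partial>lborel)"
      using M by (intro nn_integral_mono epow_mono mult_left_mono ennreal_mult_le_squares) auto
    also have "\<dots> = (\<integral>\<^sup>+x. epow (?c U x + ?c V x) M \<partial>lborel)"
      by (simp add: distrib_left nn_integral_add)
    also have "\<dots> \<le> (\<integral>\<^sup>+x. ennreal (2 powr M) * (epow (?c U x) M + epow (?c V x) M) \<partial>lborel)"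
      using M by (intro nn_integral_mono epow_plus_le) auto
    also have "\<dots> = ennreal (2 powr M) * ((\<integral>\<^sup>+x. epow (?c U x) M \<partial>lborel) + (\<integral>\<^sup>+x. epow (?c V x) M \<partial>lborel))"
      by (simp add: nn_integral_cmult nn_integral_add)
    also have "\<dots> \<le> ennreal (2 powr M) * (epow (ennreal (c * t powr - a)) M + epow (ennreal (c * t powr - a)) M)"
      by (intro mult_left_mono add_mono conv t UV) auto
    also have "\<dots> = epow (ennreal (C * t powr - a)) M"
    proof -
      have "ennreal (C * t powr - a) = ennreal 2 * ennreal (c * t powr - a) * ennreal (2 powr (1 / M))"
        using c by (simp add: C_def ennreal_mult[symmetric] ennreal_numeral[symmetric] mult_ac del: ennreal_numeral)
      then have "epow (ennreal (C * t powr - a)) M = ennreal (2 powr M) * epow (ennreal (c * t powr - a)) M * 2"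
        using M by (simp only: epow_mult) (simp add: epow_ennreal powr_powr epow_2)
      then show ?thesis by (simp add: mult_2[symmetric] mult_ac)
    qed
    finally show ?thesis .
  qed
  have zero: "AE x in lborel. U x = 0" if [measurable]: "U \<in> borel_measurable borel" and U: "sum_modular m M (\<lambda>x. U x / 0) \<le> 2" for U
  proof -
    have "AE x in lborel. min (epow (U x / 0) m) (epow (U x / 0) M) \<noteq> \<infinity>"
      by (rule nn_integral_noteq_infinite) (use U in \<open>auto simp: sum_modular_def top_unique\<close>)
    then show ?thesis
      by eventually_elim (auto simp: min_def divide_ennreal_def ennreal_mult_top split: if_splits)
  qed
  have "(\<integral>\<^sup>+x. epow (\<integral>\<^sup>+y. ennreal (kernel_majorant \<alpha> t (x - y)) * (U y * V y) \<partial>lborel) M \<partial>lborel)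
       \<le> epow (ennreal (C * t powr - a) * (\<phi> * \<psi>)) M"
    if t: "0 < t" "t < T" and [measurable]: "U \<in> borel_measurable borel" "V \<in> borel_measurable borel"
      and UV: "sum_modular m M (\<lambda>x. U x / \<phi>) \<le> 2" "sum_modular m M (\<lambda>x. V x / \<psi>) \<le> 2" for t U V \<phi> \<psi>
  proof -
    consider "\<phi> = 0 \<or> \<psi> = 0" | "\<phi> \<noteq> 0" "\<psi> \<noteq> 0" "\<phi> = \<infinity> \<or> \<psi> = \<infinity>" | "\<phi> \<noteq> 0" "\<psi> \<noteq> 0" "\<phi> \<noteq> \<infinity>" "\<psi> \<noteq> \<infinity>"
      by blast
    then show ?thesis
    proof cases
      case 1
      have "AE y in lborel. U y * V y = 0"
      proof (cases "\<phi> = 0")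
        case True
        then have "AE y in lborel. U y = 0" using zero[of U] UV by simp
        then show ?thesis by eventually_elim simp
      next
        case False
        then have "AE y in lborel. V y = 0" using zero[of V] UV 1 by simp
        then show ?thesis by eventually_elim simp
      qed
      then have "(\<integral>\<^sup>+y. ennreal (kernel_majorant \<alpha> t (x - y)) * (U y * V y) \<partial>lborel) = 0" for x
        by (subst nn_integral_0_iff_AE) (auto elim!: eventually_mono)
      then show ?thesis by simp
    next
      case 2
      then have "ennreal (C * t powr - a) * (\<phi> * \<psi>) = \<infinity>"
        using C0 t by (auto simp: ennreal_mult_top ennreal_top_mult ennreal_mult_eq_top_iff)
      then show ?thesis by simp
    next
      case 3
      have "U y * V y = (\<phi> * \<psi>) * ((U y / \<phi>) * (V y / \<psi>))" for y
      proof -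
        have "w = z * (w / z)" if "z \<noteq> 0" "z \<noteq> \<infinity>" for w z :: ennreal
          using ennreal_mult_divide_eq[of z w] that by (simp add: ennreal_times_divide mult.commute)
        then have "U y = \<phi> * (U y / \<phi>)" "V y = \<psi> * (V y / \<psi>)"
          using 3 by blast+
        then show ?thesis by (metis mult.assoc mult.left_commute)
      qed
      then have "(\<integral>\<^sup>+x. epow (\<integral>\<^sup>+y. ennreal (kernel_majorant \<alpha> t (x - y)) * (U y * V y) \<partial>lborel) M \<partial>lborel) =
        (\<integral>\<^sup>+x. epow ((\<phi> * \<psi>) * (\<integral>\<^sup>+y. ennreal (kernel_majorant \<alpha> t (x - y)) * ((U y / \<phi>) * (V y / \<psi>)) \<partial>lborel)) M \<partial>lborel)"
        by (subst nn_integral_cmult[symmetric]) (auto intro!: nn_integral_cong arg_cong[where f = "\<lambda>x. epow x M"] simp: mult_ac)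
      also have "\<dots> = epow (\<phi> * \<psi>) M *
          (\<integral>\<^sup>+x. epow (\<integral>\<^sup>+y. ennreal (kernel_majorant \<alpha> t (x - y)) * ((U y / \<phi>) * (V y / \<psi>)) \<partial>lborel) M \<partial>lborel)"
        unfolding epow_mult by (rule nn_integral_cmult) measurable
      also have "\<dots> \<le> epow (\<phi> * \<psi>) M * epow (ennreal (C * t powr - a)) M"
        by (intro mult_left_mono main t UV) auto
      finally show ?thesis by (simp only: epow_mult mult_ac)
    qed
  qed
  then show ?thesis using C0 by (intro exI[of _ C]) auto
qed

section \<open>The positive Duhamel operator\<close>

definition majorant_op :: "real \<Rightarrow> real \<Rightarrow> (real \<times> (real^3) \<Rightarrow> ennreal) \<Rightarrow> real \<times> (real^3) \<Rightarrow> ennreal" where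
  "majorant_op D \<alpha> W z = (\<integral>\<^sup>+s. indicator {0<..<fst z} s *
     (\<integral>\<^sup>+y. ennreal (D * kernel_majorant \<alpha> (fst z - s) (snd z - y)) * W (s, y) \<partial>lborel) \<partial>lborel)"

lemma majorant_op_measurable [measurable]:
  assumes [measurable]: "W \<in> borel_measurable (borel \<Otimes>\<^sub>M borel)"
  shows "majorant_op D \<alpha> W \<in> borel_measurable (borel \<Otimes>\<^sub>M borel)"
proof -
  have *: "indicator {0<..<a} s = (if 0 < s \<and> s < a then 1 else (0::ennreal))" for a s :: real
    by (auto simp: indicator_def)
  show ?thesis unfolding majorant_op_def[abs_def] * by measurable
qed

lemma majorant_op_mono: "(\<And>z. W z \<le> W' z) \<Longrightarrow> majorant_op D \<alpha> W z \<le> majorant_op D \<alpha> W' z"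
  unfolding majorant_op_def by (intro nn_integral_mono mult_left_mono) auto

lemma majorant_op_add:
  assumes [measurable]: "W \<in> borel_measurable (borel \<Otimes>\<^sub>M borel)" "W' \<in> borel_measurable (borel \<Otimes>\<^sub>M borel)"
  shows "majorant_op D \<alpha> (\<lambda>z. W z + W' z) z = majorant_op D \<alpha> W z + majorant_op D \<alpha> W' z"
  unfolding majorant_op_def by (simp add: distrib_left nn_integral_add)

lemma majorant_op_SUP:
  assumes [measurable]: "\<And>n. W n \<in> borel_measurable (borel \<Otimes>\<^sub>M borel)" and inc: "incseq W"
  shows "majorant_op D \<alpha> (\<lambda>z. SUP n. W n z) z = (SUP n. majorant_op D \<alpha> (W n) z)"
proof -
  have inc': "W n z \<le> W m z" if "n \<le> m" for n m z using inc that by (cases z) (auto simp: incseq_def le_fun_def)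
  have "(\<integral>\<^sup>+y. ennreal (D * kernel_majorant \<alpha> (fst z - s) (snd z - y)) * (SUP n. W n (s, y)) \<partial>lborel) =
     (SUP n. \<integral>\<^sup>+y. ennreal (D * kernel_majorant \<alpha> (fst z - s) (snd z - y)) * W n (s, y) \<partial>lborel)" for s
    by (subst nn_integral_monotone_convergence_SUP[symmetric])
       (auto simp: SUP_mult_left_ennreal incseq_def le_fun_def intro!: mult_left_mono inc')
  then have "majorant_op D \<alpha> (\<lambda>z. SUP n. W n z) z = (\<integral>\<^sup>+s. (SUP n. indicator {0<..<fst z} s *
     (\<integral>\<^sup>+y. ennreal (D * kernel_majorant \<alpha> (fst z - s) (snd z - y)) * W n (s, y) \<partial>lborel)) \<partial>lborel)"
    unfolding majorant_op_def by (simp add: SUP_mult_left_ennreal)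
  also have "\<dots> = (SUP n. majorant_op D \<alpha> (W n) z)"
    unfolding majorant_op_def
    by (rule nn_integral_monotone_convergence_SUP)
       (auto simp: incseq_def le_fun_def intro!: mult_left_mono nn_integral_mono inc')
  finally show ?thesis .
qed

text \<open>Minkowski's inequality moves the L^M norm in \<open>x\<close> inside the time integral,
  where the spatial estimate at each time \<open>s\<close> leaves the scalar kernel
  \<open>\<bar>t - s\<bar> powr - a\<close>.\<close>

lemma majorant_op_bound:
  fixes \<alpha> m M T D :: real
  assumes \<alpha>: "1 / 2 < \<alpha>" and m: "2 < m" "m \<le> M" and T: "0 < T" and D: "0 < D"
  defines "a \<equiv> (1 + 3 * (2 / m - 1 / M)) / (2 * \<alpha>)"
  shows "\<exists>c>0. \<forall>t U V \<phi> \<psi>. 0 < t \<longrightarrow> t < T \<longrightarrow>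
     U \<in> borel_measurable (borel \<Otimes>\<^sub>M borel) \<longrightarrow> V \<in> borel_measurable (borel \<Otimes>\<^sub>M borel) \<longrightarrow>
     \<phi> \<in> borel_measurable borel \<longrightarrow> \<psi> \<in> borel_measurable borel \<longrightarrow>
     (AE s in lborel. 0 < s \<and> s < T \<longrightarrow> sum_modular m M (\<lambda>x. U (s, x) / \<phi> s) \<le> 2 \<and>
         sum_modular m M (\<lambda>x. V (s, x) / \<psi> s) \<le> 2) \<longrightarrow>
     (\<integral>\<^sup>+x. epow (majorant_op D \<alpha> (\<lambda>z. U z * V z) (t, x)) M \<partial>lborel)
       \<le> epow (ennreal c * (\<integral>\<^sup>+s. indicator {0<..<t} s * (ennreal (\<bar>t - s\<bar> powr - a) * (\<phi> s * \<psi> s)) \<partial>lborel)) M"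
proof -
  obtain c where c: "0 < c" and bil: "\<And>t U V \<phi> \<psi>. 0 < t \<Longrightarrow> t < T \<Longrightarrow> U \<in> borel_measurable borel \<Longrightarrow>
     V \<in> borel_measurable borel \<Longrightarrow>
     sum_modular m M (\<lambda>x. U x / \<phi>) \<le> 2 \<Longrightarrow> sum_modular m M (\<lambda>x. V x / \<psi>) \<le> 2 \<Longrightarrow>
     (\<integral>\<^sup>+x. epow (\<integral>\<^sup>+y. ennreal (kernel_majorant \<alpha> t (x - y)) * (U y * V y) \<partial>lborel) M \<partial>lborel)
       \<le> epow (ennreal (c * t powr - a) * (\<phi> * \<psi>)) M"
    using kernel_bilinear_bound[OF \<alpha> m T] unfolding a_def by blast
  have "(\<integral>\<^sup>+x. epow (majorant_op D \<alpha> (\<lambda>z. U z * V z) (t, x)) M \<partial>lborel)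
       \<le> epow (ennreal (D * c) * (\<integral>\<^sup>+s. indicator {0<..<t} s * (ennreal (\<bar>t - s\<bar> powr - a) * (\<phi> s * \<psi> s)) \<partial>lborel)) M"
    if t: "0 < t" "t < T"
      and [measurable]: "U \<in> borel_measurable (borel \<Otimes>\<^sub>M borel)" "V \<in> borel_measurable (borel \<Otimes>\<^sub>M borel)"
        "\<phi> \<in> borel_measurable borel" "\<psi> \<in> borel_measurable borel"
      and sz: "AE s in lborel. 0 < s \<and> s < T \<longrightarrow> sum_modular m M (\<lambda>x. U (s, x) / \<phi> s) \<le> 2 \<and>
         sum_modular m M (\<lambda>x. V (s, x) / \<psi> s) \<le> 2" for t U V \<phi> \<psi>
  proof -
    define G where "G = (\<lambda>(s, x). indicator {0<..<t} s *
      (\<integral>\<^sup>+y. ennreal (D * kernel_majorant \<alpha> (t - s) (x - y)) * (U (s, y) * V (s, y)) \<partial>lborel))"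
    define w where "w s = indicator {0<..<t} s * (ennreal (D * c * (t - s) powr - a) * (\<phi> s * \<psi> s))" for s
    have [measurable]: "G \<in> borel_measurable (lborel \<Otimes>\<^sub>M lborel)" "w \<in> borel_measurable lborel"
      unfolding G_def w_def[abs_def] by measurable
    have "(\<integral>\<^sup>+x. epow (majorant_op D \<alpha> (\<lambda>z. U z * V z) (t, x)) M \<partial>lborel) =
       (\<integral>\<^sup>+x. epow (\<integral>\<^sup>+s. G (s, x) \<partial>lborel) M \<partial>lborel)"
      by (simp add: majorant_op_def G_def)
    also have "\<dots> \<le> epow (\<integral>\<^sup>+s. w s \<partial>lborel) M"
    proof (rule nn_integral_minkowski)
      show "AE s in lborel. (\<integral>\<^sup>+x. epow (G (s, x)) M \<partial>lborel) \<le> epow (w s) M"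
        using sz
      proof eventually_elim
        case (elim s)
        show ?case
        proof (cases "0 < s \<and> s < t")
          case True
          have "(\<integral>\<^sup>+x. epow (G (s, x)) M \<partial>lborel) = (\<integral>\<^sup>+x. epow (ennreal D) M *
              epow (\<integral>\<^sup>+y. ennreal (kernel_majorant \<alpha> (t - s) (x - y)) * (U (s, y) * V (s, y)) \<partial>lborel) M \<partial>lborel)"
            using True D by (simp add: G_def ennreal_mult kernel_majorant_nonneg mult.assoc nn_integral_cmult epow_mult)
          also have "\<dots> = epow (ennreal D) M * (\<integral>\<^sup>+x.
              epow (\<integral>\<^sup>+y. ennreal (kernel_majorant \<alpha> (t - s) (x - y)) * (U (s, y) * V (s, y)) \<partial>lborel) M \<partial>lborel)"
            by (rule nn_integral_cmult) measurable
          also have "\<dots> \<le> epow (ennreal D) M * epow (ennreal (c * (t - s) powr - a) * (\<phi> s * \<psi> s)) M"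
            using True t elim by (intro mult_left_mono bil) auto
          also have "\<dots> = epow (w s) M"
            using True D c by (simp add: w_def epow_mult ennreal_mult mult.assoc)
          finally show ?thesis .
        qed (auto simp: G_def w_def)
      qed
    qed (use m in \<open>auto intro: sigma_finite_lborel\<close>)
    also have "\<dots> \<le> epow (\<integral>\<^sup>+s. ennreal (D * c) * (indicator {0<..<t} s * (ennreal (\<bar>t - s\<bar> powr - a) * (\<phi> s * \<psi> s))) \<partial>lborel) M"
      using m t D c by (intro epow_mono nn_integral_mono) (auto simp: w_def ennreal_mult mult_ac split: split_indicator)
    also have "(\<integral>\<^sup>+s. ennreal (D * c) * (indicator {0<..<t} s * (ennreal (\<bar>t - s\<bar> powr - a) * (\<phi> s * \<psi> s))) \<partial>lborel) =
        ennreal (D * c) * (\<integral>\<^sup>+s. indicator {0<..<t} s * (ennreal (\<bar>t - s\<bar> powr - a) * (\<phi> s * \<psi> s)) \<partial>lborel)"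
      by (rule nn_integral_cmult) measurable
    finally show ?thesis .
  qed
  then show ?thesis using c D by (intro exI[of _ "D * c"]) auto
qed

section \<open>The Duhamel term and Picard iteration\<close>

text \<open>The bilinear term of \<open>mild_solution\<close> for functions of the pair
  \<open>(t, x)\<close>, with Borel measure and an indicator, so that joint measurability follows
  from measurability on the product. An integral that does not converge counts as 0 here.\<close>

definition duhamel :: "real \<Rightarrow> (real \<times> (real^3) \<Rightarrow> real^3) \<Rightarrow> real \<times> (real^3) \<Rightarrow> real^3" where
  "duhamel \<alpha> u z = (LINT s|lborel. indicator {0<..<fst z} s *\<^sub>R oseen_conv \<alpha> (fst z - s) (\<lambda>y. u (s, y)) (snd z))"

lemma conv_lborel:
  fixes v :: "real^3 \<Rightarrow> real"
  assumes [measurable]: "K \<in> borel_measurable borel" "v \<in> borel_measurable borel"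
  shows "conv K v x = (LINT y|lborel. K (x - y) * v y)"
    and "conv_exists K v x \<longleftrightarrow> integrable lborel (\<lambda>y. K (x - y) * v y)"
  unfolding conv_def conv_exists_def
  by (simp_all add: integral_completion integrable_completion)

lemma oseen_conv_lborel:
  assumes [measurable]: "v \<in> borel_measurable borel"
  shows "oseen_conv \<alpha> t v x =
     (\<chi> j. \<Sum>h\<in>UNIV. \<Sum>k\<in>UNIV. LINT y|lborel. oseen_kernel \<alpha> t j h k (x - y) * (v y $ h * v y $ k))"
  unfolding oseen_conv_def by (subst conv_lborel(1)) auto

lemma borel_measurable_vec_lambda' [measurable (raw)]:
  fixes f :: "'a \<Rightarrow> 'n::finite \<Rightarrow> real"
  assumes "\<And>i. (\<lambda>x. f x i) \<in> borel_measurable M"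
  shows "(\<lambda>x. \<chi> i. f x i) \<in> borel_measurable M"
proof (subst borel_measurable_euclidean_space, safe)
  fix b :: "real^'n" assume "b \<in> Basis"
  then obtain i where "b = axis i 1" by (auto simp: Basis_vec_def)
  then show "(\<lambda>x. (\<chi> i. f x i) \<bullet> b) \<in> borel_measurable M"
    using assms[of i] by (simp add: inner_axis)
qed

lemma oseen_conv_measurable [measurable]:
  assumes [measurable]: "u \<in> borel_measurable (borel \<Otimes>\<^sub>M borel)" "f \<in> borel_measurable N" "g \<in> borel_measurable N" "h \<in> borel_measurable N"
  shows "(\<lambda>z. oseen_conv \<alpha> (f z) (\<lambda>y. u (g z, y)) (h z)) \<in> borel_measurable N"
proof -
  have "(\<lambda>y. u (g z, y)) \<in> borel_measurable borel" for z
    by measurable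
  then show ?thesis by (subst oseen_conv_lborel) measurable
qed

lemma duhamel_measurable [measurable]:
  assumes [measurable]: "u \<in> borel_measurable (borel \<Otimes>\<^sub>M borel)"
  shows "duhamel \<alpha> u \<in> borel_measurable (borel \<Otimes>\<^sub>M borel)"
proof -
  have *: "indicator {0<..<a} s = (if 0 < s \<and> s < a then 1 else (0::real))" for a s :: real
    by (auto simp: indicator_def)
  show ?thesis unfolding duhamel_def[abs_def] * by measurable
qed

lemma oseen_conv_integrable:
  fixes v :: "real^3 \<Rightarrow> real^3"
  assumes K: "\<And>x. \<bar>oseen_kernel \<alpha> t j h k x\<bar> \<le> C * kernel_majorant \<alpha> t x" and C: "0 < C"
    and [measurable]: "v \<in> borel_measurable borel"
    and fin: "(\<integral>\<^sup>+y. ennreal (27 * C * kernel_majorant \<alpha> t (x - y)) * (ennreal (norm (v y)) * ennreal (norm (v y))) \<partial>lborel) < \<infinity>"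
  shows "integrable lborel (\<lambda>y. oseen_kernel \<alpha> t j h k (x - y) * (v y $ h * v y $ k))"
proof (rule integrableI_bounded)
  show "(\<integral>\<^sup>+y. ennreal (norm (oseen_kernel \<alpha> t j h k (x - y) * (v y $ h * v y $ k))) \<partial>lborel) < \<infinity>"
  proof (rule le_less_trans[OF nn_integral_mono fin])
    fix y
    have "\<bar>oseen_kernel \<alpha> t j h k (x - y)\<bar> * (\<bar>v y $ h\<bar> * \<bar>v y $ k\<bar>) \<le>
        27 * C * kernel_majorant \<alpha> t (x - y) * (norm (v y) * norm (v y))"
    proof (intro mult_mono component_le_norm_cart)
      show "\<bar>oseen_kernel \<alpha> t j h k (x - y)\<bar> \<le> 27 * C * kernel_majorant \<alpha> t (x - y)"
        using K[of "x - y"] mult_nonneg_nonneg[OF less_imp_le[OF C] kernel_majorant_nonneg[of \<alpha> t "x - y"]] by linarith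
    qed (use C kernel_majorant_nonneg in auto)
    then have "ennreal (norm (oseen_kernel \<alpha> t j h k (x - y) * (v y $ h * v y $ k))) \<le>
        ennreal (27 * C * kernel_majorant \<alpha> t (x - y) * (norm (v y) * norm (v y)))"
      by (intro ennreal_leI) (simp add: abs_mult)
    also have "\<dots> = ennreal (27 * C * kernel_majorant \<alpha> t (x - y)) * (ennreal (norm (v y)) * ennreal (norm (v y)))"
      using C kernel_majorant_nonneg by (simp add: ennreal_mult)
    finally show "ennreal (norm (oseen_kernel \<alpha> t j h k (x - y) * (v y $ h * v y $ k))) \<le> \<dots>" .
  qed
qed measurable

text \<open>The quadratic difference telescopes into a term with \<open>(v - w) $ h * v $ k\<close>
  and one with \<open>w $ h * (v - w) $ k\<close>. The factor 27 is the number of index triples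
  \<open>(j, h, k)\<close>, which share one majorant. The finiteness assumptions make all integrals
  converge, so that they may be subtracted.\<close>

lemma oseen_conv_diff_bound:
  fixes v w :: "real^3 \<Rightarrow> real^3"
  assumes K: "\<And>j h k x. \<bar>oseen_kernel \<alpha> t j h k x\<bar> \<le> C * kernel_majorant \<alpha> t x" and C: "0 < C"
    and [measurable]: "v \<in> borel_measurable borel" "w \<in> borel_measurable borel"
    and fin: "(\<integral>\<^sup>+y. ennreal (27 * C * kernel_majorant \<alpha> t (x - y)) * (ennreal (norm (v y)) * ennreal (norm (v y))) \<partial>lborel) < \<infinity>"
      "(\<integral>\<^sup>+y. ennreal (27 * C * kernel_majorant \<alpha> t (x - y)) * (ennreal (norm (w y)) * ennreal (norm (w y))) \<partial>lborel) < \<infinity>"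
  shows "ennreal (norm (oseen_conv \<alpha> t v x - oseen_conv \<alpha> t w x)) \<le>
    (\<integral>\<^sup>+y. ennreal (27 * C * kernel_majorant \<alpha> t (x - y)) *
       (ennreal (norm (v y - w y)) * (ennreal (norm (v y)) + ennreal (norm (w y)))) \<partial>lborel)"
proof -
  let ?K = "oseen_kernel \<alpha> t"
  let ?F = "\<lambda>y. ennreal (norm (v y - w y)) * (ennreal (norm (v y)) + ennreal (norm (w y)))"
  let ?J = "\<integral>\<^sup>+y. ennreal (C * kernel_majorant \<alpha> t (x - y)) * ?F y \<partial>lborel"
  have int: "integrable lborel (\<lambda>y. ?K j h k (x - y) * (v y $ h * v y $ k))"
    "integrable lborel (\<lambda>y. ?K j h k (x - y) * (w y $ h * w y $ k))" for j h k
    using oseen_conv_integrable[OF K C _ fin(1)] oseen_conv_integrable[OF K C _ fin(2)] by auto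
  have comp: "(oseen_conv \<alpha> t v x - oseen_conv \<alpha> t w x) $ j = (\<Sum>h\<in>UNIV. \<Sum>k\<in>UNIV.
      LINT y|lborel. ?K j h k (x - y) * (v y $ h * v y $ k - w y $ h * w y $ k))" for j
    by (simp add: oseen_conv_lborel right_diff_distrib int sum_subtractf)
  have le: "ennreal \<bar>LINT y|lborel. ?K j h k (x - y) * (v y $ h * v y $ k - w y $ h * w y $ k)\<bar> \<le> ?J" for j h k
  proof -
    have "ennreal (norm (LINT y|lborel. ?K j h k (x - y) * (v y $ h * v y $ k - w y $ h * w y $ k))) \<le>
        (\<integral>\<^sup>+y. ennreal (norm (?K j h k (x - y) * (v y $ h * v y $ k - w y $ h * w y $ k))) \<partial>lborel)"
      using int[of j h k] by (intro integral_norm_bound_ennreal) (simp add: right_diff_distrib)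
    also have "\<dots> \<le> ?J"
    proof (rule nn_integral_mono)
      fix y
      have "\<bar>v y $ h * v y $ k - w y $ h * w y $ k\<bar> =
          \<bar>(v y - w y) $ h * v y $ k + w y $ h * (v y - w y) $ k\<bar>" by (simp add: algebra_simps)
      also have "\<dots> \<le> \<bar>(v y - w y) $ h\<bar> * \<bar>v y $ k\<bar> + \<bar>w y $ h\<bar> * \<bar>(v y - w y) $ k\<bar>"
        by (rule order_trans[OF abs_triangle_ineq]) (simp add: abs_mult)
      also have "\<dots> \<le> norm (v y - w y) * norm (v y) + norm (w y) * norm (v y - w y)"
        by (intro add_mono mult_mono component_le_norm_cart) auto
      finally have "\<bar>v y $ h * v y $ k - w y $ h * w y $ k\<bar> \<le> norm (v y - w y) * (norm (v y) + norm (w y))"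
        by (simp add: algebra_simps)
      then have "\<bar>?K j h k (x - y)\<bar> * \<bar>v y $ h * v y $ k - w y $ h * w y $ k\<bar> \<le>
         C * kernel_majorant \<alpha> t (x - y) * (norm (v y - w y) * (norm (v y) + norm (w y)))"
        using C kernel_majorant_nonneg by (intro mult_mono K) auto
      then have "ennreal (norm (?K j h k (x - y) * (v y $ h * v y $ k - w y $ h * w y $ k))) \<le>
         ennreal (C * kernel_majorant \<alpha> t (x - y) * (norm (v y - w y) * (norm (v y) + norm (w y))))"
        by (intro ennreal_leI) (simp add: abs_mult)
      also have "\<dots> = ennreal (C * kernel_majorant \<alpha> t (x - y)) * ?F y"
        using C kernel_majorant_nonneg by (simp add: ennreal_mult ennreal_plus)
      finally show "ennreal (norm (?K j h k (x - y) * (v y $ h * v y $ k - w y $ h * w y $ k))) \<le> \<dots>" .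
    qed
    finally show ?thesis by simp
  qed
  have "ennreal (norm (oseen_conv \<alpha> t v x - oseen_conv \<alpha> t w x)) \<le>
      ennreal (\<Sum>j\<in>UNIV. \<Sum>h\<in>UNIV. \<Sum>k\<in>UNIV. \<bar>LINT y|lborel. ?K j h k (x - y) * (v y $ h * v y $ k - w y $ h * w y $ k)\<bar>)"
  proof (rule ennreal_leI)
    have "norm (oseen_conv \<alpha> t v x - oseen_conv \<alpha> t w x) \<le>
        (\<Sum>j\<in>UNIV. \<bar>(oseen_conv \<alpha> t v x - oseen_conv \<alpha> t w x) $ j\<bar>)" by (rule norm_le_l1_cart)
    also have "\<dots> \<le> (\<Sum>j\<in>UNIV. \<Sum>h\<in>UNIV. \<Sum>k\<in>UNIV. \<bar>LINT y|lborel. ?K j h k (x - y) * (v y $ h * v y $ k - w y $ h * w y $ k)\<bar>)"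
      unfolding comp by (intro sum_mono order_trans[OF sum_abs] sum_abs)
    finally show "norm (oseen_conv \<alpha> t v x - oseen_conv \<alpha> t w x) \<le> \<dots>" .
  qed
  also have "\<dots> = (\<Sum>j\<in>UNIV. \<Sum>h\<in>UNIV. \<Sum>k\<in>UNIV. ennreal \<bar>LINT y|lborel. ?K j h k (x - y) * (v y $ h * v y $ k - w y $ h * w y $ k)\<bar>)"
    by (simp add: sum_ennreal sum_nonneg)
  also have "\<dots> \<le> (\<Sum>j\<in>(UNIV::3 set). \<Sum>h\<in>(UNIV::3 set). \<Sum>k\<in>(UNIV::3 set). ?J)"
    by (intro sum_mono le)
  also have "\<dots> = ennreal 27 * ?J" by simp
  also have "\<dots> = (\<integral>\<^sup>+y. ennreal 27 * (ennreal (C * kernel_majorant \<alpha> t (x - y)) * ?F y) \<partial>lborel)"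
    by (rule nn_integral_cmult[symmetric]) measurable
  also have "\<dots> = (\<integral>\<^sup>+y. ennreal (27 * C * kernel_majorant \<alpha> t (x - y)) * ?F y \<partial>lborel)"
    using C kernel_majorant_nonneg
    by (intro nn_integral_cong) (simp only: mult.assoc[of 27] ennreal_mult zero_le_numeral mult.assoc mult_nonneg_nonneg less_imp_le)
  finally show ?thesis .
qed

lemma oseen_conv_zero [simp]: "oseen_conv \<alpha> t (\<lambda>y. 0) x = 0"
  by (simp add: oseen_conv_lborel vec_eq_iff)

lemma oseen_conv_bound:
  fixes v :: "real^3 \<Rightarrow> real^3"
  assumes K: "\<And>j h k x. \<bar>oseen_kernel \<alpha> t j h k x\<bar> \<le> C * kernel_majorant \<alpha> t x" and C: "0 < C"
    and [measurable]: "v \<in> borel_measurable borel"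
  shows "ennreal (norm (oseen_conv \<alpha> t v x)) \<le>
    (\<integral>\<^sup>+y. ennreal (27 * C * kernel_majorant \<alpha> t (x - y)) * (ennreal (norm (v y)) * ennreal (norm (v y))) \<partial>lborel)"
proof (cases "(\<integral>\<^sup>+y. ennreal (27 * C * kernel_majorant \<alpha> t (x - y)) * (ennreal (norm (v y)) * ennreal (norm (v y))) \<partial>lborel) < \<infinity>")
  case True
  then show ?thesis
    using oseen_conv_diff_bound[OF K C, of v "\<lambda>_. 0" x] by simp
qed (simp add: less_top[symmetric])

lemma duhamel_integrable:
  assumes K: "\<And>t j h k x. 0 < t \<Longrightarrow> \<bar>oseen_kernel \<alpha> t j h k x\<bar> \<le> C * kernel_majorant \<alpha> t x" and C: "0 < C"
    and [measurable]: "u \<in> borel_measurable (borel \<Otimes>\<^sub>M borel)"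
    and fin: "majorant_op (27 * C) \<alpha> (\<lambda>z. ennreal (norm (u z)) * ennreal (norm (u z))) (t, x) < \<infinity>"
  shows "AE s in lborel. 0 < s \<and> s < t \<longrightarrow>
      (\<integral>\<^sup>+y. ennreal (27 * C * kernel_majorant \<alpha> (t - s) (x - y)) * (ennreal (norm (u (s, y))) * ennreal (norm (u (s, y)))) \<partial>lborel) < \<infinity>"
    "integrable lborel (\<lambda>s. indicator {0<..<t} s *\<^sub>R oseen_conv \<alpha> (t - s) (\<lambda>y. u (s, y)) x)"
proof -
  let ?I = "\<lambda>s. \<integral>\<^sup>+y. ennreal (27 * C * kernel_majorant \<alpha> (t - s) (x - y)) *
     (ennreal (norm (u (s, y))) * ennreal (norm (u (s, y)))) \<partial>lborel"
  have fin': "(\<integral>\<^sup>+s. indicator {0<..<t} s * ?I s \<partial>lborel) < \<infinity>"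
    using fin by (simp add: majorant_op_def)
  have "AE s in lborel. indicator {0<..<t} s * ?I s \<noteq> \<infinity>"
    by (rule nn_integral_noteq_infinite) (use fin' in auto)
  then show "AE s in lborel. 0 < s \<and> s < t \<longrightarrow> ?I s < \<infinity>"
    by eventually_elim (auto simp: less_top)
  show "integrable lborel (\<lambda>s. indicator {0<..<t} s *\<^sub>R oseen_conv \<alpha> (t - s) (\<lambda>y. u (s, y)) x)"
  proof (rule integrableI_bounded)
    have "(\<integral>\<^sup>+s. ennreal (norm (indicator {0<..<t} s *\<^sub>R oseen_conv \<alpha> (t - s) (\<lambda>y. u (s, y)) x)) \<partial>lborel) \<le>
       (\<integral>\<^sup>+s. indicator {0<..<t} s * ?I s \<partial>lborel)"
      by (intro nn_integral_mono) (auto split: split_indicator intro!: oseen_conv_bound K C)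
    then show "(\<integral>\<^sup>+s. ennreal (norm (indicator {0<..<t} s *\<^sub>R oseen_conv \<alpha> (t - s) (\<lambda>y. u (s, y)) x)) \<partial>lborel) < \<infinity>"
      using fin' by (rule le_less_trans)
  qed measurable
qed

lemma duhamel_diff_bound:
  assumes K: "\<And>t j h k x. 0 < t \<Longrightarrow> \<bar>oseen_kernel \<alpha> t j h k x\<bar> \<le> C * kernel_majorant \<alpha> t x" and C: "0 < C"
    and [measurable]: "u \<in> borel_measurable (borel \<Otimes>\<^sub>M borel)" "v \<in> borel_measurable (borel \<Otimes>\<^sub>M borel)"
    and finu: "majorant_op (27 * C) \<alpha> (\<lambda>z. ennreal (norm (u z)) * ennreal (norm (u z))) z < \<infinity>"
    and finv: "majorant_op (27 * C) \<alpha> (\<lambda>z. ennreal (norm (v z)) * ennreal (norm (v z))) z < \<infinity>"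
  shows "ennreal (norm (duhamel \<alpha> u z - duhamel \<alpha> v z)) \<le>
     majorant_op (27 * C) \<alpha> (\<lambda>z. ennreal (norm (u z - v z)) * (ennreal (norm (u z)) + ennreal (norm (v z)))) z"
proof -
  obtain t x where z: "z = (t, x)" by (cases z)
  let ?M = "majorant_op (27 * C) \<alpha>"
  have iu: "AE s in lborel. 0 < s \<and> s < t \<longrightarrow>
      (\<integral>\<^sup>+y. ennreal (27 * C * kernel_majorant \<alpha> (t - s) (x - y)) * (ennreal (norm (u (s, y))) * ennreal (norm (u (s, y)))) \<partial>lborel) < \<infinity>"
    "integrable lborel (\<lambda>s. indicator {0<..<t} s *\<^sub>R oseen_conv \<alpha> (t - s) (\<lambda>y. u (s, y)) x)"
    by (rule duhamel_integrable[OF K C _ finu[unfolded z]]; simp)+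
  have iv: "AE s in lborel. 0 < s \<and> s < t \<longrightarrow>
      (\<integral>\<^sup>+y. ennreal (27 * C * kernel_majorant \<alpha> (t - s) (x - y)) * (ennreal (norm (v (s, y))) * ennreal (norm (v (s, y)))) \<partial>lborel) < \<infinity>"
    "integrable lborel (\<lambda>s. indicator {0<..<t} s *\<^sub>R oseen_conv \<alpha> (t - s) (\<lambda>y. v (s, y)) x)"
    by (rule duhamel_integrable[OF K C _ finv[unfolded z]]; simp)+
  let ?F = "\<lambda>z. ennreal (norm (u z - v z)) * (ennreal (norm (u z)) + ennreal (norm (v z)))"
  let ?ou = "\<lambda>s. oseen_conv \<alpha> (t - s) (\<lambda>y. u (s, y)) x" and ?ov = "\<lambda>s. oseen_conv \<alpha> (t - s) (\<lambda>y. v (s, y)) x"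
  have "duhamel \<alpha> u z - duhamel \<alpha> v z = (LINT s|lborel. indicator {0<..<t} s *\<^sub>R (?ou s - ?ov s))"
    using iu(2) iv(2) by (simp add: duhamel_def z scaleR_diff_right)
  then have "ennreal (norm (duhamel \<alpha> u z - duhamel \<alpha> v z)) \<le>
      (\<integral>\<^sup>+s. ennreal (norm (indicator {0<..<t} s *\<^sub>R (?ou s - ?ov s))) \<partial>lborel)"
    using iu(2) iv(2) by (simp only: scaleR_diff_right) (intro integral_norm_bound_ennreal Bochner_Integration.integrable_diff; simp)
  also have "\<dots> \<le> ?M ?F z"
    unfolding majorant_op_def z
  proof (rule nn_integral_mono_AE)
    show "AE s in lborel. ennreal (norm (indicator {0<..<t} s *\<^sub>R (?ou s - ?ov s))) \<le>
       indicator {0<..<fst (t, x)} s * (\<integral>\<^sup>+y. ennreal (27 * C * kernel_majorant \<alpha> (fst (t, x) - s) (snd (t, x) - y)) * ?F (s, y) \<partial>lborel)"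
      using iu(1) iv(1)
    proof eventually_elim
      case (elim s)
      then show ?case
        by (auto split: split_indicator intro!: oseen_conv_diff_bound K C)
    qed
  qed
  finally show ?thesis .
qed

text \<open>The difference of two Duhamel terms is controlled by the increment of the majorant; in this
  additive form no subtraction of possibly infinite quantities occurs.\<close>

lemma duhamel_difference_le:
  assumes K: "\<And>t j h k x. 0 < t \<Longrightarrow> \<bar>oseen_kernel \<alpha> t j h k x\<bar> \<le> C * kernel_majorant \<alpha> t x" and C: "0 < C"
    and [measurable]: "u \<in> borel_measurable (borel \<Otimes>\<^sub>M borel)" "v \<in> borel_measurable (borel \<Otimes>\<^sub>M borel)"
      "U \<in> borel_measurable (borel \<Otimes>\<^sub>M borel)" "V \<in> borel_measurable (borel \<Otimes>\<^sub>M borel)"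
    and u: "\<And>z. ennreal (norm (u z)) \<le> U z" and v: "\<And>z. ennreal (norm (v z)) \<le> V z"
    and uv: "\<And>z. ennreal (norm (u z - v z)) + V z \<le> U z"
  shows "ennreal (norm (duhamel \<alpha> u z - duhamel \<alpha> v z)) + majorant_op (27 * C) \<alpha> (\<lambda>z. V z * V z) z \<le>
     majorant_op (27 * C) \<alpha> (\<lambda>z. U z * U z) z"
proof (cases "majorant_op (27 * C) \<alpha> (\<lambda>z. U z * U z) z < \<infinity>")
  case fin: True
  let ?M = "majorant_op (27 * C) \<alpha>"
  have VU: "V z \<le> U z" for z using uv[of z] by (rule order_trans[rotated]) simp
  have finu: "?M (\<lambda>z. ennreal (norm (u z)) * ennreal (norm (u z))) z < \<infinity>"
    by (rule le_less_trans[OF majorant_op_mono fin]) (intro mult_mono u; simp)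
  have finv: "?M (\<lambda>z. ennreal (norm (v z)) * ennreal (norm (v z))) z < \<infinity>"
    by (rule le_less_trans[OF majorant_op_mono fin]) (intro mult_mono order_trans[OF v VU]; simp)
  let ?F = "\<lambda>z. ennreal (norm (u z - v z)) * (ennreal (norm (u z)) + ennreal (norm (v z)))"
  have "ennreal (norm (duhamel \<alpha> u z - duhamel \<alpha> v z)) \<le> ?M ?F z"
    by (rule duhamel_diff_bound[OF K C _ _ finu finv]) auto
  then have "ennreal (norm (duhamel \<alpha> u z - duhamel \<alpha> v z)) + ?M (\<lambda>z. V z * V z) z \<le>
      ?M ?F z + ?M (\<lambda>z. V z * V z) z" by (rule add_right_mono)
  also have "\<dots> = ?M (\<lambda>z. ?F z + V z * V z) z" by (rule majorant_op_add[symmetric]) measurable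
  also have "\<dots> \<le> ?M (\<lambda>z. U z * U z) z"
  proof (rule majorant_op_mono)
    fix z
    let ?d = "ennreal (norm (u z - v z))"
    \<comment> \<open>With d for the norm of the difference, the bound d + V \<le> U is used twice,
      to pass from d (U + V) + V^2 = d U + V (d + V) to (d + V) U and then to U^2.\<close>
    have "?F z + V z * V z \<le> ?d * (U z + V z) + V z * V z"
      by (intro add_right_mono mult_left_mono add_mono u v) auto
    also have "\<dots> = ?d * U z + V z * (?d + V z)" by (simp add: algebra_simps)
    also have "\<dots> \<le> ?d * U z + V z * U z" by (intro add_left_mono mult_left_mono uv) auto
    also have "\<dots> = (?d + V z) * U z" by (simp add: algebra_simps)
    also have "\<dots> \<le> U z * U z" by (intro mult_right_mono uv) auto
    finally show "?F z + V z * V z \<le> U z * U z" .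
  qed
  finally show ?thesis .
qed (simp add: less_top[symmetric])

lemma duhamel_zero [simp]: "duhamel \<alpha> (\<lambda>z. 0) z = 0"
  by (simp add: duhamel_def)

section \<open>The two iterations and their limit\<close>

fun majorant_iterate where
  "majorant_iterate D \<alpha> E 0 = E"
| "majorant_iterate D \<alpha> E (Suc n) =
     (\<lambda>z. E z + majorant_op D \<alpha> (\<lambda>z. majorant_iterate D \<alpha> E n z * majorant_iterate D \<alpha> E n z) z)"

lemma majorant_iterate_measurable [measurable]:
  assumes [measurable]: "E \<in> borel_measurable (borel \<Otimes>\<^sub>M borel)"
  shows "majorant_iterate D \<alpha> E n \<in> borel_measurable (borel \<Otimes>\<^sub>M borel)"
  by (induction n) auto

lemma majorant_iterate_incseq: "incseq (majorant_iterate D \<alpha> E)"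
proof -
  have "majorant_iterate D \<alpha> E n z \<le> majorant_iterate D \<alpha> E (Suc n) z" for n z
  proof (induction n arbitrary: z)
    case (Suc n)
    then show ?case by (auto intro!: add_left_mono majorant_op_mono mult_mono)
  qed simp
  then show ?thesis by (auto intro!: incseq_SucI le_funI)
qed

fun picard_iterate where
  "picard_iterate \<alpha> e 0 = e"
| "picard_iterate \<alpha> e (Suc n) = (\<lambda>z. e z - duhamel \<alpha> (picard_iterate \<alpha> e n) z)"

lemma picard_iterate_measurable [measurable]:
  assumes [measurable]: "e \<in> borel_measurable (borel \<Otimes>\<^sub>M borel)"
  shows "picard_iterate \<alpha> e n \<in> borel_measurable (borel \<Otimes>\<^sub>M borel)"
  by (induction n) auto

text \<open>Each Picard increment is bounded by the corresponding increment of the monotone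
  iteration. These bounds telescope, so the Picard iterates form a Cauchy sequence wherever
  \<open>U\<close> is finite; elsewhere \<open>u\<close> is set to 0. The equation is claimed where
  the quadratic term of \<open>U\<close> is finite, and there \<open>U\<close> itself is finite
  because it equals \<open>E\<close> plus that term.\<close>

theorem picard_limit:
  assumes K: "\<And>t j h k x. 0 < t \<Longrightarrow> \<bar>oseen_kernel \<alpha> t j h k x\<bar> \<le> C * kernel_majorant \<alpha> t x" and C: "0 < C"
    and [measurable]: "e \<in> borel_measurable (borel \<Otimes>\<^sub>M borel)"
  defines "E \<equiv> \<lambda>z. ennreal (norm (e z))"
  defines "U \<equiv> \<lambda>z. SUP n. majorant_iterate (27 * C) \<alpha> E n z"
  obtains u where "u \<in> borel_measurable (borel \<Otimes>\<^sub>M borel)" "\<And>z. ennreal (norm (u z)) \<le> U z"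
    "\<And>z. ennreal (norm (u z - e z)) \<le> majorant_op (27 * C) \<alpha> (\<lambda>z. U z * U z) z"
    "\<And>z. majorant_op (27 * C) \<alpha> (\<lambda>z. U z * U z) z < \<infinity> \<Longrightarrow> u z = e z - duhamel \<alpha> u z"
proof -
  let ?M = "majorant_op (27 * C) \<alpha>"
  let ?U = "majorant_iterate (27 * C) \<alpha> E"
  let ?u = "picard_iterate \<alpha> e"
  have [measurable]: "E \<in> borel_measurable (borel \<Otimes>\<^sub>M borel)" unfolding E_def by measurable
  have [measurable]: "U \<in> borel_measurable (borel \<Otimes>\<^sub>M borel)" unfolding U_def by measurable
  have inc: "?U n z \<le> ?U m z" if "n \<le> m" for n m z
    using majorant_iterate_incseq[of "27 * C" \<alpha> E] that by (cases z) (auto simp: incseq_def le_fun_def)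
  have UM: "(SUP n. ?M (\<lambda>z. ?U n z * ?U n z) z) = ?M (\<lambda>z. U z * U z) z" for z
  proof -
    have "U z * U z = (SUP n. ?U n z * ?U n z)" for z
    proof -
      have sq: "x * x = epow x 2" for x using epow_add[of x 1 1] by simp
      show ?thesis unfolding sq U_def by (rule epow_SUP) simp
    qed
    then show ?thesis
      by (simp only:) (rule majorant_op_SUP[symmetric], auto simp: incseq_def le_fun_def intro!: mult_mono inc)
  qed
  have Ueq: "U z = E z + ?M (\<lambda>z. U z * U z) z" for z
  proof -
    have "U z = (SUP n. ?U (Suc n) z)"
      unfolding U_def
    proof (rule SUP_eq)
      fix n show "\<exists>k\<in>UNIV. ?U n z \<le> ?U (Suc k) z" by (rule bexI[of _ n], rule inc) auto
    next
      fix n show "\<exists>k\<in>UNIV. ?U (Suc n) z \<le> ?U k z" by (rule bexI[of _ "Suc n"]) auto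
    qed
    also have "\<dots> = E z + (SUP n. ?M (\<lambda>z. ?U n z * ?U n z) z)"
      by (simp add: ennreal_SUP_add_right)
    finally show ?thesis unfolding UM .
  qed
  have pstep: "ennreal (norm (?u n z)) \<le> ?U n z \<and> ennreal (norm (?u (Suc n) z - ?u n z)) + ?U n z \<le> ?U (Suc n) z" for n z
  proof (induction n arbitrary: z)
    case 0
    \<comment> \<open>The initial increment is a Duhamel difference with the zero function, whose
      majorant is 0.\<close>
    have "ennreal (norm (duhamel \<alpha> e z - duhamel \<alpha> (\<lambda>_. 0) z)) + ?M (\<lambda>z. 0 * 0) z \<le> ?M (\<lambda>z. E z * E z) z"
      by (rule duhamel_difference_le[OF K C]) (auto simp: E_def)
    then have "ennreal (norm (duhamel \<alpha> e z)) \<le> ?M (\<lambda>z. E z * E z) z"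
      by (rule order_trans[rotated]) simp
    from add_right_mono[OF this, of "E z"] show ?case
      by (simp add: E_def add.commute)
  next
    case (Suc n)
    have 1: "ennreal (norm (?u (Suc n) z)) \<le> ?U (Suc n) z" for z
    proof -
      have "ennreal (norm (?u (Suc n) z)) \<le> ennreal (norm (?u (Suc n) z - ?u n z) + norm (?u n z))"
        by (intro ennreal_leI) (metis diff_add_cancel norm_triangle_ineq)
      also have "\<dots> \<le> ennreal (norm (?u (Suc n) z - ?u n z)) + ?U n z"
        using Suc.IH[of z] by (simp only: ennreal_plus norm_ge_zero add_left_mono)
      finally show ?thesis using Suc.IH[of z] order_trans by blast
    qed
    have "ennreal (norm (duhamel \<alpha> (?u (Suc n)) z - duhamel \<alpha> (?u n) z)) + ?M (\<lambda>z. ?U n z * ?U n z) z \<le>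
        ?M (\<lambda>z. ?U (Suc n) z * ?U (Suc n) z) z"
      by (rule duhamel_difference_le[OF K C]) (use 1 Suc.IH in \<open>auto simp del: picard_iterate.simps majorant_iterate.simps\<close>)
    from add_right_mono[OF this, of "E z"]
    have "ennreal (norm (?u (Suc (Suc n)) z - ?u (Suc n) z)) + ?U (Suc n) z \<le> ?U (Suc (Suc n)) z"
      by (simp add: add_ac norm_minus_commute)
    with 1 show ?case by blast
  qed
  have tele: "ennreal (norm (?u m z - ?u n z)) + ?U n z \<le> ?U m z" if "n \<le> m" for n m z
    using that
  proof (induction m rule: dec_induct)
    case (step m)
    have "ennreal (norm (?u (Suc m) z - ?u n z)) \<le> ennreal (norm (?u (Suc m) z - ?u m z) + norm (?u m z - ?u n z))"
      by (intro ennreal_leI) (metis add_diff_eq diff_add_cancel norm_triangle_ineq)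
    then have "ennreal (norm (?u (Suc m) z - ?u n z)) + ?U n z \<le>
        ennreal (norm (?u (Suc m) z - ?u m z)) + (ennreal (norm (?u m z - ?u n z)) + ?U n z)"
      by (simp only: ennreal_plus norm_ge_zero add_right_mono flip: add.assoc)
    also have "\<dots> \<le> ennreal (norm (?u (Suc m) z - ?u m z)) + ?U m z"
      by (intro add_left_mono step.IH)
    also have "\<dots> \<le> ?U (Suc m) z" using pstep[of m z] by blast
    finally show ?case .
  qed simp
  define u where "u z = (if U z < \<infinity> then lim (\<lambda>n. ?u n z) else 0)" for z
  have [measurable]: "u \<in> borel_measurable (borel \<Otimes>\<^sub>M borel)"
  proof -
    have [measurable]: "(\<lambda>z. lim (\<lambda>n. ?u n z)) \<in> borel_measurable (borel \<Otimes>\<^sub>M borel)"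
      by (rule borel_measurable_lim_metric) measurable
    show ?thesis unfolding u_def[abs_def] by measurable
  qed
  have UU: "?U n z \<le> U z" for n z unfolding U_def by (rule SUP_upper) simp
  have lim: "(\<lambda>n. ?u n z) \<longlonglongrightarrow> u z" if fin: "U z < \<infinity>" for z
  proof -
    define a where "a n = enn2real (?U n z)" for n
    have a: "?U n z = ennreal (a n)" for n
      using le_less_trans[OF UU fin, of n] by (simp add: a_def)
    have a0: "0 \<le> a n" for n by (simp add: a_def)
    have inca: "a n \<le> a m" if "n \<le> m" for n m
      using inc[OF that, of z] by (simp add: a a0)
    obtain b where b: "U z = ennreal b" "0 \<le> b" using fin by (cases "U z") auto
    have "a n \<le> b" for n using UU[of n z] by (simp add: a b)
    then have "convergent a"
      using inca by (intro Bseq_monoseq_convergent BseqI'[of _ b]) (auto simp: a0 monoseq_def)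
    then have Ca: "Cauchy a" by (rule convergent_Cauchy)
    have d: "norm (?u m z - ?u n z) \<le> norm (a m - a n)" if "n \<le> m" for n m
      using tele[OF that, of z] inca[OF that] a0
      by (simp add: a ennreal_plus[symmetric] del: ennreal_plus)
    have "Cauchy (\<lambda>n. ?u n z)"
    proof (rule CauchyI)
      fix \<epsilon> :: real assume "0 < \<epsilon>"
      then obtain N where N: "\<And>m n. N \<le> m \<Longrightarrow> N \<le> n \<Longrightarrow> norm (a m - a n) < \<epsilon>"
        using CauchyD[OF Ca] by blast
      have "norm (?u m z - ?u n z) < \<epsilon>" if "N \<le> m" "N \<le> n" for m n
      proof (cases "n \<le> m")
        case True
        then show ?thesis using d N[OF that] by (meson le_less_trans)
      next
        case False
        then have "norm (?u n z - ?u m z) < \<epsilon>" using d[of m n] N[OF that(2,1)] by auto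
        then show ?thesis by (simp add: norm_minus_commute)
      qed
      then show "\<exists>N. \<forall>m\<ge>N. \<forall>n\<ge>N. norm (?u m z - ?u n z) < \<epsilon>" by blast
    qed
    then have "convergent (\<lambda>n. ?u n z)" by (simp add: Cauchy_convergent_iff)
    then show ?thesis using fin by (simp add: u_def convergent_LIMSEQ_iff)
  qed
  have uU: "ennreal (norm (u z - ?u n z)) + ?U n z \<le> U z" for n z
  proof (cases "U z < \<infinity>")
    case True
    have "(\<lambda>m. ennreal (norm (?u m z - ?u n z)) + ?U n z) \<longlonglongrightarrow> ennreal (norm (u z - ?u n z)) + ?U n z"
      by (intro tendsto_intros lim True)
    then show ?thesis
    proof (rule LIMSEQ_le_const2)
      show "\<exists>N. \<forall>m\<ge>N. ennreal (norm (?u m z - ?u n z)) + ?U n z \<le> U z"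
        using order_trans[OF tele UU] by blast
    qed
  qed (simp add: less_top[symmetric])
  have u_le: "ennreal (norm (u z)) \<le> U z" for z
  proof -
    have "ennreal (norm (u z)) \<le> ennreal (norm (u z - ?u 0 z) + norm (?u 0 z))"
      by (intro ennreal_leI) (metis diff_add_cancel norm_triangle_ineq)
    also have "\<dots> = ennreal (norm (u z - ?u 0 z)) + ?U 0 z"
      by (simp add: E_def)
    also have "\<dots> \<le> U z" by (rule uU)
    finally show ?thesis .
  qed
  show ?thesis
  proof (rule that)
    show "ennreal (norm (u z)) \<le> U z" for z by (rule u_le)
    show "ennreal (norm (u z - e z)) \<le> ?M (\<lambda>z. U z * U z) z" for z
    proof -
      have "ennreal (norm (e z)) + ennreal (norm (u z - e z)) \<le> ennreal (norm (e z)) + ?M (\<lambda>z. U z * U z) z"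
        using uU[of z 0] unfolding Ueq[of z] by (simp add: E_def add.commute)
      then show ?thesis by (simp add: ennreal_add_left_cancel_le)
    qed
    show "u z = e z - duhamel \<alpha> u z" if finM: "?M (\<lambda>z. U z * U z) z < \<infinity>" for z
    proof -
      have fin: "U z < \<infinity>" using finM Ueq[of z] by (simp add: E_def)
      have le: "ennreal (norm (duhamel \<alpha> u z - duhamel \<alpha> (?u n) z)) + ?M (\<lambda>z. ?U n z * ?U n z) z \<le>
          ?M (\<lambda>z. U z * U z) z" for n
        by (rule duhamel_difference_le[OF K C]) (use u_le pstep uU in auto)
      \<comment> \<open>The distance of the Duhamel terms is at most \<open>B - b n\<close>, the
        remainder of an increasing sequence with limit \<open>B\<close>; this replaces dominated
        convergence for the nested integrals.\<close>
      define b where "b n = enn2real (?M (\<lambda>z. ?U n z * ?U n z) z)" for n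
      define B where "B = enn2real (?M (\<lambda>z. U z * U z) z)"
      have B: "?M (\<lambda>z. U z * U z) z = ennreal B" "0 \<le> B" using finM by (simp_all add: B_def)
      have "?M (\<lambda>z. ?U n z * ?U n z) z \<le> ?M (\<lambda>z. U z * U z) z" for n
        by (intro majorant_op_mono mult_mono UU) auto
      from le_less_trans[OF this finM] have b: "?M (\<lambda>z. ?U n z * ?U n z) z = ennreal (b n)" "0 \<le> b n" for n
        by (simp_all add: b_def)
      have "(\<lambda>n. ?M (\<lambda>z. ?U n z * ?U n z) z) \<longlonglongrightarrow> ?M (\<lambda>z. U z * U z) z"
        unfolding UM[symmetric]
        by (rule LIMSEQ_SUP) (auto simp: incseq_def intro!: majorant_op_mono mult_mono inc)
      then have "b \<longlonglongrightarrow> B" unfolding B b using b B by (simp add: tendsto_ennreal_iff)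
      then have "(\<lambda>n. B - b n) \<longlonglongrightarrow> B - B" by (intro tendsto_intros)
      then have B0: "(\<lambda>n. B - b n) \<longlonglongrightarrow> 0" by simp
      have nle: "norm (duhamel \<alpha> (?u n) z - duhamel \<alpha> u z) \<le> B - b n" for n
        using le[of n] b B by (simp add: ennreal_plus[symmetric] norm_minus_commute del: ennreal_plus)
      have "(\<lambda>n. duhamel \<alpha> (?u n) z - duhamel \<alpha> u z) \<longlonglongrightarrow> 0"
        by (rule Lim_null_comparison[OF _ B0], rule always_eventually, rule allI, rule nle)
      then have "(\<lambda>n. duhamel \<alpha> (?u n) z) \<longlonglongrightarrow> duhamel \<alpha> u z"
        by (subst Lim_null)
      then have L1: "(\<lambda>n. e z - duhamel \<alpha> (?u n) z) \<longlonglongrightarrow> e z - duhamel \<alpha> u z"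
        by (intro tendsto_diff tendsto_const)
      have "(\<lambda>n. ?u (Suc n) z) \<longlonglongrightarrow> u z" by (rule LIMSEQ_Suc[OF lim[OF fin]])
      then have L2: "(\<lambda>n. e z - duhamel \<alpha> (?u n) z) \<longlonglongrightarrow> u z" by simp
      show ?thesis by (rule LIMSEQ_unique[OF L2 L1])
    qed
  qed measurable
qed

section \<open>Scalar majorants in time\<close>

text \<open>The mediant of two fractions lies below the larger one. With
  \<open>x / 0 = \<infinity>\<close> for \<open>x \<noteq> 0\<close>, \<open>0 / 0 = 0\<close> and
  \<open>x / \<infinity> = 0\<close> this covers all degenerate cases. It serves to add functions
  that are normalised by different sizes.\<close>

lemma ennreal_mediant_le_max: "(E + G) / (\<phi> + \<psi>) \<le> max (E / \<phi>) (G / (\<psi>::ennreal))"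
proof -
  have top0: "x / 0 = top" if "x \<noteq> 0" for x :: ennreal
    using that by (simp add: divide_ennreal_def ennreal_mult_top)
  consider "\<phi> = top \<or> \<psi> = top" | "\<phi> = 0" | "\<psi> = 0" | "\<phi> \<noteq> top" "\<psi> \<noteq> top" "\<phi> \<noteq> 0" "\<psi> \<noteq> 0" by blast
  then show ?thesis
  proof cases
    case 1
    then show ?thesis by (auto simp: divide_ennreal_def)
  next
    case 2
    then show ?thesis by (cases "E = 0") (auto simp: top0)
  next
    case 3
    then show ?thesis by (cases "G = 0") (auto simp: top0)
  next
    case 4
    let ?c = "max (E / \<phi>) (G / \<psi>)"
    have *: "w = (w / z) * z" if "z \<noteq> 0" "z \<noteq> top" for w z :: ennreal
      using ennreal_mult_divide_eq[of z w] that by (simp add: ennreal_times_divide ennreal_divide_times mult.commute)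
    have "E + G \<le> ?c * \<phi> + ?c * \<psi>"
      by (subst *[OF 4(3,1), of E], subst *[OF 4(4,2), of G], intro add_mono mult_right_mono) auto
    also have "\<dots> = ?c * (\<phi> + \<psi>)" by (simp add: distrib_left)
    finally have "(E + G) / (\<phi> + \<psi>) \<le> ?c * (\<phi> + \<psi>) / (\<phi> + \<psi>)" by (rule divide_right_mono_ennreal)
    also have "\<dots> = ?c" using 4 by (intro ennreal_mult_divide_eq) auto
    finally show ?thesis .
  qed
qed

text \<open>The modular of the larger of two quotients is at most the sum of their modulars. This is
  the origin of the bound 2 in the hypotheses of the bilinear estimates.\<close>

lemma sum_modular_add:
  assumes [measurable]: "E \<in> borel_measurable borel" "G \<in> borel_measurable borel"
    and m: "0 < m" "0 < M"
    and E: "sum_modular m M (\<lambda>x. E x / \<phi>) \<le> 1" and G: "sum_modular m M (\<lambda>x. G x / \<psi>) \<le> 1"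
  shows "sum_modular m M (\<lambda>x. (E x + G x) / (\<phi> + \<psi>)) \<le> 2"
proof -
  let ?n = "\<lambda>u. min (epow u m) (epow u M)"
  have mono: "?n u \<le> ?n v" if "u \<le> v" for u v
    using that m by (intro min.mono epow_mono) auto
  have "sum_modular m M (\<lambda>x. (E x + G x) / (\<phi> + \<psi>)) \<le> (\<integral>\<^sup>+x. ?n (E x / \<phi>) + ?n (G x / \<psi>) \<partial>lborel)"
    unfolding sum_modular_def
  proof (rule nn_integral_mono)
    fix x
    have "?n ((E x + G x) / (\<phi> + \<psi>)) \<le> ?n (max (E x / \<phi>) (G x / \<psi>))" by (rule mono[OF ennreal_mediant_le_max])
    also have "\<dots> \<le> ?n (E x / \<phi>) + ?n (G x / \<psi>)" by (cases "E x / \<phi> \<le> G x / \<psi>") (auto simp: max_def)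
    finally show "?n ((E x + G x) / (\<phi> + \<psi>)) \<le> ?n (E x / \<phi>) + ?n (G x / \<psi>)" .
  qed
  also have "\<dots> = sum_modular m M (\<lambda>x. E x / \<phi>) + sum_modular m M (\<lambda>x. G x / \<psi>)"
    unfolding sum_modular_def by (rule nn_integral_add) measurable
  also have "\<dots> \<le> 1 + 1" by (intro add_mono E G)
  finally show ?thesis by simp
qed

lemma sum_modular_le_of_power:
  assumes [measurable]: "G \<in> borel_measurable borel"
    and G: "(\<integral>\<^sup>+x. epow (G x) M \<partial>lborel) \<le> epow \<psi> M"
  shows "sum_modular m M (\<lambda>x. G x / \<psi>) \<le> 1"
proof -
  have "sum_modular m M (\<lambda>x. G x / \<psi>) \<le> (\<integral>\<^sup>+x. epow (G x) M / epow \<psi> M \<partial>lborel)"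
    unfolding sum_modular_def epow_divide[symmetric] by (intro nn_integral_mono) auto
  also have "\<dots> = (\<integral>\<^sup>+x. epow (G x) M \<partial>lborel) / epow \<psi> M" by (rule nn_integral_divide) measurable
  also have "\<dots> \<le> epow \<psi> M / epow \<psi> M" by (intro divide_right_mono_ennreal G)
  also have "\<dots> \<le> 1"
    by (cases "epow \<psi> M"; cases "epow \<psi> M = 0") (auto simp: divide_ennreal)
  finally show ?thesis .
qed

lemma ennreal_divide_real: "0 < r \<Longrightarrow> x / ennreal r = ennreal (1 / r) * x"
  by (simp add: divide_ennreal_def inverse_ennreal inverse_eq_divide mult.commute)

lemma ennreal_mult_mult: "0 \<le> r \<Longrightarrow> 0 \<le> s \<Longrightarrow> ennreal r * (ennreal s * x) = ennreal (r * s) * x"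
  by (simp add: ennreal_mult mult.assoc)

lemma ennreal_cancel_real: "0 < r \<Longrightarrow> x = ennreal r * (x / ennreal r)"
  by (simp add: ennreal_divide_real ennreal_mult_mult)

text \<open>For exponents at least 1, dividing a function by \<open>K\<close> divides its modular at
  least by \<open>K\<close>. A modular bound \<open>K\<close> thus becomes the bound 1 for the
  function divided by \<open>K\<close>.\<close>

lemma epow_divide_const_le:
  assumes K: "1 \<le> K" and e: "1 \<le> e"
  shows "epow (x / ennreal K) e \<le> epow x e / ennreal K"
proof -
  have "inverse (epow (ennreal K) e) \<le> inverse (ennreal K)"
    using K e powr_mono[of 1 e K] by (simp add: epow_ennreal inverse_ennreal ennreal_le_iff)
  then show ?thesis by (simp add: divide_ennreal_def epow_mult epow_inverse mult_left_mono)
qed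

text \<open>\<open>g\<close> is the reciprocal of the time exponent, and \<open>hls\<close> is the
  mapping property of the fractional integral from exponent p/2 to p. Assuming it here separates the
  iteration in time from harmonic analysis.\<close>

locale time_setting =
  fixes T K a :: real and g :: "real \<Rightarrow> real"
  assumes T: "0 < T" and K: "1 \<le> K"
    and g_measurable [measurable]: "g \<in> borel_measurable borel"
    and g: "\<And>s. 0 < s \<Longrightarrow> s < T \<Longrightarrow> 0 < g s \<and> g s \<le> 1"
    and hls: "\<And>F. F \<in> borel_measurable borel \<Longrightarrow>
        (\<integral>\<^sup>+s. indicator {0<..<T} s * epow (F s) (1 / (2 * g s)) \<partial>lborel) \<le> 1 \<Longrightarrow>
        (\<integral>\<^sup>+t. indicator {0<..<T} t * epow (\<integral>\<^sup>+s. indicator {0<..<T} s *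
            (ennreal (\<bar>t - s\<bar> powr - a) * F s) \<partial>lborel) (1 / g t) \<partial>lborel) \<le> ennreal K"
begin

lemma g_pos: "t \<in> {0<..<T} \<Longrightarrow> 0 < g t" "t \<in> {0<..<T} \<Longrightarrow> 1 \<le> 1 / g t" "t \<in> {0<..<T} \<Longrightarrow> 0 \<le> 1 / g t"
  using g[of t] by auto

text \<open>The integral runs over all of (0, T) and not only over s < t, as in \<open>hls\<close>;
  for nonnegative functions it dominates the causal integral.\<close>

definition J :: "(real \<Rightarrow> ennreal) \<Rightarrow> real \<Rightarrow> ennreal" where
  "J F t = (\<integral>\<^sup>+s. indicator {0<..<T} s * (ennreal (\<bar>t - s\<bar> powr - a) * F s) \<partial>lborel)"

definition tmod :: "(real \<Rightarrow> ennreal) \<Rightarrow> ennreal" where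
  "tmod F = (\<integral>\<^sup>+t. indicator {0<..<T} t * epow (F t) (1 / g t) \<partial>lborel)"

lemma J_measurable [measurable]:
  assumes [measurable]: "F \<in> borel_measurable borel"
  shows "J F \<in> borel_measurable borel"
  unfolding J_def[abs_def] by measurable

lemma J_mono: "(\<And>s. 0 < s \<Longrightarrow> s < T \<Longrightarrow> F s \<le> G s) \<Longrightarrow> J F t \<le> J G t"
  unfolding J_def by (intro nn_integral_mono) (auto split: split_indicator intro!: mult_left_mono)

lemma J_cmult:
  assumes [measurable]: "F \<in> borel_measurable borel"
  shows "J (\<lambda>s. c * F s) t = c * J F t"
  unfolding J_def by (subst nn_integral_cmult[symmetric]) (auto simp: mult_ac)

lemma J_SUP:
  assumes [measurable]: "\<And>n. F n \<in> borel_measurable borel" and inc: "incseq F"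
  shows "J (\<lambda>s. SUP n. F n s) t = (SUP n. J (F n) t)"
  unfolding J_def
  by (subst nn_integral_monotone_convergence_SUP[symmetric])
     (use inc in \<open>auto simp: SUP_mult_left_ennreal incseq_def le_fun_def intro!: mult_left_mono\<close>)

lemma tmod_mono: "(\<And>s. 0 < s \<Longrightarrow> s < T \<Longrightarrow> F s \<le> G s) \<Longrightarrow> tmod F \<le> tmod G"
  unfolding tmod_def by (intro nn_integral_mono) (auto split: split_indicator intro!: epow_mono g_pos)

lemma tmod_J:
  assumes [measurable]: "F \<in> borel_measurable borel"
    and F: "(\<integral>\<^sup>+s. indicator {0<..<T} s * epow (F s) (1 / (2 * g s)) \<partial>lborel) \<le> 1"
  shows "tmod (\<lambda>t. J F t / ennreal K) \<le> 1"
proof -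
  have "tmod (\<lambda>t. J F t / ennreal K) \<le> (\<integral>\<^sup>+t. (indicator {0<..<T} t * epow (J F t) (1 / g t)) / ennreal K \<partial>lborel)"
    unfolding tmod_def by (intro nn_integral_mono) (auto split: split_indicator intro!: epow_divide_const_le K g_pos)
  also have "\<dots> = (\<integral>\<^sup>+t. indicator {0<..<T} t * epow (J F t) (1 / g t) \<partial>lborel) / ennreal K"
    by (rule nn_integral_divide) measurable
  also have "\<dots> \<le> ennreal K / ennreal K"
    unfolding J_def by (intro divide_right_mono_ennreal hls F) measurable
  also have "\<dots> = 1" using K by (simp add: divide_ennreal)
  finally show ?thesis .
qed

text \<open>These functions follow the size of the quadratic part only. The datum has size
  \<open>\<phi>\<close>, and \<open>\<phi> s + time_iterate c \<phi> n s\<close> measures a whole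
  iterate at time \<open>s\<close>.\<close>

fun time_iterate :: "real \<Rightarrow> (real \<Rightarrow> ennreal) \<Rightarrow> nat \<Rightarrow> real \<Rightarrow> ennreal" where
  "time_iterate c \<phi> 0 = (\<lambda>t. 0)"
| "time_iterate c \<phi> (Suc n) = (\<lambda>t. ennreal c * J (\<lambda>s. (\<phi> s + time_iterate c \<phi> n s) * (\<phi> s + time_iterate c \<phi> n s)) t)"

lemma time_iterate_measurable [measurable]:
  assumes [measurable]: "\<phi> \<in> borel_measurable borel"
  shows "time_iterate c \<phi> n \<in> borel_measurable borel"
  by (induction n) auto

lemma time_iterate_inc: "time_iterate c \<phi> n t \<le> time_iterate c \<phi> (Suc n) t"
proof (induction n arbitrary: t)
  case (Suc n)
  then show ?case by (auto intro!: mult_left_mono J_mono mult_mono add_left_mono)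
qed simp

text \<open>The ball of radius \<open>\<epsilon>\<close> is invariant. The factor 16 is the square
  of 4, and 4 accounts for a factor 2 from the power of a sum and a factor 2 from adding two
  modulars bounded by 1.\<close>

lemma time_iterate_bound:
  assumes [measurable]: "\<phi> \<in> borel_measurable borel" and c: "0 < c" and \<epsilon>: "0 < \<epsilon>" "16 * c * \<epsilon> * K \<le> 1"
    and \<phi>: "tmod (\<lambda>t. \<phi> t / ennreal \<epsilon>) \<le> 1"
  shows "tmod (\<lambda>t. time_iterate c \<phi> n t / ennreal \<epsilon>) \<le> 1"
proof (induction n)
  case 0
  show ?case by (simp add: tmod_def)
next
  case (Suc n)
  let ?\<psi> = "time_iterate c \<phi> n"
  define F where "F s = ((\<phi> s + ?\<psi> s) / ennreal (4 * \<epsilon>)) * ((\<phi> s + ?\<psi> s) / ennreal (4 * \<epsilon>))" for s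
  have [measurable]: "F \<in> borel_measurable borel" unfolding F_def[abs_def] by measurable
  have "(\<integral>\<^sup>+s. indicator {0<..<T} s * epow (F s) (1 / (2 * g s)) \<partial>lborel) \<le>
     (\<integral>\<^sup>+s. ennreal (1/2) * (indicator {0<..<T} s * epow (\<phi> s / ennreal \<epsilon>) (1 / g s) +
          indicator {0<..<T} s * epow (?\<psi> s / ennreal \<epsilon>) (1 / g s)) \<partial>lborel)"
  proof (rule nn_integral_mono)
    fix s
    show "indicator {0<..<T} s * epow (F s) (1 / (2 * g s)) \<le> ennreal (1/2) * (indicator {0<..<T} s * epow (\<phi> s / ennreal \<epsilon>) (1 / g s) +
          indicator {0<..<T} s * epow (?\<psi> s / ennreal \<epsilon>) (1 / g s))"
    proof (cases "s \<in> {0<..<T}")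
      case True
      let ?e = "1 / g s"
      have e: "1 \<le> ?e" "0 \<le> ?e" using g_pos[OF True] by auto
      have h: "1 / (2 * g s) + 1 / (2 * g s) = ?e" by simp
      have d: "x / ennreal (4 * \<epsilon>) = ennreal (1/4) * (x / ennreal \<epsilon>)" for x
        using \<epsilon> by (simp add: divide_ennreal_def inverse_ennreal ennreal_mult[symmetric] mult_ac)
      have "epow (F s) (1 / (2 * g s)) = epow ((\<phi> s + ?\<psi> s) / ennreal (4 * \<epsilon>)) ?e"
        unfolding F_def epow_mult epow_add[symmetric] h ..
      also have "\<dots> = ennreal ((1/4) powr ?e) * epow (\<phi> s / ennreal \<epsilon> + ?\<psi> s / ennreal \<epsilon>) ?e"
        unfolding d epow_mult by (simp add: epow_ennreal add_divide_distrib_ennreal)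
      also have "\<dots> \<le> ennreal ((1/4) powr ?e) * (ennreal (2 powr ?e) *
          (epow (\<phi> s / ennreal \<epsilon>) ?e + epow (?\<psi> s / ennreal \<epsilon>) ?e))"
        by (intro mult_left_mono epow_plus_le e) auto
      also have "\<dots> = ennreal ((1/2) powr ?e) * (epow (\<phi> s / ennreal \<epsilon>) ?e + epow (?\<psi> s / ennreal \<epsilon>) ?e)"
        by (simp add: ennreal_mult[symmetric] powr_mult[symmetric] mult.assoc[symmetric])
      also have "\<dots> \<le> ennreal (1/2) * (epow (\<phi> s / ennreal \<epsilon>) ?e + epow (?\<psi> s / ennreal \<epsilon>) ?e)"
        using powr_mono'[of 1 ?e "1/2"] e by (intro mult_right_mono ennreal_leI) auto
      finally show ?thesis using True by simp
    qed simp
  qed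
  also have "\<dots> = ennreal (1/2) * (tmod (\<lambda>t. \<phi> t / ennreal \<epsilon>) + tmod (\<lambda>t. ?\<psi> t / ennreal \<epsilon>))"
    unfolding tmod_def by (simp add: nn_integral_cmult nn_integral_add)
  also have "\<dots> \<le> ennreal (1/2) * (1 + 1)" by (intro mult_left_mono add_mono \<phi> Suc) auto
  also have "\<dots> = ennreal (1/2) * ennreal 2" by simp
  also have "\<dots> = 1" by (subst ennreal_mult[symmetric]) auto
  finally have A: "tmod (\<lambda>t. J F t / ennreal K) \<le> 1" by (intro tmod_J) auto
  have B: "time_iterate c \<phi> (Suc n) t / ennreal \<epsilon> \<le> J F t / ennreal K" for t
  proof -
    have "(\<phi> s + ?\<psi> s) * (\<phi> s + ?\<psi> s) = ennreal (16 * \<epsilon> * \<epsilon>) * F s" for s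
    proof -
      have "x * x = ennreal (16 * \<epsilon> * \<epsilon>) * ((x / ennreal (4 * \<epsilon>)) * (x / ennreal (4 * \<epsilon>)))" for x
      proof -
        define y where "y = x / ennreal (4 * \<epsilon>)"
        have x: "x = ennreal (4 * \<epsilon>) * y" unfolding y_def using \<epsilon> by (intro ennreal_cancel_real) simp
        have "16 * \<epsilon> * \<epsilon> = (4 * \<epsilon>) * (4 * \<epsilon>)" by simp
        moreover have "ennreal ((4 * \<epsilon>) * (4 * \<epsilon>)) = ennreal (4 * \<epsilon>) * ennreal (4 * \<epsilon>)"
          using \<epsilon> by (intro ennreal_mult) auto
        ultimately have "ennreal (16 * \<epsilon> * \<epsilon>) = ennreal (4 * \<epsilon>) * ennreal (4 * \<epsilon>)" by (simp only:)
        then show ?thesis unfolding y_def[symmetric] by (simp only: x mult_ac)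
      qed
      then show ?thesis unfolding F_def .
    qed
    then have "time_iterate c \<phi> (Suc n) t = ennreal (c * (16 * \<epsilon> * \<epsilon>)) * J F t"
      using c \<epsilon> by (simp add: J_cmult ennreal_mult_mult)
    then have "time_iterate c \<phi> (Suc n) t / ennreal \<epsilon> = ennreal (16 * c * \<epsilon>) * J F t"
      using c \<epsilon> by (simp only: ennreal_divide_real) (subst ennreal_mult_mult, auto simp: field_simps)
    also have "\<dots> \<le> ennreal (1 / K) * J F t"
      using \<epsilon> K by (intro mult_right_mono ennreal_leI) (auto simp: field_simps)
    also have "\<dots> = J F t / ennreal K"
      using K by (simp add: ennreal_divide_real)
    finally show ?thesis .
  qed
  show ?case by (rule order_trans[OF tmod_mono[OF B] A])
qed

text \<open>The limit \<open>\<psi>\<close> of the time iterates solves \<psi> = c J((\<phi> +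
  \<psi>)^2). By induction, the quadratic part of every majorant iterate has slices bounded by
  \<open>\<psi>\<close> in L^M. The datum is controlled only in L^m + L^M, so the whole iterate is
  measured there against \<open>\<phi> + \<psi>\<close>. Monotone convergence passes to
  \<open>U\<close>.\<close>

lemma small_majorant:
  assumes [measurable]: "E \<in> borel_measurable (borel \<Otimes>\<^sub>M borel)" "\<phi> \<in> borel_measurable borel"
    and c: "0 < c" and \<epsilon>: "0 < \<epsilon>" "16 * c * \<epsilon> * K \<le> 1"
    and m: "0 < m" "0 < M"
    and bil: "\<And>t U V \<phi> \<psi>. 0 < t \<Longrightarrow> t < T \<Longrightarrow>
     U \<in> borel_measurable (borel \<Otimes>\<^sub>M borel) \<Longrightarrow> V \<in> borel_measurable (borel \<Otimes>\<^sub>M borel) \<Longrightarrow>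
     \<phi> \<in> borel_measurable borel \<Longrightarrow> \<psi> \<in> borel_measurable borel \<Longrightarrow>
     (AE s in lborel. 0 < s \<and> s < T \<longrightarrow> sum_modular m M (\<lambda>x. U (s, x) / \<phi> s) \<le> 2 \<and>
         sum_modular m M (\<lambda>x. V (s, x) / \<psi> s) \<le> 2) \<Longrightarrow>
     (\<integral>\<^sup>+x. epow (majorant_op D \<alpha> (\<lambda>z. U z * V z) (t, x)) M \<partial>lborel)
       \<le> epow (ennreal c * (\<integral>\<^sup>+s. indicator {0<..<t} s * (ennreal (\<bar>t - s\<bar> powr - a) * (\<phi> s * \<psi> s)) \<partial>lborel)) M"
    and E: "AE s in lborel. 0 < s \<and> s < T \<longrightarrow> sum_modular m M (\<lambda>x. E (s, x) / \<phi> s) \<le> 1"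
    and \<phi>: "tmod (\<lambda>t. \<phi> t / ennreal \<epsilon>) \<le> 1"
  defines "U \<equiv> \<lambda>z. SUP n. majorant_iterate D \<alpha> E n z"
  obtains \<psi> where "\<psi> \<in> borel_measurable borel" "tmod (\<lambda>t. \<psi> t / ennreal \<epsilon>) \<le> 1"
    "\<And>t. 0 < t \<Longrightarrow> t < T \<Longrightarrow> (\<integral>\<^sup>+x. epow (majorant_op D \<alpha> (\<lambda>z. U z * U z) (t, x)) M \<partial>lborel) \<le> epow (\<psi> t) M"
proof -
  define \<psi> where "\<psi> t = (SUP n. time_iterate c \<phi> n t)" for t
  have [measurable]: "\<psi> \<in> borel_measurable borel" unfolding \<psi>_def[abs_def] by measurable
  have inc: "incseq (\<lambda>n. time_iterate c \<phi> n)"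
    using time_iterate_inc by (auto intro!: incseq_SucI le_funI)
  then have inc': "time_iterate c \<phi> n t \<le> time_iterate c \<phi> k t" if "n \<le> k" for n k t
    using that by (auto simp: incseq_def le_fun_def)
  have \<psi>1: "tmod (\<lambda>t. \<psi> t / ennreal \<epsilon>) \<le> 1"
  proof -
    have "tmod (\<lambda>t. \<psi> t / ennreal \<epsilon>) = (\<integral>\<^sup>+t. (SUP n. indicator {0<..<T} t * epow (time_iterate c \<phi> n t / ennreal \<epsilon>) (1 / g t)) \<partial>lborel)"
      unfolding tmod_def
    proof (intro nn_integral_cong)
      fix t
      show "indicator {0<..<T} t * epow (\<psi> t / ennreal \<epsilon>) (1 / g t) =
          (SUP n. indicator {0<..<T} t * epow (time_iterate c \<phi> n t / ennreal \<epsilon>) (1 / g t))"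
      proof (cases "t \<in> {0<..<T}")
        case True
        have "\<psi> t / ennreal \<epsilon> = (SUP n. time_iterate c \<phi> n t / ennreal \<epsilon>)"
          unfolding \<psi>_def divide_ennreal_def by (simp add: SUP_mult_right_ennreal)
        then show ?thesis using True g_pos[OF True] by (simp add: epow_SUP)
      qed simp
    qed
    also have "\<dots> = (SUP n. tmod (\<lambda>t. time_iterate c \<phi> n t / ennreal \<epsilon>))"
      unfolding tmod_def
      by (rule nn_integral_monotone_convergence_SUP)
         (auto simp: incseq_def le_fun_def split: split_indicator intro!: epow_mono divide_right_mono_ennreal inc' g_pos)
    also have "\<dots> \<le> 1" by (intro SUP_least time_iterate_bound c \<epsilon> \<phi>) auto
    finally show ?thesis .
  qed
  have \<psi>eq: "ennreal c * J (\<lambda>s. (\<phi> s + \<psi> s) * (\<phi> s + \<psi> s)) t = \<psi> t" for t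
  proof -
    have sq: "x * x = epow x 2" for x using epow_add[of x 1 1] by simp
    have "(\<phi> s + \<psi> s) * (\<phi> s + \<psi> s) = (SUP n. (\<phi> s + time_iterate c \<phi> n s) * (\<phi> s + time_iterate c \<phi> n s))" for s
      unfolding sq \<psi>_def by (subst epow_SUP[symmetric]) (auto simp: ennreal_SUP_add_right)
    then have "J (\<lambda>s. (\<phi> s + \<psi> s) * (\<phi> s + \<psi> s)) t = (SUP n. J (\<lambda>s. (\<phi> s + time_iterate c \<phi> n s) * (\<phi> s + time_iterate c \<phi> n s)) t)"
      by (simp only:) (rule J_SUP, auto simp: incseq_def le_fun_def intro!: mult_mono add_left_mono inc')
    then have "ennreal c * J (\<lambda>s. (\<phi> s + \<psi> s) * (\<phi> s + \<psi> s)) t = (SUP n. time_iterate c \<phi> (Suc n) t)"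
      by (simp add: SUP_mult_left_ennreal)
    also have "\<dots> = \<psi> t"
      unfolding \<psi>_def
    proof (rule SUP_eq)
      fix n show "\<exists>k\<in>UNIV. time_iterate c \<phi> (Suc n) t \<le> time_iterate c \<phi> k t" by blast
    next
      fix n show "\<exists>k\<in>UNIV. time_iterate c \<phi> n t \<le> time_iterate c \<phi> (Suc k) t" using time_iterate_inc by blast
    qed
    finally show ?thesis .
  qed
  let ?U = "majorant_iterate D \<alpha> E"
  have it: "(\<integral>\<^sup>+x. epow (majorant_op D \<alpha> (\<lambda>z. ?U n z * ?U n z) (t, x)) M \<partial>lborel) \<le> epow (\<psi> t) M"
    if t: "0 < t" "t < T" for n t
    using t
  proof (induction n arbitrary: t)
    \<comment> \<open>Since \<open>\<psi>\<close> is a fixed point, the bilinear estimate applied to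
      a function of size \<open>\<phi> + \<psi>\<close> returns exactly
      \<open>\<psi>\<close>.\<close>
    have step: "(\<integral>\<^sup>+x. epow (majorant_op D \<alpha> (\<lambda>z. W z * W z) (t, x)) M \<partial>lborel) \<le> epow (\<psi> t) M"
      if t: "0 < t" "t < T" and [measurable]: "W \<in> borel_measurable (borel \<Otimes>\<^sub>M borel)"
        and W: "AE s in lborel. 0 < s \<and> s < T \<longrightarrow> sum_modular m M (\<lambda>x. W (s, x) / (\<phi> s + \<psi> s)) \<le> 2" for t W
    proof -
      have "(\<integral>\<^sup>+x. epow (majorant_op D \<alpha> (\<lambda>z. W z * W z) (t, x)) M \<partial>lborel) \<le>
        epow (ennreal c * (\<integral>\<^sup>+s. indicator {0<..<t} s * (ennreal (\<bar>t - s\<bar> powr - a) * ((\<phi> s + \<psi> s) * (\<phi> s + \<psi> s))) \<partial>lborel)) M"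
        using W by (intro bil t) (auto elim!: eventually_mono)
      also have "\<dots> \<le> epow (ennreal c * J (\<lambda>s. (\<phi> s + \<psi> s) * (\<phi> s + \<psi> s)) t) M"
        unfolding J_def using m t by (intro epow_mono mult_left_mono nn_integral_mono) (auto split: split_indicator)
      finally show ?thesis unfolding \<psi>eq .
    qed
    case 0
    have "sum_modular m M (\<lambda>x. 0 / \<psi> s) \<le> 1" for s by (simp add: sum_modular_def)
    then have "AE s in lborel. 0 < s \<and> s < T \<longrightarrow> sum_modular m M (\<lambda>x. (E (s, x) + 0) / (\<phi> s + \<psi> s)) \<le> 2"
      using E by (auto elim!: eventually_mono intro!: sum_modular_add m simp del: add_0_right)
    then show ?case using 0 by (intro step) auto
    case (Suc n)
    have "AE s in lborel. 0 < s \<and> s < T \<longrightarrow> sum_modular m M (\<lambda>x. ?U (Suc n) (s, x) / (\<phi> s + \<psi> s)) \<le> 2"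
      using E
    proof (eventually_elim, safe)
      fix s assume s: "sum_modular m M (\<lambda>x. E (s, x) / \<phi> s) \<le> 1" "0 < s" "s < T"
      have "sum_modular m M (\<lambda>x. majorant_op D \<alpha> (\<lambda>z. ?U n z * ?U n z) (s, x) / \<psi> s) \<le> 1"
        by (rule sum_modular_le_of_power[OF _ Suc.IH[OF s(2,3)]]) measurable
      from sum_modular_add[OF _ _ m s(1) this]
      show "sum_modular m M (\<lambda>x. ?U (Suc n) (s, x) / (\<phi> s + \<psi> s)) \<le> 2" by simp
    qed
    then show ?case using Suc.prems by (intro step) auto
  qed
  have incU: "?U n z \<le> ?U k z" if "n \<le> k" for n k z
    using majorant_iterate_incseq[of D \<alpha> E] that by (cases z) (auto simp: incseq_def le_fun_def)
  have "(\<integral>\<^sup>+x. epow (majorant_op D \<alpha> (\<lambda>z. U z * U z) (t, x)) M \<partial>lborel) \<le> epow (\<psi> t) M"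
    if t: "0 < t" "t < T" for t
  proof -
    have sq: "x * x = epow x 2" for x using epow_add[of x 1 1] by simp
    have "U z * U z = (SUP n. ?U n z * ?U n z)" for z
      unfolding sq U_def by (rule epow_SUP) simp
    then have "majorant_op D \<alpha> (\<lambda>z. U z * U z) z = (SUP n. majorant_op D \<alpha> (\<lambda>z. ?U n z * ?U n z) z)" for z
      by (simp only:) (rule majorant_op_SUP, auto simp: incseq_def le_fun_def intro!: mult_mono incU)
    then have "(\<integral>\<^sup>+x. epow (majorant_op D \<alpha> (\<lambda>z. U z * U z) (t, x)) M \<partial>lborel) =
       (\<integral>\<^sup>+x. (SUP n. epow (majorant_op D \<alpha> (\<lambda>z. ?U n z * ?U n z) (t, x)) M) \<partial>lborel)"
      using m by (simp add: epow_SUP)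
    also have "\<dots> = (SUP n. \<integral>\<^sup>+x. epow (majorant_op D \<alpha> (\<lambda>z. ?U n z * ?U n z) (t, x)) M \<partial>lborel)"
      using m by (intro nn_integral_monotone_convergence_SUP)
        (auto simp: incseq_def le_fun_def intro!: epow_mono majorant_op_mono mult_mono incU)
    also have "\<dots> \<le> epow (\<psi> t) M" by (intro SUP_least it t)
    finally show ?thesis .
  qed
  then show ?thesis using \<psi>1 by (intro that[of \<psi>]) auto
qed

end

section \<open>Uniqueness for the scalar inequality in time\<close>

context time_setting
begin

text \<open>One halving of the radius \<open>l\<close> on an interval beyond \<open>b\<close>. As
  \<open>\<omega>\<close> vanishes before \<open>b\<close>, only times in the interval enter the
  integral; there \<open>\<phi>\<close> has size at most \<open>\<eta>\<close>, and
  \<open>2 * c * \<eta> * K \<le> 1\<close> gives the factor 1/2.\<close>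

lemma time_unique_step:
  assumes [measurable]: "\<omega> \<in> borel_measurable borel" "\<phi> \<in> borel_measurable borel"
    and c: "0 < c" and \<eta>: "0 < \<eta>" "2 * c * \<eta> * K \<le> 1" and l: "0 < l"
    and ineq: "AE t in lborel. 0 < t \<and> t < T \<longrightarrow>
       \<omega> t \<le> ennreal c * (\<integral>\<^sup>+s. indicator {0<..<t} s * (ennreal (\<bar>t - s\<bar> powr - a) * (\<omega> s * \<phi> s)) \<partial>lborel)"
    and b: "0 \<le> b" "b' \<le> T" and zero: "AE t in lborel. 0 < t \<and> t < b \<longrightarrow> \<omega> t = 0"
    and \<omega>: "tmod (\<lambda>t. indicator {b<..<b'} t * (\<omega> t / ennreal l)) \<le> 1"
    and \<phi>: "tmod (\<lambda>t. indicator {b<..<b'} t * (\<phi> t / ennreal \<eta>)) \<le> 1"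
  shows "tmod (\<lambda>t. indicator {b<..<b'} t * (\<omega> t / ennreal (l / 2))) \<le> 1"
proof -
  let ?i = "\<lambda>t. indicator {b<..<b'} t :: ennreal"
  define F where "F s = (?i s * (\<omega> s / ennreal l)) * (?i s * (\<phi> s / ennreal \<eta>))" for s
  have [measurable]: "F \<in> borel_measurable borel" unfolding F_def[abs_def] by measurable
  have "(\<integral>\<^sup>+s. indicator {0<..<T} s * epow (F s) (1 / (2 * g s)) \<partial>lborel) \<le>
     (\<integral>\<^sup>+s. ennreal (1/2) * (indicator {0<..<T} s * epow (?i s * (\<omega> s / ennreal l)) (1 / g s)) +
         ennreal (1/2) * (indicator {0<..<T} s * epow (?i s * (\<phi> s / ennreal \<eta>)) (1 / g s)) \<partial>lborel)"
  proof (rule nn_integral_mono)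
    fix s
    have h: "1 / (2 * g s) = 1 / g s * (1/2)" by simp
    \<comment> \<open>The product is measured with half the exponent, so Young's inequality with
      weights 1/2 bounds its modular by the mean of the two modulars.\<close>
    have "epow (F s) (1 / (2 * g s)) = epow (epow (?i s * (\<omega> s / ennreal l)) (1 / g s)) (1/2) *
        epow (epow (?i s * (\<phi> s / ennreal \<eta>)) (1 / g s)) (1 - 1/2)"
      unfolding F_def epow_mult[of "?i s * (\<omega> s / ennreal l)"] epow_epow h by simp
    also have "\<dots> \<le> ennreal (1/2) * epow (?i s * (\<omega> s / ennreal l)) (1 / g s) +
        ennreal (1 - 1/2) * epow (?i s * (\<phi> s / ennreal \<eta>)) (1 / g s)"
      by (rule young_ennreal) auto
    finally show "indicator {0<..<T} s * epow (F s) (1 / (2 * g s)) \<le>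
        ennreal (1/2) * (indicator {0<..<T} s * epow (?i s * (\<omega> s / ennreal l)) (1 / g s)) +
         ennreal (1/2) * (indicator {0<..<T} s * epow (?i s * (\<phi> s / ennreal \<eta>)) (1 / g s))"
      by (auto split: split_indicator)
  qed
  also have "\<dots> = ennreal (1/2) * tmod (\<lambda>t. ?i t * (\<omega> t / ennreal l)) + ennreal (1/2) * tmod (\<lambda>t. ?i t * (\<phi> t / ennreal \<eta>))"
    unfolding tmod_def by (simp add: nn_integral_cmult nn_integral_add)
  also have "\<dots> \<le> ennreal (1/2) * 1 + ennreal (1/2) * 1" by (intro add_mono mult_left_mono \<omega> \<phi>) auto
  also have "\<dots> = ennreal (1/2 + 1/2)" by (subst ennreal_plus) auto
  also have "\<dots> = 1" by simp
  finally have A: "tmod (\<lambda>t. J F t / ennreal K) \<le> 1" by (intro tmod_J) auto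
  have B: "AE t in lborel. ?i t * (\<omega> t / ennreal (l / 2)) \<le> J F t / ennreal K"
    using ineq
  proof eventually_elim
    case (elim t)
    show ?case
    proof (cases "t \<in> {b<..<b'}")
      case True
      then have t: "0 < t" "t < T" using b by auto
      have "(\<integral>\<^sup>+s. indicator {0<..<t} s * (ennreal (\<bar>t - s\<bar> powr - a) * (\<omega> s * \<phi> s)) \<partial>lborel) \<le>
          (\<integral>\<^sup>+s. ennreal (l * \<eta>) * (indicator {0<..<T} s * (ennreal (\<bar>t - s\<bar> powr - a) * F s)) \<partial>lborel)"
      proof (rule nn_integral_mono_AE)
        show "AE s in lborel. indicator {0<..<t} s * (ennreal (\<bar>t - s\<bar> powr - a) * (\<omega> s * \<phi> s)) \<le>
           ennreal (l * \<eta>) * (indicator {0<..<T} s * (ennreal (\<bar>t - s\<bar> powr - a) * F s))"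
          using zero AE_lborel_singleton[of b]
        proof eventually_elim
          case (elim s)
          show ?case
          proof (cases "b < s \<and> s < t")
            case st: True
            have "\<omega> s * \<phi> s = ennreal (l * \<eta>) * F s"
            proof -
              define x y where "x = \<omega> s / ennreal l" and "y = \<phi> s / ennreal \<eta>"
              have "\<omega> s = ennreal l * x" "\<phi> s = ennreal \<eta> * y"
                unfolding x_def y_def using l \<eta> by (intro ennreal_cancel_real; simp)+
              moreover have "F s = x * y" using st True by (simp add: F_def x_def y_def)
              moreover have "ennreal (l * \<eta>) = ennreal l * ennreal \<eta>" using l \<eta> by (intro ennreal_mult) auto
              ultimately show ?thesis by (simp only: mult_ac)
            qed
            then show ?thesis using st True t b by (simp add: mult_ac)
          next
            case False
            then show ?thesis using elim by (cases "0 < s \<and> s < t") auto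
          qed
        qed
      qed
      also have "\<dots> = ennreal (l * \<eta>) * J F t" unfolding J_def by (rule nn_integral_cmult) measurable
      finally have "\<omega> t \<le> ennreal c * (ennreal (l * \<eta>) * J F t)"
        using elim t by (meson mult_left_mono order_trans zero_le)
      then have "\<omega> t / ennreal (l / 2) \<le> ennreal c * (ennreal (l * \<eta>) * J F t) / ennreal (l / 2)"
        by (rule divide_right_mono_ennreal)
      also have "\<dots> = ennreal (2 * c * \<eta>) * J F t"
      proof -
        have "ennreal c * (ennreal (l * \<eta>) * J F t) / ennreal (l / 2) =
            ennreal (1 / (l / 2) * (c * (l * \<eta>))) * J F t"
          using c l \<eta> by (subst ennreal_divide_real) (auto simp: ennreal_mult_mult simp del: divide_divide_eq_right)
        also have "1 / (l / 2) * (c * (l * \<eta>)) = 2 * c * \<eta>" using l by simp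
        finally show ?thesis .
      qed
      also have "\<dots> \<le> ennreal (1 / K) * J F t"
        using \<eta> K by (intro mult_right_mono ennreal_leI) (auto simp: field_simps)
      also have "\<dots> = J F t / ennreal K"
        using K by (simp add: ennreal_divide_real)
      finally show ?thesis using True by simp
    qed simp
  qed
  have "tmod (\<lambda>t. ?i t * (\<omega> t / ennreal (l / 2))) \<le> tmod (\<lambda>t. J F t / ennreal K)"
    unfolding tmod_def
  proof (rule nn_integral_mono_AE)
    show "AE t in lborel. indicator {0<..<T} t * epow (?i t * (\<omega> t / ennreal (l / 2))) (1 / g t) \<le>
        indicator {0<..<T} t * epow (J F t / ennreal K) (1 / g t)"
      using B by eventually_elim (auto split: split_indicator intro!: epow_mono g_pos)
  qed
  then show ?thesis using A by simp
qed

lemma tmod_divide_le: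
  assumes [measurable]: "F \<in> borel_measurable borel" and k: "1 \<le> k"
  shows "tmod (\<lambda>t. F t / ennreal k) \<le> tmod F / ennreal k"
proof -
  have "tmod (\<lambda>t. F t / ennreal k) \<le> (\<integral>\<^sup>+t. (indicator {0<..<T} t * epow (F t) (1 / g t)) / ennreal k \<partial>lborel)"
    unfolding tmod_def by (intro nn_integral_mono) (auto split: split_indicator intro!: epow_divide_const_le k g_pos)
  also have "\<dots> = tmod F / ennreal k" unfolding tmod_def by (rule nn_integral_divide) measurable
  finally show ?thesis .
qed

text \<open>Repeated halving bounds the modular of \<open>\<omega>\<close> divided by
  \<open>L\<close> on the interval by 2^(-n) for every \<open>n\<close>. The starting radius
  \<open>L\<close> exists because the modular of \<open>\<omega>\<close> is finite; this is where
  the finiteness enters.\<close>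

lemma time_unique_interval:
  assumes [measurable]: "\<omega> \<in> borel_measurable borel" "\<phi> \<in> borel_measurable borel"
    and c: "0 < c" and \<eta>: "0 < \<eta>" "2 * c * \<eta> * K \<le> 1"
    and ineq: "AE t in lborel. 0 < t \<and> t < T \<longrightarrow>
       \<omega> t \<le> ennreal c * (\<integral>\<^sup>+s. indicator {0<..<t} s * (ennreal (\<bar>t - s\<bar> powr - a) * (\<omega> s * \<phi> s)) \<partial>lborel)"
    and b: "0 \<le> b" "b' \<le> T" and zero: "AE t in lborel. 0 < t \<and> t < b \<longrightarrow> \<omega> t = 0"
    and \<omega>: "tmod \<omega> < \<infinity>"
    and \<phi>: "tmod (\<lambda>t. indicator {b<..<b'} t * (\<phi> t / ennreal \<eta>)) \<le> 1"
  shows "AE t in lborel. 0 < t \<and> t < b' \<longrightarrow> \<omega> t = 0"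
proof -
  let ?i = "\<lambda>t. indicator {b<..<b'} t :: ennreal"
  obtain w where w: "tmod \<omega> = ennreal w" "0 \<le> w" using \<omega> by (cases "tmod \<omega>") auto
  define L where "L = max 1 w"
  have L: "1 \<le> L" "tmod \<omega> \<le> ennreal L" using w by (auto simp: L_def intro: ennreal_leI)
  have "tmod (\<lambda>t. ?i t * (\<omega> t / ennreal L)) \<le> tmod (\<lambda>t. \<omega> t / ennreal L)"
    by (rule tmod_mono) (auto split: split_indicator)
  also have "\<dots> \<le> tmod \<omega> / ennreal L" using L by (intro tmod_divide_le) auto
  also have "\<dots> \<le> ennreal L / ennreal L" by (intro divide_right_mono_ennreal L)
  also have "\<dots> = 1" using L by (simp add: divide_ennreal)
  finally have start: "tmod (\<lambda>t. ?i t * (\<omega> t / ennreal L)) \<le> 1" .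
  have half: "tmod (\<lambda>t. ?i t * (\<omega> t / ennreal (L / 2 ^ n))) \<le> 1" for n
  proof (induction n)
    case (Suc n)
    have "tmod (\<lambda>t. ?i t * (\<omega> t / ennreal (L / 2 ^ n / 2))) \<le> 1"
      by (rule time_unique_step[OF _ _ c \<eta> _ ineq b zero Suc \<phi>]) (use L in auto)
    then show ?case by (simp add: mult.commute)
  qed (use start in simp)
  let ?X = "tmod (\<lambda>t. ?i t * (\<omega> t / ennreal L))"
  have X: "?X \<le> ennreal ((1/2) ^ n)" for n
  proof -
    have "?X = tmod (\<lambda>t. (?i t * (\<omega> t / ennreal (L / 2 ^ n))) / ennreal (2 ^ n))"
    proof -
      have "\<omega> t / ennreal L = (\<omega> t / ennreal (L / 2 ^ n)) / ennreal (2 ^ n)" for t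
        using L by (simp add: ennreal_divide_real ennreal_mult_mult del: ennreal_power)
      then show ?thesis by (simp only: ennreal_times_divide)
    qed
    also have "\<dots> \<le> tmod (\<lambda>t. ?i t * (\<omega> t / ennreal (L / 2 ^ n))) / ennreal (2 ^ n)"
      by (intro tmod_divide_le) auto
    also have "\<dots> \<le> 1 / ennreal (2 ^ n)" by (intro divide_right_mono_ennreal half)
    also have "\<dots> = ennreal ((1/2) ^ n)"
      by (simp add: ennreal_divide_real power_divide del: ennreal_power)
    finally show ?thesis .
  qed
  have "(\<lambda>n. ennreal ((1/2) ^ n)) \<longlonglongrightarrow> ennreal 0"
    by (intro tendsto_ennrealI LIMSEQ_realpow_zero) auto
  then have "?X \<le> ennreal 0" by (rule LIMSEQ_le_const) (use X in blast)
  then have "?X = 0" by simp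
  then have "AE t in lborel. indicator {0<..<T} t * epow (?i t * (\<omega> t / ennreal L)) (1 / g t) = 0"
    unfolding tmod_def by (subst (asm) nn_integral_0_iff_AE) auto
  then show ?thesis
    using zero AE_lborel_singleton[of b]
  proof eventually_elim
    case (elim t)
    show ?case
    proof (cases "b < t \<and> t < b'")
      case True
      then have "\<omega> t / ennreal L = 0" using elim(1) b by auto
      then show ?thesis by (simp add: divide_ennreal_def ennreal_inverse_eq_0_iff)
    qed (use elim in auto)
  qed
qed

text \<open>The modular of \<open>\<phi>\<close> is finite though possibly large, so by dominated
  convergence its restriction to a short interval beyond any time falls below the threshold set by
  \<open>\<eta>\<close>. The lower bound on \<open>g\<close> keeps the exponents bounded, whence
  \<open>\<phi> / \<eta>\<close> still has finite modular.\<close>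

lemma time_unique:
  assumes [measurable]: "\<omega> \<in> borel_measurable borel" "\<phi> \<in> borel_measurable borel"
    and c: "0 < c"
    and ineq: "AE t in lborel. 0 < t \<and> t < T \<longrightarrow>
       \<omega> t \<le> ennreal c * (\<integral>\<^sup>+s. indicator {0<..<t} s * (ennreal (\<bar>t - s\<bar> powr - a) * (\<omega> s * \<phi> s)) \<partial>lborel)"
    and \<omega>: "tmod \<omega> < \<infinity>" and \<phi>: "tmod \<phi> < \<infinity>"
    and \<gamma>: "0 < \<gamma>" "\<And>t. 0 < t \<Longrightarrow> t < T \<Longrightarrow> \<gamma> \<le> g t"
  shows "AE t in lborel. 0 < t \<and> t < T \<longrightarrow> \<omega> t = 0"
proof -
  define \<eta> where "\<eta> = min 1 (1 / (2 * c * K))"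
  have \<eta>: "0 < \<eta>" "\<eta> \<le> 1" using c K by (auto simp: \<eta>_def)
  have "\<eta> * (2 * c * K) \<le> 1 / (2 * c * K) * (2 * c * K)"
    using c K by (intro mult_right_mono) (auto simp: \<eta>_def)
  then have \<eta>c: "2 * c * \<eta> * K \<le> 1" using c K by (simp add: mult_ac)
  let ?h = "\<lambda>t. indicator {0<..<T} t * epow (\<phi> t / ennreal \<eta>) (1 / g t)"
  have fin: "(\<integral>\<^sup>+t. ?h t \<partial>lborel) < \<infinity>"
  proof -
    have "(\<integral>\<^sup>+t. ?h t \<partial>lborel) \<le> (\<integral>\<^sup>+t. ennreal ((1 / \<eta>) powr (1 / \<gamma>)) * (indicator {0<..<T} t * epow (\<phi> t) (1 / g t)) \<partial>lborel)"
    proof (rule nn_integral_mono)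
      fix t
      show "?h t \<le> ennreal ((1 / \<eta>) powr (1 / \<gamma>)) * (indicator {0<..<T} t * epow (\<phi> t) (1 / g t))"
      proof (cases "t \<in> {0<..<T}")
        case True
        have "(1 / \<eta>) powr (1 / g t) \<le> (1 / \<eta>) powr (1 / \<gamma>)"
          using \<eta> \<gamma> True by (intro powr_mono divide_left_mono) (auto intro!: mult_pos_pos g_pos)
        then have "epow (inverse (ennreal \<eta>)) (1 / g t) \<le> ennreal ((1 / \<eta>) powr (1 / \<gamma>))"
          using \<eta> by (simp add: inverse_ennreal epow_ennreal divide_inverse ennreal_leI)
        then show ?thesis using True
          by (simp add: divide_ennreal_def epow_mult mult.commute mult_left_mono)
      qed simp
    qed
    also have "\<dots> = ennreal ((1 / \<eta>) powr (1 / \<gamma>)) * tmod \<phi>" unfolding tmod_def by (rule nn_integral_cmult) measurable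
    also have "\<dots> < \<infinity>" using \<phi> by (simp add: ennreal_mult_less_top)
    finally show ?thesis .
  qed
  define S where "S = {b. 0 \<le> b \<and> b \<le> T \<and> (AE t in lborel. 0 < t \<and> t < b \<longrightarrow> \<omega> t = 0)}"
  have S0: "0 \<in> S" using T by (auto simp: S_def)
  have bdd: "bdd_above S" by (auto simp: S_def)
  define B where "B = Sup S"
  have B: "0 \<le> B" "B \<le> T" unfolding B_def using S0 bdd by (auto intro!: cSup_upper cSup_least simp: S_def)
  \<comment> \<open>The supremum is attained, because countably many elements of \<open>S\<close>
    approach it and a countable union of null sets is null.\<close>
  have BS: "B \<in> S"
  proof -
    have "\<exists>b\<in>S. B - 1 / real (Suc n) < b" for n
      using less_cSupD[of S "B - 1 / real (Suc n)"] S0 unfolding B_def by auto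
    then obtain b where b: "\<And>n. b n \<in> S" "\<And>n. B - 1 / real (Suc n) < b n" by metis
    have "AE t in lborel. \<forall>n. 0 < t \<and> t < b n \<longrightarrow> \<omega> t = 0"
      using b(1) by (subst AE_all_countable) (auto simp: S_def)
    then have "AE t in lborel. 0 < t \<and> t < B \<longrightarrow> \<omega> t = 0"
    proof eventually_elim
      case (elim t)
      show ?case
      proof safe
        assume t: "0 < t" "t < B"
        then obtain n where "1 / real (Suc n) < B - t" using reals_Archimedean[of "B - t"] by (auto simp: inverse_eq_divide)
        then have "t < b n" using b(2)[of n] by linarith
        then show "\<omega> t = 0" using elim t by blast
      qed
    qed
    then show ?thesis using B by (simp add: S_def)
  qed
  have "B = T"
  proof (rule ccontr)
    assume "B \<noteq> T"
    then have BT: "B < T" using B by simp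
    define d where "d n = (T - B) / real (Suc n)" for n
    have d: "0 < d n" "d n \<le> T - B" for n
      using BT divide_left_mono[of 1 "real (Suc n)" "T - B"] by (auto simp: d_def)
    have "(\<lambda>n. \<integral>\<^sup>+t. ?h t * indicator {B<..<B + d n} t \<partial>lborel) \<longlonglongrightarrow> (\<integral>\<^sup>+t. 0 \<partial>(lborel::real measure))"
    proof (rule nn_integral_dominated_convergence[where w = ?h])
      show "AE t in lborel. (\<lambda>n. ?h t * indicator {B<..<B + d n} t) \<longlonglongrightarrow> 0"
      proof (intro AE_I2)
        fix t
        have "d \<longlonglongrightarrow> 0" unfolding d_def using LIMSEQ_Suc[OF tendsto_divide_0[OF tendsto_const filterlim_real_sequentially[THEN filterlim_at_top_imp_at_infinity]]] .
        have "eventually (\<lambda>n. ?h t * indicator {B<..<B + d n} t = 0) sequentially"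
        proof (cases "B < t")
          case True
          then have "eventually (\<lambda>n. d n < t - B) sequentially"
            using order_tendstoD(2)[OF \<open>d \<longlonglongrightarrow> 0\<close>, of "t - B"] by simp
          then show ?thesis by eventually_elim auto
        qed auto
        then show "(\<lambda>n. ?h t * indicator {B<..<B + d n} t) \<longlonglongrightarrow> 0" by (rule tendsto_eventually)
      qed
    qed (use fin in \<open>auto split: split_indicator\<close>)
    then have "eventually (\<lambda>n. (\<integral>\<^sup>+t. ?h t * indicator {B<..<B + d n} t \<partial>lborel) < 1) sequentially"
      by (rule order_tendstoD) simp
    then obtain n where n: "(\<integral>\<^sup>+t. ?h t * indicator {B<..<B + d n} t \<partial>lborel) < 1"
      unfolding eventually_sequentially by blast
    have "tmod (\<lambda>t. indicator {B<..<B + d n} t * (\<phi> t / ennreal \<eta>)) = (\<integral>\<^sup>+t. ?h t * indicator {B<..<B + d n} t \<partial>lborel)"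
      unfolding tmod_def by (intro nn_integral_cong) (auto split: split_indicator)
    then have small: "tmod (\<lambda>t. indicator {B<..<B + d n} t * (\<phi> t / ennreal \<eta>)) \<le> 1" using n by simp
    have zero: "AE t in lborel. 0 < t \<and> t < B \<longrightarrow> \<omega> t = 0" using BS by (simp add: S_def)
    have le: "B + d n \<le> T" using d[of n] by simp
    have "AE t in lborel. 0 < t \<and> t < B + d n \<longrightarrow> \<omega> t = 0"
      by (rule time_unique_interval[OF assms(1,2) c \<eta>(1) \<eta>c ineq B(1) le zero \<omega> small])
    then have "B + d n \<in> S" using B d[of n] le by (simp add: S_def)
    then have "B + d n \<le> B" using cSup_upper[OF _ bdd] unfolding B_def by blast
    then show False using d[of n] by simp
  qed
  then show ?thesis using BS by (simp add: S_def)
qed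

end

section \<open>The variable exponent in space\<close>

lemma ennreal_divide_divide: "0 < r \<Longrightarrow> 0 < s \<Longrightarrow> x / ennreal r / ennreal s = x / ennreal (r * s)"
  by (simp add: ennreal_divide_real ennreal_mult_mult mult.commute[of s r])

section \<open>Borel representatives of Lebesgue measurable functions\<close>

lemma borel_measurable_lebesgue_on:
  fixes S :: "'a::euclidean_space set"
  assumes "f \<in> borel_measurable borel"
  shows "f \<in> borel_measurable (lebesgue_on S)"
  using assms by (intro measurable_restrict_space1 measurable_completion) simp

lemma lebesgue_on_borel_representative_real:
  fixes f :: "'a::euclidean_space \<Rightarrow> real"
  assumes f: "f \<in> borel_measurable (lebesgue_on S)" and S: "S \<in> sets borel"
  shows "\<exists>f'\<in>borel_measurable borel. AE x in lborel. x \<in> S \<longrightarrow> f x = f' x"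
proof -
  have "(\<lambda>x. if x \<in> S then f x else 0) \<in> borel_measurable lebesgue"
    using f S by (intro borel_measurable_if_I) auto
  then obtain f' where "f' \<in> borel_measurable lborel" "AE x in lborel. (if x \<in> S then f x else 0) = f' x"
    using completion_ex_borel_measurable_real by blast
  then show ?thesis by (intro bexI[of _ f']) (auto elim!: eventually_mono)
qed

lemma lebesgue_on_borel_representative_vec:
  fixes f :: "'a::euclidean_space \<Rightarrow> real^'n"
  assumes f: "f \<in> borel_measurable (lebesgue_on S)" and S: "S \<in> sets borel"
  shows "\<exists>f'\<in>borel_measurable borel. AE x in lborel. x \<in> S \<longrightarrow> f x = f' x"
proof -
  have "\<exists>f'\<in>borel_measurable borel. AE x in lborel. x \<in> S \<longrightarrow> f x $ i = f' x" for i
    using f S by (intro lebesgue_on_borel_representative_real) measurable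
  then obtain f' where f': "\<And>i. f' i \<in> borel_measurable borel" "\<And>i. AE x in lborel. x \<in> S \<longrightarrow> f x $ i = f' i x"
    by metis
  show ?thesis
  proof (rule bexI)
    have "AE x in lborel. \<forall>i\<in>UNIV. x \<in> S \<longrightarrow> f x $ i = f' i x"
      using f'(2) by (intro AE_finite_allI) auto
    then show "AE x in lborel. x \<in> S \<longrightarrow> f x = (\<chi> i. f' i x)"
      by eventually_elim (auto simp: vec_eq_iff)
  next
    show "(\<lambda>x. \<chi> i. f' i x) \<in> borel_measurable borel" using f'(1) by measurable
  qed
qed

lemma AE_lebesgue_on_iff:
  fixes S :: "'a::euclidean_space set"
  assumes "S \<in> sets borel"
  shows "(AE x in lebesgue_on S. P x) \<longleftrightarrow> (AE x in lborel. x \<in> S \<longrightarrow> P x)"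
  using assms by (subst AE_restrict_space_iff) (auto simp: AE_completion_iff)

lemma nn_integral_lebesgue_on:
  fixes S :: "'a::euclidean_space set"
  assumes "S \<in> sets borel"
  shows "(\<integral>\<^sup>+x. f x \<partial>lebesgue_on S) = (\<integral>\<^sup>+x. indicator S x * f x \<partial>lborel)"
  using assms by (subst nn_integral_restrict_space) (auto simp: nn_integral_completion mult.commute)

text \<open>\<open>qr\<close> is a real Borel representative of \<open>q\<close> whose values lie in
  [m, M] everywhere, so that powers with exponent \<open>qr x\<close> obey pointwise bounds. The
  condition \<open>decay\<close> is one-sided because 1/qr is at least 1/M.\<close>

locale space_setting =
  fixes q :: "real^3 \<Rightarrow> ennreal" and qr :: "real^3 \<Rightarrow> real" and m M cq :: real
  assumes qr_measurable [measurable]: "qr \<in> borel_measurable borel"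
    and m: "2 < m" "m \<le> M" and cq: "0 < cq"
    and qr: "\<And>x. m \<le> qr x" "\<And>x. qr x \<le> M"
    and q_qr: "AE x in lborel. q x = ennreal (qr x)"
    and decay: "AE x in lborel. 1 / qr x - 1 / M \<le> cq / ln (exp 1 + norm x)"
begin

definition qmod :: "(real^3 \<Rightarrow> ennreal) \<Rightarrow> ennreal" where
  "qmod B = (\<integral>\<^sup>+x. epow (B x) (qr x) \<partial>lborel)"

lemma qr_ge: "0 \<le> qr x" "1 \<le> qr x" "0 < qr x"
  using qr(1)[of x] m by auto

lemma qmod_mono: "(\<And>x. B x \<le> B' x) \<Longrightarrow> qmod B \<le> qmod B'"
  unfolding qmod_def by (intro nn_integral_mono epow_mono qr_ge)

lemma modular_eq_qmod: "modular UNIV q v = qmod (\<lambda>x. ennreal (norm (v x)))"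
proof -
  have "modular UNIV q v = (\<integral>\<^sup>+x. omega (q x) (norm (v x)) \<partial>lborel)"
    unfolding modular_def by (subst nn_integral_lebesgue_on) auto
  also have "\<dots> = qmod (\<lambda>x. ennreal (norm (v x)))"
    unfolding qmod_def
  proof (rule nn_integral_cong_AE)
    show "AE x in lborel. omega (q x) (norm (v x)) = epow (ennreal (norm (v x))) (qr x)"
      using q_qr
    proof eventually_elim
      case (elim x)
      then show ?case using qr_ge[of x] by (simp add: omega_def epow_ennreal)
    qed
  qed
  finally show ?thesis .
qed

lemma modular_scale: "0 < c \<Longrightarrow> modular UNIV q (\<lambda>x. v x /\<^sub>R c) = qmod (\<lambda>x. ennreal (norm (v x)) / ennreal c)"
  by (simp add: modular_eq_qmod divide_ennreal divide_inverse mult.commute)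

lemma qmod_divide_le:
  assumes [measurable]: "B \<in> borel_measurable borel" and k: "1 \<le> k"
  shows "qmod (\<lambda>x. B x / ennreal k) \<le> qmod B / ennreal k"
proof -
  have "qmod (\<lambda>x. B x / ennreal k) \<le> (\<integral>\<^sup>+x. epow (B x) (qr x) / ennreal k \<partial>lborel)"
    unfolding qmod_def by (intro nn_integral_mono epow_divide_const_le k qr_ge)
  also have "\<dots> = qmod B / ennreal k" unfolding qmod_def by (rule nn_integral_divide) measurable
  finally show ?thesis .
qed

lemma bdd_below_norm_set: "bdd_below {c. 0 < c \<and> P c}" for P :: "real \<Rightarrow> bool"
  by (rule bdd_belowI[of _ 0]) auto

lemma var_norm_le:
  assumes "0 < c" "qmod (\<lambda>x. ennreal (norm (v x)) / ennreal c) \<le> 1"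
  shows "var_norm UNIV q v \<le> c"
  unfolding var_norm_def using assms by (intro cInf_lower bdd_below_norm_set) (auto simp: modular_scale)

text \<open>The infimum of the empty set of reals is an unspecified number, so a norm carries
  information only once an admissible scale exists. One is obtained by dividing by the maximum of 1
  and the finite modular, since the exponents are at least 1.\<close>

lemma var_norm_set_nonempty:
  fixes v :: "real^3 \<Rightarrow> real^3"
  assumes v: "v \<in> var_Lebesgue UNIV q"
  shows "{c. 0 < c \<and> modular UNIV q (\<lambda>x. v x /\<^sub>R c) \<le> 1} \<noteq> {}"
proof -
  obtain c where c: "0 < c" "modular UNIV q (\<lambda>x. c *\<^sub>R v x) < \<infinity>" using v by (auto simp: var_Lebesgue_def)
  have "v \<in> borel_measurable (lebesgue_on UNIV)" using v by (simp add: var_Lebesgue_def)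
  then obtain v' where [measurable]: "v' \<in> borel_measurable borel" and v': "AE x in lborel. v x = v' x"
    using lebesgue_on_borel_representative_vec[of v UNIV] by auto
  obtain w where w: "modular UNIV q (\<lambda>x. c *\<^sub>R v x) = ennreal w" "0 \<le> w"
    using c by (cases "modular UNIV q (\<lambda>x. c *\<^sub>R v x)") auto
  define k where "k = max 1 w"
  have k: "1 \<le> k" "w \<le> k" by (auto simp: k_def)
  have e: "(v x /\<^sub>R (k / c)) = (c *\<^sub>R v x) /\<^sub>R k" for x using c k by (simp add: field_simps)
  have "modular UNIV q (\<lambda>x. v x /\<^sub>R (k / c)) = qmod (\<lambda>x. ennreal (norm (c *\<^sub>R v x)) / ennreal k)"
    unfolding e using k by (intro modular_scale) simp
  also have "\<dots> = qmod (\<lambda>x. ennreal (norm (c *\<^sub>R v' x)) / ennreal k)"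
    unfolding qmod_def using v' by (intro nn_integral_cong_AE) (auto elim!: eventually_mono)
  also have "\<dots> \<le> qmod (\<lambda>x. ennreal (norm (c *\<^sub>R v' x))) / ennreal k"
    using k by (intro qmod_divide_le) auto
  also have "qmod (\<lambda>x. ennreal (norm (c *\<^sub>R v' x))) = modular UNIV q (\<lambda>x. c *\<^sub>R v x)"
    unfolding modular_eq_qmod qmod_def using v' by (intro nn_integral_cong_AE) (auto elim!: eventually_mono)
  also have "\<dots> / ennreal k \<le> ennreal k / ennreal k"
    unfolding w using k by (intro divide_right_mono_ennreal ennreal_leI)
  also have "\<dots> = 1" using k by (simp add: divide_ennreal)
  finally have "modular UNIV q (\<lambda>x. v x /\<^sub>R (k / c)) \<le> 1" .
  moreover have "0 < k / c" using k c by simp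
  ultimately show ?thesis by blast
qed

lemma var_norm_nonneg:
  fixes v :: "real^3 \<Rightarrow> real^3"
  assumes v: "v \<in> var_Lebesgue UNIV q"
  shows "0 \<le> var_norm UNIV q v"
  unfolding var_norm_def by (rule cInf_greatest[OF var_norm_set_nonempty[OF v]]) auto

lemma qmod_le_of_var_norm_less:
  fixes v :: "real^3 \<Rightarrow> real^3"
  assumes v: "v \<in> var_Lebesgue UNIV q" and c: "var_norm UNIV q v < c"
  shows "qmod (\<lambda>x. ennreal (norm (v x)) / ennreal c) \<le> 1"
proof -
  obtain d where d: "0 < d" "d < c" "modular UNIV q (\<lambda>x. v x /\<^sub>R d) \<le> 1"
    using cInf_lessD[OF var_norm_set_nonempty[OF v]] c unfolding var_norm_def by auto
  have "qmod (\<lambda>x. ennreal (norm (v x)) / ennreal c) \<le> qmod (\<lambda>x. ennreal (norm (v x)) / ennreal d)"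
    using d by (intro qmod_mono) (auto simp: divide_ennreal intro!: ennreal_leI divide_left_mono)
  also have "\<dots> \<le> 1" using d by (simp add: modular_scale)
  finally show ?thesis .
qed

lemma var_LebesgueI:
  fixes v :: "real^3 \<Rightarrow> real^3"
  assumes [measurable]: "v \<in> borel_measurable borel" and c: "0 < c" "qmod (\<lambda>x. ennreal (norm (v x)) / ennreal c) \<le> 1"
  shows "v \<in> var_Lebesgue UNIV q"
proof -
  have "v \<in> borel_measurable (lebesgue_on UNIV)" by (rule borel_measurable_lebesgue_on) measurable
  moreover have "modular UNIV q (\<lambda>x. (1 / c) *\<^sub>R v x) < \<infinity>"
  proof -
    have "modular UNIV q (\<lambda>x. (1 / c) *\<^sub>R v x) = modular UNIV q (\<lambda>x. v x /\<^sub>R c)"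
      by (simp add: inverse_eq_divide)
    also have "\<dots> \<le> 1" using c by (simp add: modular_scale)
    finally show ?thesis by (rule le_less_trans) simp
  qed
  ultimately show ?thesis using c unfolding var_Lebesgue_def by (auto intro!: exI[of _ "1 / c"])
qed

text \<open>Below 1 the larger exponent gives the smaller power, above 1 the smaller exponent does.
  In both cases one of the two end-point powers lies below the power with the intermediate exponent
  \<open>qr x\<close>.\<close>

lemma sum_modular_le_qmod: "sum_modular m M B \<le> qmod B"
  unfolding sum_modular_def qmod_def
proof (rule nn_integral_mono)
  fix x
  show "min (epow (B x) m) (epow (B x) M) \<le> epow (B x) (qr x)"
  proof (cases "B x")
    case (real b)
    show ?thesis
    proof (cases "b \<le> 1")
      case True
      then have "b powr M \<le> b powr (qr x)" using real qr[of x] by (intro powr_mono') auto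
      then show ?thesis using real by (auto simp: epow_ennreal intro!: min.coboundedI2 ennreal_leI)
    next
      case False
      then have "b powr m \<le> b powr (qr x)" using qr[of x] by (intro powr_mono) auto
      then show ?thesis using real by (auto simp: epow_ennreal intro!: min.coboundedI1 ennreal_leI)
    qed
  qed simp
qed

lemma qmod_add:
  assumes [measurable]: "A \<in> borel_measurable borel" "B \<in> borel_measurable borel"
    and A: "qmod (\<lambda>x. A x / a) \<le> 1" and B: "qmod (\<lambda>x. B x / b) \<le> 1"
  shows "qmod (\<lambda>x. (A x + B x) / (a + b) / ennreal 2) \<le> 1"
proof -
  have "qmod (\<lambda>x. (A x + B x) / (a + b)) \<le> (\<integral>\<^sup>+x. epow (A x / a) (qr x) + epow (B x / b) (qr x) \<partial>lborel)"
    unfolding qmod_def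
  proof (rule nn_integral_mono)
    fix x
    have "epow ((A x + B x) / (a + b)) (qr x) \<le> epow (max (A x / a) (B x / b)) (qr x)"
      by (intro epow_mono ennreal_mediant_le_max qr_ge)
    also have "\<dots> \<le> epow (A x / a) (qr x) + epow (B x / b) (qr x)" by (cases "A x / a \<le> B x / b") (auto simp: max_def)
    finally show "epow ((A x + B x) / (a + b)) (qr x) \<le> epow (A x / a) (qr x) + epow (B x / b) (qr x)" .
  qed
  also have "\<dots> = qmod (\<lambda>x. A x / a) + qmod (\<lambda>x. B x / b)" unfolding qmod_def by (rule nn_integral_add) measurable
  also have "\<dots> \<le> 1 + 1" by (intro add_mono A B)
  also have "\<dots> = ennreal 2" by simp
  finally have le: "qmod (\<lambda>x. (A x + B x) / (a + b)) \<le> ennreal 2" .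
  have "qmod (\<lambda>x. (A x + B x) / (a + b) / ennreal 2) \<le> qmod (\<lambda>x. (A x + B x) / (a + b)) / ennreal 2"
    by (intro qmod_divide_le) auto
  also have "\<dots> \<le> ennreal 2 / ennreal 2" by (intro divide_right_mono_ennreal le)
  also have "\<dots> = 1" by (simp add: divide_ennreal)
  finally show ?thesis .
qed

text \<open>The power 4 exceeds the dimension; it is shared among the three coordinates as 4/3 >
  1.\<close>

lemma nn_integral_decay_finite: "(\<integral>\<^sup>+x. ennreal ((exp 1 + norm (x::real^3)) powr - 4) \<partial>lborel) < \<infinity>"
proof -
  have "(\<integral>\<^sup>+x. ennreal ((exp 1 + norm (x::real^3)) powr - 4) \<partial>lborel) \<le>
      (\<integral>\<^sup>+x. (\<Prod>b\<in>(Basis::(real^3) set). ennreal ((1 + \<bar>x \<bullet> b\<bar>) powr - (4/3))) \<partial>lborel)"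
  proof (rule nn_integral_mono)
    fix x :: "real^3"
    have e: "(1::real) \<le> exp 1" by simp
    have "exp 1 + norm x \<noteq> 0" using e norm_ge_zero[of x] by linarith
    then have "(exp 1 + norm x) powr - 4 = (\<Prod>b\<in>(Basis::(real^3) set). (exp 1 + norm x) powr - (4/3))"
      using powr_power[of "exp 1 + norm x" "- (4/3)" 3] by (simp add: DIM_cart)
    also have "\<dots> \<le> (\<Prod>b\<in>Basis. (1 + \<bar>x \<bullet> b\<bar>) powr - (4/3))"
      using e Basis_le_norm[of _ x] by (intro prod_mono) (auto intro!: powr_mono2' add_mono)
    finally show "ennreal ((exp 1 + norm x) powr - 4) \<le> (\<Prod>b\<in>Basis. ennreal ((1 + \<bar>x \<bullet> b\<bar>) powr - (4/3)))"
      by (subst prod_ennreal) (auto intro: ennreal_leI)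
  qed
  also have "\<dots> = (\<Prod>b\<in>(Basis::(real^3) set). \<integral>\<^sup>+y. ennreal ((1 + \<bar>y\<bar>) powr - (4/3)) \<partial>lborel)"
    by (rule nn_integral_lborel_prod) auto
  also have "\<dots> < \<infinity>"
    using nn_integral_one_plus_abs_powr_finite[of "4/3"] by (simp add: power_less_top_ennreal)
  finally show ?thesis .
qed

text \<open>Since \<open>qr \<le> M\<close> and \<open>1 / qr - 1 / M\<close> decays logarithmically, constants have finite
  modular for the exponent \<open>1 / (1 / qr - 1 / M)\<close>, so \<open>L\<^sup>M\<close> embeds into the variable space.\<close>

lemma power_embeds:
  obtains \<Lambda> where "1 \<le> \<Lambda>"
    "\<And>B \<psi>. B \<in> borel_measurable borel \<Longrightarrow> 0 < \<psi> \<Longrightarrow> (\<integral>\<^sup>+x. epow (B x) M \<partial>lborel) \<le> epow (ennreal \<psi>) M \<Longrightarrow>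
       qmod (\<lambda>x. B x / ennreal (\<Lambda> * \<psi>)) \<le> 1"
proof -
  have M: "0 < M" using m by simp
  obtain C where C: "(\<integral>\<^sup>+x. ennreal ((exp 1 + norm (x::real^3)) powr - 4) \<partial>lborel) = ennreal C" "0 \<le> C"
    using nn_integral_decay_finite by (cases "\<integral>\<^sup>+x. ennreal ((exp 1 + norm (x::real^3)) powr - 4) \<partial>lborel") auto
  \<comment> \<open>With 1/s = 1/qr - 1/M the decay condition gives ln (e + |x|) \<le> cq s, so this
    choice makes l^(-s) at most (e + |x|)^(-4), which is integrable.\<close>
  define l where "l = exp (4 * cq)"
  define \<Lambda> where "\<Lambda> = l * (1 + C)"
  have l: "1 \<le> l" using cq by (simp add: l_def)
  have \<Lambda>: "1 \<le> \<Lambda>" unfolding \<Lambda>_def using l C mult_mono[of 1 l 1 "1 + C"] by simp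
  have "qmod (\<lambda>x. B x / ennreal (\<Lambda> * \<psi>)) \<le> 1"
    if [measurable]: "B \<in> borel_measurable borel" and \<psi>: "0 < \<psi>"
      and B: "(\<integral>\<^sup>+x. epow (B x) M \<partial>lborel) \<le> epow (ennreal \<psi>) M" for B \<psi>
  proof -
    define z where "z x = B x / ennreal \<psi>" for x
    have [measurable]: "z \<in> borel_measurable borel" unfolding z_def[abs_def] by measurable
    have "(\<integral>\<^sup>+x. epow (z x) M \<partial>lborel) = (\<integral>\<^sup>+x. epow (B x) M \<partial>lborel) / epow (ennreal \<psi>) M"
      unfolding z_def epow_divide by (rule nn_integral_divide) measurable
    also have "\<dots> \<le> epow (ennreal \<psi>) M / epow (ennreal \<psi>) M" by (intro divide_right_mono_ennreal B)
    also have "\<dots> = 1" using \<psi> by (simp add: epow_ennreal divide_ennreal)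
    finally have z: "(\<integral>\<^sup>+x. epow (z x) M \<partial>lborel) \<le> 1" .
    have "qmod (\<lambda>x. z x / ennreal l) \<le> (\<integral>\<^sup>+x. epow (z x) M + ennreal ((exp 1 + norm x) powr - 4) \<partial>lborel)"
      unfolding qmod_def
    proof (rule nn_integral_mono_AE)
      show "AE x in lborel. epow (z x / ennreal l) (qr x) \<le> epow (z x) M + ennreal ((exp 1 + norm x) powr - 4)"
        using decay
      proof eventually_elim
        case (elim x)
        show ?case
        proof (cases "qr x = M")
          case True
          have "epow (z x / ennreal l) M \<le> epow (z x) M"
          proof -
            have "epow (z x / ennreal l) M \<le> epow (z x) M / ennreal l"
              using l m by (intro epow_divide_const_le) auto
            also have "\<dots> = ennreal (1 / l) * epow (z x) M" using l by (simp add: ennreal_divide_real)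
            also have "\<dots> \<le> ennreal 1 * epow (z x) M" using l by (intro mult_right_mono ennreal_leI) auto
            finally show ?thesis by simp
          qed
          then show ?thesis using True by (simp add: add_increasing2)
        next
          case False
          then have qM: "qr x < M" using qr[of x] by simp
          \<comment> \<open>Young's inequality is used with the weights qr/M and qr/s, whose sum is
            1: exponent \<open>M\<close> for \<open>z\<close>, exponent \<open>s\<close> for the
            constant \<open>1 / l\<close>.\<close>
          define \<theta> where "\<theta> = qr x / M"
          have \<theta>: "0 < \<theta>" "\<theta> < 1" using qM qr_ge[of x] M by (auto simp: \<theta>_def)
          define s where "s = qr x / (1 - \<theta>)"
          have s: "1 / s = 1 / qr x - 1 / M" "0 < s"
            using \<theta> qr_ge[of x] M by (auto simp: s_def \<theta>_def field_simps)
          have "1 / s \<le> cq / ln (exp 1 + norm x)" using elim s by simp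
          moreover have lnp: "0 < ln (exp 1 + norm x)"
          proof -
            have "1 < exp (1::real)" by simp
            then have "1 < exp 1 + norm x" using norm_ge_zero[of x] by linarith
            then show ?thesis by simp
          qed
          ultimately have "ln (exp 1 + norm x) \<le> cq * s" using s(2) by (simp add: field_simps)
          then have ls: "l powr - s \<le> (exp 1 + norm x) powr - 4"
            by (simp add: l_def powr_def mult.commute add_pos_nonneg)
               (smt (verit, best) exp_gt_zero norm_ge_zero)
          have "epow (z x / ennreal l) (qr x) = epow (epow (z x) M) \<theta> * epow (ennreal (l powr - s)) (1 - \<theta>)"
          proof -
            have "epow (z x / ennreal l) (qr x) = epow (z x) (qr x) * ennreal (inverse l powr qr x)"
              using l by (simp add: divide_ennreal_def epow_mult inverse_ennreal epow_ennreal)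
            moreover have "inverse l powr qr x = (l powr - s) powr (1 - \<theta>)"
              using \<theta> l by (simp add: s_def powr_powr inverse_powr powr_minus)
            ultimately show ?thesis using M by (simp add: epow_epow epow_ennreal \<theta>_def)
          qed
          also have "\<dots> \<le> ennreal \<theta> * epow (z x) M + ennreal (1 - \<theta>) * ennreal (l powr - s)"
            by (rule young_ennreal[OF \<theta>])
          also have "\<dots> \<le> ennreal 1 * epow (z x) M + ennreal 1 * ennreal ((exp 1 + norm x) powr - 4)"
            using \<theta> ls by (intro add_mono mult_mono ennreal_leI) auto
          finally show ?thesis by simp
        qed
      qed
    qed
    also have "\<dots> = (\<integral>\<^sup>+x. epow (z x) M \<partial>lborel) + (\<integral>\<^sup>+x. ennreal ((exp 1 + norm (x::real^3)) powr - 4) \<partial>lborel)"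
      by (rule nn_integral_add) measurable
    also have "\<dots> \<le> ennreal 1 + ennreal C" unfolding C using z by (intro add_mono) auto
    also have "\<dots> = ennreal (1 + C)" using C by simp
    finally have le: "qmod (\<lambda>x. z x / ennreal l) \<le> ennreal (1 + C)" .
    have "qmod (\<lambda>x. B x / ennreal (\<Lambda> * \<psi>)) = qmod (\<lambda>x. z x / ennreal l / ennreal (1 + C))"
      using \<psi> l C unfolding qmod_def z_def \<Lambda>_def
      by (intro nn_integral_cong) (simp add: ennreal_divide_divide mult_ac del: ennreal_plus)
    also have "\<dots> \<le> qmod (\<lambda>x. z x / ennreal l) / ennreal (1 + C)" using C by (intro qmod_divide_le) auto
    also have "\<dots> \<le> ennreal (1 + C) / ennreal (1 + C)" by (intro divide_right_mono_ennreal le)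
    also have "\<dots> = 1" using C by (simp add: divide_ennreal)
    finally show ?thesis .
  qed
  with \<Lambda> show ?thesis by (rule that)
qed

text \<open>The modular decreases in the scale, so strict sublevel sets of the norm are countable
  unions over rational scales. Times without any admissible scale are separated, since there the
  norm is the constant \<open>Inf {}\<close>.\<close>

lemma var_norm_measurable:
  fixes u :: "real \<times> (real^3) \<Rightarrow> real^3"
  assumes [measurable]: "u \<in> borel_measurable (borel \<Otimes>\<^sub>M borel)"
  shows "(\<lambda>t. var_norm UNIV q (\<lambda>x. u (t, x))) \<in> borel_measurable borel"
proof -
  define R where "R c t = qmod (\<lambda>x. ennreal (norm (u (t, x))) / ennreal c)" for c t
  have [measurable]: "R c \<in> borel_measurable borel" for c
    unfolding R_def[abs_def] qmod_def by measurable
  have Rmono: "R d t \<le> R c t" if "0 < c" "c \<le> d" for c d t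
    unfolding R_def using that by (intro qmod_mono) (auto simp: divide_ennreal intro!: ennreal_leI divide_left_mono)
  have S: "{c. 0 < c \<and> modular UNIV q (\<lambda>x. u (t, x) /\<^sub>R c) \<le> 1} = {c. 0 < c \<and> R c t \<le> 1}" for t
    by (auto simp: modular_scale R_def)
  have "(var_norm UNIV q (\<lambda>x. u (t, x)) < c) \<longleftrightarrow>
     (\<exists>d\<in>{d\<in>\<rat>. 0 < d \<and> d < c}. R d t \<le> 1) \<or> (\<not> (\<exists>d\<in>{d\<in>\<rat>. 0 < d}. R d t \<le> 1) \<and> Inf {} < c)" for t and c :: real
  proof (cases "\<exists>d>0. R d t \<le> 1")
    case True
    then obtain d0 where d0: "0 < d0" "R d0 t \<le> 1" by blast
    obtain r where r: "r \<in> \<rat>" "d0 < r" "r < d0 + 1" using Rats_dense_in_real[of d0 "d0 + 1"] by auto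
    then have "\<exists>d\<in>{d\<in>\<rat>. 0 < d}. R d t \<le> 1" using d0 Rmono[of d0 r t] by (intro bexI[of _ r]) auto
    moreover have "(var_norm UNIV q (\<lambda>x. u (t, x)) < c) \<longleftrightarrow> (\<exists>d\<in>{d\<in>\<rat>. 0 < d \<and> d < c}. R d t \<le> 1)"
    proof
      assume "var_norm UNIV q (\<lambda>x. u (t, x)) < c"
      then obtain d where d: "0 < d" "R d t \<le> 1" "d < c"
        unfolding var_norm_def S using cInf_lessD[of "{c. 0 < c \<and> R c t \<le> 1}" c] d0 by auto
      obtain r where r: "r \<in> \<rat>" "d < r" "r < c" using Rats_dense_in_real[OF d(3)] by auto
      then show "\<exists>d\<in>{d\<in>\<rat>. 0 < d \<and> d < c}. R d t \<le> 1" using d Rmono[of d r t] by (intro bexI[of _ r]) auto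
    next
      assume "\<exists>d\<in>{d\<in>\<rat>. 0 < d \<and> d < c}. R d t \<le> 1"
      then obtain d where d: "0 < d" "d < c" "R d t \<le> 1" by auto
      then have "var_norm UNIV q (\<lambda>x. u (t, x)) \<le> d" unfolding var_norm_def S by (intro cInf_lower bdd_below_norm_set) auto
      then show "var_norm UNIV q (\<lambda>x. u (t, x)) < c" using d by simp
    qed
    ultimately show ?thesis by blast
  next
    case False
    then have E: "{c. 0 < c \<and> R c t \<le> 1} = {}" by auto
    show ?thesis using False unfolding var_norm_def S E by auto
  qed
  moreover have "countable {d\<in>\<rat>. 0 < d \<and> d < c}" "countable {d\<in>\<rat>. 0 < d}" for c :: real
    by (auto intro: countable_subset[OF _ countable_rat])
  ultimately have "Measurable.pred borel (\<lambda>t. var_norm UNIV q (\<lambda>x. u (t, x)) < c)" for c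
    by (simp only:) measurable
  then show ?thesis by (subst borel_measurable_iff_less) (simp add: pred_def)
qed

end

section \<open>Existence and uniqueness of mild solutions\<close>

locale mild_setting = space_setting q qr m M cq + time_setting T K a g
  for q qr m M cq T K a g +
  fixes p :: "real \<Rightarrow> ennreal" and \<alpha> \<gamma> C Cb :: real
  assumes p_g: "AE t in lborel. 0 < t \<and> t < T \<longrightarrow> p t = ennreal (1 / g t)"
    and \<gamma>: "0 < \<gamma>" "\<And>t. 0 < t \<Longrightarrow> t < T \<Longrightarrow> \<gamma> \<le> g t"
    and C: "0 < C" and kernel: "\<And>t j h k x. 0 < t \<Longrightarrow> \<bar>oseen_kernel \<alpha> t j h k x\<bar> \<le> C * kernel_majorant \<alpha> t x"
    and Cb: "0 < Cb"
    and bil: "\<And>t U V \<phi> \<psi>. 0 < t \<Longrightarrow> t < T \<Longrightarrow>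
     U \<in> borel_measurable (borel \<Otimes>\<^sub>M borel) \<Longrightarrow> V \<in> borel_measurable (borel \<Otimes>\<^sub>M borel) \<Longrightarrow>
     \<phi> \<in> borel_measurable borel \<Longrightarrow> \<psi> \<in> borel_measurable borel \<Longrightarrow>
     (AE s in lborel. 0 < s \<and> s < T \<longrightarrow> sum_modular m M (\<lambda>x. U (s, x) / \<phi> s) \<le> 2 \<and>
         sum_modular m M (\<lambda>x. V (s, x) / \<psi> s) \<le> 2) \<Longrightarrow>
     (\<integral>\<^sup>+x. epow (majorant_op (27 * C) \<alpha> (\<lambda>z. U z * V z) (t, x)) M \<partial>lborel)
       \<le> epow (ennreal Cb * (\<integral>\<^sup>+s. indicator {0<..<t} s * (ennreal (\<bar>t - s\<bar> powr - a) * (\<phi> s * \<psi> s)) \<partial>lborel)) M"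
begin

abbreviation "maj \<equiv> majorant_op (27 * C) \<alpha>"

lemma M_pos: "0 < M" "0 < m" "1 < M"
  using m by auto

lemma epow_const_le:
  assumes "t \<in> {0<..<T}" "0 \<le> k"
  shows "epow (ennreal k) (1 / g t) \<le> ennreal (max 1 k powr (1 / \<gamma>))"
proof -
  have "k powr (1 / g t) \<le> max 1 k powr (1 / g t)" using assms g_pos(3)[of t] by (intro powr_mono2) auto
  also have "\<dots> \<le> max 1 k powr (1 / \<gamma>)"
    using \<gamma>(1) \<gamma>(2)[of t] assms by (intro powr_mono divide_left_mono) (auto intro!: mult_pos_pos g_pos)
  finally show ?thesis using assms by (simp add: epow_ennreal ennreal_leI)
qed

lemma tmod_cmult_finite:
  assumes [measurable]: "F \<in> borel_measurable borel" and F: "tmod F < \<infinity>" and k: "0 \<le> k"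
  shows "tmod (\<lambda>t. ennreal k * F t) < \<infinity>"
proof -
  have "tmod (\<lambda>t. ennreal k * F t) \<le> (\<integral>\<^sup>+t. ennreal (max 1 k powr (1 / \<gamma>)) * (indicator {0<..<T} t * epow (F t) (1 / g t)) \<partial>lborel)"
    unfolding tmod_def
    by (intro nn_integral_mono) (auto simp: epow_mult split: split_indicator intro!: mult_right_mono epow_const_le k)
  also have "\<dots> = ennreal (max 1 k powr (1 / \<gamma>)) * tmod F" unfolding tmod_def by (rule nn_integral_cmult) measurable
  also have "\<dots> < \<infinity>" using F by (simp add: ennreal_mult_less_top)
  finally show ?thesis .
qed

lemma tmod_add_finite:
  assumes [measurable]: "F \<in> borel_measurable borel" "G \<in> borel_measurable borel" and F: "tmod F < \<infinity>" "tmod G < \<infinity>"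
  shows "tmod (\<lambda>t. F t + G t) < \<infinity>"
proof -
  have "tmod (\<lambda>t. F t + G t) \<le> (\<integral>\<^sup>+t. ennreal (2 powr (1 / \<gamma>)) * (indicator {0<..<T} t * epow (F t) (1 / g t) +
      indicator {0<..<T} t * epow (G t) (1 / g t)) \<partial>lborel)"
    unfolding tmod_def
  proof (rule nn_integral_mono)
    fix t
    show "indicator {0<..<T} t * epow (F t + G t) (1 / g t) \<le> ennreal (2 powr (1 / \<gamma>)) *
       (indicator {0<..<T} t * epow (F t) (1 / g t) + indicator {0<..<T} t * epow (G t) (1 / g t))"
    proof (cases "t \<in> {0<..<T}")
      case True
      have "epow (F t + G t) (1 / g t) \<le> ennreal (2 powr (1 / g t)) * (epow (F t) (1 / g t) + epow (G t) (1 / g t))"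
        by (intro epow_plus_le g_pos True)
      also have "\<dots> \<le> ennreal (2 powr (1 / \<gamma>)) * (epow (F t) (1 / g t) + epow (G t) (1 / g t))"
        using epow_const_le[OF True, of 2] by (intro mult_right_mono) (auto simp: epow_2)
      finally show ?thesis using True by simp
    qed simp
  qed
  also have "\<dots> = ennreal (2 powr (1 / \<gamma>)) * (tmod F + tmod G)"
    unfolding tmod_def by (simp add: nn_integral_cmult nn_integral_add)
  also have "\<dots> < \<infinity>" using F by (simp add: ennreal_mult_less_top)
  finally show ?thesis .
qed

lemma tmod_const_finite:
  assumes "0 \<le> k"
  shows "tmod (\<lambda>t. ennreal k) < \<infinity>"
proof -
  have "tmod (\<lambda>t. 1) = ennreal T" unfolding tmod_def using T by simp
  then have "tmod (\<lambda>t. ennreal k * 1) < \<infinity>" using assms by (intro tmod_cmult_finite) auto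
  then show ?thesis by simp
qed

lemma tmod_finite_AE:
  assumes [measurable]: "F \<in> borel_measurable borel" and F: "tmod F < \<infinity>"
  shows "AE t in lborel. 0 < t \<and> t < T \<longrightarrow> F t < \<infinity>"
proof -
  have "AE t in lborel. indicator {0<..<T} t * epow (F t) (1 / g t) \<noteq> \<infinity>"
    by (rule nn_integral_noteq_infinite) (use F in \<open>auto simp: tmod_def\<close>)
  then show ?thesis by eventually_elim (auto simp: top.not_eq_extremum[symmetric] less_top[symmetric])
qed

lemma modular_time: "modular {0<..<T} p \<phi> = tmod (\<lambda>t. ennreal \<bar>\<phi> t\<bar>)" for \<phi> :: "real \<Rightarrow> real"
proof -
  have "modular {0<..<T} p \<phi> = (\<integral>\<^sup>+t. indicator {0<..<T} t * omega (p t) (norm (\<phi> t)) \<partial>lborel)"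
    unfolding modular_def by (subst nn_integral_lebesgue_on) auto
  also have "\<dots> = tmod (\<lambda>t. ennreal \<bar>\<phi> t\<bar>)"
    unfolding tmod_def
  proof (rule nn_integral_cong_AE)
    show "AE t in lborel. indicator {0<..<T} t * omega (p t) (norm (\<phi> t)) =
        indicator {0<..<T} t * epow (ennreal \<bar>\<phi> t\<bar>) (1 / g t)"
      using p_g
    proof eventually_elim
      case (elim t)
      show ?case
      proof (cases "t \<in> {0<..<T}")
        case True
        then show ?thesis using elim g_pos(3)[OF True] by (simp add: omega_def epow_ennreal)
      qed simp
    qed
  qed
  finally show ?thesis .
qed

lemma tmod_cong_AE:
  assumes "AE t in lborel. 0 < t \<and> t < T \<longrightarrow> F t = G t"
  shows "tmod F = tmod G"
  unfolding tmod_def using assms by (intro nn_integral_cong_AE) (auto elim!: eventually_mono split: split_indicator)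

lemma AE_slab:
  assumes "AE z in lborel. fst z \<in> {0<..<T} \<longrightarrow> Q (fst z) (snd z)"
  shows "AE t in lborel. 0 < t \<and> t < T \<longrightarrow> (AE x in (lborel :: (real^3) measure). Q t x)"
proof -
  have "AE z in lborel \<Otimes>\<^sub>M lborel. fst z \<in> {0<..<T} \<longrightarrow> Q (fst z) (snd z)"
    using assms by (simp only: lborel_prod)
  from lborel_pair.AE_pair[OF this]
  show ?thesis by (auto elim!: eventually_mono)
qed

lemma AE_slab_iff:
  fixes Q :: "real \<Rightarrow> real^3 \<Rightarrow> bool"
  shows "(AE z in slab T. (case z of (t, x) \<Rightarrow> Q t x)) \<longleftrightarrow> (AE z in lborel. fst z \<in> {0<..<T} \<longrightarrow> Q (fst z) (snd z))"
  by (subst AE_lebesgue_on_iff) (auto simp: case_prod_unfold mem_Times_iff intro!: borel_open open_Times)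

text \<open>The Borel function \<open>\<phi>\<close> stands for the norms of the slices. The modular
  bound is stated for all \<open>c > \<phi> t\<close>, because the infimum defining the norm yields
  admissible scales above it, while \<open>\<phi> t\<close> itself may be 0.\<close>

lemma mixed_representative:
  assumes u: "u \<in> mixed_Lebesgue T p q"
  obtains u' \<phi> where "u' \<in> borel_measurable (borel \<Otimes>\<^sub>M borel)" "\<phi> \<in> borel_measurable borel"
    "\<And>t. 0 \<le> \<phi> t"
    "AE z in lborel. fst z \<in> {0<..<T} \<longrightarrow> u (fst z) (snd z) = u' z"
    "AE t in lborel. 0 < t \<and> t < T \<longrightarrow> u t \<in> var_Lebesgue UNIV q \<and> var_norm UNIV q (u t) = \<phi> t \<and> (AE x in lborel. u t x = u' (t, x)) \<and>
        (\<forall>c>\<phi> t. qmod (\<lambda>x. ennreal (norm (u' (t, x))) / ennreal c) \<le> 1)"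
    "tmod (\<lambda>t. ennreal (\<phi> t)) < \<infinity>"
    "\<And>\<epsilon>. mixed_norm T p q u < \<epsilon> \<Longrightarrow> tmod (\<lambda>t. ennreal (\<phi> t) / ennreal \<epsilon>) \<le> 1"
proof -
  have sets: "{0<..<T} \<times> (UNIV :: (real^3) set) \<in> sets borel" by (intro borel_open open_Times) auto
  have "(\<lambda>(t, x). u t x) \<in> borel_measurable (slab T)" using u by (simp add: mixed_Lebesgue_def)
  then obtain u' where u'm: "u' \<in> borel_measurable borel"
    and u': "AE z in lborel. z \<in> {0<..<T} \<times> UNIV \<longrightarrow> (case z of (t, x) \<Rightarrow> u t x) = u' z"
    using lebesgue_on_borel_representative_vec[OF _ sets] by blast
  have u'm': "u' \<in> borel_measurable (borel \<Otimes>\<^sub>M borel)" using u'm by (simp add: borel_prod)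
  have u'': "AE z in lborel. fst z \<in> {0<..<T} \<longrightarrow> u (fst z) (snd z) = u' z"
    using u' by (auto elim!: eventually_mono simp: case_prod_unfold mem_Times_iff)
  let ?N = "\<lambda>t. var_norm UNIV q (u t)"
  have N: "?N \<in> var_Lebesgue {0<..<T} p" using u by (simp add: mixed_Lebesgue_def)
  then have "?N \<in> borel_measurable (lebesgue_on {0<..<T})" by (simp add: var_Lebesgue_def)
  then obtain \<phi>0 where \<phi>0m[measurable]: "\<phi>0 \<in> borel_measurable borel"
    and \<phi>0: "AE t in lborel. t \<in> {0<..<T} \<longrightarrow> ?N t = \<phi>0 t"
    using lebesgue_on_borel_representative_real[of ?N "{0<..<T}", OF _ borel_open[OF open_greaterThanLessThan]] by blast
  define \<phi> where "\<phi> t = max 0 (\<phi>0 t)" for t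
  have \<phi>m[measurable]: "\<phi> \<in> borel_measurable borel" unfolding \<phi>_def[abs_def] by measurable
  have vL: "AE t in lborel. 0 < t \<and> t < T \<longrightarrow> u t \<in> var_Lebesgue UNIV q"
  proof -
    have "AE t in lebesgue_on {0<..<T}. u t \<in> var_Lebesgue UNIV q" using u by (simp add: mixed_Lebesgue_def)
    then show ?thesis by (subst (asm) AE_lebesgue_on_iff) auto
  qed
  have sec: "AE t in lborel. 0 < t \<and> t < T \<longrightarrow> (AE x in lborel. u t x = u' (t, x))"
    using AE_slab[of "\<lambda>t x. u t x = u' (t, x)"] u'' by simp
  have main: "AE t in lborel. 0 < t \<and> t < T \<longrightarrow> u t \<in> var_Lebesgue UNIV q \<and> ?N t = \<phi> t \<and> (AE x in lborel. u t x = u' (t, x)) \<and>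
        (\<forall>c>\<phi> t. qmod (\<lambda>x. ennreal (norm (u' (t, x))) / ennreal c) \<le> 1)"
    using vL sec \<phi>0
  proof eventually_elim
    case (elim t)
    show ?case
    proof (intro impI)
      assume t: "0 < t \<and> t < T"
      have ut: "u t \<in> var_Lebesgue UNIV q" "AE x in lborel. u t x = u' (t, x)" using elim t by auto
      have eq: "?N t = \<phi> t" using elim t var_norm_nonneg[OF ut(1)] by (simp add: \<phi>_def)
      have "qmod (\<lambda>x. ennreal (norm (u' (t, x))) / ennreal c) \<le> 1" if "\<phi> t < c" for c
      proof -
        have "qmod (\<lambda>x. ennreal (norm (u' (t, x))) / ennreal c) = qmod (\<lambda>x. ennreal (norm (u t x)) / ennreal c)"
          unfolding qmod_def using ut(2) by (intro nn_integral_cong_AE) (auto elim!: eventually_mono)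
        then show ?thesis using qmod_le_of_var_norm_less[OF ut(1)] eq that by simp
      qed
      then show "u t \<in> var_Lebesgue UNIV q \<and> ?N t = \<phi> t \<and> (AE x in lborel. u t x = u' (t, x)) \<and>
        (\<forall>c>\<phi> t. qmod (\<lambda>x. ennreal (norm (u' (t, x))) / ennreal c) \<le> 1)" using ut eq by simp
    qed
  qed
  have scale: "modular {0<..<T} p (\<lambda>t. ?N t /\<^sub>R c) = tmod (\<lambda>t. ennreal (\<phi> t) / ennreal c)" if "0 < c" for c
    unfolding modular_time using main that
    by (intro tmod_cong_AE) (auto elim!: eventually_mono simp: \<phi>_def divide_ennreal abs_mult divide_inverse mult.commute)
  obtain c where c: "0 < c" "modular {0<..<T} p (\<lambda>t. c *\<^sub>R ?N t) < \<infinity>" using N by (auto simp: var_Lebesgue_def)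
  have fin: "tmod (\<lambda>t. ennreal (\<phi> t)) < \<infinity>"
  proof -
    have "modular {0<..<T} p (\<lambda>t. c *\<^sub>R ?N t) = tmod (\<lambda>t. ennreal c * ennreal (\<phi> t))"
      unfolding modular_time using main c
      by (intro tmod_cong_AE) (auto elim!: eventually_mono simp: \<phi>_def abs_mult ennreal_mult)
    then have "tmod (\<lambda>t. ennreal (1 / c) * (ennreal c * ennreal (\<phi> t))) < \<infinity>"
      using c by (subst tmod_cmult_finite) auto
    then show ?thesis using c by (simp add: ennreal_mult_mult)
  qed
  have small: "tmod (\<lambda>t. ennreal (\<phi> t) / ennreal \<epsilon>) \<le> 1" if \<epsilon>: "mixed_norm T p q u < \<epsilon>" for \<epsilon>
  proof -
    let ?S = "{c. 0 < c \<and> modular {0<..<T} p (\<lambda>t. ?N t /\<^sub>R c) \<le> 1}"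
    obtain w where w: "tmod (\<lambda>t. ennreal (\<phi> t)) = ennreal w" "0 \<le> w" using fin by (cases "tmod (\<lambda>t. ennreal (\<phi> t))") auto
    have "tmod (\<lambda>t. ennreal (\<phi> t) / ennreal (max 1 w)) \<le> tmod (\<lambda>t. ennreal (\<phi> t)) / ennreal (max 1 w)"
      by (intro tmod_divide_le) auto
    also have "\<dots> \<le> ennreal (max 1 w) / ennreal (max 1 w)"
      unfolding w by (intro divide_right_mono_ennreal ennreal_leI) auto
    also have "\<dots> = 1" using divide_ennreal[of "max 1 w" "max 1 w"] by simp
    finally have "max 1 w \<in> ?S" using scale[of "max 1 w"] by simp
    then obtain d where d: "0 < d" "d < \<epsilon>" "modular {0<..<T} p (\<lambda>t. ?N t /\<^sub>R d) \<le> 1"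
      using cInf_lessD[of ?S \<epsilon>] \<epsilon> unfolding mixed_norm_def var_norm_def[of "{0<..<T}"] by auto
    have "tmod (\<lambda>t. ennreal (\<phi> t) / ennreal \<epsilon>) \<le> tmod (\<lambda>t. ennreal (\<phi> t) / ennreal d)"
      using d by (intro tmod_mono) (auto simp: divide_ennreal \<phi>_def intro!: ennreal_leI divide_left_mono)
    also have "\<dots> \<le> 1" using d scale by simp
    finally show ?thesis .
  qed
  show ?thesis by (rule that[OF u'm' \<phi>m _ u'' main fin small]) (simp_all add: \<phi>_def)
qed

text \<open>The size \<open>h\<close> may be infinite, though by finiteness of its modular only on a
  null set of times; positivity makes it an admissible scale wherever it is finite.\<close>

lemma mixedI:
  assumes [measurable]: "u \<in> borel_measurable (borel \<Otimes>\<^sub>M borel)" "h \<in> borel_measurable borel"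
    and h: "\<And>t. 0 < h t" "tmod h < \<infinity>"
    and u: "AE t in lborel. 0 < t \<and> t < T \<longrightarrow> h t < \<infinity> \<longrightarrow> qmod (\<lambda>x. ennreal (norm (u (t, x))) / h t) \<le> 1"
  shows "(\<lambda>t x. u (t, x)) \<in> mixed_Lebesgue T p q"
proof -
  let ?N = "\<lambda>t. var_norm UNIV q (\<lambda>x. u (t, x))"
  have 1: "(\<lambda>(t, x). u (t, x)) \<in> borel_measurable (slab T)"
    by (rule borel_measurable_lebesgue_on) (simp add: borel_prod[symmetric])
  have 2: "AE t in lborel. 0 < t \<and> t < T \<longrightarrow> (\<lambda>x. u (t, x)) \<in> var_Lebesgue UNIV q \<and> 0 \<le> ?N t \<and> ennreal (?N t) \<le> h t"
    using u tmod_finite_AE[OF assms(2) h(2)]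
  proof eventually_elim
    case (elim t)
    show ?case
    proof (intro impI)
      assume t: "0 < t \<and> t < T"
      then have "h t < \<infinity>" using elim by simp
      then obtain r where r: "h t = ennreal r" "0 < r" using h(1)[of t] by (cases "h t") (auto simp: ennreal_less_zero_iff)
      have q: "qmod (\<lambda>x. ennreal (norm (u (t, x))) / ennreal r) \<le> 1" using elim t r by simp
      have vL: "(\<lambda>x. u (t, x)) \<in> var_Lebesgue UNIV q" by (rule var_LebesgueI[OF _ r(2) q]) measurable
      with var_norm_le[OF r(2) q] var_norm_nonneg[OF vL] r
      show "(\<lambda>x. u (t, x)) \<in> var_Lebesgue UNIV q \<and> 0 \<le> ?N t \<and> ennreal (?N t) \<le> h t"
        by (auto intro: ennreal_leI)
    qed
  qed
  have 3: "?N \<in> var_Lebesgue {0<..<T} p"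
  proof -
    have "?N \<in> borel_measurable (lebesgue_on {0<..<T})"
      by (intro borel_measurable_lebesgue_on var_norm_measurable) measurable
    moreover have "modular {0<..<T} p (\<lambda>t. 1 *\<^sub>R ?N t) < \<infinity>"
    proof -
      have "modular {0<..<T} p (\<lambda>t. 1 *\<^sub>R ?N t) \<le> tmod h"
        unfolding modular_time unfolding tmod_def
        using 2 by (intro nn_integral_mono_AE) (auto elim!: eventually_mono split: split_indicator intro!: epow_mono g_pos)
      then show ?thesis using h(2) by (rule le_less_trans)
    qed
    ultimately show ?thesis unfolding var_Lebesgue_def by (auto intro!: exI[of _ 1])
  qed
  have 4: "AE t in lebesgue_on {0<..<T}. (\<lambda>x. u (t, x)) \<in> var_Lebesgue UNIV q"
    by (subst AE_lebesgue_on_iff) (use 2 in \<open>auto elim!: eventually_mono\<close>)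
  show ?thesis using 1 3 4 by (simp add: mixed_Lebesgue_def)
qed

end

section \<open>Existence\<close>

context mild_setting
begin

lemma epow_less_top: "epow x b < \<infinity> \<longleftrightarrow> x < \<infinity>"
  by (cases x) (auto simp: epow_ennreal)

text \<open>The passage from slices back to the product requires the exceptional set to be
  measurable, hence the assumption on \<open>Q\<close>.\<close>

lemma AE_slabI:
  assumes [measurable]: "Measurable.pred (borel \<Otimes>\<^sub>M borel) Q"
    and Q: "AE t in lborel. 0 < t \<and> t < T \<longrightarrow> (AE x in (lborel :: (real^3) measure). Q (t, x))"
  shows "AE z in lborel. fst z \<in> {0<..<T} \<longrightarrow> Q z"
proof -
  have "AE t in lborel. AE x in (lborel :: (real^3) measure). fst (t, x) \<in> {0<..<T} \<longrightarrow> Q (t, x)"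
    using Q by (auto elim!: eventually_mono)
  then have "AE z in lborel \<Otimes>\<^sub>M lborel. fst z \<in> {0<..<T} \<longrightarrow> Q z"
  proof (rule lborel_pair.AE_pair_measure[rotated])
    show "{z \<in> space (lborel \<Otimes>\<^sub>M lborel). fst z \<in> {0<..<T} \<longrightarrow> Q z} \<in> sets (lborel \<Otimes>\<^sub>M (lborel :: (real^3) measure))"
      by measurable
  qed
  then show ?thesis by (simp only: lborel_prod)
qed

lemma majorant_finite_AE:
  assumes [measurable]: "W \<in> borel_measurable (borel \<Otimes>\<^sub>M borel)" "\<psi> \<in> borel_measurable borel"
    and W: "\<And>t. 0 < t \<Longrightarrow> t < T \<Longrightarrow> (\<integral>\<^sup>+x. epow (maj W (t, x)) M \<partial>lborel) \<le> epow (\<psi> t) M"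
    and \<psi>: "tmod \<psi> < \<infinity>"
  shows "AE z in lborel. fst z \<in> {0<..<T} \<longrightarrow> maj W z < \<infinity>"
proof (rule AE_slabI)
  show "AE t in lborel. 0 < t \<and> t < T \<longrightarrow> (AE x in lborel. maj W (t, x) < \<infinity>)"
    using tmod_finite_AE[OF assms(2) \<psi>]
  proof eventually_elim
    case (elim t)
    show ?case
    proof (intro impI)
      assume t: "0 < t \<and> t < T"
      then have "(\<integral>\<^sup>+x. epow (maj W (t, x)) M \<partial>lborel) < \<infinity>"
        using W[of t] elim epow_less_top[of "\<psi> t" M] by (auto intro: le_less_trans)
      then have "AE x in lborel. epow (maj W (t, x)) M \<noteq> \<infinity>"
        by (intro nn_integral_noteq_infinite) auto
      then show "AE x in lborel. maj W (t, x) < \<infinity>" by eventually_elim (auto simp: less_top)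
    qed
  qed
qed measurable

lemma tmod_half_add:
  assumes [measurable]: "F \<in> borel_measurable borel" "G \<in> borel_measurable borel" and F: "tmod F \<le> 1" "tmod G \<le> 1"
  shows "tmod (\<lambda>t. ennreal (1/4) * (F t + G t)) \<le> 1"
proof -
  have "tmod (\<lambda>t. ennreal (1/4) * (F t + G t)) \<le> (\<integral>\<^sup>+t. ennreal (1/2) * (indicator {0<..<T} t * epow (F t) (1 / g t) +
      indicator {0<..<T} t * epow (G t) (1 / g t)) \<partial>lborel)"
    unfolding tmod_def
  proof (rule nn_integral_mono)
    fix t
    show "indicator {0<..<T} t * epow (ennreal (1/4) * (F t + G t)) (1 / g t) \<le> ennreal (1/2) *
       (indicator {0<..<T} t * epow (F t) (1 / g t) + indicator {0<..<T} t * epow (G t) (1 / g t))"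
    proof (cases "t \<in> {0<..<T}")
      case True
      let ?e = "1 / g t"
      have e: "1 \<le> ?e" "0 \<le> ?e" using g_pos[OF True] by auto
      have "epow (ennreal (1/4) * (F t + G t)) ?e = ennreal ((1/4) powr ?e) * epow (F t + G t) ?e"
        unfolding epow_mult by (subst epow_ennreal) auto
      also have "\<dots> \<le> ennreal ((1/4) powr ?e) * (ennreal (2 powr ?e) * (epow (F t) ?e + epow (G t) ?e))"
        by (intro mult_left_mono epow_plus_le e) auto
      also have "\<dots> = ennreal ((1/4) powr ?e * 2 powr ?e) * (epow (F t) ?e + epow (G t) ?e)"
        by (rule ennreal_mult_mult) auto
      also have "(1/4) powr ?e * 2 powr ?e = (1/2) powr ?e" by (simp add: powr_mult[symmetric])
      also have "ennreal ((1/2) powr ?e) * (epow (F t) ?e + epow (G t) ?e) \<le> ennreal (1/2) * (epow (F t) ?e + epow (G t) ?e)"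
        using powr_mono'[of 1 ?e "1/2"] e by (intro mult_right_mono ennreal_leI) auto
      finally show ?thesis using True by simp
    qed simp
  qed
  also have "\<dots> = ennreal (1/2) * (tmod F + tmod G)"
    unfolding tmod_def by (simp add: nn_integral_cmult nn_integral_add)
  also have "\<dots> \<le> ennreal (1/2) * (1 + 1)" by (intro mult_left_mono add_mono F) auto
  also have "\<dots> = ennreal (1/2) * ennreal 2" by simp
  also have "\<dots> = 1" by (subst ennreal_mult[symmetric]) auto
  finally show ?thesis .
qed

text \<open>The monotone iteration bounds the difference of \<open>u\<close> and the datum by a
  majorant whose slices have size \<open>\<psi>\<close> in L^M, and the embedding of L^M returns
  this difference to the variable space.\<close>

lemma mild_existence:
  assumes E: "E \<in> mixed_Lebesgue T p q" and \<epsilon>: "0 < \<epsilon>" "16 * Cb * (4 * \<epsilon>) * K \<le> 1" and small: "mixed_norm T p q E < \<epsilon>"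
  obtains u where "u \<in> borel_measurable (borel \<Otimes>\<^sub>M borel)" "(\<lambda>t x. u (t, x)) \<in> mixed_Lebesgue T p q"
    "AE z in lborel. fst z \<in> {0<..<T} \<longrightarrow> maj (\<lambda>z. ennreal (norm (u z)) * ennreal (norm (u z))) z < \<infinity> \<and>
       u z = E (fst z) (snd z) - duhamel \<alpha> u z"
proof -
  obtain e \<phi> where [measurable]: "e \<in> borel_measurable (borel \<Otimes>\<^sub>M borel)" "\<phi> \<in> borel_measurable borel"
    and \<phi>0: "\<And>t. 0 \<le> \<phi> t"
    and eE: "AE z in lborel. fst z \<in> {0<..<T} \<longrightarrow> E (fst z) (snd z) = e z"
    and sec: "AE t in lborel. 0 < t \<and> t < T \<longrightarrow> E t \<in> var_Lebesgue UNIV q \<and> var_norm UNIV q (E t) = \<phi> t \<and> (AE x in lborel. E t x = e (t, x)) \<and>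
        (\<forall>c>\<phi> t. qmod (\<lambda>x. ennreal (norm (e (t, x))) / ennreal c) \<le> 1)"
    and \<phi>fin: "tmod (\<lambda>t. ennreal (\<phi> t)) < \<infinity>"
    and \<phi>small: "\<And>\<epsilon>. mixed_norm T p q E < \<epsilon> \<Longrightarrow> tmod (\<lambda>t. ennreal (\<phi> t) / ennreal \<epsilon>) \<le> 1"
    by (rule mixed_representative[OF E]) blast
  \<comment> \<open>The norm of a slice may be 0, so a constant \<open>\<eta> > 0\<close> is added
    to get a strictly larger, admissible scale. The factor \<open>k\<close> makes the modular of
    \<open>\<eta> / \<epsilon>\<close> at most \<open>k * T \<le> 1\<close>; the sum of both sizes
    then has radius \<open>4 * \<epsilon>\<close>.\<close>
  define k where "k = min 1 (1 / T)"
  define \<eta> where "\<eta> = \<epsilon> * k"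
  have k: "0 < k" "k \<le> 1" "k * T \<le> 1" using T by (auto simp: k_def min_def field_simps)
  have \<eta>: "0 < \<eta>" using \<epsilon> k by (simp add: \<eta>_def)
  let ?\<phi> = "\<lambda>t. ennreal (\<phi> t + \<eta>)"
  have kmod: "tmod (\<lambda>t. ennreal \<eta> / ennreal \<epsilon>) \<le> 1"
  proof -
    have "tmod (\<lambda>t. ennreal \<eta> / ennreal \<epsilon>) \<le> (\<integral>\<^sup>+t. ennreal k * indicator {0<..<T} t \<partial>lborel)"
      unfolding tmod_def
    proof (rule nn_integral_mono)
      fix t
      show "indicator {0<..<T} t * epow (ennreal \<eta> / ennreal \<epsilon>) (1 / g t) \<le> ennreal k * indicator {0<..<T} t"
      proof (cases "t \<in> {0<..<T}")
        case True
        have "k powr (1 / g t) \<le> k powr 1" using k g_pos[OF True] by (intro powr_mono') auto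
        then show ?thesis using True \<epsilon> k by (simp add: \<eta>_def divide_ennreal epow_ennreal ennreal_leI)
      qed simp
    qed
    also have "\<dots> = ennreal (k * T)" using T k by (simp add: nn_integral_cmult_indicator ennreal_mult)
    also have "\<dots> \<le> 1" using k by (simp add: ennreal_le_1)
    finally show ?thesis .
  qed
  have \<phi>mod: "tmod (\<lambda>t. ?\<phi> t / ennreal (4 * \<epsilon>)) \<le> 1"
  proof -
    have "?\<phi> t / ennreal (4 * \<epsilon>) = ennreal (1/4) * (ennreal (\<phi> t) / ennreal \<epsilon> + ennreal \<eta> / ennreal \<epsilon>)" for t
      using \<epsilon> \<phi>0[of t] \<eta> by (simp add: divide_ennreal ennreal_mult[symmetric] ennreal_plus[symmetric] add_divide_distrib del: ennreal_plus)
    then show ?thesis using tmod_half_add[OF _ _ \<phi>small[OF small] kmod] by simp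
  qed
  let ?E = "\<lambda>z. ennreal (norm (e z))"
  have qe: "AE t in lborel. 0 < t \<and> t < T \<longrightarrow> qmod (\<lambda>x. ?E (t, x) / ?\<phi> t) \<le> 1"
    using sec by eventually_elim (use \<eta> in auto)
  have size: "AE s in lborel. 0 < s \<and> s < T \<longrightarrow> sum_modular m M (\<lambda>x. ?E (s, x) / ?\<phi> s) \<le> 1"
    using qe by eventually_elim (blast intro: order_trans[OF sum_modular_le_qmod])
  define U where "U z = (SUP n. majorant_iterate (27 * C) \<alpha> ?E n z)" for z
  have [measurable]: "U \<in> borel_measurable (borel \<Otimes>\<^sub>M borel)" unfolding U_def[abs_def] by measurable
  have \<epsilon>4: "0 < 4 * \<epsilon>" using \<epsilon> by simp
  have "\<exists>\<psi>. \<psi> \<in> borel_measurable borel \<and> tmod (\<lambda>t. \<psi> t / ennreal (4 * \<epsilon>)) \<le> 1 \<and>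
      (\<forall>t. 0 < t \<longrightarrow> t < T \<longrightarrow> (\<integral>\<^sup>+x. epow (maj (\<lambda>z. U z * U z) (t, x)) M \<partial>lborel) \<le> epow (\<psi> t) M)"
    unfolding U_def
    by (rule small_majorant[where E = ?E and \<phi> = ?\<phi> and \<epsilon> = "4 * \<epsilon>" and c = Cb and D = "27 * C" and \<alpha> = \<alpha> and m = m and M = M];
        (fact Cb | fact \<epsilon>4 | fact \<epsilon>(2) | fact M_pos(1) | fact M_pos(2) | fact size | fact \<phi>mod |
         (rule bil; assumption) | (intro exI conjI allI impI, assumption, assumption, simp) | measurable))
  then obtain \<psi> where [measurable]: "\<psi> \<in> borel_measurable borel" and \<psi>: "tmod (\<lambda>t. \<psi> t / ennreal (4 * \<epsilon>)) \<le> 1"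
    and \<psi>U: "\<And>t. 0 < t \<Longrightarrow> t < T \<Longrightarrow> (\<integral>\<^sup>+x. epow (maj (\<lambda>z. U z * U z) (t, x)) M \<partial>lborel) \<le> epow (\<psi> t) M"
    by blast
  have \<psi>fin: "tmod \<psi> < \<infinity>"
  proof -
    have "tmod (\<lambda>t. ennreal (4 * \<epsilon>) * (\<psi> t / ennreal (4 * \<epsilon>))) < \<infinity>"
      using \<epsilon>4 by (intro tmod_cmult_finite le_less_trans[OF \<psi>]) auto
    then show ?thesis using ennreal_cancel_real[OF \<epsilon>4] by (simp del: ennreal_times_divide)
  qed
  have "\<exists>u. u \<in> borel_measurable (borel \<Otimes>\<^sub>M borel) \<and> (\<forall>z. ennreal (norm (u z)) \<le> U z) \<and>
      (\<forall>z. ennreal (norm (u z - e z)) \<le> maj (\<lambda>z. U z * U z) z) \<and>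
      (\<forall>z. maj (\<lambda>z. U z * U z) z < \<infinity> \<longrightarrow> u z = e z - duhamel \<alpha> u z)"
    unfolding U_def
    by (rule picard_limit[where C = C and e = e and \<alpha> = \<alpha>];
        ((rule kernel; assumption) | fact C | (intro exI conjI allI impI, assumption, blast, blast, blast) | measurable))
  then obtain u where [measurable]: "u \<in> borel_measurable (borel \<Otimes>\<^sub>M borel)" and uU: "\<And>z. ennreal (norm (u z)) \<le> U z"
    and ue: "\<And>z. ennreal (norm (u z - e z)) \<le> maj (\<lambda>z. U z * U z) z"
    and ueq: "\<And>z. maj (\<lambda>z. U z * U z) z < \<infinity> \<Longrightarrow> u z = e z - duhamel \<alpha> u z"
    by blast
  have "AE z in lborel. fst z \<in> {0<..<T} \<longrightarrow> maj (\<lambda>z. U z * U z) z < \<infinity>"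
    by (rule majorant_finite_AE[OF _ _ \<psi>U \<psi>fin]) measurable
  then have eqn: "AE z in lborel. fst z \<in> {0<..<T} \<longrightarrow> maj (\<lambda>z. ennreal (norm (u z)) * ennreal (norm (u z))) z < \<infinity> \<and>
       u z = E (fst z) (snd z) - duhamel \<alpha> u z"
    using eE
  proof eventually_elim
    case (elim z)
    have "maj (\<lambda>z. ennreal (norm (u z)) * ennreal (norm (u z))) z \<le> maj (\<lambda>z. U z * U z) z"
      by (intro majorant_op_mono mult_mono uU) auto
    then show ?case using elim ueq[of z] by (auto intro: le_less_trans)
  qed
  obtain \<Lambda> where \<Lambda>: "1 \<le> \<Lambda>" and emb: "\<And>B \<psi>. B \<in> borel_measurable borel \<Longrightarrow> 0 < \<psi> \<Longrightarrow>
      (\<integral>\<^sup>+x. epow (B x) M \<partial>lborel) \<le> epow (ennreal \<psi>) M \<Longrightarrow> qmod (\<lambda>x. B x / ennreal (\<Lambda> * \<psi>)) \<le> 1"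
    using power_embeds by blast
  \<comment> \<open>The factor 2 comes from \<open>qmod_add\<close> and \<open>\<Lambda>\<close>
    from the embedding of L^M; the second \<open>\<eta>\<close> keeps the scale of the quadratic
    part positive.\<close>
  define h where "h t = ennreal 2 * (?\<phi> t + ennreal \<Lambda> * (\<psi> t + ennreal \<eta>))" for t
  have [measurable]: "h \<in> borel_measurable borel" unfolding h_def[abs_def] by measurable
  have hpos: "0 < h t" for t
  proof -
    have "0 < ?\<phi> t" using \<eta> \<phi>0[of t] by (simp add: ennreal_less_zero_iff add_nonneg_pos del: ennreal_plus)
    also have "?\<phi> t = ennreal 1 * (?\<phi> t + 0)" by simp
    also have "\<dots> \<le> h t" unfolding h_def by (intro mult_mono add_mono ennreal_leI) auto
    finally show ?thesis .
  qed
  have hfin: "tmod h < \<infinity>"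
  proof -
    have "tmod (\<lambda>t. ennreal (\<phi> t) + ennreal \<eta>) < \<infinity>"
      using \<eta> by (intro tmod_add_finite \<phi>fin tmod_const_finite) auto
    then have 1: "tmod ?\<phi> < \<infinity>" using \<eta> \<phi>0 by simp
    show ?thesis unfolding h_def
      using \<Lambda> \<eta> by (intro tmod_cmult_finite tmod_add_finite 1 \<psi>fin tmod_const_finite) auto
  qed
  have "AE t in lborel. 0 < t \<and> t < T \<longrightarrow> h t < \<infinity> \<longrightarrow> qmod (\<lambda>x. ennreal (norm (u (t, x))) / h t) \<le> 1"
    using qe
  proof eventually_elim
    case (elim t)
    show ?case
    proof (intro impI)
      assume t: "0 < t \<and> t < T" and hf: "h t < \<infinity>"
      let ?B = "\<lambda>x. maj (\<lambda>z. U z * U z) (t, x)"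
      have "\<psi> t \<noteq> \<infinity>" using hf \<Lambda> by (auto simp: h_def ennreal_mult_top)
      then obtain w where w: "\<psi> t = ennreal w" "0 \<le> w" by (cases "\<psi> t") auto
      have "(\<integral>\<^sup>+x. epow (?B x) M \<partial>lborel) \<le> epow (ennreal (w + \<eta>)) M"
        using t w \<eta> M_pos by (intro order_trans[OF \<psi>U] epow_mono) (auto simp: ennreal_leI)
      then have B: "qmod (\<lambda>x. ?B x / ennreal (\<Lambda> * (w + \<eta>))) \<le> 1"
        using w \<eta> by (intro emb) auto
      have A: "qmod (\<lambda>x. ?E (t, x) / ?\<phi> t) \<le> 1" using elim t by simp
      have C: "qmod (\<lambda>x. (?E (t, x) + ?B x) / (?\<phi> t + ennreal (\<Lambda> * (w + \<eta>))) / ennreal 2) \<le> 1"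
        by (rule qmod_add[OF _ _ A B]) measurable
      have pos: "0 < \<phi> t + \<eta>" "0 < \<Lambda> * (w + \<eta>)" using \<phi>0[of t] \<eta> \<Lambda> w by (auto intro!: add_nonneg_pos mult_pos_pos)
      have hh: "h t = ennreal ((\<phi> t + \<eta> + \<Lambda> * (w + \<eta>)) * 2)"
        unfolding h_def w using pos \<Lambda> w \<eta>
        by (simp add: ennreal_mult[symmetric] ennreal_plus[symmetric] ennreal_numeral[symmetric] mult.commute del: ennreal_plus ennreal_numeral)
      have "ennreal (norm (u (t, x))) / h t \<le> (?E (t, x) + ?B x) / (?\<phi> t + ennreal (\<Lambda> * (w + \<eta>))) / ennreal 2" for x
      proof -
        have "ennreal (norm (u (t, x))) \<le> ennreal (norm (e (t, x)) + norm (u (t, x) - e (t, x)))"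
          by (intro ennreal_leI) (metis add.commute diff_add_cancel norm_triangle_ineq)
        also have "\<dots> \<le> ?E (t, x) + ?B x" using ue[of "(t, x)"] by (simp add: add_left_mono)
        finally have "ennreal (norm (u (t, x))) / h t \<le> (?E (t, x) + ?B x) / h t" by (rule divide_right_mono_ennreal)
        also have "\<dots> = (?E (t, x) + ?B x) / ennreal (\<phi> t + \<eta> + \<Lambda> * (w + \<eta>)) / ennreal 2"
          unfolding hh using pos by (intro ennreal_divide_divide[symmetric]) auto
        also have "ennreal (\<phi> t + \<eta> + \<Lambda> * (w + \<eta>)) = ?\<phi> t + ennreal (\<Lambda> * (w + \<eta>))"
          using pos by (intro ennreal_plus) auto
        finally show ?thesis .
      qed
      then show "qmod (\<lambda>x. ennreal (norm (u (t, x))) / h t) \<le> 1" by (rule order_trans[OF qmod_mono C])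
    qed
  qed
  then have "(\<lambda>t x. u (t, x)) \<in> mixed_Lebesgue T p q"
    by (intro mixedI[OF _ _ hpos hfin]) auto
  then show ?thesis using eqn by (intro that[of u]) auto
qed

end

section \<open>Mild solutions through Borel representatives, and uniqueness\<close>

lemma lebesgue_on_integral:
  fixes f :: "real \<Rightarrow> 'b::{banach, second_countable_topology}"
  assumes [measurable]: "f \<in> borel_measurable borel" and S: "S \<in> sets borel"
  shows "integrable (lebesgue_on S) f \<longleftrightarrow> integrable lborel (\<lambda>s. indicator S s *\<^sub>R f s)"
    and "(LINT s|lebesgue_on S. f s) = (LINT s|lborel. indicator S s *\<^sub>R f s)"
proof -
  have [measurable]: "S \<in> sets borel" by fact
  show "integrable (lebesgue_on S) f \<longleftrightarrow> integrable lborel (\<lambda>s. indicator S s *\<^sub>R f s)"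
    using S by (subst integrable_restrict_space) (auto simp: integrable_completion)
  show "(LINT s|lebesgue_on S. f s) = (LINT s|lborel. indicator S s *\<^sub>R f s)"
    using S by (subst integral_restrict_space) (auto simp: integral_completion)
qed

lemma oseen_conv_cong_AE:
  fixes v w :: "real^3 \<Rightarrow> real^3"
  assumes v: "v \<in> borel_measurable lebesgue" and w: "w \<in> borel_measurable borel" and eq: "AE y in lborel. v y = w y"
  shows "oseen_conv \<alpha> t v x = oseen_conv \<alpha> t w x"
proof -
  have [measurable]: "v \<in> borel_measurable lebesgue" "w \<in> borel_measurable lebesgue"
    using v w by (auto intro: measurable_completion)
  have "conv (oseen_kernel \<alpha> t j h k) (\<lambda>y. v y $ h * v y $ k) x = conv (oseen_kernel \<alpha> t j h k) (\<lambda>y. w y $ h * w y $ k) x" for j h k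
  proof -
    have "(\<lambda>y. oseen_kernel \<alpha> t j h k (x - y)) \<in> borel_measurable borel" by measurable
    then have [measurable]: "(\<lambda>y. oseen_kernel \<alpha> t j h k (x - y)) \<in> borel_measurable lebesgue"
      by (auto intro: measurable_completion)
    show ?thesis unfolding conv_def
    proof (rule integral_cong_AE)
      show "AE y in lebesgue. oseen_kernel \<alpha> t j h k (x - y) *\<^sub>R (v y $ h * v y $ k) =
          oseen_kernel \<alpha> t j h k (x - y) *\<^sub>R (w y $ h * w y $ k)"
        using AE_completion[OF eq] by eventually_elim simp
    qed measurable
  qed
  then show ?thesis by (simp add: oseen_conv_def)
qed

context mild_setting
begin

text \<open>Finiteness of the majorant supplies the convergence clauses of
  \<open>mild_solution\<close>, first for the convolutions at almost every \<open>s\<close> and then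
  for the time integral.\<close>

lemma mild_solutionI:
  assumes [measurable]: "u \<in> borel_measurable (borel \<Otimes>\<^sub>M borel)"
    and u: "AE z in lborel. fst z \<in> {0<..<T} \<longrightarrow> maj (\<lambda>z. ennreal (norm (u z)) * ennreal (norm (u z))) z < \<infinity> \<and>
       u z = e0 \<alpha> u0 f (fst z) (snd z) - duhamel \<alpha> u z"
  shows "mild_solution T \<alpha> u0 f (\<lambda>t x. u (t, x))"
  unfolding mild_solution_def
proof (subst AE_slab_iff, use u in eventually_elim, intro impI)
  fix z assume z: "fst z \<in> {0<..<T} \<longrightarrow> maj (\<lambda>z. ennreal (norm (u z)) * ennreal (norm (u z))) z < \<infinity> \<and>
       u z = e0 \<alpha> u0 f (fst z) (snd z) - duhamel \<alpha> u z" "fst z \<in> {0<..<T}"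
  obtain t x where tx: "z = (t, x)" by (cases z)
  have fin: "maj (\<lambda>z. ennreal (norm (u z)) * ennreal (norm (u z))) (t, x) < \<infinity>" using z tx by simp
  have i1: "AE s in lborel. 0 < s \<and> s < t \<longrightarrow>
      (\<integral>\<^sup>+y. ennreal (27 * C * kernel_majorant \<alpha> (t - s) (x - y)) * (ennreal (norm (u (s, y))) * ennreal (norm (u (s, y)))) \<partial>lborel) < \<infinity>"
    and i2: "integrable lborel (\<lambda>s. indicator {0<..<t} s *\<^sub>R oseen_conv \<alpha> (t - s) (\<lambda>y. u (s, y)) x)"
    by (rule duhamel_integrable[OF kernel C _ fin]; simp)+
  have 1: "AE s in lebesgue_on {0<..<t}. \<forall>j h k.
           conv_exists (oseen_kernel \<alpha> (t - s) j h k) (\<lambda>y. u (s, y) $ h * u (s, y) $ k) x"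
  proof (subst AE_lebesgue_on_iff, simp, use i1 in eventually_elim, intro impI allI)
    fix s j h k
    assume s: "0 < s \<and> s < t \<longrightarrow>
      (\<integral>\<^sup>+y. ennreal (27 * C * kernel_majorant \<alpha> (t - s) (x - y)) * (ennreal (norm (u (s, y))) * ennreal (norm (u (s, y)))) \<partial>lborel) < \<infinity>"
      "s \<in> {0<..<t}"
    have "integrable lborel (\<lambda>y. oseen_kernel \<alpha> (t - s) j h k (x - y) * (u (s, y) $ h * u (s, y) $ k))"
      using s by (intro oseen_conv_integrable[OF kernel C]) auto
    then show "conv_exists (oseen_kernel \<alpha> (t - s) j h k) (\<lambda>y. u (s, y) $ h * u (s, y) $ k) x"
      by (subst conv_lborel(2)) auto
  qed
  have m: "(\<lambda>s. oseen_conv \<alpha> (t - s) (\<lambda>y. u (s, y)) x) \<in> borel_measurable borel" by measurable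
  show "(AE s in lebesgue_on {0<..<fst z}. \<forall>j h k.
           conv_exists (oseen_kernel \<alpha> (fst z - s) j h k) (\<lambda>y. u (s, y) $ h * u (s, y) $ k) (snd z)) \<and>
        integrable (lebesgue_on {0<..<fst z}) (\<lambda>s. oseen_conv \<alpha> (fst z - s) (\<lambda>y. u (s, y)) (snd z)) \<and>
        u (fst z, snd z) = e0 \<alpha> u0 f (fst z) (snd z) - (LINT s|lebesgue_on {0<..<fst z}. oseen_conv \<alpha> (fst z - s) (\<lambda>y. u (s, y)) (snd z))"
    unfolding tx fst_conv snd_conv using 1 i2 z by (simp add: tx lebesgue_on_integral[OF m] duhamel_def)
qed

text \<open>For almost every \<open>s\<close> the slices of \<open>v\<close> and \<open>v'\<close>
  agree almost everywhere in space, so their convolutions coincide at every point, and hence so do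
  the time integrals.\<close>

lemma mild_solutionD:
  assumes v: "mild_solution T \<alpha> u0 f v" and [measurable]: "v' \<in> borel_measurable (borel \<Otimes>\<^sub>M borel)"
    and eq: "AE z in lborel. fst z \<in> {0<..<T} \<longrightarrow> v (fst z) (snd z) = v' z"
    and sec: "AE t in lborel. 0 < t \<and> t < T \<longrightarrow> v t \<in> var_Lebesgue UNIV q \<and> (AE x in lborel. v t x = v' (t, x))"
  shows "AE z in lborel. fst z \<in> {0<..<T} \<longrightarrow> v' z = e0 \<alpha> u0 f (fst z) (snd z) - duhamel \<alpha> v' z"
  using v[unfolded mild_solution_def AE_slab_iff] eq
proof (eventually_elim, intro impI)
  fix z assume z: "fst z \<in> {0<..<T} \<longrightarrow> (AE s in lebesgue_on {0<..<fst z}. \<forall>j h k.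
           conv_exists (oseen_kernel \<alpha> (fst z - s) j h k) (\<lambda>y. v s y $ h * v s y $ k) (snd z)) \<and>
        integrable (lebesgue_on {0<..<fst z}) (\<lambda>s. oseen_conv \<alpha> (fst z - s) (v s) (snd z)) \<and>
        v (fst z) (snd z) = e0 \<alpha> u0 f (fst z) (snd z) - (LINT s|lebesgue_on {0<..<fst z}. oseen_conv \<alpha> (fst z - s) (v s) (snd z))"
    "fst z \<in> {0<..<T} \<longrightarrow> v (fst z) (snd z) = v' z" "fst z \<in> {0<..<T}"
  obtain t x where tx: "z = (t, x)" by (cases z)
  have m: "(\<lambda>s. oseen_conv \<alpha> (t - s) (\<lambda>y. v' (s, y)) x) \<in> borel_measurable borel" by measurable
  have "(LINT s|lebesgue_on {0<..<t}. oseen_conv \<alpha> (t - s) (v s) x) =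
      (LINT s|lebesgue_on {0<..<t}. oseen_conv \<alpha> (t - s) (\<lambda>y. v' (s, y)) x)"
  proof (rule integral_cong_AE)
    show "(\<lambda>s. oseen_conv \<alpha> (t - s) (v s) x) \<in> borel_measurable (lebesgue_on {0<..<t})"
      using z tx by (auto dest: borel_measurable_integrable)
    show "(\<lambda>s. oseen_conv \<alpha> (t - s) (\<lambda>y. v' (s, y)) x) \<in> borel_measurable (lebesgue_on {0<..<t})"
      by (rule borel_measurable_lebesgue_on[OF m])
    show "AE s in lebesgue_on {0<..<t}. oseen_conv \<alpha> (t - s) (v s) x = oseen_conv \<alpha> (t - s) (\<lambda>y. v' (s, y)) x"
    proof (subst AE_lebesgue_on_iff, simp, use sec in eventually_elim, intro impI)
      fix s assume s: "0 < s \<and> s < T \<longrightarrow> v s \<in> var_Lebesgue UNIV q \<and> (AE x in lborel. v s x = v' (s, x))" "s \<in> {0<..<t}"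
      then have vs: "v s \<in> var_Lebesgue UNIV q" "AE x in lborel. v s x = v' (s, x)" using z tx by auto
      have "v s \<in> borel_measurable (lebesgue_on UNIV)" using vs by (simp add: var_Lebesgue_def)
      from borel_measurable_if_I[OF this] have "v s \<in> borel_measurable lebesgue" by simp
      then show "oseen_conv \<alpha> (t - s) (v s) x = oseen_conv \<alpha> (t - s) (\<lambda>y. v' (s, y)) x"
        by (rule oseen_conv_cong_AE[OF _ _ vs(2)]) measurable
    qed
  qed
  also have "\<dots> = duhamel \<alpha> v' z" by (simp add: lebesgue_on_integral[OF m] duhamel_def tx)
  finally show "v' z = e0 \<alpha> u0 f (fst z) (snd z) - duhamel \<alpha> v' z" using z tx by simp
qed

text \<open>A version for functions of any size: division by a bound for the finite modular reduces
  it to \<open>tmod_J\<close>, and boundedness of the exponents allows scaling back.\<close>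

lemma tmod_J_finite:
  assumes [measurable]: "F \<in> borel_measurable borel" and F: "tmod F < \<infinity>" and k: "0 \<le> k"
  shows "tmod (\<lambda>t. ennreal k * J (\<lambda>s. F s * F s) t) < \<infinity>"
proof -
  obtain w where w: "tmod F = ennreal w" "0 \<le> w" using F by (cases "tmod F") auto
  define l where "l = max 1 w"
  have l: "1 \<le> l" "0 < l" by (auto simp: l_def)
  have "tmod (\<lambda>t. F t / ennreal l) \<le> tmod F / ennreal l" using l by (intro tmod_divide_le) auto
  also have "\<dots> \<le> ennreal l / ennreal l" unfolding w by (intro divide_right_mono_ennreal ennreal_leI) (simp add: l_def)
  also have "\<dots> = 1" using l by (simp add: divide_ennreal)
  finally have F1: "tmod (\<lambda>t. F t / ennreal l) \<le> 1" .
  define G where "G s = (F s / ennreal l) * (F s / ennreal l)" for s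
  have [measurable]: "G \<in> borel_measurable borel" unfolding G_def[abs_def] by measurable
  have "epow (G s) (1 / (2 * g s)) = epow (F s / ennreal l) (1 / g s)" for s
  proof -
    have h: "1 / (2 * g s) + 1 / (2 * g s) = 1 / g s" by simp
    show ?thesis unfolding G_def epow_mult epow_add[symmetric] h ..
  qed
  then have "tmod (\<lambda>t. J G t / ennreal K) \<le> 1"
    using F1 by (intro tmod_J) (auto simp: tmod_def)
  then have "tmod (\<lambda>t. J G t / ennreal K) < \<infinity>" by (rule le_less_trans) simp
  then have "tmod (\<lambda>t. ennreal (k * (l * l) * K) * (J G t / ennreal K)) < \<infinity>"
    using k l K by (intro tmod_cmult_finite) auto
  moreover have "ennreal (k * (l * l) * K) * (J G t / ennreal K) = ennreal k * J (\<lambda>s. F s * F s) t" for t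
  proof -
    have "F s * F s = ennreal (l * l) * G s" for s
    proof -
      define y where "y = F s / ennreal l"
      have "F s = ennreal l * y" unfolding y_def using l by (intro ennreal_cancel_real) simp
      moreover have "G s = y * y" by (simp add: G_def y_def)
      moreover have "ennreal (l * l) = ennreal l * ennreal l" using l by (intro ennreal_mult) auto
      ultimately show ?thesis by (simp only: mult_ac)
    qed
    then have JF: "J (\<lambda>s. F s * F s) t = ennreal (l * l) * J G t" by (simp add: J_cmult)
    define y where "y = J G t / ennreal K"
    have "J G t = ennreal K * y" unfolding y_def using K by (intro ennreal_cancel_real) simp
    then show ?thesis unfolding y_def[symmetric] JF
      using k l K by (simp add: ennreal_mult_mult mult.assoc)
  qed
  ultimately show ?thesis by simp
qed

text \<open>The difference of two solutions is a difference of Duhamel terms and thus has slices in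
  L^M at almost every time, although the solutions are controlled only in L^m + L^M. Its L^M norm
  \<open>\<omega>\<close> satisfies a linear integral inequality in time, whose coefficient
  \<open>P\<close> is the combined size of the solutions, of finite modular but not small.\<close>

lemma mild_unique:
  assumes [measurable]: "u \<in> borel_measurable (borel \<Otimes>\<^sub>M borel)" "v \<in> borel_measurable (borel \<Otimes>\<^sub>M borel)"
      "\<phi> \<in> borel_measurable borel" "\<chi>\<^sub>v \<in> borel_measurable borel"
    and nn: "\<And>t. 0 \<le> \<phi> t" "\<And>t. 0 \<le> \<chi>\<^sub>v t"
    and qu: "AE t in lborel. 0 < t \<and> t < T \<longrightarrow> (\<forall>c>\<phi> t. qmod (\<lambda>x. ennreal (norm (u (t, x))) / ennreal c) \<le> 1)"
    and qv: "AE t in lborel. 0 < t \<and> t < T \<longrightarrow> (\<forall>c>\<chi>\<^sub>v t. qmod (\<lambda>x. ennreal (norm (v (t, x))) / ennreal c) \<le> 1)"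
    and fin: "tmod (\<lambda>t. ennreal (\<phi> t)) < \<infinity>" "tmod (\<lambda>t. ennreal (\<chi>\<^sub>v t)) < \<infinity>"
    and equ: "AE z in lborel. fst z \<in> {0<..<T} \<longrightarrow> u z = e z - duhamel \<alpha> u z"
    and eqv: "AE z in lborel. fst z \<in> {0<..<T} \<longrightarrow> v z = e z - duhamel \<alpha> v z"
  shows "AE z in lborel. fst z \<in> {0<..<T} \<longrightarrow> v z = u z"
proof -
  let ?u = "\<lambda>z. ennreal (norm (u z))" and ?v = "\<lambda>z. ennreal (norm (v z))"
  \<comment> \<open>Adding 1 gives a scale strictly above the norm of the slice.\<close>
  let ?pu = "\<lambda>t. ennreal (\<phi> t + 1)" and ?pv = "\<lambda>t. ennreal (\<chi>\<^sub>v t + 1)"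
  define w where "w z = ennreal (norm (u z - v z))" for z
  define \<Phi> where "\<Phi> z = ?u z + ?v z" for z
  define P where "P t = ?pu t + ?pv t" for t
  have [measurable]: "w \<in> borel_measurable (borel \<Otimes>\<^sub>M borel)" "\<Phi> \<in> borel_measurable (borel \<Otimes>\<^sub>M borel)" "P \<in> borel_measurable borel"
    unfolding w_def[abs_def] \<Phi>_def[abs_def] P_def[abs_def] by measurable
  have su: "AE s in lborel. 0 < s \<and> s < T \<longrightarrow> sum_modular m M (\<lambda>x. ?u (s, x) / ?pu s) \<le> 1"
    using qu by eventually_elim (auto intro: order_trans[OF sum_modular_le_qmod])
  have sv: "AE s in lborel. 0 < s \<and> s < T \<longrightarrow> sum_modular m M (\<lambda>x. ?v (s, x) / ?pv s) \<le> 1"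
    using qv by eventually_elim (auto intro: order_trans[OF sum_modular_le_qmod])
  have s\<Phi>: "AE s in lborel. 0 < s \<and> s < T \<longrightarrow> sum_modular m M (\<lambda>x. \<Phi> (s, x) / P s) \<le> 2"
    using su sv
  proof eventually_elim
    case (elim s)
    then show ?case unfolding \<Phi>_def P_def by (auto intro!: sum_modular_add M_pos)
  qed
  have Pfin: "tmod P < \<infinity>"
  proof -
    have "tmod (\<lambda>t. (ennreal (\<phi> t) + ennreal 1) + (ennreal (\<chi>\<^sub>v t) + ennreal 1)) < \<infinity>"
      by (intro tmod_add_finite fin tmod_const_finite) auto
    then show ?thesis unfolding P_def[abs_def] using nn by simp
  qed
  define \<psi> where "\<psi> t = ennreal Cb * J (\<lambda>s. P s * P s) t" for t
  have [measurable]: "\<psi> \<in> borel_measurable borel" unfolding \<psi>_def[abs_def] by measurable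
  have \<psi>fin: "tmod \<psi> < \<infinity>" unfolding \<psi>_def[abs_def] using Cb Pfin by (intro tmod_J_finite) auto
  have \<Phi>\<Phi>: "(\<integral>\<^sup>+x. epow (maj (\<lambda>z. \<Phi> z * \<Phi> z) (t, x)) M \<partial>lborel) \<le> epow (\<psi> t) M" if t: "0 < t" "t < T" for t
  proof -
    have "(\<integral>\<^sup>+x. epow (maj (\<lambda>z. \<Phi> z * \<Phi> z) (t, x)) M \<partial>lborel) \<le>
      epow (ennreal Cb * (\<integral>\<^sup>+s. indicator {0<..<t} s * (ennreal (\<bar>t - s\<bar> powr - a) * (P s * P s)) \<partial>lborel)) M"
      using s\<Phi> by (intro bil t) (auto elim!: eventually_mono)
    also have "\<dots> \<le> epow (\<psi> t) M"
      unfolding \<psi>_def J_def using M_pos t by (intro epow_mono mult_left_mono nn_integral_mono) (auto split: split_indicator)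
    finally show ?thesis .
  qed
  have finz: "AE z in lborel. fst z \<in> {0<..<T} \<longrightarrow> maj (\<lambda>z. \<Phi> z * \<Phi> z) z < \<infinity>"
    by (rule majorant_finite_AE[OF _ _ \<Phi>\<Phi> \<psi>fin]) measurable
  have wle: "AE z in lborel. fst z \<in> {0<..<T} \<longrightarrow> w z \<le> maj (\<lambda>z. w z * \<Phi> z) z"
    using finz equ eqv
  proof eventually_elim
    case (elim z)
    show ?case
    proof (intro impI)
      assume z: "fst z \<in> {0<..<T}"
      have f: "maj (\<lambda>z. \<Phi> z * \<Phi> z) z < \<infinity>" using elim z by simp
      have "maj (\<lambda>z. ?u z * ?u z) z < \<infinity>" "maj (\<lambda>z. ?v z * ?v z) z < \<infinity>"
        by (rule le_less_trans[OF majorant_op_mono f], simp add: \<Phi>_def mult_mono)+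
      then have "ennreal (norm (duhamel \<alpha> u z - duhamel \<alpha> v z)) \<le> maj (\<lambda>z. w z * \<Phi> z) z"
        unfolding w_def \<Phi>_def by (intro duhamel_diff_bound[OF kernel C]) auto
      moreover have "u z - v z = - (duhamel \<alpha> u z - duhamel \<alpha> v z)" using elim z by simp
      then have "norm (u z - v z) = norm (duhamel \<alpha> u z - duhamel \<alpha> v z)" by (simp only: norm_minus_cancel)
      ultimately show "w z \<le> maj (\<lambda>z. w z * \<Phi> z) z" by (simp add: w_def)
    qed
  qed
  define \<omega> where "\<omega> t = epow (\<integral>\<^sup>+x. epow (w (t, x)) M \<partial>lborel) (1 / M)" for t
  have [measurable]: "\<omega> \<in> borel_measurable borel" unfolding \<omega>_def[abs_def] by measurable
  have \<omega>M: "epow (\<omega> t) M = (\<integral>\<^sup>+x. epow (w (t, x)) M \<partial>lborel)" for t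
    using M_pos by (simp add: \<omega>_def epow_epow)
  have s\<omega>: "sum_modular m M (\<lambda>x. w (s, x) / \<omega> s) \<le> 1" for s
    by (rule sum_modular_le_of_power) (simp_all add: \<omega>M)
  have wsec: "AE t in lborel. 0 < t \<and> t < T \<longrightarrow> (AE x in lborel. w (t, x) \<le> maj (\<lambda>z. w z * \<Phi> z) (t, x))"
    using AE_slab[of "\<lambda>t x. w (t, x) \<le> maj (\<lambda>z. w z * \<Phi> z) (t, x)"] wle by simp
  have main: "AE t in lborel. 0 < t \<and> t < T \<longrightarrow>
     epow (\<omega> t) M \<le> (\<integral>\<^sup>+x. epow (maj (\<lambda>z. w z * \<Phi> z) (t, x)) M \<partial>lborel)"
    using wsec
  proof (eventually_elim, intro impI)
    fix t assume t: "0 < t \<and> t < T \<longrightarrow> (AE x in lborel. w (t, x) \<le> maj (\<lambda>z. w z * \<Phi> z) (t, x))" "0 < t \<and> t < T"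
    then have "AE x in lborel. epow (w (t, x)) M \<le> epow (maj (\<lambda>z. w z * \<Phi> z) (t, x)) M"
      using M_pos by (auto elim!: eventually_mono intro: epow_mono)
    then show "epow (\<omega> t) M \<le> (\<integral>\<^sup>+x. epow (maj (\<lambda>z. w z * \<Phi> z) (t, x)) M \<partial>lborel)"
      unfolding \<omega>M by (rule nn_integral_mono_AE)
  qed
  have ineq: "AE t in lborel. 0 < t \<and> t < T \<longrightarrow>
       \<omega> t \<le> ennreal Cb * (\<integral>\<^sup>+s. indicator {0<..<t} s * (ennreal (\<bar>t - s\<bar> powr - a) * (\<omega> s * P s)) \<partial>lborel)"
    using main
  proof (eventually_elim, intro impI)
    fix t assume t: "0 < t \<and> t < T \<longrightarrow> epow (\<omega> t) M \<le> (\<integral>\<^sup>+x. epow (maj (\<lambda>z. w z * \<Phi> z) (t, x)) M \<partial>lborel)" "0 < t \<and> t < T"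
    have s1: "sum_modular m M (\<lambda>x. w (s, x) / \<omega> s) \<le> 2" for s using s\<omega>[of s] by (rule order_trans) simp
    have "epow (\<omega> t) M \<le> (\<integral>\<^sup>+x. epow (maj (\<lambda>z. w z * \<Phi> z) (t, x)) M \<partial>lborel)" using t by simp
    also have "\<dots> \<le> epow (ennreal Cb * (\<integral>\<^sup>+s. indicator {0<..<t} s * (ennreal (\<bar>t - s\<bar> powr - a) * (\<omega> s * P s)) \<partial>lborel)) M"
      using t s\<Phi> by (intro bil) (auto elim!: eventually_mono simp: s1)
    finally show "\<omega> t \<le> ennreal Cb * (\<integral>\<^sup>+s. indicator {0<..<t} s * (ennreal (\<bar>t - s\<bar> powr - a) * (\<omega> s * P s)) \<partial>lborel)"
      using M_pos by (simp add: epow_le_iff)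
  qed
  \<comment> \<open>The scalar uniqueness lemma asks for a finite modular of
    \<open>\<omega>\<close>; it follows from the crude bound of the difference by the sum of the two
    solutions.\<close>
  have "AE t in lborel. 0 < t \<and> t < T \<longrightarrow> \<omega> t \<le> \<psi> t"
    using main
  proof (eventually_elim, intro impI)
    fix t assume t: "0 < t \<and> t < T \<longrightarrow> epow (\<omega> t) M \<le> (\<integral>\<^sup>+x. epow (maj (\<lambda>z. w z * \<Phi> z) (t, x)) M \<partial>lborel)" "0 < t \<and> t < T"
    have w\<Phi>: "w z \<le> \<Phi> z" for z
      unfolding w_def \<Phi>_def using norm_triangle_ineq4[of "u z" "v z"] by (simp add: ennreal_leI flip: ennreal_plus)
    have "epow (\<omega> t) M \<le> (\<integral>\<^sup>+x. epow (maj (\<lambda>z. w z * \<Phi> z) (t, x)) M \<partial>lborel)" using t by simp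
    also have "\<dots> \<le> (\<integral>\<^sup>+x. epow (maj (\<lambda>z. \<Phi> z * \<Phi> z) (t, x)) M \<partial>lborel)"
      using M_pos by (intro nn_integral_mono epow_mono majorant_op_mono mult_right_mono w\<Phi>) auto
    also have "\<dots> \<le> epow (\<psi> t) M" using t by (intro \<Phi>\<Phi>) auto
    finally show "\<omega> t \<le> \<psi> t" using M_pos by (simp add: epow_le_iff)
  qed
  then have "tmod \<omega> \<le> tmod \<psi>"
    unfolding tmod_def by (intro nn_integral_mono_AE) (auto elim!: eventually_mono split: split_indicator intro!: epow_mono g_pos)
  then have \<omega>fin: "tmod \<omega> < \<infinity>" using \<psi>fin by (rule le_less_trans)
  have "AE t in lborel. 0 < t \<and> t < T \<longrightarrow> \<omega> t = 0"
    by (rule time_unique[OF _ _ Cb ineq \<omega>fin Pfin \<gamma>]) measurable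
  then have "AE t in lborel. 0 < t \<and> t < T \<longrightarrow> (AE x in lborel. v (t, x) = u (t, x))"
  proof (eventually_elim, intro impI)
    fix t assume "0 < t \<and> t < T \<longrightarrow> \<omega> t = 0" "0 < t \<and> t < T"
    then have "(\<integral>\<^sup>+x. epow (w (t, x)) M \<partial>lborel) = 0" using \<omega>M[of t] by simp
    then have "AE x in lborel. epow (w (t, x)) M = 0" by (subst (asm) nn_integral_0_iff_AE) auto
    then show "AE x in lborel. v (t, x) = u (t, x)" by eventually_elim (auto simp: w_def ennreal_eq_0_iff)
  qed
  then show ?thesis by (intro AE_slabI) auto
qed

theorem mild_well_posed:
  "\<exists>\<epsilon>>0. \<forall>u0 f. e0 \<alpha> u0 f \<in> mixed_Lebesgue T p q \<and> mixed_norm T p q (e0 \<alpha> u0 f) \<le> \<epsilon> \<longrightarrow>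
       (\<exists>u \<in> mixed_Lebesgue T p q. mild_solution T \<alpha> u0 f u \<and>
          (\<forall>v \<in> mixed_Lebesgue T p q. mild_solution T \<alpha> u0 f v \<longrightarrow> (AE (t, x) in slab T. v t x = u t x)))"
proof -
  \<comment> \<open>The value solves \<open>16 * Cb * (4 * \<epsilon>) * K = 1\<close>. Half of it
    is returned in the end, so that a norm at most this half is strictly below
    \<open>\<epsilon>\<close>.\<close>
  define \<epsilon> where "\<epsilon> = 1 / (64 * Cb * K)"
  have \<epsilon>: "0 < \<epsilon>" "16 * Cb * (4 * \<epsilon>) * K \<le> 1" using Cb K by (auto simp: \<epsilon>_def)
  have "\<exists>u \<in> mixed_Lebesgue T p q. mild_solution T \<alpha> u0 f u \<and>
          (\<forall>v \<in> mixed_Lebesgue T p q. mild_solution T \<alpha> u0 f v \<longrightarrow> (AE (t, x) in slab T. v t x = u t x))"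
    if E: "e0 \<alpha> u0 f \<in> mixed_Lebesgue T p q" and small: "mixed_norm T p q (e0 \<alpha> u0 f) \<le> \<epsilon> / 2" for u0 f
  proof -
    have "mixed_norm T p q (e0 \<alpha> u0 f) < \<epsilon>" using small \<epsilon> by simp
    then obtain u where um[measurable]: "u \<in> borel_measurable (borel \<Otimes>\<^sub>M borel)" and umix: "(\<lambda>t x. u (t, x)) \<in> mixed_Lebesgue T p q"
      and ueq: "AE z in lborel. fst z \<in> {0<..<T} \<longrightarrow> maj (\<lambda>z. ennreal (norm (u z)) * ennreal (norm (u z))) z < \<infinity> \<and>
         u z = e0 \<alpha> u0 f (fst z) (snd z) - duhamel \<alpha> u z"
      using mild_existence[OF E \<epsilon>] by blast
    have umild: "mild_solution T \<alpha> u0 f (\<lambda>t x. u (t, x))" by (rule mild_solutionI[OF um ueq])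
    have rep: "\<exists>v' \<phi>. v' \<in> borel_measurable (borel \<Otimes>\<^sub>M borel) \<and> \<phi> \<in> borel_measurable borel \<and> (\<forall>t. 0 \<le> \<phi> t) \<and>
        (AE z in lborel. fst z \<in> {0<..<T} \<longrightarrow> v (fst z) (snd z) = v' z) \<and>
        (AE t in lborel. 0 < t \<and> t < T \<longrightarrow> (\<forall>c>\<phi> t. qmod (\<lambda>x. ennreal (norm (v' (t, x))) / ennreal c) \<le> 1)) \<and>
        tmod (\<lambda>t. ennreal (\<phi> t)) < \<infinity> \<and>
        (AE z in lborel. fst z \<in> {0<..<T} \<longrightarrow> v' z = e0 \<alpha> u0 f (fst z) (snd z) - duhamel \<alpha> v' z)"
      if v: "v \<in> mixed_Lebesgue T p q" "mild_solution T \<alpha> u0 f v" for v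
    proof -
      obtain v' \<phi> where v': "v' \<in> borel_measurable (borel \<Otimes>\<^sub>M borel)" "\<phi> \<in> borel_measurable borel" "\<And>t. 0 \<le> \<phi> t"
        "AE z in lborel. fst z \<in> {0<..<T} \<longrightarrow> v (fst z) (snd z) = v' z"
        and sec: "AE t in lborel. 0 < t \<and> t < T \<longrightarrow> v t \<in> var_Lebesgue UNIV q \<and> var_norm UNIV q (v t) = \<phi> t \<and> (AE x in lborel. v t x = v' (t, x)) \<and>
          (\<forall>c>\<phi> t. qmod (\<lambda>x. ennreal (norm (v' (t, x))) / ennreal c) \<le> 1)"
        and fin: "tmod (\<lambda>t. ennreal (\<phi> t)) < \<infinity>"
        by (rule mixed_representative[OF v(1)]) blast
      have 1: "AE t in lborel. 0 < t \<and> t < T \<longrightarrow> v t \<in> var_Lebesgue UNIV q \<and> (AE x in lborel. v t x = v' (t, x))"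
        using sec by eventually_elim blast
      have 2: "AE t in lborel. 0 < t \<and> t < T \<longrightarrow> (\<forall>c>\<phi> t. qmod (\<lambda>x. ennreal (norm (v' (t, x))) / ennreal c) \<le> 1)"
        using sec by eventually_elim blast
      have 3: "AE z in lborel. fst z \<in> {0<..<T} \<longrightarrow> v' z = e0 \<alpha> u0 f (fst z) (snd z) - duhamel \<alpha> v' z"
        by (rule mild_solutionD[OF v(2) v'(1) v'(4) 1])
      show ?thesis using v' 2 3 fin by blast
    qed
    \<comment> \<open>The constructed solution is represented in the same way as any competitor;
      this supplies the sizes of its slices for the comparison.\<close>
    obtain u' \<phi> where u': "u' \<in> borel_measurable (borel \<Otimes>\<^sub>M borel)" "\<phi> \<in> borel_measurable borel" "\<And>t. 0 \<le> \<phi> t"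
      "AE z in lborel. fst z \<in> {0<..<T} \<longrightarrow> u (fst z, snd z) = u' z"
      "AE t in lborel. 0 < t \<and> t < T \<longrightarrow> (\<forall>c>\<phi> t. qmod (\<lambda>x. ennreal (norm (u' (t, x))) / ennreal c) \<le> 1)"
      "tmod (\<lambda>t. ennreal (\<phi> t)) < \<infinity>"
      "AE z in lborel. fst z \<in> {0<..<T} \<longrightarrow> u' z = e0 \<alpha> u0 f (fst z) (snd z) - duhamel \<alpha> u' z"
      using rep[OF umix umild] by blast
    have "AE (t, x) in slab T. v t x = u (t, x)" if v: "v \<in> mixed_Lebesgue T p q" "mild_solution T \<alpha> u0 f v" for v
    proof -
      obtain v' \<psi> where v': "v' \<in> borel_measurable (borel \<Otimes>\<^sub>M borel)" "\<psi> \<in> borel_measurable borel" "\<And>t. 0 \<le> \<psi> t"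
        "AE z in lborel. fst z \<in> {0<..<T} \<longrightarrow> v (fst z) (snd z) = v' z"
        "AE t in lborel. 0 < t \<and> t < T \<longrightarrow> (\<forall>c>\<psi> t. qmod (\<lambda>x. ennreal (norm (v' (t, x))) / ennreal c) \<le> 1)"
        "tmod (\<lambda>t. ennreal (\<psi> t)) < \<infinity>"
        "AE z in lborel. fst z \<in> {0<..<T} \<longrightarrow> v' z = e0 \<alpha> u0 f (fst z) (snd z) - duhamel \<alpha> v' z"
        using rep[OF v] by blast
      have "AE z in lborel. fst z \<in> {0<..<T} \<longrightarrow> v' z = u' z"
        by (rule mild_unique[OF u'(1) v'(1) u'(2) v'(2) u'(3) v'(3) u'(5) v'(5) u'(6) v'(6) u'(7) v'(7)])
      then show ?thesis
        unfolding AE_slab_iff using u'(4) v'(4) by eventually_elim auto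
    qed
    then show ?thesis using umix umild by (intro bexI[of _ "\<lambda>t x. u (t, x)"]) auto
  qed
  then show ?thesis using \<epsilon> by (intro exI[of _ "\<epsilon> / 2"]) auto
qed

end

section \<open>Consequences of the hypotheses on the exponents\<close>

lemma log_modulus_less:
  fixes c \<epsilon> d :: real
  assumes c: "0 < c" and \<epsilon>: "0 < \<epsilon>" and d: "0 < d" "d < exp (- (c / \<epsilon>))"
  shows "c / ln (exp 1 + 1 / d) < \<epsilon>"
proof -
  have "d * exp (c / \<epsilon>) < exp (- (c / \<epsilon>)) * exp (c / \<epsilon>)" using d(2) by (intro mult_strict_right_mono) auto
  then have "d * exp (c / \<epsilon>) < 1" by (simp add: mult_exp_exp)
  then have "exp (c / \<epsilon>) < 1 / d" using d(1) by (simp add: pos_less_divide_eq mult.commute)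
  then have "exp (c / \<epsilon>) < exp 1 + 1 / d" by (simp add: add_strict_increasing2)
  then have "ln (exp (c / \<epsilon>)) < ln (exp 1 + 1 / d)" by (subst ln_less_cancel_iff) (auto intro: less_trans[OF exp_gt_zero])
  then have l: "c / \<epsilon> < ln (exp 1 + 1 / d)" by simp
  then have "0 < ln (exp 1 + 1 / d)" using c \<epsilon> by (meson divide_pos_pos less_trans)
  then show ?thesis using l \<epsilon> by (simp add: field_simps)
qed

text \<open>The supremum of the almost everywhere lower bounds is that of a sequence of them, so
  only countably many null sets have to be discarded.\<close>

lemma exponent_inf_AE:
  assumes S: "S \<in> sets borel"
  shows "AE x in lborel. x \<in> S \<longrightarrow> exponent_inf S p \<le> p x"
proof -
  let ?A = "{m. AE x in lebesgue_on S. m \<le> p x}"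
  have "?A \<noteq> {}" by (auto intro!: exI[of _ 0])
  then obtain f :: "nat \<Rightarrow> ennreal" where f: "range f \<subseteq> ?A" "Sup ?A = (SUP n. f n)"
    using ennreal_Sup_countable_SUP[of ?A] by auto
  have "AE x in lebesgue_on S. \<forall>n. f n \<le> p x" using f(1) by (subst AE_all_countable) auto
  then have "AE x in lebesgue_on S. exponent_inf S p \<le> p x"
    unfolding exponent_inf_def f(2) by eventually_elim (auto intro: SUP_least)
  then show ?thesis by (subst (asm) AE_lebesgue_on_iff[OF S])
qed

lemma exponent_sup_AE:
  assumes S: "S \<in> sets borel"
  shows "AE x in lborel. x \<in> S \<longrightarrow> p x \<le> exponent_sup S p"
  using esssup_AE[where f = p and M = "lebesgue_on S"] unfolding exponent_sup_def AE_lebesgue_on_iff[OF S] .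

text \<open>A set of full measure meets every interval. Together with continuity this turns almost
  everywhere bounds on 1/p into bounds at every point.\<close>

lemma AE_lborel_dense:
  fixes t d :: real
  assumes P: "AE s in lborel. 0 < s \<longrightarrow> P s" and t: "0 < t" and d: "0 < d"
  obtains s where "t < s" "s < t + d" "P s"
proof -
  obtain N where N: "N \<in> null_sets lborel" "{s. \<not> (0 < s \<longrightarrow> P s)} \<subseteq> N"
    using P by (auto simp: eventually_ae_filter)
  have "\<not> {t<..<t+d} \<subseteq> N"
  proof
    assume "{t<..<t+d} \<subseteq> N"
    then have "emeasure lborel {t<..<t+d} \<le> emeasure lborel N" using N by (intro emeasure_mono) auto
    then show False using N d by auto
  qed
  then obtain s where s: "t < s" "s < t + d" "s \<notin> N" unfolding subset_eq by auto
  then have "P s" using N(2) t less_trans[OF t s(1)] by blast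
  with s show ?thesis by (intro that) auto
qed

text \<open>With \<open>w = 1 + M * (1 - 2 / m)\<close> the second factor of \<open>theta1\<close>
  is 1 + 1/w - 1/(M - 1). Since \<open>m \<le> M\<close> gives \<open>w \<le> M - 1\<close>, this
  factor is at least 1.\<close>

lemma theta1_ge:
  assumes m: "2 < m" "m \<le> M"
  shows "2 / m - 1 / M \<le> theta1 m M"
proof -
  have i: "0 < 1 / M" "1 / M \<le> 1 / m" "1 / m < 1 / 2" using m by (auto intro!: divide_left_mono)
  have eq2: "2 / m = 2 * (1 / m)" by simp
  define w where "w = 1 + M * (1 - 2 / m)"
  have w: "0 < w" "w \<le> M - 1"
  proof -
    have "0 < M * (1 - 2 / m)" using m by (intro mult_pos_pos) auto
    then show "0 < w" by (simp add: w_def)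
    have "M * (1 / M) \<le> M * (1 / m)" using m i by (intro mult_left_mono) auto
    then have "1 \<le> M * (1 / m)" using m by simp
    then show "w \<le> M - 1" unfolding w_def eq2 right_diff_distrib by linarith
  qed
  have "(2 + M * (1 - 2 / m)) / w - 1 / (M - 1) = 1 + (1 / w - 1 / (M - 1))"
    using w(1) by (simp add: w_def field_simps)
  moreover have "1 / (M - 1) \<le> 1 / w" using w by (intro divide_left_mono) (auto intro!: mult_pos_pos)
  ultimately have "1 \<le> (2 + M * (1 - 2 / m)) / w - 1 / (M - 1)" by simp
  moreover have "0 \<le> 2 / m - 1 / M" using i eq2 by linarith
  ultimately have "(2 / m - 1 / M) * 1 \<le> (2 / m - 1 / M) * ((2 + M * (1 - 2 / m)) / w - 1 / (M - 1))"
    by (intro mult_left_mono)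
  then show ?thesis unfolding theta1_def w_def[symmetric] by simp
qed

theorem theorem4p20:
  fixes T \<alpha> :: real
    and q :: "real^3 \<Rightarrow> ennreal"
    and p :: "real \<Rightarrow> ennreal"
  assumes "0 < T"
    and "1 / 2 < \<alpha>" and "\<alpha> \<le> 1"
    and "q \<in> log_holder_exponents UNIV"
    and "ennreal (3 / (2 * \<alpha> - 1)) < exponent_inf UNIV q"
    and "exponent_inf UNIV q \<le> exponent_sup UNIV q"
    and "exponent_sup UNIV q = exponent_at_infinity q"
    and "exponent_at_infinity q < \<infinity>"
    and "p \<in> log_holder_exponents {0<..}"
    and "ennreal (2 * \<alpha> / (2 * \<alpha> - 1)) < exponent_inf {0<..} p"
    and "exponent_inf {0<..} p \<le> exponent_sup {0<..} p"
    and "exponent_sup {0<..} p < \<infinity>"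
    and "\<alpha> / enn2real (exponent_inf {0<..} p)
           + 3 * theta1 (enn2real (exponent_inf UNIV q)) (enn2real (exponent_at_infinity q)) / 2
         \<le> \<alpha> - 1 / 2"
  shows "\<exists>\<epsilon>>0. \<forall>u0 f.
           admissible_data T \<alpha> u0 f \<and>
           e0 \<alpha> u0 f \<in> mixed_Lebesgue T p q \<and>
           mixed_norm T p q (e0 \<alpha> u0 f) \<le> \<epsilon> \<longrightarrow>
           (\<exists>u \<in> mixed_Lebesgue T p q.
              mild_solution T \<alpha> u0 f u \<and>
              (\<forall>v \<in> mixed_Lebesgue T p q. mild_solution T \<alpha> u0 f v \<longrightarrow>
                 (AE (t, x) in slab T. v t x = u t x)))"
proof -
  note \<alpha> = assms(2,3)
  define m where "m = enn2real (exponent_inf UNIV q)"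
  define M where "M = enn2real (exponent_at_infinity q)"
  define P where "P = enn2real (exponent_inf {0<..} p)"
  define P' where "P' = enn2real (exponent_sup {0<..} p)"
  have M_eq: "exponent_at_infinity q = ennreal M" using assms(8) by (simp add: M_def)
  have m_le: "exponent_inf UNIV q \<le> ennreal M" using assms(6,7) M_eq by simp
  have m_eq: "exponent_inf UNIV q = ennreal m"
    using le_less_trans[OF m_le ennreal_less_top] by (simp add: m_def)
  have mM: "m \<le> M" using m_le unfolding m_eq by (subst (asm) ennreal_le_iff) (simp add: M_def)
  have "3 / (2 * \<alpha> - 1) < m" using assms(5) unfolding m_eq using \<alpha> by (subst (asm) ennreal_less_iff) auto
  \<comment> \<open>By \<open>\<alpha> \<le> 1\<close> the lower bound for the space exponent is at
    least 3, and likewise that for the time exponent at least 2; this yields \<open>m > 2\<close>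
    and \<open>P > 2\<close>.\<close>
  moreover have "3 \<le> 3 / (2 * \<alpha> - 1)" using \<alpha> by (simp add: field_simps)
  ultimately have m: "2 < m" by simp
  have P'_eq: "exponent_sup {0<..} p = ennreal P'" using assms(12) by (simp add: P'_def)
  have P_eq: "exponent_inf {0<..} p = ennreal P"
    using le_less_trans[OF assms(11) assms(12)] by (simp add: P_def)
  have PP': "P \<le> P'" using assms(11) unfolding P_eq P'_eq by (subst (asm) ennreal_le_iff) (simp add: P'_def)
  have P1: "2 * \<alpha> / (2 * \<alpha> - 1) < P" using assms(10) unfolding P_eq using \<alpha> by (subst (asm) ennreal_less_iff) auto
  have "2 \<le> 2 * \<alpha> / (2 * \<alpha> - 1)" using \<alpha> by (simp add: field_simps)
  then have P: "2 < P" using P1 by simp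

  have q: "q \<in> var_exponents UNIV" using assms(4) by (simp add: log_holder_exponents_def)
  obtain cq g\<^sub>q where cq: "0 < cq" "\<And>x. \<bar>enn2real (inverse (q x)) - g\<^sub>q\<bar> \<le> cq / ln (exp 1 + norm x)"
    using assms(4) unfolding log_holder_exponents_def Let_def by auto
  have q1: "1 \<le> q x" for x using q by (simp add: var_exponents_def)
  have inv_q: "inverse (q x) = ennreal (enn2real (inverse (q x)))" for x
  proof -
    have "q x \<noteq> 0" using q1[of x] by auto
    then have "inverse (q x) < top" by (simp add: less_top[symmetric])
    then show ?thesis by (rule ennreal_enn2real[symmetric])
  qed
  \<comment> \<open>The decay condition only provides some constant; it is identified with the limit
    of 1/q at infinity, hence with \<open>1 / M\<close>.\<close>
  have gq: "g\<^sub>q = 1 / M"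
  proof -
    have ln_lim: "LIM x (at_infinity :: (real^3) filter). ln (exp 1 + norm x) :> at_top"
      by (intro filterlim_compose[OF ln_at_top] filterlim_tendsto_add_at_top[OF tendsto_const] filterlim_norm_at_top)
    have "((\<lambda>x. cq / ln (exp 1 + norm (x::real^3))) \<longlongrightarrow> 0) at_infinity"
      by (rule tendsto_divide_0[OF tendsto_const filterlim_at_top_imp_at_infinity[OF ln_lim]])
    then have "((\<lambda>x. enn2real (inverse (q x)) - g\<^sub>q) \<longlongrightarrow> 0) at_infinity"
      by (rule Lim_null_comparison[rotated]) (use cq(2) in \<open>auto intro: always_eventually\<close>)
    then have lim: "((\<lambda>x. enn2real (inverse (q x))) \<longlongrightarrow> g\<^sub>q) at_infinity" by (subst Lim_null)
    then have g0: "0 \<le> g\<^sub>q" by (rule tendsto_lowerbound) (auto simp: always_eventually trivial_limit_at_infinity)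
    have "((\<lambda>x. ennreal (enn2real (inverse (q x)))) \<longlongrightarrow> ennreal g\<^sub>q) at_infinity" using lim by (rule tendsto_ennrealI)
    then have "((\<lambda>x. inverse (q x)) \<longlongrightarrow> ennreal g\<^sub>q) at_infinity" by (simp only: inv_q[symmetric])
    then have "Lim at_infinity (\<lambda>x. inverse (q x)) = ennreal g\<^sub>q" by (intro tendsto_Lim) (auto simp: trivial_limit_at_infinity)
    then have e: "inverse (ennreal g\<^sub>q) = ennreal M" using M_eq by (simp add: exponent_at_infinity_def)
    have "g\<^sub>q \<noteq> 0" using e by auto
    then have "inverse g\<^sub>q = M" using e g0 m mM by (simp add: inverse_ennreal)
    then show ?thesis by (auto simp: inverse_eq_divide)
  qed
  have qm: "q \<in> borel_measurable (lebesgue_on UNIV)" using q by (simp add: var_exponents_def)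
  have "(\<lambda>x. enn2real (q x)) \<in> borel_measurable (lebesgue_on UNIV)" using qm by measurable
  then obtain q0 where q0m [measurable]: "q0 \<in> borel_measurable borel" and q0: "AE x in lborel. enn2real (q x) = q0 x"
    using lebesgue_on_borel_representative_real[of "\<lambda>x. enn2real (q x)" UNIV] by auto
  \<comment> \<open>Clamping enforces the bounds at every point and changes the representative only
    on a null set.\<close>
  define qr where "qr x = max m (min M (q0 x))" for x
  have [measurable]: "qr \<in> borel_measurable borel" unfolding qr_def[abs_def] by measurable
  have q_qr: "AE x in lborel. q x = ennreal (qr x)"
    using exponent_inf_AE[OF sets.top[of borel, unfolded space_borel], of q]
      exponent_sup_AE[OF sets.top[of borel, unfolded space_borel], of q] q0
  proof eventually_elim
    case (elim x)
    then have "ennreal m \<le> q x" "q x \<le> ennreal M" using m_eq assms(7) M_eq by auto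
    then obtain r where r: "q x = ennreal r" "0 \<le> r" "m \<le> r" "r \<le> M"
      using m mM by (cases "q x") (auto simp: ennreal_le_iff top_unique)
    then show ?case using elim by (simp add: qr_def max_absorb2 min_absorb2)
  qed
  have space: "space_setting q qr m M cq"
  proof
    show "m \<le> qr x" "qr x \<le> M" for x using mM by (auto simp: qr_def)
    show "AE x in lborel. 1 / qr x - 1 / M \<le> cq / ln (exp 1 + norm x)"
      using q_qr
    proof eventually_elim
      case (elim x)
      have "0 < qr x" using m by (simp add: qr_def)
      then have "enn2real (inverse (q x)) = 1 / qr x" using elim by (simp add: inverse_ennreal inverse_eq_divide)
      then show ?case using cq(2)[of x] gq by simp
    qed
  qed (use m mM cq q_qr in auto)

  define gp where "gp t = enn2real (inverse (p t))" for t
  have pv: "p \<in> var_exponents {0<..}" using assms(9) by (simp add: log_holder_exponents_def)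
  obtain cp where cp: "0 < cp" "\<And>s t. 0 < s \<Longrightarrow> 0 < t \<Longrightarrow> \<bar>gp s - gp t\<bar> \<le> cp / ln (exp 1 + 1 / \<bar>s - t\<bar>)"
    using assms(9) unfolding log_holder_exponents_def Let_def gp_def by auto
  have p_AE: "AE t in lborel. 0 < t \<longrightarrow> p t = ennreal (1 / gp t) \<and> 1 / P' \<le> gp t \<and> gp t \<le> 1 / P"
    using exponent_inf_AE[OF greaterThan_borel, of 0 p] exponent_sup_AE[OF greaterThan_borel, of 0 p]
  proof eventually_elim
    case (elim t)
    show ?case
    proof
      assume "0 < t"
      then have "ennreal P \<le> p t" "p t \<le> ennreal P'" using elim P_eq P'_eq by auto
      then obtain r where r: "p t = ennreal r" "0 \<le> r" "P \<le> r" "r \<le> P'"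
        using P PP' by (cases "p t") (auto simp: ennreal_le_iff top_unique)
      then have "gp t = 1 / r" using P by (simp add: gp_def inverse_ennreal inverse_eq_divide)
      then show "p t = ennreal (1 / gp t) \<and> 1 / P' \<le> gp t \<and> gp t \<le> 1 / P"
        using r P by (auto intro!: divide_left_mono)
    qed
  qed
  \<comment> \<open>The bounds hold almost everywhere; the modulus of continuity of
    \<open>gp\<close> extends them to every point of the half-line.\<close>
  have gp: "1 / P' \<le> gp t \<and> gp t \<le> 1 / P" if t: "0 < t" for t
  proof -
    have "1 / P' - \<epsilon> \<le> gp t \<and> gp t \<le> 1 / P + \<epsilon>" if \<epsilon>: "0 < \<epsilon>" for \<epsilon>
    proof -
      obtain s where s: "t < s" "s < t + exp (- (cp / \<epsilon>))" "1 / P' \<le> gp s \<and> gp s \<le> 1 / P"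
        by (rule AE_lborel_dense[OF _ t, of "\<lambda>s. 1 / P' \<le> gp s \<and> gp s \<le> 1 / P" "exp (- (cp / \<epsilon>))"])
           (use p_AE in \<open>auto elim!: eventually_mono\<close>)
      have "\<bar>gp s - gp t\<bar> < \<epsilon>"
        using cp(2)[of s t] log_modulus_less[OF cp(1) \<epsilon>, of "\<bar>s - t\<bar>"] s t by simp
      then show ?thesis using s(3) by linarith
    qed
    then show ?thesis by (meson diff_le_eq field_le_epsilon)
  qed
  \<comment> \<open>Continuation by a constant outside (0, T), together with continuity inside,
    gives a Borel function on the whole line.\<close>
  define g where "g t = (if t \<in> {0<..<T} then gp t else 1 / P)" for t
  have "continuous_on {0<..<T} gp"
    unfolding continuous_on_iff
  proof (intro ballI allI impI)
    fix t \<epsilon> :: real assume t: "t \<in> {0<..<T}" and \<epsilon>: "0 < \<epsilon>"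
    show "\<exists>d>0. \<forall>s\<in>{0<..<T}. dist s t < d \<longrightarrow> dist (gp s) (gp t) < \<epsilon>"
    proof (intro exI[of _ "exp (- (cp / \<epsilon>))"] conjI ballI impI)
      fix s assume s: "s \<in> {0<..<T}" "dist s t < exp (- (cp / \<epsilon>))"
      show "dist (gp s) (gp t) < \<epsilon>"
      proof (cases "s = t")
        case False
        then show ?thesis using cp(2)[of s t] log_modulus_less[OF cp(1) \<epsilon>, of "\<bar>s - t\<bar>"] s t
          by (simp add: dist_real_def)
      qed (use \<epsilon> in simp)
    qed simp
  qed
  then have gm [measurable]: "g \<in> borel_measurable borel"
    unfolding g_def[abs_def] by (intro borel_measurable_continuous_on_if continuous_on_const) auto
  have gb: "1 / P' \<le> g s \<and> g s \<le> 1 / P" if "0 < s" "s < T" for s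
    using gp[of s] that by (simp add: g_def)

  define a where "a = (1 + 3 * (2 / m - 1 / M)) / (2 * \<alpha>)"
  have a0: "0 \<le> a"
  proof -
    have "1 / M \<le> 1 / m" using m mM by (intro divide_left_mono) auto
    moreover have "0 < 1 / m" "2 / m = 2 * (1 / m)" using m by auto
    ultimately have "0 \<le> 2 / m - 1 / M" by linarith
    then show ?thesis unfolding a_def using \<alpha> by (intro divide_nonneg_pos) auto
  qed
  \<comment> \<open>Doubling the hypothesis on \<open>theta1\<close>, with
    \<open>2 / m - 1 / M\<close> in place of \<open>theta1\<close>, bounds the numerator of
    \<open>a\<close> by \<open>2 * \<alpha> - 2 * (\<alpha> / P)\<close>; division by
    \<open>2 * \<alpha>\<close> gives the claim.\<close>
  have a1: "a \<le> 1 - 1 / P"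
  proof -
    have "\<alpha> / P + 3 * (2 / m - 1 / M) / 2 \<le> \<alpha> - 1 / 2"
    proof -
      have weaken: "x + 3 * d / 2 \<le> b" if "x + 3 * z / 2 \<le> b" "d \<le> z" for x z b d :: real
        using that by linarith
      show ?thesis
        using weaken[OF assms(13)] theta1_ge[OF m mM] unfolding m_def M_def P_def by blast
    qed
    moreover have "1 + 3 * d \<le> 2 * \<alpha> - 2 * x" if "x + 3 * d / 2 \<le> \<alpha> - 1 / 2" for x d :: real
      using that by linarith
    ultimately have "1 + 3 * (2 / m - 1 / M) \<le> 2 * \<alpha> - 2 * (\<alpha> / P)" by blast
    then have "a \<le> (2 * \<alpha> - 2 * (\<alpha> / P)) / (2 * \<alpha>)"
      unfolding a_def using \<alpha> by (intro divide_right_mono) auto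
    also have "\<dots> = 1 - 1 / P" using \<alpha> by (simp add: diff_divide_distrib)
    finally show ?thesis .
  qed
  have hol: "\<bar>g s - g t\<bar> \<le> cp / ln (exp 1 + 1 / \<bar>s - t\<bar>)" if "0 < s" "s < T" "0 < t" "t < T" for s t
    using cp(2)[of s t] that by (simp add: g_def)
  have P'0: "0 < 1 / P'" using P PP' by simp
  obtain K where K: "1 \<le> K" and hls: "\<And>F. F \<in> borel_measurable borel \<Longrightarrow>
        (\<integral>\<^sup>+s. indicator {0<..<T} s * epow (F s) (1 / (2 * g s)) \<partial>lborel) \<le> 1 \<Longrightarrow>
        (\<integral>\<^sup>+t. indicator {0<..<T} t * epow (\<integral>\<^sup>+s. indicator {0<..<T} s *
            (ennreal (\<bar>t - s\<bar> powr - a) * F s) \<partial>lborel) (1 / g t) \<partial>lborel) \<le> ennreal K"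
  proof (rule fractional_integral_bound[OF assms(1) gm P P'0 cp(1) gb hol a0 a1], goal_cases)
    case (7 K)
    show thesis by (rule that[OF 7(2,3)])
  qed
  have time: "time_setting T K a g"
  proof
    show "0 < g s \<and> g s \<le> 1" if "0 < s" "s < T" for s
    proof -
      have "1 / P \<le> 1" using P by simp
      then show ?thesis using gb[OF that] P'0 by linarith
    qed
  qed (use assms(1) K hls in auto)
  obtain C where C: "0 < C" "\<And>t j h k x. 0 < t \<Longrightarrow> \<bar>oseen_kernel \<alpha> t j h k x\<bar> \<le> C * kernel_majorant \<alpha> t x"
    using oseen_kernel_bound[OF \<alpha>(1)] by blast
  have C27: "0 < 27 * C" using C by simp
  obtain Cb where Cb: "0 < Cb" and bil: "\<And>t U V \<phi> \<psi>. 0 < t \<Longrightarrow> t < T \<Longrightarrow>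
     U \<in> borel_measurable (borel \<Otimes>\<^sub>M borel) \<Longrightarrow> V \<in> borel_measurable (borel \<Otimes>\<^sub>M borel) \<Longrightarrow>
     \<phi> \<in> borel_measurable borel \<Longrightarrow> \<psi> \<in> borel_measurable borel \<Longrightarrow>
     (AE s in lborel. 0 < s \<and> s < T \<longrightarrow> sum_modular m M (\<lambda>x. U (s, x) / \<phi> s) \<le> 2 \<and>
         sum_modular m M (\<lambda>x. V (s, x) / \<psi> s) \<le> 2) \<Longrightarrow>
     (\<integral>\<^sup>+x. epow (majorant_op (27 * C) \<alpha> (\<lambda>z. U z * V z) (t, x)) M \<partial>lborel)
       \<le> epow (ennreal Cb * (\<integral>\<^sup>+s. indicator {0<..<t} s * (ennreal (\<bar>t - s\<bar> powr - a) * (\<phi> s * \<psi> s)) \<partial>lborel)) M"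
    using majorant_op_bound[OF \<alpha>(1) m mM assms(1) C27] unfolding a_def by blast
  interpret mild_setting q qr m M cq T K a g p \<alpha> "1 / P'" C Cb
  proof (intro mild_setting.intro mild_setting_axioms.intro space time)
    show "AE t in lborel. 0 < t \<and> t < T \<longrightarrow> p t = ennreal (1 / g t)"
      using p_AE by eventually_elim (simp add: g_def)
  qed (use P'0 gb C Cb bil in auto)
  show ?thesis using mild_well_posed by blast
qed

end
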